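(* Let $\mathbf{k}$ be a field, $\Sigma$ a finite set, $\alpha=(\alpha_I,\alpha_\circ)$ a rational evaluation, and $(\mathcal{K},\mathrm{tr}_{\mathcal{K}})$ the associated symmetric Frobenius algebra. Let $\mathcal{F}_0:\mathcal{C}'_{\mathcal{K}}\to\mathsf{Kar}(\mathcal{C}_\alpha)$ be the full monoidal functor from the Frobenius–Brauer category of $\mathcal{K}$ taking $+$ to $X_0^+=(+,e_0^+)$, $-$ to $X_0^-=(-,e_0^-)$, and an arc with a dot $x\in\mathcal{K}$ to the arc with the same label. Then $\mathcal{F}_0$ factors through the quotient $\mathcal{C}_{\mathcal{K}}$ of $\mathcal{C}'_{\mathcal{K}}$ by the ideal of negligible morphisms and induces a fully faithful and monoidal functor $$\mathcal{F}:\ \mathcal{C}_{\mathcal{K}}\longrightarrow\mathsf{Kar}(\mathcal{C}_\alpha).$$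
   Context: Evaluations. $\Sigma^*$ is the free monoid of words in $\Sigma$ (including the empty word $\emptyset$) and $\Sigma^*_\circ$ is the set of words up to cyclic equivalence $\omega_1\omega_2\sim\omega_2\omega_1$. An evaluation is a pair $\alpha=(\alpha_I,\alpha_\circ)$ of functions $\alpha_I:\Sigma^*\to\mathbf{k}$, $\alpha_\circ:\Sigma^*_\circ\to\mathbf{k}$. Cobordisms. A finite sign sequence $\varepsilon$ is viewed as an oriented $0$-manifold. A cobordism from $\varepsilon$ to $\varepsilon'$ is a compact oriented $1$-manifold with finitely many interior dots labelled by elements of $\Sigma$, some of whose boundary points ("outer" ones) are identified with the points of $\varepsilon$ (at the bottom) and $\varepsilon'$ (at the top), the strand being oriented upward at a $+$ and downward at a $-$; the remaining boundary points are called inner. Cobordisms are taken up to structure-preserving diffeomorphism rel outer boundary. Components are outer arcs (two outer endpoints), half-intervals (one outer and one inner endpoint), floating intervals (two inner endpoints) and circles; each carries a word read from head to tail (against the orientation), up to cyclic rotation for a circle. Composition $yx$ is stacking $y$ on top of $x$; the tensor product is juxtaposition. A closed cobordism (no outer boundary) evaluates to the product over its components of $\alpha_I(\omega)$ for an interval with word $\omega$ and $\alpha_\circ(\omega)$ for a circle with word $\omega$. The category $\mathcal{C}_\alpha$ has finite sign sequences as objects; $\mathrm{Hom}(\varepsilon,\varepsilon')$ is spanned over $\mathbf{k}$ by cobordisms from $\varepsilon$ to $\varepsilon'$ modulo the linear combinations $x$ such that, for every cobordism $y$ from $\varepsilon'$ to $\varepsilon$, the closure of $yx$ (joining the $i$-th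 bottom point with the $i$-th top point by an undecorated arc for every $i$) evaluates to $0$. It is a rigid symmetric monoidal $\mathbf{k}$-linear category; its unit object $\mathbf 1$ is the empty sequence $\emptyset_0$. Put $A(\varepsilon)=\mathrm{Hom}_{\mathcal{C}_\alpha}(\emptyset_0,\varepsilon)$. The evaluation $\alpha$ is rational if $A(+-)$ is finite-dimensional (equivalently, all hom spaces of $\mathcal{C}_\alpha$ are finite-dimensional). The Karoubi envelope $\mathsf{Kar}(\mathcal{C}_\alpha)$ is obtained by first forming finite direct sums of objects and then splitting all idempotents; for an idempotent $e\in\mathrm{End}(X)$ the corresponding object is denoted $(X,e)$. State spaces. $A(+)$ is spanned by the half-intervals $|\omega\rangle$ with word $\omega$, and $A(-)$ by the half-intervals $\langle\omega|$; the pairing $A(-)\otimes A(+)\to\mathbf{k}$, $(\langle\omega_1|,|\omega_2\rangle)=\alpha_I(\omega_1\omega_2)$, is perfect. Let $k=\dim A(+)$ and fix a basis $v^1,\dots,v^k$ of $A(+)$ and the dual basis $v_1,\dots,v_k$ of $A(-)$, $(v_j,v^i)=\delta_{i,j}$. The algebra $A(+-)$ and $\mathcal{K}$. Bending strands gives identifications $\mathrm{End}_{\mathcal{C}_\alpha}(+)\cong A(+-)\cong\mathrm{End}_{\mathcal{C}_\alpha}(-)^{\mathrm{op}}$, and $A(+-)$ is given the algebra structure transported from composition in $\mathrm{End}_{\mathcal{C}_\alpha}(+)$, with unit $1$ the undecorated arc; it acts on $A(+)$ on the left by composition. It is spanned by arcs decorated by words and by pairs of half-intervals $|\omega_1\rangle\otimes\langle\omega_2|$.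 $\mathcal{K}\subset A(+-)$ is the kernel of the action on $A(+)$; it is a two-sided ideal and a unital algebra with unit $1_{\mathcal{K}}=1-\sum_{i=1}^k v^i\otimes v_i$. The map $\mathrm{tr}_{\mathcal{K}}:\mathcal{K}\to\mathbf{k}$ is the restriction to $\mathcal{K}$ of the circular closure map on $A(+-)$, which joins the $+$ and $-$ endpoints by an undecorated arc and evaluates via $\alpha$ (an arc with word $\omega$ goes to $\alpha_\circ(\omega)$, $|\omega_1\rangle\otimes\langle\omega_2|$ goes to $\alpha_I(\omega_2\omega_1)$). With it $\mathcal{K}$ is a symmetric Frobenius algebra. Let $e_0^+\in\mathrm{End}_{\mathcal{C}_\alpha}(+)$ and $e_0^-\in\mathrm{End}_{\mathcal{C}_\alpha}(-)$ be the idempotents corresponding to $1_{\mathcal{K}}$ under the bending identifications; these identifications restrict to $\mathrm{End}(X_0^+)\cong\mathcal{K}\cong\mathrm{End}(X_0^-)^{\mathrm{op}}$. Frobenius–Brauer category. For a symmetric Frobenius algebra $(B,\mathrm{tr}_B)$ over $\mathbf{k}$, $\mathcal{C}'_B$ is the $\mathbf{k}$-linear symmetric monoidal category whose objects are finite sign sequences and whose morphisms are $\mathbf{k}$-linear combinations of oriented $1$-cobordisms without inner endpoints, with dots labelled by elements of $B$, modulo the relations: the diagram is $\mathbf{k}$-linear in the label of each dot; two consecutive dots on a strand with labels $b_1,b_2$ (read from head to tail) equal one dot labelled $b_1b_2$; a dot labelled $1$ can be erased; a circle carrying a dot labelled $b$ equals $\mathrm{tr}_B(b)$. A morphism $x:\varepsilon\to\varepsilon'$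 in $\mathcal{C}'_B$ is negligible if for every $y:\varepsilon'\to\varepsilon$ the closure of $yx$ (joining corresponding bottom and top endpoints by arcs) equals $0\in\mathbf{k}$; $\mathcal{C}_B$ is the quotient of $\mathcal{C}'_B$ by the ideal of negligible morphisms (the "gligible quotient"). The functor $\mathcal{F}_0$: the strand $+\to+$ (respectively $-\to-$) with dot $x\in\mathcal{K}$ goes to the element of $\mathrm{End}(X_0^+)$ (respectively $\mathrm{End}(X_0^-)$) corresponding to $x$; the arc $\mathbf{1}\to{+}{-}$ with dot $x$ goes to $x\in A(+-)$ viewed as a morphism $\mathbf{1}\to X_0^+\otimes X_0^-$; other arcs are treated likewise (bending strands), and permutation diagrams go to permutation morphisms. *)

theory Defs
  imports Complex_Main "HOL-Library.Multiset" "HOL-Library.Poly_Mapping"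
begin

section \<open>Words up to cyclic equivalence\<close>

definition cyc_eq :: "'s list \<Rightarrow> 's list \<Rightarrow> bool"
  where "cyc_eq u v \<longleftrightarrow> (\<exists>x y. u = x @ y \<and> v = y @ x)"

lemma cyc_eq_rotate: "cyc_eq u v \<longleftrightarrow> (\<exists>n. v = rotate n u)"
proof
  assume "cyc_eq u v"
  then obtain x y where "u = x @ y" "v = y @ x" by (auto simp: cyc_eq_def)
  then have "v = rotate (length x) u" by (simp add: rotate_append)
  then show "\<exists>n. v = rotate n u" by blast
next
  assume "\<exists>n. v = rotate n u"
  then obtain n where "v = rotate n u" by blast
  then have "v = drop (n mod length u) u @ take (n mod length u) u"
    by (simp add: rotate_drop_take)
  then show "cyc_eq u v"
    unfolding cyc_eq_def by (metis append_take_drop_id)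
qed

lemma cyc_eq_equivp: "equivp cyc_eq"
proof (rule equivpI)
  show "reflp cyc_eq"
    by (rule reflpI) (auto simp: cyc_eq_def)
  show "symp cyc_eq"
    by (rule sympI) (auto simp: cyc_eq_def)
  show "transp cyc_eq"
    by (rule transpI) (metis cyc_eq_rotate rotate_rotate)
qed

quotient_type 's cword = "'s list" / cyc_eq
  by (rule cyc_eq_equivp)

lift_definition cyc :: "'s list \<Rightarrow> 's cword" is "\<lambda>w. w" .

lift_definition cletters :: "'s cword \<Rightarrow> 's set" is set
  by (auto simp: cyc_eq_def)

text \<open>An evaluation \<open>(\<alpha>\<^sub>I, \<alpha>\<^sub>\<circ>)\<close>.  The alphabet is a set \<open>S\<close> (possibly empty), and only the
  values on words over \<open>S\<close> are ever used.\<close>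

type_synonym ('s, 'k) evaluation = "('s list \<Rightarrow> 'k) \<times> ('s cword \<Rightarrow> 'k)"


section \<open>Decorated oriented 1-cobordisms\<close>

datatype sign = Pos | Neg

datatype point = Bot nat | Top nat

text \<open>\<open>Seg p w q\<close> is an interval with head \<open>p\<close>, tail \<open>q\<close> and word \<open>w\<close> read from head to tail;
  \<open>None\<close> is an inner endpoint and \<open>Some\<close> an outer one.  A decorated compact oriented 1-manifold,
  up to diffeomorphism relative to its outer boundary, is the finite multiset of its components.\<close>

datatype ('p, 's) strand = Seg "'p option" "'s list" "'p option" | Circ "'s cword"

type_synonym ('p, 's) diagram = "('p, 's) strand multiset"

fun head_end :: "('p, 's) strand \<Rightarrow> 'p multiset" where
  "head_end (Seg (Some p) w q) = {#p#}"
| "head_end (Seg None w q) = {#}"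
| "head_end (Circ c) = {#}"

fun tail_end :: "('p, 's) strand \<Rightarrow> 'p multiset" where
  "tail_end (Seg p w (Some q)) = {#q#}"
| "tail_end (Seg p w None) = {#}"
| "tail_end (Circ c) = {#}"

fun letters :: "('p, 's) strand \<Rightarrow> 's set" where
  "letters (Seg p w q) = set w"
| "letters (Circ c) = cletters c"

fun no_inner :: "('p, 's) strand \<Rightarrow> bool" where
  "no_inner (Seg p w q) \<longleftrightarrow> p \<noteq> None \<and> q \<noteq> None"
| "no_inner (Circ c) \<longleftrightarrow> True"

fun rename_strand :: "('p \<Rightarrow> 'q) \<Rightarrow> ('p, 's) strand \<Rightarrow> ('q, 's) strand" where
  "rename_strand f (Seg p w q) = Seg (map_option f p) w (map_option f q)"
| "rename_strand f (Circ c) = Circ c"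

definition rename :: "('p \<Rightarrow> 'q) \<Rightarrow> ('p, 's) diagram \<Rightarrow> ('q, 's) diagram"
  where "rename f D = image_mset (rename_strand f) D"

text \<open>Strands point upward at a \<open>+\<close> and downward at a \<open>-\<close>: the outer points of a cobordism from
  \<open>a\<close> to \<open>b\<close> at which a strand has its head, respectively its tail.\<close>

definition heads :: "sign list \<Rightarrow> sign list \<Rightarrow> point set" where
  "heads a b = {Bot i |i. i < length a \<and> a ! i = Neg} \<union> {Top i |i. i < length b \<and> b ! i = Pos}"

definition tails :: "sign list \<Rightarrow> sign list \<Rightarrow> point set" where
  "tails a b = {Bot i |i. i < length a \<and> a ! i = Pos} \<union> {Top i |i. i < length b \<and> b ! i = Neg}"

definition cobs :: "'s set \<Rightarrow> sign list \<Rightarrow> sign list \<Rightarrow> (point, 's) diagram set" where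
  "cobs S a b = {D. (\<Sum>c\<in>#D. head_end c) = mset_set (heads a b) \<and>
                    (\<Sum>c\<in>#D. tail_end c) = mset_set (tails a b) \<and>
                    (\<forall>c\<in>#D. letters c \<subseteq> S)}"

definition cobs_no_inner :: "'s set \<Rightarrow> sign list \<Rightarrow> sign list \<Rightarrow> (point, 's) diagram set" where
  "cobs_no_inner S a b = {D \<in> cobs S a b. \<forall>c\<in>#D. no_inner c}"

text \<open>\<open>joins h t D D'\<close>: \<open>D'\<close> arises from \<open>D\<close> by joining the outer head \<open>h\<close> to the outer tail \<open>t\<close>
  by an undecorated arc.\<close>

inductive joins :: "'p \<Rightarrow> 'p \<Rightarrow> ('p, 's) diagram \<Rightarrow> ('p, 's) diagram \<Rightarrow> bool" where
  "joins h t (add_mset (Seg (Some h) w (Some t)) D) (add_mset (Circ (cyc w)) D)"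
| "joins h t (add_mset (Seg p u (Some t)) (add_mset (Seg (Some h) w q) D))
     (add_mset (Seg p (u @ w) q) D)"

definition glue :: "'p \<Rightarrow> 'p \<Rightarrow> ('p, 's) diagram \<Rightarrow> ('p, 's) diagram"
  where "glue p q D = (THE D'. joins p q D D' \<or> joins q p D D')"

text \<open>Stacking \<open>E\<close> on top of \<open>D\<close> along \<open>n\<close> middle points.\<close>

definition stack :: "nat \<Rightarrow> (point, 's) diagram \<Rightarrow> (point, 's) diagram \<Rightarrow> (point, 's) diagram" where
  "stack n E D = rename (case_sum id id)
     (fold (\<lambda>i. glue (Inl (Top i)) (Inr (Bot i))) [0..<n] (rename Inl D + rename Inr E))"

definition diagram_closure :: "nat \<Rightarrow> (point, 's) diagram \<Rightarrow> (point, 's) diagram" where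
  "diagram_closure n D = fold (\<lambda>i. glue (Bot i) (Top i)) [0..<n] D"

fun shift :: "nat \<Rightarrow> nat \<Rightarrow> point \<Rightarrow> point" where
  "shift m n (Bot i) = Bot (m + i)"
| "shift m n (Top i) = Top (n + i)"

text \<open>\<open>E\<close> placed to the right of a diagram with \<open>m\<close> bottom and \<open>n\<close> top points.\<close>

definition juxtapose ::
    "nat \<Rightarrow> nat \<Rightarrow> (point, 's) diagram \<Rightarrow> (point, 's) diagram \<Rightarrow> (point, 's) diagram"
  where "juxtapose m n D E = D + rename (shift m n) E"

definition perm_diagram :: "sign list \<Rightarrow> (nat \<Rightarrow> nat) \<Rightarrow> (point, 's) diagram" where
  "perm_diagram a \<pi> = mset (map (\<lambda>i. case a ! i of
       Pos \<Rightarrow> Seg (Some (Top (\<pi> i))) [] (Some (Bot i))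
     | Neg \<Rightarrow> Seg (Some (Bot i)) [] (Some (Top (\<pi> i)))) [0..<length a])"

definition id_diagram :: "sign list \<Rightarrow> (point, 's) diagram"
  where "id_diagram a = perm_diagram a (\<lambda>i. i)"

definition swap_diagram :: "sign list \<Rightarrow> sign list \<Rightarrow> (point, 's) diagram" where
  "swap_diagram a b =
     perm_diagram (a @ b) (\<lambda>i. if i < length a then i + length b else i - length a)"

fun eval_strand :: "('s, 'k) evaluation \<Rightarrow> ('p, 's) strand \<Rightarrow> 'k" where
  "eval_strand \<alpha> (Seg p w q) = fst \<alpha> w"
| "eval_strand \<alpha> (Circ c) = snd \<alpha> c"

text \<open>Only meaningful on closed diagrams.\<close>

definition eval_diagram :: "('s, 'k::field) evaluation \<Rightarrow> ('p, 's) diagram \<Rightarrow> 'k"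
  where "eval_diagram \<alpha> D = (\<Prod>c\<in>#D. eval_strand \<alpha> c)"


section \<open>Linear combinations\<close>

abbreviation gen :: "'a \<Rightarrow> 'a \<Rightarrow>\<^sub>0 'k::field"
  where "gen a \<equiv> Poly_Mapping.single a 1"

definition scale :: "'k::field \<Rightarrow> ('a \<Rightarrow>\<^sub>0 'k) \<Rightarrow> ('a \<Rightarrow>\<^sub>0 'k)"
  where "scale c = Poly_Mapping.map ((*) c)"

definition lin :: "('a \<Rightarrow> 'b) \<Rightarrow> ('a \<Rightarrow>\<^sub>0 'k::field) \<Rightarrow> ('b \<Rightarrow>\<^sub>0 'k)" where
  "lin f x = (\<Sum>a\<in>Poly_Mapping.keys x. Poly_Mapping.single (f a) (Poly_Mapping.lookup x a))"

definition bilin ::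
    "('a \<Rightarrow> 'b \<Rightarrow> 'c) \<Rightarrow> ('a \<Rightarrow>\<^sub>0 'k::field) \<Rightarrow> ('b \<Rightarrow>\<^sub>0 'k) \<Rightarrow> ('c \<Rightarrow>\<^sub>0 'k)" where
  "bilin f x y = (\<Sum>a\<in>Poly_Mapping.keys x. \<Sum>b\<in>Poly_Mapping.keys y.
     Poly_Mapping.single (f a b) (Poly_Mapping.lookup x a * Poly_Mapping.lookup y b))"

definition eval_comb :: "('s, 'k::field) evaluation \<Rightarrow> (('p, 's) diagram \<Rightarrow>\<^sub>0 'k) \<Rightarrow> 'k" where
  "eval_comb \<alpha> x = (\<Sum>D\<in>Poly_Mapping.keys x. Poly_Mapping.lookup x D * eval_diagram \<alpha> D)"

type_synonym ('s, 'k) comb = "(point, 's) diagram \<Rightarrow>\<^sub>0 'k"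


section \<open>Linear strict symmetric monoidal categories and functors\<close>

text \<open>\<open>cmp C a b c g f\<close> is the composite of \<open>f : a \<rightarrow> b\<close> and \<open>g : b \<rightarrow> c\<close>, and
  \<open>tensm C a a' b b' f g\<close> is the tensor product of \<open>f : a \<rightarrow> a'\<close> and \<open>g : b \<rightarrow> b'\<close>.
  The operations take the objects as arguments because the same value can be a morphism
  in several hom spaces.\<close>

record ('o, 'm, 'k) moncat =
  obj :: "'o set"
  hom :: "'o \<Rightarrow> 'o \<Rightarrow> 'm set"
  idm :: "'o \<Rightarrow> 'm"
  cmp :: "'o \<Rightarrow> 'o \<Rightarrow> 'o \<Rightarrow> 'm \<Rightarrow> 'm \<Rightarrow> 'm"
  zerom :: "'o \<Rightarrow> 'o \<Rightarrow> 'm"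
  plusm :: "'o \<Rightarrow> 'o \<Rightarrow> 'm \<Rightarrow> 'm \<Rightarrow> 'm"
  scalm :: "'o \<Rightarrow> 'o \<Rightarrow> 'k \<Rightarrow> 'm \<Rightarrow> 'm"
  unito :: 'o
  tenso :: "'o \<Rightarrow> 'o \<Rightarrow> 'o"
  tensm :: "'o \<Rightarrow> 'o \<Rightarrow> 'o \<Rightarrow> 'o \<Rightarrow> 'm \<Rightarrow> 'm \<Rightarrow> 'm"
  symm :: "'o \<Rightarrow> 'o \<Rightarrow> 'm"

record ('o, 'm, 'p, 'n) funct =
  on_obj :: "'o \<Rightarrow> 'p"
  on_hom :: "'o \<Rightarrow> 'o \<Rightarrow> 'm \<Rightarrow> 'n"

definition linear_functor ::
    "('o, 'm, 'k) moncat \<Rightarrow> ('p, 'n, 'k) moncat \<Rightarrow> ('o, 'm, 'p, 'n) funct \<Rightarrow> bool" where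
  "linear_functor C D F \<longleftrightarrow>
     (\<forall>a\<in>obj C. on_obj F a \<in> obj D) \<and>
     (\<forall>a\<in>obj C. \<forall>b\<in>obj C. \<forall>x\<in>hom C a b. on_hom F a b x \<in> hom D (on_obj F a) (on_obj F b)) \<and>
     (\<forall>a\<in>obj C. on_hom F a a (idm C a) = idm D (on_obj F a)) \<and>
     (\<forall>a\<in>obj C. \<forall>b\<in>obj C. \<forall>c\<in>obj C. \<forall>x\<in>hom C a b. \<forall>y\<in>hom C b c.
        on_hom F a c (cmp C a b c y x) =
        cmp D (on_obj F a) (on_obj F b) (on_obj F c) (on_hom F b c y) (on_hom F a b x)) \<and>
     (\<forall>a\<in>obj C. \<forall>b\<in>obj C. \<forall>x\<in>hom C a b. \<forall>y\<in>hom C a b.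
        on_hom F a b (plusm C a b x y) =
        plusm D (on_obj F a) (on_obj F b) (on_hom F a b x) (on_hom F a b y)) \<and>
     (\<forall>a\<in>obj C. \<forall>b\<in>obj C. \<forall>x\<in>hom C a b. \<forall>r.
        on_hom F a b (scalm C a b r x) = scalm D (on_obj F a) (on_obj F b) r (on_hom F a b x))"

definition monoidal_functor ::
    "('o, 'm, 'k) moncat \<Rightarrow> ('p, 'n, 'k) moncat \<Rightarrow> ('o, 'm, 'p, 'n) funct \<Rightarrow> bool" where
  "monoidal_functor C D F \<longleftrightarrow> linear_functor C D F \<and>
     on_obj F (unito C) = unito D \<and>
     (\<forall>a\<in>obj C. \<forall>b\<in>obj C. on_obj F (tenso C a b) = tenso D (on_obj F a) (on_obj F b)) \<and>
     (\<forall>a\<in>obj C. \<forall>a'\<in>obj C. \<forall>b\<in>obj C. \<forall>b'\<in>obj C. \<forall>x\<in>hom C a a'. \<forall>y\<in>hom C b b'.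
        on_hom F (tenso C a b) (tenso C a' b') (tensm C a a' b b' x y) =
        tensm D (on_obj F a) (on_obj F a') (on_obj F b) (on_obj F b')
          (on_hom F a a' x) (on_hom F b b' y))"

definition preserves_symmetry ::
    "('o, 'm, 'k) moncat \<Rightarrow> ('p, 'n, 'k) moncat \<Rightarrow> ('o, 'm, 'p, 'n) funct \<Rightarrow> bool" where
  "preserves_symmetry C D F \<longleftrightarrow> (\<forall>a\<in>obj C. \<forall>b\<in>obj C.
     on_hom F (tenso C a b) (tenso C b a) (symm C a b) = symm D (on_obj F a) (on_obj F b))"

definition full_functor ::
    "('o, 'm, 'k) moncat \<Rightarrow> ('p, 'n, 'k) moncat \<Rightarrow> ('o, 'm, 'p, 'n) funct \<Rightarrow> bool" where
  "full_functor C D F \<longleftrightarrow> (\<forall>a\<in>obj C. \<forall>b\<in>obj C.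
     on_hom F a b ` hom C a b = hom D (on_obj F a) (on_obj F b))"

definition faithful_functor ::
    "('o, 'm, 'k) moncat \<Rightarrow> ('o, 'm, 'p, 'n) funct \<Rightarrow> bool" where
  "faithful_functor C F \<longleftrightarrow> (\<forall>a\<in>obj C. \<forall>b\<in>obj C. inj_on (on_hom F a b) (hom C a b))"

text \<open>The quotient of \<open>C\<close> by an ideal \<open>N\<close>; morphisms are cosets.\<close>

definition coset ::
    "('o, 'm, 'k) moncat \<Rightarrow> ('o \<Rightarrow> 'o \<Rightarrow> 'm set) \<Rightarrow> 'o \<Rightarrow> 'o \<Rightarrow> 'm \<Rightarrow> 'm set"
  where "coset C N a b x = plusm C a b x ` N a b"

definition quot ::
    "('o, 'm, 'k) moncat \<Rightarrow> ('o \<Rightarrow> 'o \<Rightarrow> 'm set) \<Rightarrow> ('o, 'm set, 'k) moncat" where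
  "quot C N = \<lparr>
     obj = obj C,
     hom = (\<lambda>a b. coset C N a b ` hom C a b),
     idm = (\<lambda>a. coset C N a a (idm C a)),
     cmp = (\<lambda>a b c Y X. \<Union>y\<in>Y. \<Union>x\<in>X. coset C N a c (cmp C a b c y x)),
     zerom = (\<lambda>a b. coset C N a b (zerom C a b)),
     plusm = (\<lambda>a b X Y. \<Union>x\<in>X. \<Union>y\<in>Y. coset C N a b (plusm C a b x y)),
     scalm = (\<lambda>a b r X. \<Union>x\<in>X. coset C N a b (scalm C a b r x)),
     unito = unito C,
     tenso = tenso C,
     tensm = (\<lambda>a a' b b' X Y. \<Union>x\<in>X. \<Union>y\<in>Y.
        coset C N (tenso C a b) (tenso C a' b') (tensm C a a' b b' x y)),
     symm = (\<lambda>a b. coset C N (tenso C a b) (tenso C b a) (symm C a b)) \<rparr>"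

definition lincomb ::
    "('o, 'm, 'k) moncat \<Rightarrow> 'o \<Rightarrow> 'o \<Rightarrow> 'k list \<Rightarrow> 'm list \<Rightarrow> 'm" where
  "lincomb C a b cs vs =
     foldr (\<lambda>(c, v) s. plusm C a b (scalm C a b c v) s) (zip cs vs) (zerom C a b)"

definition fin_dim_hom :: "('o, 'm, 'k) moncat \<Rightarrow> 'o \<Rightarrow> 'o \<Rightarrow> bool" where
  "fin_dim_hom C a b \<longleftrightarrow> (\<exists>vs. set vs \<subseteq> hom C a b \<and>
     (\<forall>x\<in>hom C a b. \<exists>cs. length cs = length vs \<and> x = lincomb C a b cs vs))"

definition hom_basis :: "('o, 'm, 'k) moncat \<Rightarrow> 'o \<Rightarrow> 'o \<Rightarrow> 'm list \<Rightarrow> bool" where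
  "hom_basis C a b vs \<longleftrightarrow> set vs \<subseteq> hom C a b \<and>
     (\<forall>x\<in>hom C a b. \<exists>!cs. length cs = length vs \<and> x = lincomb C a b cs vs)"


section \<open>The Karoubi envelope\<close>

type_synonym 'm matrix = "nat \<Rightarrow> nat \<Rightarrow> 'm"

definition mk_mat :: "nat \<Rightarrow> nat \<Rightarrow> (nat \<Rightarrow> nat \<Rightarrow> 'm) \<Rightarrow> 'm matrix"
  where "mk_mat m n f = (\<lambda>i j. if i < m \<and> j < n then f i j else undefined)"

text \<open>Finite direct sums: an object is a finite list of objects, and the \<open>(i, j)\<close> entry of a
  matrix \<open>Xs \<rightarrow> Ys\<close> is a morphism \<open>Xs ! j \<rightarrow> Ys ! i\<close>.  In a tensor product the pair of indices
  \<open>(i, j)\<close> is at position \<open>i * length Ys + j\<close>.\<close>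

definition additive_envelope :: "('o, 'm, 'k) moncat \<Rightarrow> ('o list, 'm matrix, 'k) moncat" where
  "additive_envelope C = \<lparr>
     obj = lists (obj C),
     hom = (\<lambda>Xs Ys. {mk_mat (length Ys) (length Xs) f |f.
        \<forall>i<length Ys. \<forall>j<length Xs. f i j \<in> hom C (Xs ! j) (Ys ! i)}),
     idm = (\<lambda>Xs. mk_mat (length Xs) (length Xs)
        (\<lambda>i j. if i = j then idm C (Xs ! i) else zerom C (Xs ! j) (Xs ! i))),
     cmp = (\<lambda>Xs Ys Zs G F. mk_mat (length Zs) (length Xs) (\<lambda>i j.
        foldr (\<lambda>l s. plusm C (Xs ! j) (Zs ! i)
                 (cmp C (Xs ! j) (Ys ! l) (Zs ! i) (G i l) (F l j)) s)
          [0..<length Ys] (zerom C (Xs ! j) (Zs ! i)))),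
     zerom = (\<lambda>Xs Ys. mk_mat (length Ys) (length Xs) (\<lambda>i j. zerom C (Xs ! j) (Ys ! i))),
     plusm = (\<lambda>Xs Ys F G. mk_mat (length Ys) (length Xs)
        (\<lambda>i j. plusm C (Xs ! j) (Ys ! i) (F i j) (G i j))),
     scalm = (\<lambda>Xs Ys r F. mk_mat (length Ys) (length Xs)
        (\<lambda>i j. scalm C (Xs ! j) (Ys ! i) r (F i j))),
     unito = [unito C],
     tenso = (\<lambda>Xs Ys. [tenso C X Y. X \<leftarrow> Xs, Y \<leftarrow> Ys]),
     tensm = (\<lambda>Xs Xs' Ys Ys' F G.
        mk_mat (length Xs' * length Ys') (length Xs * length Ys) (\<lambda>i j.
          tensm C (Xs ! (j div length Ys)) (Xs' ! (i div length Ys'))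
                  (Ys ! (j mod length Ys)) (Ys' ! (i mod length Ys'))
            (F (i div length Ys') (j div length Ys)) (G (i mod length Ys') (j mod length Ys)))),
     symm = (\<lambda>Xs Ys. mk_mat (length Ys * length Xs) (length Xs * length Ys) (\<lambda>i j.
        if i div length Xs = j mod length Ys \<and> i mod length Xs = j div length Ys
        then symm C (Xs ! (j div length Ys)) (Ys ! (j mod length Ys))
        else zerom C (tenso C (Xs ! (j div length Ys)) (Ys ! (j mod length Ys)))
                     (tenso C (Ys ! (i div length Xs)) (Xs ! (i mod length Xs))))) \<rparr>"

definition idempotent_completion ::
    "('o, 'm, 'k) moncat \<Rightarrow> ('o \<times> 'm, 'm, 'k) moncat" where
  "idempotent_completion C = \<lparr>
     obj = {(X, e). X \<in> obj C \<and> e \<in> hom C X X \<and> cmp C X X X e e = e},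
     hom = (\<lambda>(X, e) (Y, f). {m \<in> hom C X Y. cmp C X Y Y f (cmp C X X Y m e) = m}),
     idm = snd,
     cmp = (\<lambda>P Q R. cmp C (fst P) (fst Q) (fst R)),
     zerom = (\<lambda>P Q. zerom C (fst P) (fst Q)),
     plusm = (\<lambda>P Q. plusm C (fst P) (fst Q)),
     scalm = (\<lambda>P Q. scalm C (fst P) (fst Q)),
     unito = (unito C, idm C (unito C)),
     tenso = (\<lambda>(X, e) (Y, f). (tenso C X Y, tensm C X X Y Y e f)),
     tensm = (\<lambda>P P' Q Q'. tensm C (fst P) (fst P') (fst Q) (fst Q')),
     symm = (\<lambda>(X, e) (Y, f).
        cmp C (tenso C X Y) (tenso C X Y) (tenso C Y X) (symm C X Y) (tensm C X X Y Y e f)) \<rparr>"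

definition karoubi ::
    "('o, 'm, 'k) moncat \<Rightarrow> ('o list \<times> 'm matrix, 'm matrix, 'k) moncat"
  where "karoubi C = idempotent_completion (additive_envelope C)"

definition mat1 :: "'m \<Rightarrow> 'm matrix"
  where "mat1 x = mk_mat 1 1 (\<lambda>i j. x)"

text \<open>The object \<open>(X, e)\<close> of the Karoubi envelope.\<close>

definition kar_obj :: "'o \<Rightarrow> 'm \<Rightarrow> 'o list \<times> 'm matrix"
  where "kar_obj X e = ([X], mat1 e)"


section \<open>The category of an evaluation\<close>

text \<open>Linear combinations of the diagrams in a class \<open>Q\<close> that is closed under stacking and
  juxtaposition and contains the permutation diagrams.\<close>

definition free_cat ::
    "(sign list \<Rightarrow> sign list \<Rightarrow> (point, 's) diagram set) \<Rightarrow>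
     (sign list, ('s, 'k::field) comb, 'k) moncat" where
  "free_cat Q = \<lparr>
     obj = UNIV,
     hom = (\<lambda>a b. {x. Poly_Mapping.keys x \<subseteq> Q a b}),
     idm = (\<lambda>a. gen (id_diagram a)),
     cmp = (\<lambda>a b c. bilin (stack (length b))),
     zerom = (\<lambda>a b. 0),
     plusm = (\<lambda>a b. (+)),
     scalm = (\<lambda>a b. scale),
     unito = [],
     tenso = (@),
     tensm = (\<lambda>a a' b b'. bilin (juxtapose (length a) (length a'))),
     symm = (\<lambda>a b. gen (swap_diagram a b)) \<rparr>"

definition cob_cat :: "'s set \<Rightarrow> (sign list, ('s, 'k::field) comb, 'k) moncat"
  where "cob_cat S = free_cat (cobs S)"

definition null_combs ::
    "'s set \<Rightarrow> ('s, 'k::field) evaluation \<Rightarrow> sign list \<Rightarrow> sign list \<Rightarrow> ('s, 'k) comb set" where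
  "null_combs S \<alpha> a b = {x \<in> hom (cob_cat S) a b.
     \<forall>D\<in>cobs S b a. eval_comb \<alpha> (lin (diagram_closure (length a)) (cmp (cob_cat S) a b a (gen D) x)) = 0}"

type_synonym ('s, 'k) cls = "('s, 'k) comb set"

definition cat :: "'s set \<Rightarrow> ('s, 'k::field) evaluation \<Rightarrow> (sign list, ('s, 'k) cls, 'k) moncat"
  where "cat S \<alpha> = quot (cob_cat S) (null_combs S \<alpha>)"

definition cls ::
    "'s set \<Rightarrow> ('s, 'k::field) evaluation \<Rightarrow> sign list \<Rightarrow> sign list \<Rightarrow> ('s, 'k) comb \<Rightarrow> ('s, 'k) cls"
  where "cls S \<alpha> = coset (cob_cat S) (null_combs S \<alpha>)"

definition rational :: "'s set \<Rightarrow> ('s, 'k::field) evaluation \<Rightarrow> bool"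
  where "rational S \<alpha> \<longleftrightarrow> fin_dim_hom (cat S \<alpha>) [] [Pos, Neg]"

definition state_space :: "'s set \<Rightarrow> ('s, 'k::field) evaluation \<Rightarrow> sign list \<Rightarrow> ('s, 'k) cls set"
  where "state_space S \<alpha> a = hom (cat S \<alpha>) [] a"

text \<open>Bending strands only changes the positions of the outer points; \<open>X\<close> becomes a morphism from
  \<open>a\<close> to \<open>b\<close> when its points are moved along \<open>f\<close>.\<close>

definition bend ::
    "'s set \<Rightarrow> ('s, 'k::field) evaluation \<Rightarrow> (point \<Rightarrow> point) \<Rightarrow> sign list \<Rightarrow> sign list \<Rightarrow>
     ('s, 'k) cls \<Rightarrow> ('s, 'k) cls"
  where "bend S \<alpha> f a b X = (\<Union>x\<in>X. cls S \<alpha> a b (lin (rename f) x))"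

text \<open>For \<open>X\<close> in \<open>A(+-)\<close>, whose outer head is \<open>Top 0\<close> and whose outer tail is \<open>Top 1\<close>: the
  corresponding morphism from \<open>a\<close> to \<open>b\<close> with outer head \<open>h\<close> and outer tail \<open>t\<close>.\<close>

definition bend_arc ::
    "'s set \<Rightarrow> ('s, 'k::field) evaluation \<Rightarrow> point \<Rightarrow> point \<Rightarrow> sign list \<Rightarrow> sign list \<Rightarrow>
     ('s, 'k) cls \<Rightarrow> ('s, 'k) cls"
  where "bend_arc S \<alpha> h t = bend S \<alpha> (\<lambda>p. if p = Top 0 then h else t)"

definition to_end_pos :: "'s set \<Rightarrow> ('s, 'k::field) evaluation \<Rightarrow> ('s, 'k) cls \<Rightarrow> ('s, 'k) cls"
  where "to_end_pos S \<alpha> = bend_arc S \<alpha> (Top 0) (Bot 0) [Pos] [Pos]"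

definition of_end_pos :: "'s set \<Rightarrow> ('s, 'k::field) evaluation \<Rightarrow> ('s, 'k) cls \<Rightarrow> ('s, 'k) cls"
  where "of_end_pos S \<alpha> = bend S \<alpha> (\<lambda>p. if p = Top 0 then Top 0 else Top 1) [] [Pos, Neg]"

definition to_end_neg :: "'s set \<Rightarrow> ('s, 'k::field) evaluation \<Rightarrow> ('s, 'k) cls \<Rightarrow> ('s, 'k) cls"
  where "to_end_neg S \<alpha> = bend_arc S \<alpha> (Bot 0) (Top 0) [Neg] [Neg]"

definition mult_A ::
    "'s set \<Rightarrow> ('s, 'k::field) evaluation \<Rightarrow> ('s, 'k) cls \<Rightarrow> ('s, 'k) cls \<Rightarrow> ('s, 'k) cls" where
  "mult_A S \<alpha> X Y = of_end_pos S \<alpha>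
     (cmp (cat S \<alpha>) [Pos] [Pos] [Pos] (to_end_pos S \<alpha> X) (to_end_pos S \<alpha> Y))"

definition one_A :: "'s set \<Rightarrow> ('s, 'k::field) evaluation \<Rightarrow> ('s, 'k) cls"
  where "one_A S \<alpha> = cls S \<alpha> [] [Pos, Neg] (gen {#Seg (Some (Top 0)) [] (Some (Top 1))#})"

definition act_A ::
    "'s set \<Rightarrow> ('s, 'k::field) evaluation \<Rightarrow> ('s, 'k) cls \<Rightarrow> ('s, 'k) cls \<Rightarrow> ('s, 'k) cls"
  where "act_A S \<alpha> X v = cmp (cat S \<alpha>) [] [Pos] [Pos] (to_end_pos S \<alpha> X) v"

text \<open>The circular closure on \<open>A(+-)\<close>; the value does not depend on the representative.\<close>

definition circular_closure :: "('s, 'k::field) evaluation \<Rightarrow> ('s, 'k) cls \<Rightarrow> 'k"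
  where "circular_closure \<alpha> X = the_elem ((\<lambda>x. eval_comb \<alpha> (lin (glue (Top 0) (Top 1)) x)) ` X)"

text \<open>The tensor product \<open>v \<otimes> w\<close> in \<open>A(+-)\<close>, and the pairing of \<open>w\<close> in \<open>A(-)\<close> with \<open>v\<close> in \<open>A(+)\<close>,
  that is, \<open>(\<langle>\<omega>\<^sub>1|, |\<omega>\<^sub>2\<rangle>) = \<alpha>\<^sub>I(\<omega>\<^sub>1\<omega>\<^sub>2)\<close>: join the two outer points of \<open>v \<otimes> w\<close> and evaluate.\<close>

definition tens_A ::
    "'s set \<Rightarrow> ('s, 'k::field) evaluation \<Rightarrow> ('s, 'k) cls \<Rightarrow> ('s, 'k) cls \<Rightarrow> ('s, 'k) cls"
  where "tens_A S \<alpha> v w = tensm (cat S \<alpha>) [] [Pos] [] [Neg] v w"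

definition pairing_A ::
    "'s set \<Rightarrow> ('s, 'k::field) evaluation \<Rightarrow> ('s, 'k) cls \<Rightarrow> ('s, 'k) cls \<Rightarrow> 'k"
  where "pairing_A S \<alpha> w v = circular_closure \<alpha> (tens_A S \<alpha> v w)"

definition dual_bases ::
    "'s set \<Rightarrow> ('s, 'k::field) evaluation \<Rightarrow> ('s, 'k) cls list \<Rightarrow> ('s, 'k) cls list \<Rightarrow> bool" where
  "dual_bases S \<alpha> vs ws \<longleftrightarrow>
     hom_basis (cat S \<alpha>) [] [Pos] vs \<and> hom_basis (cat S \<alpha>) [] [Neg] ws \<and>
     length ws = length vs \<and>
     (\<forall>i<length vs. \<forall>j<length vs. pairing_A S \<alpha> (ws ! j) (vs ! i) = (if i = j then 1 else 0))"


section \<open>The Frobenius algebra of an evaluation\<close>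

record ('b, 'k) frobenius =
  carr :: "'b set"
  fplus :: "'b \<Rightarrow> 'b \<Rightarrow> 'b"
  fscal :: "'k \<Rightarrow> 'b \<Rightarrow> 'b"
  fmult :: "'b \<Rightarrow> 'b \<Rightarrow> 'b"
  fone :: 'b
  ftrace :: "'b \<Rightarrow> 'k"

definition K_carrier :: "'s set \<Rightarrow> ('s, 'k::field) evaluation \<Rightarrow> ('s, 'k) cls set" where
  "K_carrier S \<alpha> =
     {X \<in> state_space S \<alpha> [Pos, Neg]. \<forall>v\<in>state_space S \<alpha> [Pos]. act_A S \<alpha> X v = zerom (cat S \<alpha>) [] [Pos]}"

text \<open>\<open>1 - (\<Sum>i. v\<^sup>i \<otimes> v\<^sub>i)\<close>, for an arbitrary choice of dual bases of \<open>A(+)\<close> and \<open>A(-)\<close>.\<close>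

definition one_K :: "'s set \<Rightarrow> ('s, 'k::field) evaluation \<Rightarrow> ('s, 'k) cls" where
  "one_K S \<alpha> = (let (vs, ws) = (SOME (vs, ws). dual_bases S \<alpha> vs ws) in
     plusm (cat S \<alpha>) [] [Pos, Neg] (one_A S \<alpha>)
       (scalm (cat S \<alpha>) [] [Pos, Neg] (- 1)
         (lincomb (cat S \<alpha>) [] [Pos, Neg] (replicate (length vs) 1)
            (map2 (tens_A S \<alpha>) vs ws))))"

definition K_alg :: "'s set \<Rightarrow> ('s, 'k::field) evaluation \<Rightarrow> (('s, 'k) cls, 'k) frobenius" where
  "K_alg S \<alpha> = \<lparr>
     carr = K_carrier S \<alpha>,
     fplus = plusm (cat S \<alpha>) [] [Pos, Neg],
     fscal = scalm (cat S \<alpha>) [] [Pos, Neg],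
     fmult = mult_A S \<alpha>,
     fone = one_K S \<alpha>,
     ftrace = circular_closure \<alpha> \<rparr>"

definition X0_pos where "X0_pos S \<alpha> = kar_obj [Pos] (to_end_pos S \<alpha> (one_K S \<alpha>))"
definition X0_neg where "X0_neg S \<alpha> = kar_obj [Neg] (to_end_neg S \<alpha> (one_K S \<alpha>))"


section \<open>The Frobenius--Brauer category and its gligible quotient\<close>

definition fb_free_cat ::
    "('b, 'k::field) frobenius \<Rightarrow> (sign list, ('b, 'k) comb, 'k) moncat"
  where "fb_free_cat B = free_cat (cobs_no_inner (carr B))"

text \<open>A component with a variable word.\<close>

definition strand_shapes :: "('b list \<Rightarrow> (point, 'b) strand) set" where
  "strand_shapes = {(\<lambda>w. Seg (Some p) w (Some q)) |p q. True} \<union> {\<lambda>w. Circ (cyc w)}"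

text \<open>The span of the local relations applied inside arbitrary diagrams \<open>a \<rightarrow> b\<close>.  In each rule
  \<open>D\<close> consists of the other components.\<close>

inductive_set fb_rels ::
    "('b, 'k::field) frobenius \<Rightarrow> sign list \<Rightarrow> sign list \<Rightarrow> ('b, 'k) comb set"
  for B a b where
  zero: "0 \<in> fb_rels B a b"
| plus: "x \<in> fb_rels B a b \<Longrightarrow> y \<in> fb_rels B a b \<Longrightarrow> x + y \<in> fb_rels B a b"
| scal: "x \<in> fb_rels B a b \<Longrightarrow> scale c x \<in> fb_rels B a b"
| label_plus:
    "s \<in> strand_shapes \<Longrightarrow> x \<in> carr B \<Longrightarrow> y \<in> carr B \<Longrightarrow>
     add_mset (s (u @ [x] @ v)) D \<in> cobs_no_inner (carr B) a b \<Longrightarrow>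
     gen (add_mset (s (u @ [fplus B x y] @ v)) D)
       - (gen (add_mset (s (u @ [x] @ v)) D) + gen (add_mset (s (u @ [y] @ v)) D)) \<in> fb_rels B a b"
| label_scal:
    "s \<in> strand_shapes \<Longrightarrow> x \<in> carr B \<Longrightarrow>
     add_mset (s (u @ [x] @ v)) D \<in> cobs_no_inner (carr B) a b \<Longrightarrow>
     gen (add_mset (s (u @ [fscal B c x] @ v)) D)
       - scale c (gen (add_mset (s (u @ [x] @ v)) D)) \<in> fb_rels B a b"
| label_mult:
    "s \<in> strand_shapes \<Longrightarrow>
     add_mset (s (u @ [x, y] @ v)) D \<in> cobs_no_inner (carr B) a b \<Longrightarrow>
     gen (add_mset (s (u @ [x, y] @ v)) D)
       - gen (add_mset (s (u @ [fmult B x y] @ v)) D) \<in> fb_rels B a b"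
| label_one:
    "s \<in> strand_shapes \<Longrightarrow>
     add_mset (s (u @ v)) D \<in> cobs_no_inner (carr B) a b \<Longrightarrow>
     gen (add_mset (s (u @ [fone B] @ v)) D) - gen (add_mset (s (u @ v)) D) \<in> fb_rels B a b"
| circle:
    "add_mset (Circ (cyc [x])) D \<in> cobs_no_inner (carr B) a b \<Longrightarrow>
     gen (add_mset (Circ (cyc [x])) D) - scale (ftrace B x) (gen D) \<in> fb_rels B a b"

text \<open>\<open>fb_cat B\<close> is \<open>\<C>'\<^sub>B\<close> and \<open>gligible_fb_cat B\<close> is \<open>\<C>\<^sub>B\<close>.\<close>

definition fb_cat ::
    "('b, 'k::field) frobenius \<Rightarrow> (sign list, ('b, 'k) comb set, 'k) moncat"
  where "fb_cat B = quot (fb_free_cat B) (fb_rels B)"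

definition fb_cls ::
    "('b, 'k::field) frobenius \<Rightarrow> sign list \<Rightarrow> sign list \<Rightarrow> ('b, 'k) comb \<Rightarrow> ('b, 'k) comb set"
  where "fb_cls B = coset (fb_free_cat B) (fb_rels B)"

definition fb_closure ::
    "('b, 'k::field) frobenius \<Rightarrow> sign list \<Rightarrow> ('b, 'k) comb set \<Rightarrow> ('b, 'k) comb set"
  where "fb_closure B a X = (\<Union>x\<in>X. fb_cls B [] [] (lin (diagram_closure (length a)) x))"

definition negligible ::
    "('b, 'k::field) frobenius \<Rightarrow> sign list \<Rightarrow> sign list \<Rightarrow> ('b, 'k) comb set set" where
  "negligible B a b = {X \<in> hom (fb_cat B) a b. \<forall>Y\<in>hom (fb_cat B) b a.
     fb_closure B a (cmp (fb_cat B) a b a Y X) = zerom (fb_cat B) [] []}"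

definition gligible_fb_cat ::
    "('b, 'k::field) frobenius \<Rightarrow> (sign list, ('b, 'k) comb set set, 'k) moncat"
  where "gligible_fb_cat B = quot (fb_cat B) (negligible B)"


section \<open>The functor\<close>

text \<open>The arc from \<open>a\<close> to \<open>b\<close> (a strand, a cup or a cap) with outer head \<open>h\<close>, outer tail \<open>t\<close> and one
  dot labelled \<open>x\<close>.\<close>

definition fb_arc ::
    "('b, 'k::field) frobenius \<Rightarrow> point \<Rightarrow> point \<Rightarrow> sign list \<Rightarrow> sign list \<Rightarrow> 'b \<Rightarrow> ('b, 'k) comb set"
  where "fb_arc B h t a b x = fb_cls B a b (gen {#Seg (Some h) [x] (Some t)#})"

text \<open>The condition on \<open>heads\<close> and \<open>tails\<close> singles out the six types of arcs: \<open>+ \<rightarrow> +\<close>, \<open>- \<rightarrow> -\<close>,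
  the cups \<open>1 \<rightarrow> +-\<close> and \<open>1 \<rightarrow> -+\<close>, and the caps \<open>+- \<rightarrow> 1\<close> and \<open>-+ \<rightarrow> 1\<close>.\<close>

definition is_F0 ::
    "'s set \<Rightarrow> ('s, 'k::field) evaluation \<Rightarrow>
     (sign list, (('s, 'k) cls, 'k) comb set, sign list list \<times> ('s, 'k) cls matrix,
      ('s, 'k) cls matrix) funct \<Rightarrow> bool" where
  "is_F0 S \<alpha> F \<longleftrightarrow>
     monoidal_functor (fb_cat (K_alg S \<alpha>)) (karoubi (cat S \<alpha>)) F \<and>
     full_functor (fb_cat (K_alg S \<alpha>)) (karoubi (cat S \<alpha>)) F \<and>
     preserves_symmetry (fb_cat (K_alg S \<alpha>)) (karoubi (cat S \<alpha>)) F \<and>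
     on_obj F [Pos] = X0_pos S \<alpha> \<and> on_obj F [Neg] = X0_neg S \<alpha> \<and>
     (\<forall>a b h t x. heads a b = {h} \<and> tails a b = {t} \<and> x \<in> K_carrier S \<alpha> \<longrightarrow>
        on_hom F a b (fb_arc (K_alg S \<alpha>) h t a b x) = mat1 (bend_arc S \<alpha> h t a b x))"

text \<open>The composite of the quotient functor \<open>\<C>'\<^sub>B \<rightarrow> \<C>\<^sub>B\<close> with \<open>F\<close> is \<open>F0\<close>.\<close>

definition induces ::
    "('b, 'k::field) frobenius \<Rightarrow> (sign list, ('b, 'k) comb set, 'p, 'n) funct \<Rightarrow>
     (sign list, ('b, 'k) comb set set, 'p, 'n) funct \<Rightarrow> bool" where
  "induces B F0 F \<longleftrightarrow>
     (\<forall>a. on_obj F a = on_obj F0 a) \<and>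
     (\<forall>a b. \<forall>X\<in>hom (fb_cat B) a b.
        on_hom F a b (coset (fb_cat B) (negligible B) a b X) = on_hom F0 a b X)"

end

theory Submission
  imports Defs
begin

text \<open>
  A combination of diagrams is negligible iff it evaluates to zero in every closed context, so the
  negligible combinations form an ideal for all the operations, and the local relations can be used
  inside any diagram.  Write \<open>\<epsilon>\<close> for \<open>1\<close> minus the sum of \<open>v\<^sup>i \<otimes> v\<^sub>i\<close>, the unit of \<open>\<K>\<close>.  Sending
  a diagram with labels in \<open>\<K>\<close> to the product over its components of the composite of \<open>\<epsilon>\<close> with the
  labels respects the relations, because \<open>\<epsilon>\<close> is an idempotent and the circular closure is the trace.
  It is full: modulo negligible combinations, \<open>\<epsilon>\<close> kills every half-interval, and an arc decorated by a
  word, once compressed by \<open>\<epsilon>\<close>, becomes an arc labelled by an element of \<open>\<K>\<close>.  It preserves closures;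
  as every morphism to test against may be compressed by \<open>\<epsilon>\<close> and so has a preimage, its kernel consists
  exactly of the negligible morphisms.

  A monoidal functor with prescribed values on the generators need not coincide with
  this one, but the closure of an endomorphism is an iterated partial trace made of cups, caps and
  permutations, which determines it on closures; fullness then gives the same kernel.
\<close>

section \<open>Linear combinations\<close>

text \<open>Diagrams are multisets, so the product of \<open>poly_mapping\<close> is disjoint union
  extended bilinearly. Stacking, juxtaposition and closure thereby become composites of three
  operations: product, gluing along a list of pairs of points, and renaming of outer points.
  Stability of an ideal is proved for these three and then read off for the categorical operations.
  This forces diagrams over arbitrary types of outer points: two stacked diagrams live over
  \<open>point + point\<close>, and the identities of the algebra A(+-) are checked with natural
  numbers as points. Isotopy is replaced by the fact that gluings at disjoint pairs commute, so that
  only the multiset of pairs matters.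

  Rationality concerns A(+-), while the unit of the kernel algebra needs dual bases of A(+) and
  A(-). The bridge is a bound on biorthogonal systems: their rank-one tensors, tested by functionals
  on A(+-), factor an identity matrix through a spanning list.

  Labels of diagrams in the Frobenius-Brauer category are themselves classes of combinations.
  Translating them requires chosen representatives, and all identities for these hold modulo null
  combinations only.\<close>

lemma lookup_scale: "Poly_Mapping.lookup (scale c x) a = c * Poly_Mapping.lookup x a"
  by (auto simp: scale_def Poly_Mapping.map.rep_eq when_def)

lemma scale_add: "scale c (x + y) = scale c x + scale c y"
  by (rule poly_mapping_eqI) (simp add: lookup_scale lookup_add algebra_simps)

lemma scale_0_right [simp]: "scale c 0 = 0"
  by (rule poly_mapping_eqI) (simp add: lookup_scale)

lemma scale_0 [simp]: "scale 0 x = 0"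
  by (rule poly_mapping_eqI) (simp add: lookup_scale)

lemma scale_1 [simp]: "scale 1 x = x"
  by (rule poly_mapping_eqI) (simp add: lookup_scale)

lemma scale_scale [simp]: "scale c (scale d x) = scale (c * d) x"
  by (rule poly_mapping_eqI) (simp add: lookup_scale)

lemma scale_minus_one: "scale (- 1) x = - x"
  by (rule poly_mapping_eqI) (simp add: lookup_scale)

lemma scale_diff: "scale c (x - y) = scale c x - scale c y"
  by (rule poly_mapping_eqI) (simp add: lookup_scale lookup_minus algebra_simps)

lemma scale_left_distrib: "scale (c + d) x = scale c x + scale d x"
  by (rule poly_mapping_eqI) (simp add: lookup_scale lookup_add algebra_simps)

lemma scale_single: "scale c (Poly_Mapping.single a d) = Poly_Mapping.single a (c * d)"
  by (rule poly_mapping_eqI) (simp add: lookup_scale lookup_single when_def)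

lemma scale_sum: "scale c (sum f A) = (\<Sum>a\<in>A. scale c (f a))"
  by (induct A rule: infinite_finite_induct) (simp_all add: scale_add)

lemma sum_singles:
  "(\<Sum>a\<in>Poly_Mapping.keys x. Poly_Mapping.single a (Poly_Mapping.lookup x a)) = x"
  by (rule poly_mapping_eqI)
    (auto simp: lookup_sum lookup_single when_def sum.delta in_keys_iff)

text \<open>The product is convolution, so scaling is multiplication by the constant monomial at
  \<open>0\<close>. Compatibility of \<open>scale\<close> with products then is associativity and
  commutativity.\<close>

lemma scale_conv_mult:
  "scale c x = Poly_Mapping.single (0::'a::monoid_add) c * x"
proof -
  have "x = (\<Sum>a\<in>Poly_Mapping.keys x. Poly_Mapping.single a (Poly_Mapping.lookup x a))"
    by (simp add: sum_singles)
  then obtain f A where x: "x = (\<Sum>a\<in>A. Poly_Mapping.single a (f a))" by blast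
  show ?thesis unfolding x scale_sum sum_distrib_left by (simp add: scale_single mult_single)
qed

lemma scale_mult_left:
  fixes x :: "'a::comm_monoid_add \<Rightarrow>\<^sub>0 'k::field"
  shows "scale c x * y = scale c (x * y)"
  by (simp add: scale_conv_mult mult.assoc)

lemma scale_mult_right:
  fixes x :: "'a::comm_monoid_add \<Rightarrow>\<^sub>0 'k::field"
  shows "x * scale c y = scale c (x * y)"
  by (metis mult.commute scale_mult_left)

text \<open>Unlike \<open>lin\<close>, it may send a basis element to a combination. This is needed
  for \<open>Phi\<close>, whose value on a single labelled diagram is a sum of decorated
  diagrams.\<close>

definition ext :: "('a \<Rightarrow> ('b \<Rightarrow>\<^sub>0 'k)) \<Rightarrow> ('a \<Rightarrow>\<^sub>0 'k::field) \<Rightarrow> ('b \<Rightarrow>\<^sub>0 'k)" where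
  "ext f x = (\<Sum>a\<in>Poly_Mapping.keys x. scale (Poly_Mapping.lookup x a) (f a))"

lemma ext_superset:
  assumes "finite A" "Poly_Mapping.keys x \<subseteq> A"
  shows "ext f x = (\<Sum>a\<in>A. scale (Poly_Mapping.lookup x a) (f a))"
  unfolding ext_def using assms
  by (intro sum.mono_neutral_left) (auto simp: in_keys_iff)

lemma ext_add: "ext f (x + y) = ext f x + ext f y"
proof -
  let ?A = "Poly_Mapping.keys x \<union> Poly_Mapping.keys y"
  have "Poly_Mapping.keys (x + y) \<subseteq> ?A" by (rule Poly_Mapping.keys_add)
  then show ?thesis
    by (simp add: ext_superset[of ?A] lookup_add scale_left_distrib sum.distrib)
qed

lemma keys_scale: "Poly_Mapping.keys (scale c x) \<subseteq> Poly_Mapping.keys x"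
  by (auto simp: in_keys_iff lookup_scale)

lemma ext_scale: "ext f (scale c x) = scale c (ext f x)"
  by (simp add: ext_superset[of "Poly_Mapping.keys x"] keys_scale lookup_scale scale_sum)

lemma ext_0 [simp]: "ext f 0 = 0"
  by (simp add: ext_def)

lemma ext_gen [simp]: "ext f (gen a) = f a"
  by (simp add: ext_def)

lemma ext_uminus: "ext f (- x) = - ext f x"
  by (metis ext_scale scale_minus_one)

lemma ext_diff: "ext f (x - y) = ext f x - ext f y"
  by (metis ext_add ext_uminus uminus_add_conv_diff add.commute)

lemma ext_sum: "ext f (sum g A) = (\<Sum>a\<in>A. ext f (g a))"
  by (induct A rule: infinite_finite_induct) (simp_all add: ext_add)

lemma lin_conv_ext: "lin f = ext (\<lambda>a. gen (f a))"
  by (rule ext) (simp add: lin_def ext_def scale_single)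

lemma bilin_conv_ext: "bilin f x y = ext (\<lambda>a. lin (f a) y) x"
  by (simp add: bilin_def lin_def ext_def scale_single scale_sum)

lemma lin_add: "lin f (x + y) = lin f x + lin f y"
  and lin_scale: "lin f (scale c x) = scale c (lin f x)"
  and lin_0 [simp]: "lin f 0 = 0"
  and lin_gen [simp]: "lin f (gen a) = gen (f a)"
  and lin_uminus: "lin f (- x) = - lin f x"
  and lin_diff: "lin f (x - y) = lin f x - lin f y"
  and lin_sum: "lin f (sum g A) = (\<Sum>a\<in>A. lin f (g a))"
  by (simp_all add: lin_conv_ext ext_add ext_scale ext_uminus ext_diff ext_sum)

lemma ext_fun_add: "ext (\<lambda>a. f a + g a) x = ext f x + ext g x"
  by (simp add: ext_def scale_add sum.distrib)

lemma ext_fun_scale: "ext (\<lambda>a. scale c (f a)) x = scale c (ext f x)"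
  by (simp add: ext_def scale_sum mult.commute)

lemma ext_fun_0 [simp]: "ext (\<lambda>a. 0) x = 0"
  by (simp add: ext_def)

lemma bilin_add_left: "bilin f (x + y) z = bilin f x z + bilin f y z"
  and bilin_add_right: "bilin f z (x + y) = bilin f z x + bilin f z y"
  and bilin_scale_left: "bilin f (scale c x) z = scale c (bilin f x z)"
  and bilin_scale_right: "bilin f z (scale c x) = scale c (bilin f z x)"
  and bilin_0_left [simp]: "bilin f 0 z = 0"
  and bilin_0_right [simp]: "bilin f z 0 = 0"
  and bilin_gen [simp]: "bilin f (gen a) (gen b) = gen (f a b)"
  by (simp_all add: bilin_conv_ext ext_add ext_scale lin_add lin_scale ext_fun_add ext_fun_scale)

section \<open>Linearity of the evaluation\<close>

lemma eval_comb_superset: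
  assumes "finite A" "Poly_Mapping.keys x \<subseteq> A"
  shows "eval_comb \<alpha> x = (\<Sum>D\<in>A. Poly_Mapping.lookup x D * eval_diagram \<alpha> D)"
  unfolding eval_comb_def using assms
  by (intro sum.mono_neutral_left) (auto simp: in_keys_iff)

lemma eval_comb_add: "eval_comb \<alpha> (x + y) = eval_comb \<alpha> x + eval_comb \<alpha> y"
proof -
  let ?A = "Poly_Mapping.keys x \<union> Poly_Mapping.keys y"
  have "Poly_Mapping.keys (x + y) \<subseteq> ?A" by (rule Poly_Mapping.keys_add)
  then show ?thesis
    by (simp add: eval_comb_superset[of ?A] lookup_add algebra_simps sum.distrib)
qed

lemma eval_comb_scale: "eval_comb \<alpha> (scale c x) = c * eval_comb \<alpha> x"
  by (simp add: eval_comb_superset[of "Poly_Mapping.keys x"] keys_scale lookup_scale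
      sum_distrib_left mult.assoc)

lemma eval_comb_0 [simp]: "eval_comb \<alpha> 0 = 0"
  by (simp add: eval_comb_def)

lemma eval_comb_gen [simp]: "eval_comb \<alpha> (gen D) = eval_diagram \<alpha> D"
  by (simp add: eval_comb_def)

lemma eval_comb_uminus: "eval_comb \<alpha> (- x) = - eval_comb \<alpha> x"
  using eval_comb_scale[of \<alpha> "- 1" x] by (simp add: scale_minus_one)

lemma eval_comb_diff: "eval_comb \<alpha> (x - y) = eval_comb \<alpha> x - eval_comb \<alpha> y"
  by (metis eval_comb_add eval_comb_uminus uminus_add_conv_diff add.commute)

lemma eval_comb_sum: "eval_comb \<alpha> (sum g A) = (\<Sum>a\<in>A. eval_comb \<alpha> (g a))"
  by (induct A rule: infinite_finite_induct) (simp_all add: eval_comb_add)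

section \<open>Spans of sets of diagrams and induction over combinations\<close>

definition combs :: "'a set \<Rightarrow> ('a \<Rightarrow>\<^sub>0 'k::field) set"
  where "combs Q = {x. Poly_Mapping.keys x \<subseteq> Q}"

lemma combs_0 [simp]: "0 \<in> combs Q"
  and combs_gen [simp]: "gen a \<in> combs Q \<longleftrightarrow> a \<in> Q"
  by (simp_all add: combs_def)

lemma combs_add [intro]: "x \<in> combs Q \<Longrightarrow> y \<in> combs Q \<Longrightarrow> x + y \<in> combs Q"
  using Poly_Mapping.keys_add[of x y] by (auto simp: combs_def)

lemma combs_scale [intro]: "x \<in> combs Q \<Longrightarrow> scale c x \<in> combs Q"
  using keys_scale[of c x] by (auto simp: combs_def)

lemma combs_uminus [intro]: "x \<in> combs Q \<Longrightarrow> - x \<in> combs Q"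
  by (simp add: combs_def)

lemma combs_diff [intro]: "x \<in> combs Q \<Longrightarrow> y \<in> combs Q \<Longrightarrow> x - y \<in> combs Q"
  by (metis combs_add combs_uminus uminus_add_conv_diff add.commute)

lemma combs_sum: "(\<And>a. a \<in> A \<Longrightarrow> g a \<in> combs Q) \<Longrightarrow> sum g A \<in> combs Q"
  by (induct A rule: infinite_finite_induct) auto

text \<open>A combination is a finite sum of scaled basis elements. The rule reduces statements
  linear in \<open>x\<close> to single diagrams and keeps membership in the span available in the
  addition and scaling steps.\<close>

lemma comb_induct [consumes 1, case_names zero gen add scale]:
  assumes x: "x \<in> combs Q" and "P 0"
    and g: "\<And>a. a \<in> Q \<Longrightarrow> P (gen a)"
    and a: "\<And>x y. x \<in> combs Q \<Longrightarrow> y \<in> combs Q \<Longrightarrow> P x \<Longrightarrow> P y \<Longrightarrow> P (x + y)"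
    and s: "\<And>c x. x \<in> combs Q \<Longrightarrow> P x \<Longrightarrow> P (scale c x)"
  shows "P x"
proof -
  have "sum (\<lambda>a. scale (Poly_Mapping.lookup x a) (gen a)) A \<in> combs Q \<and>
        P (sum (\<lambda>a. scale (Poly_Mapping.lookup x a) (gen a)) A)"
    if "A \<subseteq> Q" for A using that
    by (induct A rule: infinite_finite_induct) (auto simp: assms(2) intro!: a s g combs_add combs_scale)
  from this[of "Poly_Mapping.keys x"] x
  show ?thesis
    by (simp add: combs_def scale_single sum_singles)
qed

lemma ext_in_combs:
  assumes "x \<in> combs Q" "\<And>a. a \<in> Q \<Longrightarrow> f a \<in> combs Q'"
  shows "ext f x \<in> combs Q'"
  using assms(1) by (induct rule: comb_induct) (auto simp: assms(2) ext_add ext_scale)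

lemma lin_in_combs:
  assumes "x \<in> combs Q" "\<And>a. a \<in> Q \<Longrightarrow> f a \<in> Q'"
  shows "lin f x \<in> combs Q'"
  unfolding lin_conv_ext using assms by (intro ext_in_combs) auto

lemma ext_cong_on:
  assumes "x \<in> combs Q" "\<And>a. a \<in> Q \<Longrightarrow> f a = g a"
  shows "ext f x = ext g x"
  using assms(1) by (induct rule: comb_induct) (auto simp: assms(2) ext_add ext_scale)

lemma lin_cong_on:
  assumes "x \<in> combs Q" "\<And>a. a \<in> Q \<Longrightarrow> f a = g a"
  shows "lin f x = lin g x"
  unfolding lin_conv_ext using assms by (intro ext_cong_on) auto

lemma combs_UNIV [simp]: "x \<in> combs UNIV"
  by (simp add: combs_def)

lemma lin_lin: "lin f (lin g x) = lin (\<lambda>a. f (g a)) x"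
  using combs_UNIV[of x] by (induct rule: comb_induct) (auto simp: lin_add lin_scale)

lemma lin_id: "lin (\<lambda>a. a) x = x"
  using combs_UNIV[of x] by (induct rule: comb_induct) (auto simp: lin_add lin_scale)

text \<open>For diagrams \<open>+\<close> is disjoint union, so this identifies the convolution
  product with bilinear disjoint union; the next lemma makes the empty diagram its unit.\<close>

lemma gen_mult_gen: "gen a * gen b = (gen (a + b) :: 'a::comm_monoid_add \<Rightarrow>\<^sub>0 'k::field)"
  by (simp add: mult_single)

lemma gen_0: "gen 0 = (1 :: 'a::comm_monoid_add \<Rightarrow>\<^sub>0 'k::field)"
  by (simp add: single_one)

lemma mult_in_combs:
  fixes x :: "'a::comm_monoid_add \<Rightarrow>\<^sub>0 'k::field"
  assumes "x \<in> combs Q" "y \<in> combs Q'" "\<And>a b. a \<in> Q \<Longrightarrow> b \<in> Q' \<Longrightarrow> a + b \<in> Q''"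
  shows "x * y \<in> combs Q''"
  using assms(1)
proof (induct rule: comb_induct)
  case (gen a)
  show ?case using assms(2)
    by (induct rule: comb_induct)
      (use gen assms(3) in \<open>auto simp: gen_mult_gen distrib_left scale_mult_right\<close>)
qed (auto simp: distrib_right scale_mult_left)

lemma lin_mult:
  fixes x y :: "'a::comm_monoid_add \<Rightarrow>\<^sub>0 'k::field" and f :: "'a \<Rightarrow> 'b::comm_monoid_add"
  assumes "\<And>a b. f (a + b) = f a + f b"
  shows "lin f (x * y) = lin f x * lin f y"
  using combs_UNIV[of x]
proof (induct rule: comb_induct)
  case (gen a)
  show ?case using combs_UNIV[of y]
    by (induct rule: comb_induct)
      (auto simp: gen_mult_gen assms distrib_left lin_add lin_scale scale_mult_right)
qed (auto simp: distrib_right lin_add lin_scale scale_mult_left)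

text \<open>The value of a diagram is a product over its components, hence multiplicative under
  disjoint union; bilinearity does the rest.\<close>

lemma eval_comb_mult: "eval_comb \<alpha> (x * y) = eval_comb \<alpha> x * eval_comb \<alpha> y"
  using combs_UNIV[of x]
proof (induct rule: comb_induct)
  case (gen a)
  show ?case using combs_UNIV[of y]
    by (induct rule: comb_induct)
      (auto simp: gen_mult_gen eval_diagram_def distrib_left eval_comb_add eval_comb_scale scale_mult_right)
qed (auto simp: distrib_right eval_comb_add eval_comb_scale scale_mult_left)

lemma eval_comb_1 [simp]: "eval_comb \<alpha> 1 = 1"
  by (simp add: gen_0[symmetric] eval_diagram_def del: single_one)

section \<open>Gluing\<close>

text \<open>One notion for both kinds of cobordism: the flag forbids inner endpoints, and outer
  points may have any type. Finiteness is built in because \<open>mset_set\<close> of an infinite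
  set is empty, disjointness because otherwise the orientation of a gluing would be
  ambiguous.\<close>

definition dgs :: "bool \<Rightarrow> 's set \<Rightarrow> 'p set \<Rightarrow> 'p set \<Rightarrow> ('p, 's) diagram set" where
  "dgs b S H T = {D. finite H \<and> finite T \<and> H \<inter> T = {} \<and>
     (\<Sum>c\<in>#D. head_end c) = mset_set H \<and> (\<Sum>c\<in>#D. tail_end c) = mset_set T \<and>
     (\<forall>c\<in>#D. letters c \<subseteq> S \<and> (b \<longrightarrow> no_inner c))}"

lemma dgs_finite: "D \<in> dgs b S H T \<Longrightarrow> finite H" "D \<in> dgs b S H T \<Longrightarrow> finite T"
  and dgs_disjoint: "D \<in> dgs b S H T \<Longrightarrow> H \<inter> T = {}"
  by (auto simp: dgs_def)

lemma head_end_cases: "head_end c = {#} \<or> (\<exists>h. head_end c = {#h#})"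
  by (cases c rule: head_end.cases) auto

lemma tail_end_cases: "tail_end c = {#} \<or> (\<exists>h. tail_end c = {#h#})"
  by (cases c rule: tail_end.cases) auto

lemma add_mset_eq_mset_set:
  assumes "finite A"
  shows "add_mset a M = mset_set A \<longleftrightarrow> a \<in> A \<and> M = mset_set (A - {a})"
proof
  assume e: "add_mset a M = mset_set A"
  then have "a \<in># mset_set A" by (metis union_single_eq_member)
  then have a: "a \<in> A" using assms by simp
  then have "mset_set A = add_mset a (mset_set (A - {a}))"
    using assms by (simp add: mset_set.remove)
  with e a show "a \<in> A \<and> M = mset_set (A - {a})" by simp
qed (use assms in \<open>simp add: mset_set.remove[of A a]\<close>)

lemma dgs_empty [simp]: "{#} \<in> dgs b S H T \<longleftrightarrow> H = {} \<and> T = {}"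
  by (auto simp: dgs_def mset_set_empty_iff dest: sym)

text \<open>Each outer point occurs exactly once, so removing a component removes its ends from the
  two boundary sets. This recursive form replaces reasoning with sums of multisets.\<close>

lemma dgs_add:
  "add_mset c D \<in> dgs b S H T \<longleftrightarrow>
     letters c \<subseteq> S \<and> (b \<longrightarrow> no_inner c) \<and> H \<inter> T = {} \<and>
     set_mset (head_end c) \<subseteq> H \<and> set_mset (tail_end c) \<subseteq> T \<and>
     D \<in> dgs b S (H - set_mset (head_end c)) (T - set_mset (tail_end c))"
  using head_end_cases[of c] tail_end_cases[of c]
  by (auto simp: dgs_def add_mset_eq_mset_set)

lemma head_dgs: "D \<in> dgs b S H T \<Longrightarrow> c \<in># D \<Longrightarrow> h \<in># head_end c \<Longrightarrow> h \<in> H"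
  by (induct D arbitrary: H T) (auto simp: dgs_add)

lemma tail_dgs: "D \<in> dgs b S H T \<Longrightarrow> c \<in># D \<Longrightarrow> h \<in># tail_end c \<Longrightarrow> h \<in> T"
  by (induct D arbitrary: H T) (auto simp: dgs_add)

lemma dgs_headE:
  assumes "D \<in> dgs b S H T" "h \<in> H"
  obtains w q D' where "D = add_mset (Seg (Some h) w q) D'"
proof -
  have "h \<in># (\<Sum>c\<in>#D. head_end c)" using assms by (simp add: dgs_def)
  then obtain c where c: "c \<in># D" "h \<in># head_end c" by auto
  then obtain w q where "c = Seg (Some h) w q" by (cases c rule: head_end.cases) auto
  with c show thesis using that by (metis multi_member_split)
qed

lemma dgs_tailE:
  assumes "D \<in> dgs b S H T" "t \<in> T"
  obtains w p D' where "D = add_mset (Seg p w (Some t)) D'"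
proof -
  have "t \<in># (\<Sum>c\<in>#D. tail_end c)" using assms by (simp add: dgs_def)
  then obtain c where c: "c \<in># D" "t \<in># tail_end c" by auto
  then obtain w p where "c = Seg p w (Some t)" by (cases c rule: tail_end.cases) auto
  with c show thesis using that by (metis multi_member_split)
qed

text \<open>The component through the head \<open>h\<close> either also ends at \<open>t\<close>,
  and gluing will close it to a circle, or the tail \<open>t\<close> is found on a component of the
  remainder.\<close>

lemma dgs_cases:
  assumes "D \<in> dgs b S H T" "h \<in> H" "t \<in> T"
  obtains (circ) w D' where "D = add_mset (Seg (Some h) w (Some t)) D'"
  | (join) p u w q D' where
      "D = add_mset (Seg p u (Some t)) (add_mset (Seg (Some h) w q) D')" "p \<noteq> Some h" "q \<noteq> Some t"
proof -
  obtain w q D1 where D1: "D = add_mset (Seg (Some h) w q) D1"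
    using dgs_headE[OF assms(1,2)] by blast
  show thesis
  proof (cases "q = Some t")
    case True
    then show thesis using D1 circ by blast
  next
    case False
    have "t \<notin># tail_end (Seg (Some h) w q)" using False by (cases q) auto
    then have d: "D1 \<in> dgs b S (H - {h}) (T - set_mset (tail_end (Seg (Some h) w q)))"
      and t: "t \<in> T - set_mset (tail_end (Seg (Some h) w q))"
      using assms D1 by (auto simp: dgs_add)
    obtain u p D2 where D2: "D1 = add_mset (Seg p u (Some t)) D2"
      using dgs_tailE[OF d t] by blast
    have "p \<noteq> Some h" using d D2 by (auto simp: dgs_add)
    then show thesis using join D1 D2 False by (metis add_mset_commute)
  qed
qed

text \<open>Outer points have multiplicity one, so no second component can carry \<open>h\<close>.
  This and \<open>tail_unique\<close> make gluing deterministic.\<close>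

lemma head_unique:
  assumes "D \<in> dgs b S H T" "D = add_mset (Seg (Some h) w q) D1" "D = add_mset (Seg (Some h) w' q') D2"
  shows "w' = w \<and> q' = q \<and> D2 = D1"
proof -
  have "D1 \<in> dgs b S (H - {h}) (T - set_mset (tail_end (Seg (Some h) w q)))"
    using assms by (auto simp: dgs_add)
  then have "Seg (Some h) w' q' \<notin># D1" using head_dgs by fastforce
  moreover have "add_mset (Seg (Some h) w q) D1 = add_mset (Seg (Some h) w' q') D2"
    using assms by simp
  ultimately show ?thesis by (auto simp: add_eq_conv_ex)
qed

lemma tail_unique:
  assumes "D \<in> dgs b S H T" "D = add_mset (Seg p w (Some t)) D1" "D = add_mset (Seg p' w' (Some t)) D2"
  shows "w' = w \<and> p' = p \<and> D2 = D1"
proof -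
  have "D1 \<in> dgs b S (H - set_mset (head_end (Seg p w (Some t)))) (T - {t})"
    using assms by (auto simp: dgs_add)
  then have "Seg p' w' (Some t) \<notin># D1" using tail_dgs by fastforce
  moreover have "add_mset (Seg p w (Some t)) D1 = add_mset (Seg p' w' (Some t)) D2"
    using assms by simp
  ultimately show ?thesis by (auto simp: add_eq_conv_ex)
qed

lemma joins_dgs:
  assumes "joins h t D D'" "D \<in> dgs b S H T"
  shows "h \<in> H \<and> t \<in> T"
  using assms by (cases rule: joins.cases) (auto simp: dgs_add)

lemma joins_unique:
  assumes "joins h t D D1" "joins h t D D2" "D \<in> dgs b S H T"
  shows "D2 = D1"
  using assms(1)
proof (cases rule: joins.cases)
  case (1 w D0)
  from assms(2) show ?thesis
  proof (cases rule: joins.cases)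
    case (1 w' D0')
    then show ?thesis using head_unique[OF assms(3) \<open>D = add_mset (Seg (Some h) w (Some t)) D0\<close>] \<open>D1 = _\<close>
      by auto
  next
    case (2 p u w' q D0')
    have "D = add_mset (Seg (Some h) w' q) (add_mset (Seg p u (Some t)) D0')"
      using 2 by (simp add: add_mset_commute)
    from head_unique[OF assms(3) \<open>D = add_mset (Seg (Some h) w (Some t)) D0\<close> this]
    have "q = Some t" by simp
    then show ?thesis using assms(3) 2(1) by (simp add: dgs_add)
  qed
next
  case (2 p u w q D0)
  have D: "D = add_mset (Seg (Some h) w q) (add_mset (Seg p u (Some t)) D0)"
    using 2 by (simp add: add_mset_commute)
  from assms(2) show ?thesis
  proof (cases rule: joins.cases)
    case (1 w' D0')
    from head_unique[OF assms(3) this(1) D]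
    have "q = Some t" by simp
    then show ?thesis using assms(3) D by (simp add: dgs_add)
  next
    case (2 p' u' w' q' D0')
    have D': "D = add_mset (Seg (Some h) w' q') (add_mset (Seg p' u' (Some t)) D0')"
      using 2 by (simp add: add_mset_commute)
    have w: "w' = w" "q' = q" using head_unique[OF assms(3) D D'] by auto
    have u: "u' = u" "p' = p"
      using tail_unique[OF assms(3) \<open>D = add_mset (Seg p u (Some t)) _\<close> 2(1)] by auto
    have "D0' = D0" using D D' w u by simp
    then show ?thesis using \<open>D1 = _\<close> 2 w u by simp
  qed
qed

lemma glue_sym: "glue p q = glue q p"
  by (rule HOL.ext) (simp add: glue_def disj_commute)

text \<open>\<open>glue\<close> is a definite description over both orientations. Heads and tails
  being disjoint, \<open>joins t h\<close> is impossible when \<open>h\<close> is a head, and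
  \<open>joins_unique\<close> leaves one result for \<open>joins h t\<close>.\<close>

lemma glue_eqI:
  assumes "D \<in> dgs b S H T" "joins h t D D'"
  shows "glue h t D = D'"
proof -
  have "h \<in> H" "t \<in> T" using joins_dgs[OF assms(2,1)] by simp_all
  then have "\<not> joins t h D D2" for D2
    using joins_dgs[of t h D D2, OF _ assms(1)] dgs_disjoint[OF assms(1)] by auto
  then have "(joins h t D X \<or> joins t h D X) \<longleftrightarrow> X = D'" for X
    using assms(2) joins_unique[OF assms(2) _ assms(1)] by metis
  then show ?thesis unfolding glue_def by simp
qed

lemma glue_circ:
  assumes "D \<in> dgs b S H T" "D = add_mset (Seg (Some h) w (Some t)) D0"
  shows "glue h t D = add_mset (Circ (cyc w)) D0"
  using assms by (intro glue_eqI[OF assms(1)]) (simp add: joins.intros)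

lemma glue_join:
  assumes "D \<in> dgs b S H T" "D = add_mset (Seg p u (Some t)) (add_mset (Seg (Some h) w q) D0)"
  shows "glue h t D = add_mset (Seg p (u @ w) q) D0"
  using assms by (intro glue_eqI[OF assms(1)]) (simp add: joins.intros)

lemma joins_glue:
  assumes "D \<in> dgs b S H T" "h \<in> H" "t \<in> T"
  shows "joins h t D (glue h t D)"
  using assms(1-3)
proof (cases rule: dgs_cases)
  case (circ w D') then show ?thesis using glue_circ[OF assms(1)] joins.intros(1) by metis
next
  case (join p u w q D') then show ?thesis using glue_join[OF assms(1)] joins.intros(2) by metis
qed

lemma cletters_cyc [simp]: "cletters (cyc w) = set w"
  by transfer simp

lemma glue_dgs1:
  assumes "D \<in> dgs b S H T" "h \<in> H" "t \<in> T"
  shows "glue h t D \<in> dgs b S (H - {h}) (T - {t})"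
  using joins_glue[OF assms] assms(1)
proof (cases rule: joins.cases)
  case (1 w D')
  then show ?thesis using assms(1) by (auto simp: dgs_add)
next
  case (2 p u w q D')
  have e: "X - {a} - Y = X - Y - {a}" for X Y :: "'a set" and a by auto
  have d: "D' \<in> dgs b S (H - set_mset (head_end (Seg p u (Some t))) - {h}) (T - {t} - set_mset (tail_end (Seg (Some h) w q)))"
    and p: "set_mset (head_end (Seg p u (Some t))) \<subseteq> H" "h \<notin> set_mset (head_end (Seg p u (Some t)))"
    and q: "set_mset (tail_end (Seg (Some h) w q)) \<subseteq> T" "t \<notin> set_mset (tail_end (Seg (Some h) w q))"
    and w: "set u \<subseteq> S" "set w \<subseteq> S" "b \<longrightarrow> p \<noteq> None \<and> q \<noteq> None" "H \<inter> T = {}"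
    using assms(1) 2(1) by (simp_all add: dgs_add) blast+
  have e: "A - {a} - B = A - B - {a}" for A B :: "'a set" and a by auto
  have [simp]: "set_mset (head_end (Seg p (u @ w) q)) = set_mset (head_end (Seg p u (Some t)))"
    "set_mset (tail_end (Seg p (u @ w) q)) = set_mset (tail_end (Seg (Some h) w q))"
    by (cases p; simp) (cases q; simp)
  show ?thesis
    unfolding 2(2) dgs_add using d p q w e[of H h] e[of T t] by auto
qed

text \<open>In stacking and closing, which of two glued points is the head depends on the sign
  there; this condition leaves the roles open.\<close>

definition opp :: "'p set \<Rightarrow> 'p set \<Rightarrow> 'p \<Rightarrow> 'p \<Rightarrow> bool"
  where "opp H T p q \<longleftrightarrow> p \<in> H \<and> q \<in> T \<or> p \<in> T \<and> q \<in> H"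

lemma glue_dgs:
  assumes "D \<in> dgs b S H T" "opp H T p q"
  shows "glue p q D \<in> dgs b S (H - {p, q}) (T - {p, q})"
proof -
  have *: "glue h t D \<in> dgs b S (H - {h, t}) (T - {h, t})" if "h \<in> H" "t \<in> T" for h t
  proof -
    have "t \<notin> H" "h \<notin> T" using that dgs_disjoint[OF assms(1)] by auto
    then have "H - {h, t} = H - {h}" "T - {h, t} = T - {t}" by auto
    then show ?thesis using glue_dgs1[OF assms(1) that] by simp
  qed
  from assms(2) *[of p q] *[of q p] show ?thesis
    by (auto simp: opp_def glue_sym[of q p] insert_commute)
qed

lemma cyc_append_commute: "cyc (u @ w) = cyc (w @ u)"
  by transfer (auto simp: cyc_eq_def)

text \<open>The first gluing closes a circle or joins two components; in the latter case the second
  gluing meets the new component at neither, one or both ends. The resulting words agree literally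
  except when the two gluings together close a circle: then they are \<open>u @ w\<close> and
  \<open>w @ u\<close>, equal as cyclic words.\<close>

lemma glue_commute1:
  assumes D: "D \<in> dgs b S H T" and h: "h1 \<in> H" "h2 \<in> H" "h1 \<noteq> h2"
    and t: "t1 \<in> T" "t2 \<in> T" "t1 \<noteq> t2"
  shows "glue h1 t1 (glue h2 t2 D) = glue h2 t2 (glue h1 t1 D)"
proof -
  note g1 = glue_dgs1[OF D h(1) t(1)] and g2 = glue_dgs1[OF D h(2) t(2)]
  from D h(1) t(1) show ?thesis
  proof (cases rule: dgs_cases)
    case (circ w D')
    note E1 = glue_circ[OF D circ]
    have D': "D' \<in> dgs b S (H - {h1}) (T - {t1})" using D circ by (simp add: dgs_add)
    from D' have "h2 \<in> H - {h1}" "t2 \<in> T - {t1}" using h t by auto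
    with D' show ?thesis
    proof (cases rule: dgs_cases)
      case (circ v D'')
      have "glue h2 t2 (glue h1 t1 D) = add_mset (Circ (cyc v)) (add_mset (Circ (cyc w)) D'')"
        using E1 circ by (intro glue_circ[OF g1]) simp
      moreover have E2: "glue h2 t2 D = add_mset (Circ (cyc v)) (add_mset (Seg (Some h1) w (Some t1)) D'')"
        using \<open>D = _\<close> circ by (intro glue_circ[OF D]) simp
      moreover have "glue h1 t1 (glue h2 t2 D) = add_mset (Circ (cyc w)) (add_mset (Circ (cyc v)) D'')"
        using E2 by (intro glue_circ[OF g2]) simp
      ultimately show ?thesis by simp
    next
      case (join p u v q D'')
      have "glue h2 t2 (glue h1 t1 D) = add_mset (Seg p (u @ v) q) (add_mset (Circ (cyc w)) D'')"
        using E1 join by (intro glue_join[OF g1]) simp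
      moreover have E2: "glue h2 t2 D = add_mset (Seg p (u @ v) q) (add_mset (Seg (Some h1) w (Some t1)) D'')"
        using circ join by (intro glue_join[OF D]) simp
      moreover have "glue h1 t1 (glue h2 t2 D) = add_mset (Circ (cyc w)) (add_mset (Seg p (u @ v) q) D'')"
        using E2 by (intro glue_circ[OF g2]) simp
      ultimately show ?thesis by simp
    qed
  next
    case (join p u w q D')
    note E1 = glue_join[OF D join(1)]
    have ph: "p \<noteq> Some h1" and qt: "q \<noteq> Some t1" using join by auto
    let ?H = "H - set_mset (head_end (Seg p u (Some t1))) - {h1}"
    let ?T = "T - {t1} - set_mset (tail_end (Seg (Some h1) w q))"
    have D': "D' \<in> dgs b S ?H ?T" using D join by (simp add: dgs_add)
    show ?thesis
    proof (cases "p = Some h2"; cases "q = Some t2")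
      assume pq: "p = Some h2" "q = Some t2"
      have "glue h2 t2 (glue h1 t1 D) = add_mset (Circ (cyc (u @ w))) D'"
        using E1 pq by (intro glue_circ[OF g1]) simp
      moreover have E2: "glue h2 t2 D = add_mset (Seg (Some h1) (w @ u) (Some t1)) D'"
        using join pq by (intro glue_join[OF D]) simp
      moreover have "glue h1 t1 (glue h2 t2 D) = add_mset (Circ (cyc (w @ u))) D'"
        using E2 by (intro glue_circ[OF g2]) simp
      ultimately show ?thesis by (simp add: cyc_append_commute)
    next
      assume pq: "p = Some h2" "q \<noteq> Some t2"
      have "t2 \<in> ?T" using pq t by (cases q) auto
      from dgs_tailE[OF D' this] obtain r v D'' where r: "D' = add_mset (Seg r v (Some t2)) D''" by blast
      have "glue h2 t2 (glue h1 t1 D) = add_mset (Seg r (v @ u @ w) q) D''"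
        using E1 pq r by (intro glue_join[OF g1]) simp
      moreover have E2: "glue h2 t2 D = add_mset (Seg r (v @ u) (Some t1)) (add_mset (Seg (Some h1) w q) D'')"
        using join pq r by (intro glue_join[OF D]) simp
      moreover have "glue h1 t1 (glue h2 t2 D) = add_mset (Seg r ((v @ u) @ w) q) D''"
        using E2 by (intro glue_join[OF g2]) simp
      ultimately show ?thesis by simp
    next
      assume pq: "p \<noteq> Some h2" "q = Some t2"
      have "h2 \<in> ?H" using pq h by (cases p) auto
      from dgs_headE[OF D' this] obtain r v D'' where r: "D' = add_mset (Seg (Some h2) v r) D''" by blast
      have "glue h2 t2 (glue h1 t1 D) = add_mset (Seg p ((u @ w) @ v) r) D''"
        using E1 pq r by (intro glue_join[OF g1]) simp
      moreover have E2: "glue h2 t2 D = add_mset (Seg (Some h1) (w @ v) r) (add_mset (Seg p u (Some t1)) D'')"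
        using join pq r by (intro glue_join[OF D]) simp
      moreover have "glue h1 t1 (glue h2 t2 D) = add_mset (Seg p (u @ w @ v) r) D''"
        using E2 by (intro glue_join[OF g2]) simp
      ultimately show ?thesis by simp
    next
      assume pq: "p \<noteq> Some h2" "q \<noteq> Some t2"
      have "h2 \<in> ?H" "t2 \<in> ?T" using pq h t by (cases p; cases q; auto)+
      with D' show ?thesis
      proof (cases rule: dgs_cases)
        case (circ v D'')
        have "glue h2 t2 (glue h1 t1 D) = add_mset (Circ (cyc v)) (add_mset (Seg p (u @ w) q) D'')"
          using E1 circ by (intro glue_circ[OF g1]) simp
        moreover have E2: "glue h2 t2 D = add_mset (Circ (cyc v)) (add_mset (Seg p u (Some t1)) (add_mset (Seg (Some h1) w q) D''))"
          using join circ by (intro glue_circ[OF D]) simp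
        moreover have "glue h1 t1 (glue h2 t2 D) = add_mset (Seg p (u @ w) q) (add_mset (Circ (cyc v)) D'')"
          using E2 by (intro glue_join[OF g2]) simp
        ultimately show ?thesis by simp
      next
        case (join r u' v s D'')
        have "glue h2 t2 (glue h1 t1 D) = add_mset (Seg r (u' @ v) s) (add_mset (Seg p (u @ w) q) D'')"
          using E1 join by (intro glue_join[OF g1]) simp
        moreover have E2: "glue h2 t2 D = add_mset (Seg r (u' @ v) s) (add_mset (Seg p u (Some t1)) (add_mset (Seg (Some h1) w q) D''))"
          using \<open>D = _\<close> join by (intro glue_join[OF D]) simp
        moreover have "glue h1 t1 (glue h2 t2 D) = add_mset (Seg p (u @ w) q) (add_mset (Seg r (u' @ v) s) D'')"
          using E2 by (intro glue_join[OF g2]) simp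
        ultimately show ?thesis by simp
      qed
    qed
  qed
qed

lemma glue_commute:
  assumes "D \<in> dgs b S H T" "opp H T p q" "opp H T p' q'" "{p, q} \<inter> {p', q'} = {}"
  shows "glue p q (glue p' q' D) = glue p' q' (glue p q D)"
  using assms(2-4) glue_commute1[OF assms(1)]
  by (auto simp: opp_def) (metis glue_sym)+

lemma dgs_plus:
  assumes "D \<in> dgs b S H T" "E \<in> dgs b S H' T'" "(H \<union> T) \<inter> (H' \<union> T') = {}"
  shows "D + E \<in> dgs b S (H \<union> H') (T \<union> T')"
  using assms by (auto simp: dgs_def mset_set_Union[symmetric] Int_Un_distrib Int_Un_distrib2)

lemma glue_plus:
  assumes "D \<in> dgs b S H T" "opp H T p q" "D + E \<in> dgs b' S' H' T'"
  shows "glue p q (D + E) = glue p q D + E"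
proof -
  have *: "glue h t (D + E) = glue h t D + E" if "h \<in> H" "t \<in> T" for h t
  proof (rule glue_eqI[OF assms(3)])
    show "joins h t (D + E) (glue h t D + E)"
      using joins_glue[OF assms(1) that]
      by (cases rule: joins.cases) (simp_all add: joins.intros)
  qed
  from assms(2) *[of p q] *[of q p] show ?thesis
    by (auto simp: opp_def glue_sym[of q p])
qed

section \<open>Renaming of outer points\<close>

lemma rename_empty [simp]: "rename f {#} = {#}"
  and rename_add_mset [simp]: "rename f (add_mset c D) = add_mset (rename_strand f c) (rename f D)"
  and rename_plus: "rename f (D + E) = rename f D + rename f E"
  by (simp_all add: rename_def)

lemma head_end_rename: "head_end (rename_strand f c) = image_mset f (head_end c)"
  by (cases c rule: head_end.cases) auto

lemma tail_end_rename: "tail_end (rename_strand f c) = image_mset f (tail_end c)"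
  by (cases c rule: tail_end.cases) auto

lemma letters_rename [simp]: "letters (rename_strand f c) = letters c"
  by (cases c) auto

lemma no_inner_rename [simp]: "no_inner (rename_strand f c) = no_inner c"
  by (cases c) auto

lemma dgs_rename:
  assumes "D \<in> dgs b S H T" "inj_on f (H \<union> T)"
  shows "rename f D \<in> dgs b S (f ` H) (f ` T)"
proof -
  have 1: "(\<Sum>c\<in>#rename f D. head_end c) = image_mset f (\<Sum>c\<in>#D. head_end c)"
    by (induct D) (auto simp: head_end_rename)
  have 2: "(\<Sum>c\<in>#rename f D. tail_end c) = image_mset f (\<Sum>c\<in>#D. tail_end c)"
    by (induct D) (auto simp: tail_end_rename)
  have i: "inj_on f H" "inj_on f T" using assms(2) by (auto simp: inj_on_Un)
  have 3: "f ` H \<inter> f ` T = {}"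
    using assms(2) dgs_disjoint[OF assms(1)] by (auto simp: inj_on_def)
  show ?thesis
    using assms(1) 3 unfolding dgs_def
    by (simp add: 1 2 i image_mset_mset_set) (auto simp: rename_def)
qed

lemma rename_joins: "joins h t D D' \<Longrightarrow> joins (f h) (f t) (rename f D) (rename f D')"
  by (induct rule: joins.induct) (auto intro: joins.intros)

lemma opp_image: "opp H T p q \<Longrightarrow> opp (f ` H) (f ` T) (f p) (f q)"
  by (auto simp: opp_def)

lemma rename_glue:
  assumes "D \<in> dgs b S H T" "opp H T p q" "inj_on f (H \<union> T)"
  shows "rename f (glue p q D) = glue (f p) (f q) (rename f D)"
proof -
  have *: "rename f (glue h t D) = glue (f h) (f t) (rename f D)" if "h \<in> H" "t \<in> T" for h t
    using glue_eqI[OF dgs_rename[OF assms(1,3)] rename_joins[OF joins_glue[OF assms(1) that]]] by simp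
  from assms(2) *[of p q] *[of q p] show ?thesis
    by (auto simp: opp_def glue_sym[of q p] glue_sym[of "f q" "f p"])
qed

lemma rename_strand_comp: "rename_strand f (rename_strand g c) = rename_strand (\<lambda>p. f (g p)) c"
  by (cases c) (auto simp: option.map_comp o_def)

lemma rename_rename: "rename f (rename g D) = rename (\<lambda>p. f (g p)) D"
  by (simp add: rename_def multiset.map_comp o_def rename_strand_comp)

lemma rename_cong:
  assumes "D \<in> dgs b S H T" "\<And>p. p \<in> H \<union> T \<Longrightarrow> f p = g p"
  shows "rename f D = rename g D"
  unfolding rename_def
proof (rule image_mset_cong)
  fix c assume c: "c \<in># D"
  have h: "f h = g h" if "h \<in># head_end c" for h
    using head_dgs[OF assms(1) c that] assms(2) by simp
  have t: "f h = g h" if "h \<in># tail_end c" for h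
    using tail_dgs[OF assms(1) c that] assms(2) by simp
  show "rename_strand f c = rename_strand g c"
  proof (cases c)
    case (Seg p w q)
    then show ?thesis using h t by (cases p; cases q) simp_all
  qed simp
qed

lemma rename_ident: "rename (\<lambda>p. p) D = D"
proof -
  have "rename_strand (\<lambda>p. p) c = c" for c :: "('a,'b) strand" by (cases c) (auto simp: option.map_ident)
  then have "rename_strand (\<lambda>p. p) = (\<lambda>c :: ('a,'b) strand. c)" by (rule HOL.ext)
  then show ?thesis by (simp add: rename_def)
qed

subsection \<open>Gluing along a list of pairs\<close>

definition glues :: "('p \<times> 'p) list \<Rightarrow> ('p, 's) diagram \<Rightarrow> ('p, 's) diagram"
  where "glues ps = fold (\<lambda>(p, q). glue p q) ps"

lemma glues_Nil [simp]: "glues [] D = D"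
  and glues_Cons [simp]: "glues ((p, q) # ps) D = glues ps (glue p q D)"
  and glues_append: "glues (ps @ qs) D = glues qs (glues ps D)"
  by (simp_all add: glues_def)

definition pts :: "('p \<times> 'p) list \<Rightarrow> 'p set"
  where "pts ps = fst ` set ps \<union> snd ` set ps"

lemma pts_Nil [simp]: "pts [] = {}"
  and pts_Cons [simp]: "pts ((p, q) # ps) = {p, q} \<union> pts ps"
  and pts_append [simp]: "pts (ps @ qs) = pts ps \<union> pts qs"
  by (auto simp: pts_def)

text \<open>The points are pairwise distinct across both columns, so no gluing consumes a point that
  another one needs, and the condition is independent of the order of the list.\<close>

definition okp :: "'p set \<Rightarrow> 'p set \<Rightarrow> ('p \<times> 'p) list \<Rightarrow> bool" where
  "okp H T ps \<longleftrightarrow> H \<inter> T = {} \<and> distinct (map fst ps @ map snd ps) \<and>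
     (\<forall>(p, q)\<in>set ps. opp H T p q)"

lemma okp_Nil [simp]: "okp H T [] \<longleftrightarrow> H \<inter> T = {}"
  by (simp add: okp_def)

lemma okp_Cons:
  "okp H T ((p, q) # ps) \<longleftrightarrow> H \<inter> T = {} \<and> opp H T p q \<and> okp (H - {p, q}) (T - {p, q}) ps"
proof
  assume a: "okp H T ((p, q) # ps)"
  then have "p \<notin> pts ps" "q \<notin> pts ps" by (auto simp: okp_def pts_def)
  have "opp (H - {p, q}) (T - {p, q}) p' q'" if "(p', q') \<in> set ps" for p' q'
  proof -
    have "opp H T p' q'" using a that by (auto simp: okp_def)
    moreover have "p' \<in> pts ps" "q' \<in> pts ps" using that by (force simp: pts_def)+
    then have "p' \<notin> {p, q}" "q' \<notin> {p, q}" using \<open>p \<notin> pts ps\<close> \<open>q \<notin> pts ps\<close> by auto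
    ultimately show ?thesis by (auto simp: opp_def)
  qed
  then show "H \<inter> T = {} \<and> opp H T p q \<and> okp (H - {p, q}) (T - {p, q}) ps"
    using a by (auto simp: okp_def)
next
  assume a: "H \<inter> T = {} \<and> opp H T p q \<and> okp (H - {p, q}) (T - {p, q}) ps"
  then have "p \<noteq> q" by (auto simp: opp_def)
  moreover have "p \<notin> pts ps" "q \<notin> pts ps" using a by (auto simp: okp_def pts_def opp_def)
  then have "p \<notin> set (map fst ps) \<union> set (map snd ps)" "q \<notin> set (map fst ps) \<union> set (map snd ps)"
    by (auto simp: pts_def)
  ultimately show "okp H T ((p, q) # ps)"
    using a by (auto simp: okp_def opp_def)
qed

lemma okp_append:
  "okp H T (ps @ qs) \<longleftrightarrow> okp H T ps \<and> okp (H - pts ps) (T - pts ps) qs"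
proof (induct ps arbitrary: H T)
  case Nil
  then show ?case by (auto simp: okp_def)
next
  case (Cons x ps)
  obtain p q where "x = (p, q)" by (cases x)
  moreover have "A - ({p, q} \<union> pts ps) = A - {p, q} - pts ps" for A by auto
  ultimately show ?case using Cons by (auto simp: okp_Cons)
qed

lemma okp_disjoint: "okp H T ps \<Longrightarrow> H \<inter> T = {}"
  by (simp add: okp_def)

lemma okp_perm: "okp H T ps \<Longrightarrow> mset qs = mset ps \<Longrightarrow> okp H T qs"
  unfolding okp_def distinct_append
  by (metis (no_types, lifting) distinct_map mset_eq_imp_distinct_iff mset_eq_setD mset_map set_map)

lemma okp_mono: "okp H T ps \<Longrightarrow> H \<subseteq> H' \<Longrightarrow> T \<subseteq> T' \<Longrightarrow> H' \<inter> T' = {} \<Longrightarrow> okp H' T' ps"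
  by (auto simp: okp_def opp_def)

lemma okp_image:
  "okp H T ps \<Longrightarrow> inj_on f (H \<union> T) \<Longrightarrow> okp (f ` H) (f ` T) (map (map_prod f f) ps)"
proof (induct ps arbitrary: H T)
  case Nil
  then show ?case by (auto simp: inj_on_def)
next
  case (Cons x ps)
  obtain p q where x: "x = (p, q)" by (cases x)
  with Cons have o: "opp H T p q" and "okp (H - {p,q}) (T - {p,q}) ps" by (auto simp: okp_Cons)
  then have "okp (f ` (H - {p,q})) (f ` (T - {p,q})) (map (map_prod f f) ps)"
    using Cons by (meson Diff_subset Un_mono inj_on_subset)
  moreover have "f ` (H - {p,q}) = f ` H - {f p, f q}" "f ` (T - {p,q}) = f ` T - {f p, f q}"
    using o Cons(3) by (auto simp: opp_def inj_on_def; blast)+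
  moreover have "f ` H \<inter> f ` T = {}"
    using Cons(2,3) okp_disjoint[OF Cons(2)] by (auto simp: inj_on_def)
  ultimately show ?case using x o by (simp add: okp_Cons opp_image)
qed

lemma glues_dgs:
  "D \<in> dgs b S H T \<Longrightarrow> okp H T ps \<Longrightarrow> glues ps D \<in> dgs b S (H - pts ps) (T - pts ps)"
proof (induct ps arbitrary: D H T)
  case (Cons x ps)
  obtain p q where "x = (p, q)" by (cases x)
  moreover have "A - ({p, q} \<union> pts ps) = A - {p, q} - pts ps" for A by auto
  ultimately show ?case using Cons glue_dgs[of D b S H T p q] by (auto simp: okp_Cons)
qed simp

lemma glues_glue_commute:
  "D \<in> dgs b S H T \<Longrightarrow> okp H T ((p, q) # ps) \<Longrightarrow> glues ps (glue p q D) = glue p q (glues ps D)"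
proof (induct ps arbitrary: D H T)
  case (Cons x ps)
  obtain r s where x: "x = (r, s)" by (cases x)
  have o1: "okp H T ((r, s) # (p, q) # ps)"
    using okp_perm[OF Cons(3), of "(r, s) # (p, q) # ps"] x by simp
  have "opp H T r s" using o1 by (simp add: okp_Cons)
  moreover have o2: "opp H T p q" using Cons by (simp add: okp_Cons)
  moreover have "{r, s} \<inter> {p, q} = {}" using Cons(3) x by (auto simp: okp_def)
  ultimately have "glue r s (glue p q D) = glue p q (glue r s D)"
    by (rule glue_commute[OF Cons(2)])
  moreover have "glue r s D \<in> dgs b S (H - {r, s}) (T - {r, s})"
    by (rule glue_dgs[OF Cons(2) \<open>opp H T r s\<close>])
  ultimately show ?case using Cons(1) o1 x by (simp add: okp_Cons[of H])
qed simp

text \<open>Any pair can be pulled to the front, because gluings at disjoint pairs commute.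
  Associativity of the product, cyclicity of the trace and the splitting of a closure into partial
  traces are reorderings of such lists.\<close>

lemma glues_perm:
  "D \<in> dgs b S H T \<Longrightarrow> okp H T ps \<Longrightarrow> mset qs = mset ps \<Longrightarrow> glues qs D = glues ps D"
proof (induct ps arbitrary: D H T qs)
  case (Cons x ps)
  obtain p q where x: "x = (p, q)" by (cases x)
  obtain us vs where qs: "qs = us @ x # vs"
    using Cons(4) by (metis list.set_intros(1) mset_eq_setD split_list)
  then have m: "mset (us @ vs) = mset ps" using Cons(4) by simp
  have "okp H T ((p, q) # us @ vs)" using okp_perm[OF Cons(3)] m x by simp
  then have o: "okp H T ((p, q) # us)" by (metis append_Cons okp_append)
  have "glues qs D = glues vs (glue p q (glues us D))"
    using qs x by (simp add: glues_append)
  also have "\<dots> = glues (us @ vs) (glue p q D)"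
    using glues_glue_commute[OF Cons(2) o] by (simp add: glues_append)
  also have "\<dots> = glues ps (glue p q D)"
  proof (rule Cons(1)[OF glue_dgs[OF Cons(2)] _ m])
    show "opp H T p q" "okp (H - {p, q}) (T - {p, q}) ps"
      using Cons(3) unfolding x okp_Cons by blast+
  qed
  finally show ?case using x by simp
qed simp

lemma glues_plus:
  "D \<in> dgs b S H T \<Longrightarrow> okp H T ps \<Longrightarrow> E \<in> dgs b S H' T' \<Longrightarrow> (H \<union> T) \<inter> (H' \<union> T') = {} \<Longrightarrow>
   glues ps (D + E) = glues ps D + E"
proof (induct ps arbitrary: D H T)
  case (Cons x ps)
  obtain p q where x: "x = (p, q)" by (cases x)
  have o: "opp H T p q" and o': "okp (H - {p,q}) (T - {p,q}) ps" using Cons x by (auto simp: okp_Cons)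
  have "glue p q (D + E) = glue p q D + E"
    using glue_plus[OF Cons(2) o dgs_plus[OF Cons(2,4,5)]] .
  moreover have "glues ps (glue p q D + E) = glues ps (glue p q D) + E"
    by (rule Cons(1)[OF glue_dgs[OF Cons(2) o] o' Cons(4)]) (use Cons(5) in blast)
  ultimately show ?case using x by simp
qed simp

lemma rename_glues:
  "D \<in> dgs b S H T \<Longrightarrow> okp H T ps \<Longrightarrow> inj_on f (H \<union> T) \<Longrightarrow>
   rename f (glues ps D) = glues (map (map_prod f f) ps) (rename f D)"
proof (induct ps arbitrary: D H T)
  case (Cons x ps)
  obtain p q where x: "x = (p, q)" by (cases x)
  have o: "opp H T p q" and o': "okp (H - {p,q}) (T - {p,q}) ps" using Cons x by (auto simp: okp_Cons)
  have "inj_on f ((H - {p,q}) \<union> (T - {p,q}))" using Cons(4) by (rule inj_on_subset) auto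
  from Cons(1)[OF glue_dgs[OF Cons(2) o] o' this] show ?case
    using x rename_glue[OF Cons(2) o Cons(4)] by simp
qed simp

subsection \<open>Undecorated arcs\<close>

definition arc :: "'p \<Rightarrow> 'p \<Rightarrow> ('p, 's) strand"
  where "arc h t = Seg (Some h) [] (Some t)"

lemma rename_fun_upd_fresh:
  assumes "D \<in> dgs b S H T" "p \<notin> H \<union> T"
  shows "rename (f(p := q)) D = rename f D"
  by (rule rename_cong[OF assms(1)]) (use assms(2) in auto)

text \<open>An arc carries the empty word, so joining it to the strand at \<open>p\<close> keeps the
  word of that strand and moves its end to the other end of the arc. Identities, permutations, cups
  and caps are all handled through this observation.\<close>

lemma glue_arc:
  assumes "D \<in> dgs b S H T" "add_mset (arc h t) D \<in> dgs b' S' H' T'"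
  shows "p \<in> H \<Longrightarrow> glue p t (add_mset (arc h t) D) = rename (id(p := h)) D"
    and "p \<in> T \<Longrightarrow> glue p h (add_mset (arc h t) D) = rename (id(p := t)) D"
proof -
  assume p: "p \<in> H"
  from dgs_headE[OF assms(1) p] obtain w q D' where D': "D = add_mset (Seg (Some p) w q) D'" by blast
  have d: "D' \<in> dgs b S (H - {p}) (T - set_mset (tail_end (Seg (Some p) w q)))"
    and q: "q \<noteq> Some p" using assms(1) D' by (auto simp: dgs_add)
  have "rename (id(p := h)) D' = D'"
    by (subst rename_fun_upd_fresh[OF d]) (use p dgs_disjoint[OF assms(1)] in \<open>auto simp: id_def rename_ident\<close>)
  moreover have "glue p t (add_mset (arc h t) D) = add_mset (Seg (Some h) ([] @ w) q) D'"
    using D' by (intro glue_join[OF assms(2)]) (simp add: arc_def)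
  ultimately show "glue p t (add_mset (arc h t) D) = rename (id(p := h)) D"
    using D' q by (cases q) auto
next
  assume p: "p \<in> T"
  from dgs_tailE[OF assms(1) p] obtain w q D' where D': "D = add_mset (Seg q w (Some p)) D'" by blast
  have d: "D' \<in> dgs b S (H - set_mset (head_end (Seg q w (Some p)))) (T - {p})"
    and q: "q \<noteq> Some p" using assms(1) D' by (auto simp: dgs_add)
  have "rename (id(p := t)) D' = D'"
    by (subst rename_fun_upd_fresh[OF d]) (use p dgs_disjoint[OF assms(1)] in \<open>auto simp: id_def rename_ident\<close>)
  moreover have "glue h p (add_mset (arc h t) D) = add_mset (Seg q (w @ []) (Some t)) D'"
    using D' by (intro glue_join[OF assms(2)]) (simp add: arc_def add_mset_commute)
  ultimately show "glue p h (add_mset (arc h t) D) = rename (id(p := t)) D"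
    using D' q by (cases q) (auto simp: glue_sym[of p h])
qed


lemma glues_swap: "glues (map prod.swap ps) D = glues ps D"
  by (induct ps arbitrary: D) (auto simp: glue_sym)

definition arc_at :: "bool \<Rightarrow> 'p \<Rightarrow> 'p \<Rightarrow> ('p, 's) strand"
  where "arc_at b p q = (if b then arc p q else arc q p)"

lemma arc_at_simps [simp]:
  "head_end (arc_at b p q) = {#if b then p else q#}" "tail_end (arc_at b p q) = {#if b then q else p#}"
  "letters (arc_at b p q) = {}" "no_inner (arc_at b p q)"
  "rename_strand h (arc_at b p q) = arc_at b (h p) (h q)"
  by (simp_all add: arc_at_def arc_def)

lemma arcs_dgs:
  assumes "distinct I" "inj_on f (set I)" "inj_on g (set I)" "f ` set I \<inter> g ` set I = {}"
  shows "mset (map (\<lambda>i. arc_at (B i) (f i) (g i)) I) \<in> dgs b S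
     ((\<lambda>i. if B i then f i else g i) ` set I) ((\<lambda>i. if B i then g i else f i) ` set I)"
  using assms
proof (induct I)
  case (Cons i I)
  have n: "f i \<notin> f ` set I" "f i \<notin> g ` set I" "g i \<notin> f ` set I" "g i \<notin> g ` set I" "f i \<noteq> g i"
    using Cons(2-) by auto
  define HA where "HA = (\<lambda>i. if B i then f i else g i) ` set I"
  define TA where "TA = (\<lambda>i. if B i then g i else f i) ` set I"
  define h where "h = (if B i then f i else g i)"
  define t where "t = (if B i then g i else f i)"
  have ih: "mset (map (\<lambda>i. arc_at (B i) (f i) (g i)) I) \<in> dgs b S HA TA"
    unfolding HA_def TA_def using Cons by auto
  have "h \<notin> HA" "t \<notin> TA" "h \<notin> TA" "t \<notin> HA" "h \<noteq> t"
    unfolding h_def t_def HA_def TA_def using n by auto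
  with ih dgs_disjoint[OF ih]
  have "add_mset (arc_at (B i) (f i) (g i)) (mset (map (\<lambda>i. arc_at (B i) (f i) (g i)) I))
    \<in> dgs b S (insert h HA) (insert t TA)"
    unfolding dgs_add by (simp add: h_def[symmetric] t_def[symmetric])
  then show ?case 
    unfolding HA_def TA_def h_def t_def by (simp only: list.map mset.simps list.set image_insert)
qed simp

text \<open>Each arc has its end \<open>g i\<close> glued to the point \<open>p i\<close> of
  \<open>D\<close> and its end \<open>f i\<close> left free, so by \<open>glue_arc\<close> the total
  effect is to move \<open>p i\<close> to \<open>f i\<close>. \<open>F\<close> is constrained on
  outer points of \<open>D\<close> only, so each application may supply a convenient global
  function.\<close>

lemma glues_arcs:
  fixes D :: "('p, 's) diagram"
  assumes "D \<in> dgs b S H T" "distinct I" "inj_on f (set I)" "inj_on g (set I)" "inj_on p (set I)"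
    "f ` set I \<inter> g ` set I = {}" "p ` set I \<subseteq> H \<union> T" "(f ` set I \<union> g ` set I) \<inter> (H \<union> T) = {}"
    "\<And>i. i \<in> set I \<Longrightarrow> F (p i) = f i" "\<And>x. x \<in> H \<union> T \<Longrightarrow> x \<notin> p ` set I \<Longrightarrow> F x = x"
    "\<And>i. i \<in> set I \<Longrightarrow> B i \<longleftrightarrow> p i \<in> H"
  shows "glues (map (\<lambda>i. (p i, g i)) I) (D + mset (map (\<lambda>i. arc_at (B i) (f i) (g i)) I)) = rename F D"
  using assms
proof (induct I arbitrary: D H T F)
  case Nil
  then have "rename F D = rename (\<lambda>x. x) D" by (intro rename_cong[OF Nil(1)]) auto
  then show ?case by (simp add: rename_ident)
next
  case (Cons i I)
  note D = Cons(2)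
  let ?A = "mset (map (\<lambda>i. arc_at (B i) (f i) (g i)) I) :: ('p, 's) diagram"
  let ?HA = "(\<lambda>i. if B i then f i else g i) ` set I"
  let ?TA = "(\<lambda>i. if B i then g i else f i) ` set I"
  let ?h = "id (p i := f i)"
  have A: "?A \<in> dgs b S ?HA ?TA" using Cons(3-) by (intro arcs_dgs) auto
  have "mset (map (\<lambda>i. arc_at (B i) (f i) (g i)) (i # I)) \<in> dgs b S
     ((\<lambda>i. if B i then f i else g i) ` set (i # I)) ((\<lambda>i. if B i then g i else f i) ` set (i # I))"
    using Cons(3-) by (intro arcs_dgs)
  from dgs_plus[OF D this] Cons(9) have DA': "\<exists>H T. D + mset (map (\<lambda>i. arc_at (B i) (f i) (g i)) (i # I)) \<in> dgs b S H T"
    by (auto simp: image_subset_iff Int_Un_distrib split: if_splits) blast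
  have DA: "D + ?A \<in> dgs b S (H \<union> ?HA) (T \<union> ?TA)"
    using Cons(9) by (intro dgs_plus[OF D A]) auto
  have pi: "p i \<in> H \<union> T" using Cons(8) by simp
  have pd: "p i \<notin> T" if "p i \<in> H" using dgs_disjoint[OF D] that by auto
  have "p i \<notin> ?HA \<union> ?TA" using Cons(9) pi by auto
  then have "rename ?h ?A = rename id ?A" by (rule rename_fun_upd_fresh[OF A])
  then have rA: "rename ?h ?A = ?A" by (simp add: id_def rename_ident)
  have "glue (p i) (g i) (add_mset (arc_at (B i) (f i) (g i)) (D + ?A)) = rename ?h (D + ?A)"
  proof (cases "p i \<in> H")
    case True
    then show ?thesis using glue_arc(1)[OF DA, of "f i" "g i" _ _ _ _ "p i"] DA' Cons(12)
      by (auto simp: arc_at_def)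
  next
    case False
    then show ?thesis using glue_arc(2)[OF DA, of "g i" "f i" _ _ _ _ "p i"] DA' Cons(12) pi
      by (auto simp: arc_at_def)
  qed
  then have 1: "glues (map (\<lambda>i. (p i, g i)) (i # I)) (D + mset (map (\<lambda>i. arc_at (B i) (f i) (g i)) (i # I)))
     = glues (map (\<lambda>i. (p i, g i)) I) (rename ?h D + ?A)"
    by (simp only: rename_plus rA list.map mset.simps glues_Cons union_mset_add_mset_right)
  have inj: "inj_on ?h (H \<union> T)" using Cons(9) by (auto simp: inj_on_def)
  have ran: "?h ` (H \<union> T) \<subseteq> insert (f i) (H \<union> T)" by auto
  have pn: "p j \<noteq> p i" "f j \<noteq> f i" "g j \<noteq> f i" "p j \<noteq> f i" "?h (p j) = p j" if j: "j \<in> set I" for j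
  proof -
    have ij: "j \<noteq> i" "j \<in> set (i # I)" "i \<in> set (i # I)" using Cons(3) j by auto
    show "p j \<noteq> p i" "f j \<noteq> f i"
      using inj_onD[OF Cons(6) _ ij(2,3)] inj_onD[OF Cons(4) _ ij(2,3)] ij(1) by blast+
    then show "?h (p j) = p j" by simp
    show "g j \<noteq> f i" using Cons(7) ij by (metis IntI empty_iff imageI)
    show "p j \<noteq> f i" using Cons(8,9) ij by (metis IntI UnI1 empty_iff imageI subsetD)
  qed
  \<comment> \<open>After the first gluing \<open>f i\<close> is an outer point, and nothing is
    known about \<open>F\<close> there; the induction hypothesis needs a renaming that fixes
    it.\<close>
  let ?F = "\<lambda>x. if x = f i then f i else F x"
  have "glues (map (\<lambda>i. (p i, g i)) I) (rename ?h D + ?A) = rename ?F (rename ?h D)"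
  proof (rule Cons(1)[OF dgs_rename[OF D inj]])
    show "distinct I" "inj_on f (set I)" "inj_on g (set I)" "inj_on p (set I)"
      "f ` set I \<inter> g ` set I = {}" using Cons(3-) by auto
    show "p ` set I \<subseteq> ?h ` H \<union> ?h ` T" using Cons(8) pn by (force simp: image_iff)
    show "(f ` set I \<union> g ` set I) \<inter> (?h ` H \<union> ?h ` T) = {}"
      using Cons(9) pn ran by (auto split: if_splits)
    show "?F (p j) = f j" if "j \<in> set I" for j using that Cons(10) pn by auto
    show "?F x = x" if "x \<in> ?h ` H \<union> ?h ` T" "x \<notin> p ` set I" for x
      using that Cons(11) by (auto split: if_splits)
    show "B j \<longleftrightarrow> p j \<in> ?h ` H" if "j \<in> set I" for j
      using that Cons(12) pn[OF that] by (force simp: image_iff split: if_splits)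
  qed
  also have "\<dots> = rename F D"
    unfolding rename_rename
    by (rule rename_cong[OF D]) (use Cons(9,10,11) in auto)
  finally show ?case using 1 by simp
qed

section \<open>Negligible combinations\<close>

abbreviation cglue :: "'p \<Rightarrow> 'p \<Rightarrow> (('p, 's) diagram \<Rightarrow>\<^sub>0 'k::field) \<Rightarrow> (('p, 's) diagram \<Rightarrow>\<^sub>0 'k)"
  where "cglue p q \<equiv> lin (glue p q)"

abbreviation cglues :: "('p \<times> 'p) list \<Rightarrow> (('p, 's) diagram \<Rightarrow>\<^sub>0 'k::field) \<Rightarrow> (('p, 's) diagram \<Rightarrow>\<^sub>0 'k)"
  where "cglues ps \<equiv> lin (glues ps)"

abbreviation cren :: "('p \<Rightarrow> 'q) \<Rightarrow> (('p, 's) diagram \<Rightarrow>\<^sub>0 'k::field) \<Rightarrow> (('q, 's) diagram \<Rightarrow>\<^sub>0 'k)"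
  where "cren f \<equiv> lin (rename f)"

abbreviation dcombs :: "bool \<Rightarrow> 's set \<Rightarrow> 'p set \<Rightarrow> 'p set \<Rightarrow> (('p, 's) diagram \<Rightarrow>\<^sub>0 'k::field) set"
  where "dcombs b S H T \<equiv> combs (dgs b S H T)"

lemma cglue_in: "x \<in> dcombs b S H T \<Longrightarrow> opp H T p q \<Longrightarrow> cglue p q x \<in> dcombs b S (H - {p, q}) (T - {p, q})"
  by (erule lin_in_combs) (rule glue_dgs)

lemma cglues_in: "x \<in> dcombs b S H T \<Longrightarrow> okp H T ps \<Longrightarrow> cglues ps x \<in> dcombs b S (H - pts ps) (T - pts ps)"
  by (erule lin_in_combs) (rule glues_dgs)

lemma cren_in: "x \<in> dcombs b S H T \<Longrightarrow> inj_on f (H \<union> T) \<Longrightarrow> cren f x \<in> dcombs b S (f ` H) (f ` T)"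
  by (erule lin_in_combs) (rule dgs_rename)

lemma mult_in:
  "x \<in> dcombs b S H T \<Longrightarrow> y \<in> dcombs b S H' T' \<Longrightarrow> (H \<union> T) \<inter> (H' \<union> T') = {} \<Longrightarrow>
   x * y \<in> dcombs b S (H \<union> H') (T \<union> T')"
  by (erule (1) mult_in_combs) (rule dgs_plus)

lemma fixes x :: "('p, 's) diagram \<Rightarrow>\<^sub>0 'k::field"
  shows cglues_Nil [simp]: "cglues [] x = x"
  and cglues_Cons: "cglues ((p, q) # ps) x = cglues ps (cglue p q x)"
  and cglues_append: "cglues (ps @ qs) x = cglues qs (cglues ps x)"
proof -
  have "glues [] = (\<lambda>D :: ('p, 's) diagram. D)"
    "glues ((p, q) # ps) = (\<lambda>D :: ('p, 's) diagram. glues ps (glue p q D))"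
    "glues (ps @ qs) = (\<lambda>D :: ('p, 's) diagram. glues qs (glues ps D))" for p q :: 'p and ps qs
    by (rule HOL.ext, simp add: glues_append)+
  then show "cglues [] x = x" "cglues ((p, q) # ps) x = cglues ps (cglue p q x)"
    "cglues (ps @ qs) x = cglues qs (cglues ps x)"
    by (simp_all add: lin_lin lin_id)
qed

lemma cglues_single [simp]: "cglues [(p, q)] x = cglue p q x"
  by (subst cglues_Cons) simp

lemma cglue_sym: "cglue p q = cglue q p"
  by (simp add: glue_sym)

lemma cglues_perm:
  "x \<in> dcombs b S H T \<Longrightarrow> okp H T ps \<Longrightarrow> mset qs = mset ps \<Longrightarrow> cglues qs x = cglues ps x"
  by (erule lin_cong_on) (rule glues_perm)

text \<open>Gluing touches only components that carry glued points. This locality allows a factor to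
  be moved past a gluing.\<close>

lemma cglues_mult:
  assumes "x \<in> dcombs b S H T" "okp H T ps" "y \<in> dcombs b S H' T'" "(H \<union> T) \<inter> (H' \<union> T') = {}"
  shows "cglues ps (x * y) = cglues ps x * y"
  using assms(1)
proof (induct rule: comb_induct)
  case (gen D)
  show ?case using assms(3)
    by (induct rule: comb_induct)
      (auto simp: gen_mult_gen glues_plus[OF gen assms(2) _ assms(4)] distrib_left lin_add lin_scale
         scale_mult_right)
qed (auto simp: distrib_right lin_add lin_scale scale_mult_left)

lemma cglues_mult_right:
  assumes "x \<in> dcombs b S H T" "okp H T ps" "y \<in> dcombs b S H' T'" "(H \<union> T) \<inter> (H' \<union> T') = {}"
  shows "cglues ps (y * x) = y * cglues ps x"
  using cglues_mult[OF assms] by (simp add: mult.commute)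

lemma cglue_mult:
  assumes "x \<in> dcombs b S H T" "opp H T p q" "y \<in> dcombs b S H' T'" "(H \<union> T) \<inter> (H' \<union> T') = {}"
  shows "cglue p q (x * y) = cglue p q x * y"
proof (cases "H \<inter> T = {}")
  case True
  then have "okp (H - {p, q}) (T - {p, q}) []" by auto
  with True assms(2) have "okp H T [(p, q)]" by (simp add: okp_Cons)
  from cglues_mult[OF assms(1) this assms(3,4)] show ?thesis by simp
next
  case False
  \<comment> \<open>No diagram has a point that is both head and tail, so the span is zero.\<close>
  then have "dgs b S H T = {}" by (auto simp: dgs_def)
  then have "x = 0" using assms(1) by (simp add: combs_def)
  then show ?thesis by simp
qed

lemma cren_mult: "cren f (x * y) = cren f x * cren f y"
  by (rule lin_mult) (rule rename_plus)

lemma cren_1 [simp]: "cren f 1 = 1"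
proof -
  have "cren f (gen {#}) = gen {#}" by (simp only: lin_gen rename_empty)
  then show ?thesis by (simp only: gen_0)
qed

lemma cren_cren: "cren f (cren g x) = cren (\<lambda>p. f (g p)) x"
  by (simp add: lin_lin rename_rename)

lemma cren_cong: "x \<in> dcombs b S H T \<Longrightarrow> (\<And>p. p \<in> H \<union> T \<Longrightarrow> f p = g p) \<Longrightarrow> cren f x = cren g x"
  by (erule lin_cong_on) (erule rename_cong)

lemma cren_ident: "cren (\<lambda>p. p) x = (x :: ('a, 'b) diagram \<Rightarrow>\<^sub>0 'k::field)"
proof -
  have "rename (\<lambda>p. p) = (\<lambda>D :: ('a, 'b) diagram. D)" by (rule HOL.ext) (rule rename_ident)
  then show ?thesis by (simp add: lin_id)
qed

lemma cren_cong_id: "x \<in> dcombs b S H T \<Longrightarrow> (\<And>p. p \<in> H \<union> T \<Longrightarrow> f p = p) \<Longrightarrow> cren f x = x"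
  using cren_cong[of x b S H T f "\<lambda>p. p"] by (simp add: cren_ident)

lemma cren_cglues:
  "x \<in> dcombs b S H T \<Longrightarrow> okp H T ps \<Longrightarrow> inj_on f (H \<union> T) \<Longrightarrow>
   cren f (cglues ps x) = cglues (map (map_prod f f) ps) (cren f x)"
  unfolding lin_lin by (erule lin_cong_on) (rule rename_glues)

lemma cren_cglue:
  "x \<in> dcombs b S H T \<Longrightarrow> opp H T p q \<Longrightarrow> inj_on f (H \<union> T) \<Longrightarrow>
   cren f (cglue p q x) = cglue (f p) (f q) (cren f x)"
  unfolding lin_lin by (erule lin_cong_on) (rule rename_glue)

lemma eval_rename: "eval_diagram \<alpha> (rename f D) = eval_diagram \<alpha> D"
proof -
  have "eval_strand \<alpha> (rename_strand f c) = eval_strand \<alpha> c" for c by (cases c) auto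
  then show ?thesis by (simp add: eval_diagram_def rename_def multiset.map_comp o_def)
qed

lemma eval_cren [simp]: "eval_comb \<alpha> (cren f x) = eval_comb \<alpha> x"
  using combs_UNIV[of x]
  by (induct rule: comb_induct) (auto simp: lin_add lin_scale eval_comb_add eval_comb_scale eval_rename)

text \<open>A combination is null if it evaluates to zero in every closed context.  The points of the
  context are natural numbers, so that there are always enough fresh ones; this makes it evident
  that null combinations are stable under disjoint union, gluing and renaming.\<close>

definition ctx :: "'s set \<Rightarrow> 'p set \<Rightarrow> 'p set \<Rightarrow> ('p \<Rightarrow> nat) \<Rightarrow> (nat, 's) diagram \<Rightarrow> (nat \<times> nat) list \<Rightarrow> bool"
  where "ctx S H T f E ps \<longleftrightarrow> inj_on f (H \<union> T) \<and> (\<exists>H' T'. E \<in> dgs False S H' T' \<and>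
     f ` (H \<union> T) \<inter> (H' \<union> T') = {} \<and> okp (f ` H \<union> H') (f ` T \<union> T') ps \<and>
     pts ps = f ` H \<union> H' \<union> (f ` T \<union> T'))"

definition null :: "'s set \<Rightarrow> ('s, 'k::field) evaluation \<Rightarrow> 'p set \<Rightarrow> 'p set \<Rightarrow> (('p, 's) diagram \<Rightarrow>\<^sub>0 'k) set"
  where "null S \<alpha> H T = {x \<in> dcombs False S H T.
     \<forall>f E ps. ctx S H T f E ps \<longrightarrow> eval_comb \<alpha> (cglues ps (cren f x * gen E)) = 0}"

lemma null_in: "x \<in> null S \<alpha> H T \<Longrightarrow> x \<in> dcombs False S H T"
  by (simp add: null_def)

lemma null_0 [simp]: "0 \<in> null S \<alpha> H T"
  by (simp add: null_def)

lemma null_add [intro]: "x \<in> null S \<alpha> H T \<Longrightarrow> y \<in> null S \<alpha> H T \<Longrightarrow> x + y \<in> null S \<alpha> H T"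
  by (auto simp: null_def lin_add eval_comb_add distrib_right)

lemma null_scale [intro]: "x \<in> null S \<alpha> H T \<Longrightarrow> scale c x \<in> null S \<alpha> H T"
  by (auto simp: null_def lin_scale eval_comb_scale scale_mult_left)

lemma null_uminus [intro]: "x \<in> null S \<alpha> H T \<Longrightarrow> - x \<in> null S \<alpha> H T"
  using null_scale[of x S \<alpha> H T "- 1"] by (simp add: scale_minus_one)

lemma null_diff [intro]: "x \<in> null S \<alpha> H T \<Longrightarrow> y \<in> null S \<alpha> H T \<Longrightarrow> x - y \<in> null S \<alpha> H T"
  by (metis null_add null_uminus uminus_add_conv_diff add.commute)

lemma null_sum: "(\<And>a. a \<in> A \<Longrightarrow> g a \<in> null S \<alpha> H T) \<Longrightarrow> sum g A \<in> null S \<alpha> H T"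
  by (induct A rule: infinite_finite_induct) auto

text \<open>The second factor is absorbed into the context: a context for \<open>x * gen D\<close>
  becomes one for \<open>x\<close> once the renamed \<open>D\<close> is added to
  \<open>E\<close>.\<close>

lemma null_mult:
  assumes x: "x \<in> null S \<alpha> H T" and y: "y \<in> dcombs False S H' T'" and d: "(H \<union> T) \<inter> (H' \<union> T') = {}"
  shows "x * y \<in> null S \<alpha> (H \<union> H') (T \<union> T')"
  using y
proof (induct rule: comb_induct)
  case (gen D)
  show ?case unfolding null_def
  proof (intro CollectI conjI allI impI)
    show "x * gen D \<in> dcombs False S (H \<union> H') (T \<union> T')"
      using gen by (intro mult_in[OF null_in[OF x] _ d]) simp
    fix f E ps assume c: "ctx S (H \<union> H') (T \<union> T') f E ps"
    then obtain H1 T1 where E: "E \<in> dgs False S H1 T1"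
      and dd: "f ` (H \<union> H' \<union> (T \<union> T')) \<inter> (H1 \<union> T1) = {}"
      and o: "okp (f ` (H \<union> H') \<union> H1) (f ` (T \<union> T') \<union> T1) ps"
      and p: "pts ps = f ` (H \<union> H') \<union> H1 \<union> (f ` (T \<union> T') \<union> T1)"
      and i: "inj_on f (H \<union> H' \<union> (T \<union> T'))" by (auto simp: ctx_def)
    have i': "inj_on f (H \<union> T)" "inj_on f (H' \<union> T')" by (rule inj_on_subset[OF i]; auto)+
    have fd: "f ` (H \<union> T) \<inter> f ` (H' \<union> T') = {}"
      using d i inj_on_image_Int[OF i, of "H \<union> T" "H' \<union> T'"] by auto
    have F: "rename f D + E \<in> dgs False S (f ` H' \<union> H1) (f ` T' \<union> T1)"
      using dd by (intro dgs_plus[OF dgs_rename[OF gen i'(2)] E]) auto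
    have "ctx S H T f (rename f D + E) ps" unfolding ctx_def
    proof (intro conjI exI, rule i'(1), rule F)
      show "f ` (H \<union> T) \<inter> (f ` H' \<union> H1 \<union> (f ` T' \<union> T1)) = {}" using dd fd by blast
      have e: "f ` (H \<union> H') \<union> H1 = f ` H \<union> (f ` H' \<union> H1)" "f ` (T \<union> T') \<union> T1 = f ` T \<union> (f ` T' \<union> T1)" by auto
      show "okp (f ` H \<union> (f ` H' \<union> H1)) (f ` T \<union> (f ` T' \<union> T1)) ps" using o e by simp
      show "pts ps = f ` H \<union> (f ` H' \<union> H1) \<union> (f ` T \<union> (f ` T' \<union> T1))" using p e by simp
    qed
    then have "eval_comb \<alpha> (cglues ps (cren f x * gen (rename f D + E))) = 0"
      using x by (simp add: null_def)
    then show "eval_comb \<alpha> (cglues ps (cren f (x * gen D) * gen E)) = 0"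
      by (simp add: cren_mult gen_mult_gen mult.assoc)
  qed
qed (auto simp: distrib_left scale_mult_right)

lemma null_mult_right:
  assumes "x \<in> null S \<alpha> H T" "y \<in> dcombs False S H' T'" "(H \<union> T) \<inter> (H' \<union> T') = {}"
  shows "y * x \<in> null S \<alpha> (H' \<union> H) (T' \<union> T)"
  using null_mult[OF assms] by (simp add: mult.commute Un_commute)

lemma dgs_nonempty_finite: "x \<in> dcombs b S H T \<Longrightarrow> x \<noteq> 0 \<Longrightarrow> finite H \<and> finite T \<and> H \<inter> T = {}"
  by (metis combs_def dgs_finite dgs_disjoint ex_in_conv keys_eq_empty mem_Collect_eq subset_iff)

lemma null_cren:
  assumes x: "x \<in> null S \<alpha> H T" and i: "inj_on g (H \<union> T)"
  shows "cren g x \<in> null S \<alpha> (g ` H) (g ` T)"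
  unfolding null_def
proof (intro CollectI conjI allI impI)
  show "cren g x \<in> dcombs False S (g ` H) (g ` T)" by (rule cren_in[OF null_in[OF x] i])
  fix f E ps assume c: "ctx S (g ` H) (g ` T) f E ps"
  have "inj_on (\<lambda>p. f (g p)) (H \<union> T)"
    using c i comp_inj_on[of g "H \<union> T" f] by (simp add: ctx_def image_Un o_def)
  then have "ctx S H T (\<lambda>p. f (g p)) E ps"
    using c by (simp add: ctx_def image_Un[symmetric] image_image)
  then show "eval_comb \<alpha> (cglues ps (cren f (cren g x) * gen E)) = 0"
    using x by (simp add: null_def cren_cren)
qed

text \<open>The gluing of \<open>x\<close> becomes the first gluing of the context. Since
  \<open>p\<close> and \<open>q\<close> are no longer outer points afterwards, the names the context
  gives them are arbitrary and may clash; they are replaced by fresh ones.\<close>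

lemma null_cglue:
  assumes x: "x \<in> null S \<alpha> H T" and o: "opp H T p q"
  shows "cglue p q x \<in> null S \<alpha> (H - {p, q}) (T - {p, q})"
proof (cases "x = 0")
  case False
  then have fin: "finite H" "finite T" and HT: "H \<inter> T = {}"
    using dgs_nonempty_finite[OF null_in[OF x]] by auto
  let ?H = "H - {p, q}" and ?T = "T - {p, q}"
  have G: "cglue p q x \<in> dcombs False S ?H ?T" by (rule cglue_in[OF null_in[OF x] o])
  show ?thesis unfolding null_def
  proof (intro CollectI conjI allI impI)
    show "cglue p q x \<in> dcombs False S ?H ?T" by (rule G)
    fix f E ps assume c: "ctx S ?H ?T f E ps"
    then obtain H1 T1 where E: "E \<in> dgs False S H1 T1"
      and dd: "f ` (?H \<union> ?T) \<inter> (H1 \<union> T1) = {}"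
      and o1: "okp (f ` ?H \<union> H1) (f ` ?T \<union> T1) ps"
      and pt: "pts ps = f ` ?H \<union> H1 \<union> (f ` ?T \<union> T1)"
      and i: "inj_on f (?H \<union> ?T)" by (auto simp: ctx_def)
    have fin': "finite (f ` (H \<union> T) \<union> H1 \<union> T1)" using fin dgs_finite[OF E] by simp
    \<comment> \<open>Fresh numbers exist because all boundaries are finite; for \<open>H\<close>
      and \<open>T\<close> this follows from \<open>x\<close> being nonzero.\<close>
    obtain a where a: "a \<notin> f ` (H \<union> T) \<union> H1 \<union> T1"
      using ex_new_if_finite[OF infinite_UNIV_nat fin'] by blast
    obtain b where b: "b \<notin> insert a (f ` (H \<union> T) \<union> H1 \<union> T1)"
      using ex_new_if_finite[OF infinite_UNIV_nat, of "insert a (f ` (H \<union> T) \<union> H1 \<union> T1)"] fin' by auto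
    have pq: "p \<noteq> q" using o HT by (auto simp: opp_def)
    let ?f = "f(p := a, q := b)"
    have i': "inj_on ?f (H \<union> T)"
    proof -
      have HT': "H \<union> T = insert p (insert q (?H \<union> ?T))" using o by (auto simp: opp_def)
      have "inj_on ?f (?H \<union> ?T) = inj_on f (?H \<union> ?T)" by (rule inj_on_cong) auto
      moreover have "?f ` (?H \<union> ?T - {p}) \<subseteq> f ` (H \<union> T)" by auto
      moreover have "?f ` (?H \<union> ?T - {q}) \<subseteq> f ` (H \<union> T)" by auto
      ultimately show ?thesis using i pq a b unfolding HT' by auto
    qed
    have im: "?f ` ?H = f ` ?H" "?f ` ?T = f ` ?T" by (rule image_cong; auto)+
    have mem: "a \<notin> f ` ?H \<union> f ` ?T \<union> H1 \<union> T1" "b \<notin> f ` ?H \<union> f ` ?T \<union> H1 \<union> T1" using a b by auto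
    have cs: "?f ` H = insert a (f ` ?H) \<and> ?f ` T = insert b (f ` ?T) \<or>
      ?f ` H = insert b (f ` ?H) \<and> ?f ` T = insert a (f ` ?T)"
    proof (cases "p \<in> H")
      case True
      then have "H = insert p ?H" "T = insert q ?T" using o HT by (auto simp: opp_def)
      then have "?f ` H = insert (?f p) (?f ` ?H)" "?f ` T = insert (?f q) (?f ` ?T)"
        by (metis image_insert)+
      then show ?thesis unfolding im using pq by simp
    next
      case False
      then have "H = insert q ?H" "T = insert p ?T" using o HT by (auto simp: opp_def)
      then have "?f ` H = insert (?f q) (?f ` ?H)" "?f ` T = insert (?f p) (?f ` ?T)"
        by (metis image_insert)+
      then show ?thesis unfolding im using pq by simp
    qed
    define A where "A = f ` ?H"
    define B where "B = f ` ?T"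
    have fH: "?f ` H \<union> H1 - {a, b} = f ` ?H \<union> H1" "?f ` T \<union> T1 - {a, b} = f ` ?T \<union> T1"
      using mem cs unfolding A_def[symmetric] B_def[symmetric] by (elim disjE; auto)+
    have fHT: "?f ` (H \<union> T) = {a, b} \<union> f ` (?H \<union> ?T)"
      using cs unfolding image_Un A_def[symmetric] B_def[symmetric] by (elim disjE; auto)
    have ab: "a \<noteq> b" using b by auto
    have dis: "(?f ` H \<union> H1) \<inter> (?f ` T \<union> T1) = {}"
      using okp_disjoint[OF o1] cs mem ab unfolding A_def[symmetric] B_def[symmetric]
      by (elim disjE; auto)
    have op: "opp (?f ` H \<union> H1) (?f ` T \<union> T1) a b"
      using opp_image[OF o, of ?f] pq by (auto simp: opp_def)
    have "ctx S H T ?f E ((a, b) # ps)" unfolding ctx_def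
    proof (intro conjI exI, rule i', rule E)
      show "?f ` (H \<union> T) \<inter> (H1 \<union> T1) = {}" unfolding fHT using a b dd by blast
      show "okp (?f ` H \<union> H1) (?f ` T \<union> T1) ((a, b) # ps)"
        unfolding okp_Cons using dis op o1 fH by simp
      have "?f ` H \<union> H1 \<union> (?f ` T \<union> T1) = ?f ` (H \<union> T) \<union> H1 \<union> T1"
        by (simp only: image_Un Un_ac)
      then show "pts ((a, b) # ps) = ?f ` H \<union> H1 \<union> (?f ` T \<union> T1)"
        unfolding fHT pts_Cons pt by (simp only: image_Un Un_ac)
    qed
    then have 0: "eval_comb \<alpha> (cglues ((a, b) # ps) (cren ?f x * gen E)) = 0"
      using x by (simp add: null_def)
    have "cren f (cglue p q x) = cren ?f (cglue p q x)"
      by (rule cren_cong[OF G]) auto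
    also have "\<dots> = cglue a b (cren ?f x)"
      using cren_cglue[OF null_in[OF x] o i'] pq by simp
    also have "\<dots> * gen E = cglue a b (cren ?f x * gen E)"
    proof (rule cglue_mult[symmetric, OF cren_in[OF null_in[OF x] i']])
      show "opp (?f ` H) (?f ` T) a b" using opp_image[OF o, of ?f] pq by simp
      show "gen E \<in> dcombs False S H1 T1" using E by simp
      show "(?f ` H \<union> ?f ` T) \<inter> (H1 \<union> T1) = {}" using mem dd
        unfolding image_Un[symmetric] fHT by (simp add: image_Un)
    qed
    finally show "eval_comb \<alpha> (cglues ps (cren f (cglue p q x) * gen E)) = 0"
      using 0 by (simp only: cglues_Cons)
  qed
qed simp

lemma null_cglues:
  "x \<in> null S \<alpha> H T \<Longrightarrow> okp H T ps \<Longrightarrow> cglues ps x \<in> null S \<alpha> (H - pts ps) (T - pts ps)"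
proof (induct ps arbitrary: x H T)
  case (Cons u ps)
  obtain p q where u: "u = (p, q)" by (cases u)
  have e: "A - ({p, q} \<union> pts ps) = A - {p, q} - pts ps" for A by auto
  have "cglue p q x \<in> null S \<alpha> (H - {p, q}) (T - {p, q})"
    by (rule null_cglue[OF Cons(2)]) (use Cons(3) u in \<open>simp add: okp_Cons\<close>)
  from Cons(1)[OF this] show ?case using Cons(3)
    unfolding u cglues_Cons okp_Cons pts_Cons e by blast
qed simp

text \<open>A combination without outer points meets none of the gluings of its context, and
  evaluation is multiplicative, so a context contributes a mere factor; the empty context shows that
  the value itself must vanish.\<close>

lemma null_closed: "x \<in> null S \<alpha> {} {} \<longleftrightarrow> x \<in> dcombs False S {} {} \<and> eval_comb \<alpha> x = 0"
proof
  assume x: "x \<in> null S \<alpha> {} {}"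
  have "{#} \<in> dgs False S {} {}" by simp
  then have "ctx S {} {} (\<lambda>_. 0) {#} []" unfolding ctx_def by (intro conjI exI) auto
  then have "eval_comb \<alpha> (cren (\<lambda>_. 0) x * gen {#}) = 0"
    using x by (fastforce simp: null_def)
  then show "x \<in> dcombs False S {} {} \<and> eval_comb \<alpha> x = 0"
    using null_in[OF x] by simp
next
  assume x: "x \<in> dcombs False S {} {} \<and> eval_comb \<alpha> x = 0"
  show "x \<in> null S \<alpha> {} {}" unfolding null_def
  proof (intro CollectI conjI allI impI)
    fix f :: "'a \<Rightarrow> nat" and E ps assume "ctx S {} {} f E ps"
    then obtain H T where E: "E \<in> dgs False S H T" and o: "okp H T ps" by (auto simp: ctx_def)
    have "cren f x \<in> dcombs False S {} {}" using cren_in[of x False S "{}" "{}" f] x by simp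
    then have "cglues ps (cren f x * gen E) = cren f x * cglues ps (gen E)"
      by (intro cglues_mult_right[of _ False S H T]) (use E o in auto)
    then show "eval_comb \<alpha> (cglues ps (cren f x * gen E)) = 0"
      using x by (simp add: eval_comb_mult del: lin_gen)
  qed (use x in simp)
qed

text \<open>It suffices to test against the diagrams with the complementary boundary: every closed context
  is turned into such a diagram by inserting an undecorated arc at each outer point.\<close>

lemma null_pairing:
  fixes x :: "('p, 's) diagram \<Rightarrow>\<^sub>0 'k::field"
  assumes x: "x \<in> dcombs False S H T" and L: "distinct L" "set L = H \<union> T" and HT: "H \<inter> T = {}"
    and z: "\<And>E. E \<in> dgs False S T H \<Longrightarrow>
      eval_comb \<alpha> (cglues (map (\<lambda>p. (Inl p, Inr p)) L) (cren Inl x * gen (rename Inr E))) = 0"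
  shows "x \<in> null S \<alpha> H T"
  unfolding null_def
proof (intro CollectI conjI allI impI, rule x)
  fix f y ps assume "ctx S H T f y ps"
  then obtain H1 T1 where y: "y \<in> dgs False S H1 T1"
    and dd: "f ` (H \<union> T) \<inter> (H1 \<union> T1) = {}"
    and o1: "okp (f ` H \<union> H1) (f ` T \<union> T1) ps"
    and pt: "pts ps = f ` H \<union> H1 \<union> (f ` T \<union> T1)"
    and i: "inj_on f (H \<union> T)" by (auto simp: ctx_def)
  define A :: "(nat + 'p, 's) diagram" where
    "A = mset (map (\<lambda>p. arc_at (p \<in> H) (Inl (f p)) (Inr p)) L)"
  define HA :: "(nat + 'p) set" where "HA = Inl ` f ` H \<union> Inr ` T"
  define TA :: "(nat + 'p) set" where "TA = Inr ` H \<union> Inl ` f ` T"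
  have A: "A \<in> dgs False S HA TA"
  proof -
    have "(\<lambda>p. if p \<in> H then Inl (f p) else Inr p) ` set L = HA"
      "(\<lambda>p. if p \<in> H then Inr p else Inl (f p)) ` set L = TA"
      using HT unfolding L(2) HA_def TA_def by auto
    moreover have "A \<in> dgs False S ((\<lambda>p. if p \<in> H then Inl (f p) else Inr p) ` set L)
        ((\<lambda>p. if p \<in> H then Inr p else Inl (f p)) ` set L)"
      unfolding A_def using L i by (intro arcs_dgs) (auto simp: inj_on_def)
    ultimately show ?thesis by (simp only:)
  qed
  define Y where "Y = rename Inl y + A"
  have il: "inj_on Inl X" "inj_on Inr X'" for X :: "'a set" and X' :: "'b set" by auto
  have y1: "rename Inl y \<in> dgs False S (Inl ` H1) (Inl ` T1)" by (rule dgs_rename[OF y]) simp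
  have Y: "Y \<in> dgs False S (Inl ` H1 \<union> HA) (Inl ` T1 \<union> TA)"
    unfolding Y_def using dd by (intro dgs_plus[OF y1 A]) (auto simp: HA_def TA_def)
  let ?ps = "map (map_prod Inl Inl) ps :: ((nat + 'p) \<times> (nat + 'p)) list"
  have o2: "okp (Inl ` H1 \<union> HA) (Inl ` T1 \<union> TA) ?ps"
    by (rule okp_mono[OF okp_image[OF o1, of Inl] _ _ dgs_disjoint[OF Y]]) (auto simp: HA_def TA_def)
  have pt2: "pts ?ps = Inl ` (f ` H \<union> H1 \<union> (f ` T \<union> T1))"
    unfolding pt[symmetric] by (simp add: pts_def image_Un image_image)
  have E1: "glues ?ps Y \<in> dgs False S (Inr ` T) (Inr ` H)"
  proof -
    have "Inl ` H1 \<union> HA - pts ?ps = Inr ` T" "Inl ` T1 \<union> TA - pts ?ps = Inr ` H"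
      unfolding pt2 HA_def TA_def by auto
    then show ?thesis using glues_dgs[OF Y o2] by (simp only:)
  qed
  \<comment> \<open>The gluings \<open>?ps\<close> consume every point of the left summand, so what
    remains lies in the image of \<open>Inr\<close> and can be read with
    \<open>projr\<close>.\<close>
  define E where "E = rename projr (glues ?ps Y)"
  have E: "E \<in> dgs False S T H"
  proof -
    have "inj_on projr (Inr ` T \<union> Inr ` H)" by (auto intro!: inj_onI)
    moreover have "projr ` Inr ` X = X" for X :: "'p set" by (simp add: image_image)
    ultimately show ?thesis using dgs_rename[OF E1, of projr] unfolding E_def by metis
  qed
  have rE: "rename Inr E = glues ?ps Y"
  proof -
    have "rename (\<lambda>p. Inr (projr p)) (glues ?ps Y) = rename (\<lambda>p. p) (glues ?ps Y)"
      by (rule rename_cong[OF E1]) auto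
    then show ?thesis unfolding E_def rename_rename by (simp only: rename_ident)
  qed
  let ?phi = "case_sum Inl (\<lambda>p. Inr (Inr p)) :: 'p + 'p \<Rightarrow> 'p + (nat + 'p)"
  let ?qs = "map (\<lambda>p. (Inl p, Inr (Inr p))) L :: (('p + (nat + 'p)) \<times> ('p + (nat + 'p))) list"
  let ?ps' = "map (map_prod Inr Inr) ?ps :: (('p + (nat + 'p)) \<times> ('p + (nat + 'p))) list"
  let ?W = "cren Inl x * gen (rename Inr Y)"
  have xl: "cren j x \<in> dcombs False S (j ` H) (j ` T)" if "inj j" for j :: "'p \<Rightarrow> 'b"
    by (rule cren_in[OF x]) (use that in \<open>simp add: inj_on_def\<close>)
  have Y2: "rename Inr Y \<in> dgs False S (Inr ` (Inl ` H1 \<union> HA)) (Inr ` (Inl ` T1 \<union> TA))"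
    by (rule dgs_rename[OF Y]) simp
  have W: "?W \<in> dcombs False S (Inl ` H \<union> Inr ` (Inl ` H1 \<union> HA)) (Inl ` T \<union> Inr ` (Inl ` T1 \<union> TA))"
    by (intro mult_in[OF xl]) (use Y2 in auto)
  have dW: "(Inl ` H \<union> Inr ` (Inl ` H1 \<union> HA)) \<inter> (Inl ` T \<union> Inr ` (Inl ` T1 \<union> TA)) = {}"
    using HT dgs_disjoint[OF Y] by auto
  have o3: "okp (Inr ` (Inl ` H1 \<union> HA)) (Inr ` (Inl ` T1 \<union> TA)) ?ps'"
    by (rule okp_image[OF o2]) simp
  have o4: "okp (Inl ` H \<union> Inr ` (Inl ` H1 \<union> HA)) (Inl ` T \<union> Inr ` (Inl ` T1 \<union> TA)) (?ps' @ ?qs)"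
    unfolding okp_append
  proof
    show "okp (Inl ` H \<union> Inr ` (Inl ` H1 \<union> HA)) (Inl ` T \<union> Inr ` (Inl ` T1 \<union> TA)) ?ps'"
      by (rule okp_mono[OF o3 _ _ dW]) auto
    have "pts ?ps' = Inr ` Inl ` (f ` H \<union> H1 \<union> (f ` T \<union> T1))"
      unfolding pt2[symmetric] by (simp add: pts_def image_Un image_image)
    then have "Inl ` H \<union> Inr ` (Inl ` H1 \<union> HA) - pts ?ps' = Inl ` H \<union> Inr ` Inr ` T"
      "Inl ` T \<union> Inr ` (Inl ` T1 \<union> TA) - pts ?ps' = Inl ` T \<union> Inr ` Inr ` H"
      unfolding HA_def TA_def by auto
    moreover have "okp (Inl ` H \<union> Inr ` Inr ` T) (Inl ` T \<union> Inr ` Inr ` H) ?qs"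
      unfolding okp_def using L HT
      by (auto simp: distinct_map inj_on_def opp_def)
    ultimately show "okp (Inl ` H \<union> Inr ` (Inl ` H1 \<union> HA) - pts ?ps')
      (Inl ` T \<union> Inr ` (Inl ` T1 \<union> TA) - pts ?ps') ?qs" by simp
  qed
  \<comment> \<open>\<open>E\<close> was built by performing the gluings of the context first.
    Performing those with the arcs first instead only moves the points of \<open>x\<close> to the
    names the context uses for them; the two orders give the same closed combination.\<close>
  have Wq: "cglues ?qs ?W = cren (\<lambda>p. Inr (Inl (f p))) x * gen (rename (\<lambda>n. Inr (Inl n)) y)"
    using x
  proof (induct rule: comb_induct)
    case (gen D)
    let ?D = "rename Inl D :: ('p + (nat + 'p), 's) diagram"
    let ?A = "mset (map (\<lambda>p. arc_at (p \<in> H) (Inr (Inl (f p))) (Inr (Inr p))) L) :: ('p + (nat + 'p), 's) diagram"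
    let ?y = "rename (\<lambda>n. Inr (Inl n)) y :: ('p + (nat + 'p), 's) diagram"
    let ?F = "case_sum (\<lambda>p. Inr (Inl (f p))) Inr :: 'p + (nat + 'p) \<Rightarrow> 'p + (nat + 'p)"
    have D: "?D \<in> dgs False S (Inl ` H) (Inl ` T)" by (rule dgs_rename[OF gen]) simp
    have rA: "rename Inr A = ?A" unfolding A_def by (induct L) auto
    have A2: "?A \<in> dgs False S (Inr ` HA) (Inr ` TA)"
      unfolding rA[symmetric] by (rule dgs_rename[OF A]) simp
    have y2: "?y \<in> dgs False S (Inr ` Inl ` H1) (Inr ` Inl ` T1)"
      using dgs_rename[OF y, of "\<lambda>n. Inr (Inl n)"] by (simp add: inj_on_def image_image)
    have DA: "?D + ?A \<in> dgs False S (Inl ` H \<union> Inr ` HA) (Inl ` T \<union> Inr ` TA)"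
      by (rule dgs_plus[OF D A2]) auto
    have "rename Inr Y = ?A + ?y"
      unfolding Y_def rename_plus rA rename_rename by (simp add: add.commute)
    then have "glues ?qs (?D + rename Inr Y) = glues ?qs ((?D + ?A) + ?y)" by (simp add: add.assoc)
    also have "\<dots> = glues ?qs (?D + ?A) + ?y"
    proof (rule glues_plus[OF DA _ y2])
      show "okp (Inl ` H \<union> Inr ` HA) (Inl ` T \<union> Inr ` TA) ?qs"
        unfolding okp_def using L HT dgs_disjoint[OF DA]
        by (auto simp: distinct_map inj_on_def opp_def HA_def TA_def)
      show "(Inl ` H \<union> Inr ` HA \<union> (Inl ` T \<union> Inr ` TA)) \<inter> (Inr ` Inl ` H1 \<union> Inr ` Inl ` T1) = {}"
        using dd by (auto simp: HA_def TA_def)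
    qed
    also have "glues ?qs (?D + ?A) = rename ?F ?D"
      using L i HT
      by (intro glues_arcs[OF D]) (auto simp: inj_on_def)
    finally show ?case by (simp add: gen_mult_gen rename_rename del: mult_single)
  qed (auto simp: lin_add lin_scale distrib_right scale_mult_left)
  have pq: "mset (?ps' @ ?qs) = mset (?qs @ ?ps')" by simp
  have "0 = eval_comb \<alpha> (cren ?phi (cglues (map (\<lambda>p. (Inl p, Inr p)) L) (cren Inl x * gen (rename Inr E))))"
    using z[OF E] by simp
  also have "cren ?phi (cglues (map (\<lambda>p. (Inl p, Inr p)) L) (cren Inl x * gen (rename Inr E)))
     = cglues ?qs (cren ?phi (cren Inl x * gen (rename Inr E)))"
  proof (subst cren_cglues)
    show "cren Inl x * gen (rename Inr E) \<in> dcombs False S (Inl ` H \<union> Inr ` T) (Inl ` T \<union> Inr ` H)"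
      by (intro mult_in[OF xl]) (use dgs_rename[OF E, of Inr] in auto)
    show "okp (Inl ` H \<union> Inr ` T) (Inl ` T \<union> Inr ` H) (map (\<lambda>p. (Inl p, Inr p)) L)"
      unfolding okp_def using L HT by (auto simp: distinct_map inj_on_def opp_def)
  qed (auto simp: inj_on_def o_def split: sum.splits)
  also have "cren ?phi (cren Inl x * gen (rename Inr E)) = cren Inl x * gen (rename Inr (glues ?ps Y))"
    unfolding rE[symmetric] cren_mult cren_cren lin_gen rename_rename by simp
  also have "rename Inr (glues ?ps Y) = glues ?ps' (rename Inr Y)"
    by (rule rename_glues[OF Y o2]) simp
  also have "cren Inl x * gen (glues ?ps' (rename Inr Y)) = cglues ?ps' ?W"
    unfolding lin_gen[symmetric]
    by (rule cglues_mult_right[OF _ o3 xl, symmetric]) (use Y2 in auto)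
  also have "cglues ?qs (cglues ?ps' ?W) = cglues (?ps' @ ?qs) ?W"
    by (simp only: cglues_append)
  also have "\<dots> = cglues (?qs @ ?ps') ?W"
    by (rule cglues_perm[OF W o4 pq[symmetric], symmetric])
  also have "\<dots> = cglues ?ps' (cglues ?qs ?W)"
    by (simp only: cglues_append)
  also have "cglues ?qs ?W = cren (\<lambda>n. Inr (Inl n)) (cren f x * gen y)"
    unfolding Wq cren_mult cren_cren lin_gen ..
  also have "?ps' = map (map_prod (\<lambda>n. Inr (Inl n)) (\<lambda>n. Inr (Inl n))) ps" by (simp add: o_def prod.map_comp)
  also have "cglues \<dots> (cren (\<lambda>n. Inr (Inl n)) (cren f x * gen y))
     = cren (\<lambda>n. Inr (Inl n)) (cglues ps (cren f x * gen y))"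
  proof (rule cren_cglues[symmetric, OF _ o1])
    show "cren f x * gen y \<in> dcombs False S (f ` H \<union> H1) (f ` T \<union> T1)"
      using y dd by (intro mult_in[OF cren_in[OF x i]]) auto
  qed (simp add: inj_on_def)
  finally show "eval_comb \<alpha> (cglues ps (cren f x * gen y)) = 0" by simp
qed

section \<open>Stacking, juxtaposition and closure\<close>

definition pos :: "sign list \<Rightarrow> nat set" where "pos a = {i. i < length a \<and> a ! i = Pos}"
definition neg :: "sign list \<Rightarrow> nat set" where "neg a = {i. i < length a \<and> a ! i = Neg}"

lemma pos_neg: "pos a \<union> neg a = {..<length a}" "pos a \<inter> neg a = {}" "finite (pos a)" "finite (neg a)"
proof -
  show "pos a \<union> neg a = {..<length a}" using sign.exhaust by (auto simp: pos_def neg_def)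
qed (auto simp: pos_def neg_def)

lemma posD: "i \<in> pos a \<Longrightarrow> i < length a" and negD: "i \<in> neg a \<Longrightarrow> i < length a"
  and pos_or_neg: "i < length a \<Longrightarrow> i \<in> pos a \<or> i \<in> neg a"
  using pos_neg(1)[of a] by auto

lemma heads_eq: "heads a b = Bot ` neg a \<union> Top ` pos b"
  and tails_eq: "tails a b = Bot ` pos a \<union> Top ` neg b"
  by (auto simp: heads_def tails_def pos_def neg_def)

lemma heads_tails_finite [simp]: "finite (heads a b)" "finite (tails a b)"
  and heads_tails_disjoint [simp]: "heads a b \<inter> tails a b = {}"
  and heads_tails_Un: "heads a b \<union> tails a b = Bot ` {..<length a} \<union> Top ` {..<length b}"
  using pos_neg[of a] pos_neg[of b] by (auto simp: heads_eq tails_eq)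

lemma cobs_eq: "cobs S a b = dgs False S (heads a b) (tails a b)"
  and cobs_no_inner_eq: "cobs_no_inner S a b = dgs True S (heads a b) (tails a b)"
  by (auto simp: cobs_no_inner_def cobs_def dgs_def)

abbreviation hdgs :: "bool \<Rightarrow> 's set \<Rightarrow> sign list \<Rightarrow> sign list \<Rightarrow> (point, 's) diagram set"
  where "hdgs b S a c \<equiv> dgs b S (heads a c) (tails a c)"

definition stk :: "nat \<Rightarrow> ((point + point) \<times> (point + point)) list"
  where "stk n = map (\<lambda>i. (Inl (Top i), Inr (Bot i))) [0..<n]"

definition clo :: "nat \<Rightarrow> (point \<times> point) list"
  where "clo n = map (\<lambda>i. (Bot i, Top i)) [0..<n]"

abbreviation both :: "'a + 'a \<Rightarrow> 'a" where "both \<equiv> case_sum id id"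

lemma stack_eq: "stack n E D = rename both (glues (stk n) (rename Inl D + rename Inr E))"
  by (simp add: stack_def glues_def stk_def fold_map o_def)

lemma diagram_closure_eq: "diagram_closure n = glues (clo n)"
  by (rule HOL.ext) (simp add: diagram_closure_def glues_def clo_def fold_map o_def)

text \<open>Brings stacking into the form product, gluing, renaming. Null combinations, local
  relations and the map \<open>PhiL\<close> are each controlled under these three
  operations.\<close>

lemma bilin_stack:
  "bilin (stack n) y x = cren both (cglues (stk n) (cren Inl x * cren Inr y))"
  using combs_UNIV[of y]
proof (induct rule: comb_induct)
  case (gen E)
  show ?case using combs_UNIV[of x]
    by (induct rule: comb_induct)
      (auto simp: stack_eq gen_mult_gen lin_add lin_scale bilin_add_right bilin_scale_right
        distrib_right scale_mult_left simp del: mult_single)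
qed (auto simp: lin_add lin_scale bilin_add_left bilin_scale_left distrib_left scale_mult_right)

lemma bilin_juxtapose: "bilin (juxtapose m n) x y = x * cren (shift m n) y"
  using combs_UNIV[of x]
proof (induct rule: comb_induct)
  case (gen E)
  show ?case using combs_UNIV[of y]
    by (induct rule: comb_induct)
      (auto simp: juxtapose_def gen_mult_gen lin_add lin_scale bilin_add_right bilin_scale_right
        distrib_left scale_mult_right simp del: mult_single)
qed (auto simp: lin_add lin_scale bilin_add_left bilin_scale_left distrib_right scale_mult_left)

abbreviation sH :: "sign list \<Rightarrow> sign list \<Rightarrow> sign list \<Rightarrow> (point + point) set"
  where "sH a b c \<equiv> Inl ` heads a b \<union> Inr ` heads b c"
abbreviation sT :: "sign list \<Rightarrow> sign list \<Rightarrow> sign list \<Rightarrow> (point + point) set"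
  where "sT a b c \<equiv> Inl ` tails a b \<union> Inr ` tails b c"

lemma sHT_disjoint: "sH a b c \<inter> sT a b c = {}"
proof -
  have "p \<in> heads a b \<Longrightarrow> p \<notin> tails a b" "p \<in> heads b c \<Longrightarrow> p \<notin> tails b c" for p
    using heads_tails_disjoint by fast+
  then show ?thesis by auto
qed

lemma okp_stk: "okp (sH a b c) (sT a b c) (stk (length b))"
  unfolding okp_def
proof (intro conjI sHT_disjoint)
  show "distinct (map fst (stk (length b)) @ map snd (stk (length b)))"
    by (auto simp: stk_def distinct_map inj_on_def)
  show "\<forall>(p, q)\<in>set (stk (length b)). opp (sH a b c) (sT a b c) p q"
  proof (clarsimp simp: stk_def)
    fix i assume "i < length b"
    then have "i \<in> pos b \<or> i \<in> neg b" using pos_neg(1)[of b] by auto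
    then show "opp (sH a b c) (sT a b c) (Inl (Top i)) (Inr (Bot i))"
      by (auto simp: opp_def heads_eq tails_eq)
  qed
qed

lemma pts_stk: "pts (stk n) = Inl ` Top ` {..<n} \<union> Inr ` Bot ` {..<n}"
  by (auto simp: pts_def stk_def image_iff)

lemma stk_rest:
  "sH a b c - pts (stk (length b)) = Inl ` Bot ` neg a \<union> Inr ` Top ` pos c"
  "sT a b c - pts (stk (length b)) = Inl ` Bot ` pos a \<union> Inr ` Top ` neg c"
  by (auto simp: pts_stk heads_eq tails_eq image_iff dest: posD negD)

text \<open>Only bottom points of the lower and top points of the upper diagram survive, so
  forgetting the side causes no clash.\<close>

lemma stk_both:
  "inj_on both ((sH a b c - pts (stk (length b))) \<union> (sT a b c - pts (stk (length b))))"
  "both ` (sH a b c - pts (stk (length b))) = heads a c"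
  "both ` (sT a b c - pts (stk (length b))) = tails a c"
  unfolding stk_rest by (auto simp: inj_on_def heads_eq tails_eq image_Un image_image)

lemma Inl_Inr_in:
  assumes "x \<in> dcombs f S (heads a b) (tails a b)" "y \<in> dcombs f S (heads b c) (tails b c)"
  shows "cren Inl x * cren Inr y \<in> dcombs f S (sH a b c) (sT a b c)"
  by (intro mult_in cren_in assms) auto

lemma stack_in:
  assumes "x \<in> dcombs f S (heads a b) (tails a b)" "y \<in> dcombs f S (heads b c) (tails b c)"
  shows "bilin (stack (length b)) y x \<in> dcombs f S (heads a c) (tails a c)"
  unfolding bilin_stack
  using cren_in[OF cglues_in[OF Inl_Inr_in[OF assms] okp_stk] stk_both(1)] by (simp only: stk_both)

lemma null_stack1:
  assumes "x \<in> null S \<alpha> (heads a b) (tails a b)" "y \<in> dcombs False S (heads b c) (tails b c)"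
  shows "bilin (stack (length b)) y x \<in> null S \<alpha> (heads a c) (tails a c)"
proof -
  have "cren Inl x * cren Inr y \<in> null S \<alpha> (sH a b c) (sT a b c)"
    by (rule null_mult[OF null_cren[OF assms(1)] cren_in[OF assms(2)]]) auto
  from null_cren[OF null_cglues[OF this okp_stk] stk_both(1)] show ?thesis
    unfolding bilin_stack by (simp only: stk_both)
qed

lemma null_stack2:
  assumes "x \<in> dcombs False S (heads a b) (tails a b)" "y \<in> null S \<alpha> (heads b c) (tails b c)"
  shows "bilin (stack (length b)) y x \<in> null S \<alpha> (heads a c) (tails a c)"
proof -
  have "cren Inl x * cren Inr y \<in> null S \<alpha> (sH a b c) (sT a b c)"
    by (rule null_mult_right[OF null_cren[OF assms(2)] cren_in[OF assms(1)]]) auto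
  from null_cren[OF null_cglues[OF this okp_stk] stk_both(1)] show ?thesis
    unfolding bilin_stack by (simp only: stk_both)
qed

lemma shift_image:
  "heads (a @ b) (c @ d) = heads a c \<union> shift (length a) (length c) ` heads b d"
  "tails (a @ b) (c @ d) = tails a c \<union> shift (length a) (length c) ` tails b d"
proof -
  have 1: "pos (a @ b) = pos a \<union> (+) (length a) ` pos b" for a b
  proof (intro set_eqI iffI)
    fix i assume "i \<in> pos (a @ b)"
    then show "i \<in> pos a \<union> (+) (length a) ` pos b"
      by (cases "i < length a") (auto simp: pos_def nth_append image_iff intro!: exI[of _ "i - length a"])
  qed (auto simp: pos_def nth_append)
  have 2: "neg (a @ b) = neg a \<union> (+) (length a) ` neg b" for a b
  proof (intro set_eqI iffI)
    fix i assume "i \<in> neg (a @ b)"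
    then show "i \<in> neg a \<union> (+) (length a) ` neg b"
      by (cases "i < length a") (auto simp: neg_def nth_append image_iff intro!: exI[of _ "i - length a"])
  qed (auto simp: neg_def nth_append)
  show "heads (a @ b) (c @ d) = heads a c \<union> shift (length a) (length c) ` heads b d"
    "tails (a @ b) (c @ d) = tails a c \<union> shift (length a) (length c) ` tails b d"
    by (auto simp: heads_eq tails_eq 1 2 image_Un image_image)
qed

lemma inj_shift [simp]: "inj_on (shift m n) X"
proof (rule inj_onI)
  fix p q assume "shift m n p = shift m n q" then show "p = q" by (cases p; cases q) auto
qed

lemma shift_disjoint:
  "(heads a c \<union> tails a c) \<inter> (shift (length a) (length c) ` X \<union> shift (length a) (length c) ` Y) = {}"
proof -
  have "shift (length a) (length c) p \<notin> heads a c \<union> tails a c" for p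
    by (cases p) (auto simp: heads_tails_Un)
  then show ?thesis by auto
qed

lemma juxtapose_in:
  assumes "x \<in> dcombs f S (heads a c) (tails a c)" "y \<in> dcombs f S (heads b d) (tails b d)"
  shows "bilin (juxtapose (length a) (length c)) x y \<in> dcombs f S (heads (a @ b) (c @ d)) (tails (a @ b) (c @ d))"
  unfolding bilin_juxtapose shift_image
  by (rule mult_in[OF assms(1) cren_in[OF assms(2)] shift_disjoint]) simp

lemma null_juxtapose1:
  assumes "x \<in> null S \<alpha> (heads a c) (tails a c)" "y \<in> dcombs False S (heads b d) (tails b d)"
  shows "bilin (juxtapose (length a) (length c)) x y \<in> null S \<alpha> (heads (a @ b) (c @ d)) (tails (a @ b) (c @ d))"
  unfolding bilin_juxtapose shift_image
  by (rule null_mult[OF assms(1) cren_in[OF assms(2)] shift_disjoint]) simp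

lemma null_juxtapose2:
  assumes "x \<in> dcombs False S (heads a c) (tails a c)" "y \<in> null S \<alpha> (heads b d) (tails b d)"
  shows "bilin (juxtapose (length a) (length c)) x y \<in> null S \<alpha> (heads (a @ b) (c @ d)) (tails (a @ b) (c @ d))"
  unfolding bilin_juxtapose shift_image
proof (rule null_mult_right[OF null_cren[OF assms(2)] assms(1)])
  show "(shift (length a) (length c) ` heads b d \<union> shift (length a) (length c) ` tails b d) \<inter>
    (heads a c \<union> tails a c) = {}"
    using shift_disjoint[of a c "heads b d" "tails b d"] by (simp only: Int_commute)
qed simp

lemma okp_clo: "okp (heads a a) (tails a a) (clo (length a))"
  unfolding okp_def
proof (intro conjI heads_tails_disjoint)
  show "distinct (map fst (clo (length a)) @ map snd (clo (length a)))"
    by (auto simp: clo_def distinct_map inj_on_def)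
  show "\<forall>(p, q)\<in>set (clo (length a)). opp (heads a a) (tails a a) p q"
  proof (clarsimp simp: clo_def)
    fix i assume "i < length a"
    then have "i \<in> pos a \<or> i \<in> neg a" using pos_neg(1)[of a] by auto
    then show "opp (heads a a) (tails a a) (Bot i) (Top i)"
      by (auto simp: opp_def heads_eq tails_eq)
  qed
qed

lemma pts_clo: "heads a a - pts (clo (length a)) = {}" "tails a a - pts (clo (length a)) = {}"
proof -
  have "pts (clo (length a)) = heads a a \<union> tails a a"
    unfolding heads_tails_Un by (auto simp: pts_def clo_def image_iff)
  then show "heads a a - pts (clo (length a)) = {}" "tails a a - pts (clo (length a)) = {}" by auto
qed

lemma heads_tails_Nil [simp]: "heads [] [] = {}" "tails [] [] = {}"
  by (auto simp: heads_def tails_def)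

lemma closure_in: "x \<in> dcombs f S (heads a a) (tails a a) \<Longrightarrow> lin (diagram_closure (length a)) x \<in> dcombs f S {} {}"
  using cglues_in[OF _ okp_clo] by (simp add: diagram_closure_eq pts_clo)

lemma null_closure: "x \<in> null S \<alpha> (heads a a) (tails a a) \<Longrightarrow> lin (diagram_closure (length a)) x \<in> null S \<alpha> {} {}"
  using null_cglues[OF _ okp_clo] by (simp add: diagram_closure_eq pts_clo)

text \<open>Exchanging bottom and top while keeping orientations turns heads of type
  \<open>a\<close> to \<open>b\<close> into tails of type \<open>b\<close> to \<open>a\<close>. This
  is the exchange of boundaries in \<open>null_pairing\<close>.\<close>

fun flip :: "point \<Rightarrow> point" where "flip (Bot i) = Top i" | "flip (Top i) = Bot i"

lemma flip_flip [simp]: "flip (flip p) = p" by (cases p) auto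

lemma inj_flip [simp]: "inj_on flip X" by (metis flip_flip inj_onI)

lemma flip_heads: "flip ` heads a b = tails b a" "flip ` tails a b = heads b a"
  by (auto simp: heads_eq tails_eq image_Un image_image)

text \<open>Stacking glues the tops of \<open>x\<close> to the bottoms of \<open>y\<close>, closing
  glues the bottoms of \<open>x\<close> to the tops of \<open>y\<close>. After \<open>y\<close> is
  flipped each pair consists of two copies of the same point, which is the shape tested in
  \<open>null_pairing\<close>.\<close>

lemma closure_stack:
  assumes x: "x \<in> dcombs False S (heads a b) (tails a b)" and y: "y \<in> dcombs False S (heads b a) (tails b a)"
  shows "eval_comb \<alpha> (lin (diagram_closure (length a)) (bilin (stack (length b)) y x)) =
    eval_comb \<alpha> (cglues (map (\<lambda>p. (Inl p, Inr p)) (map Top [0..<length b] @ map Bot [0..<length a]))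
      (cren Inl x * cren Inr (cren flip y)))"
proof -
  let ?w = "cglues (stk (length b)) (cren Inl x * cren Inr y)"
  let ?clo = "map (\<lambda>i. (Inl (Bot i), Inr (Top i))) [0..<length a] :: ((point + point) \<times> (point + point)) list"
  let ?H = "sH a b a" and ?T = "sT a b a"
  have w0: "cren Inl x * cren Inr y \<in> dcombs False S ?H ?T" by (rule Inl_Inr_in[OF x y])
  have w: "?w \<in> dcombs False S (?H - pts (stk (length b))) (?T - pts (stk (length b)))"
    by (rule cglues_in[OF w0 okp_stk])
  have oc: "okp (?H - pts (stk (length b))) (?T - pts (stk (length b))) ?clo"
    unfolding stk_rest okp_def
  proof (intro conjI)
    show "(Inl ` Bot ` neg a \<union> Inr ` Top ` pos a) \<inter> (Inl ` Bot ` pos a \<union> Inr ` Top ` neg a) = {}"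
      using pos_neg(2)[of a] by auto
    show "distinct (map fst ?clo @ map snd ?clo)" by (auto simp: distinct_map inj_on_def)
    show "\<forall>(p, q)\<in>set ?clo. opp (Inl ` Bot ` neg a \<union> Inr ` Top ` pos a) (Inl ` Bot ` pos a \<union> Inr ` Top ` neg a) p q"
    proof (clarsimp)
      fix i assume "i < length a"
      from pos_or_neg[OF this]
      show "opp (Inl ` Bot ` neg a \<union> Inr ` Top ` pos a) (Inl ` Bot ` pos a \<union> Inr ` Top ` neg a) (Inl (Bot i)) (Inr (Top i))"
        by (auto simp: opp_def)
    qed
  qed
  have cm: "map (map_prod both both) ?clo = clo (length a)" by (simp add: clo_def)
  have "lin (diagram_closure (length a)) (bilin (stack (length b)) y x) = cglues (clo (length a)) (cren both ?w)"
    by (simp only: diagram_closure_eq bilin_stack)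
  also have "\<dots> = cren both (cglues ?clo ?w)"
    unfolding cm[symmetric] by (rule cren_cglues[symmetric, OF w oc stk_both(1)])
  also have "cglues ?clo ?w = cglues (stk (length b) @ ?clo) (cren Inl x * cren Inr y)"
    by (simp only: cglues_append)
  finally have 1: "eval_comb \<alpha> (lin (diagram_closure (length a)) (bilin (stack (length b)) y x)) =
    eval_comb \<alpha> (cglues (stk (length b) @ ?clo) (cren Inl x * cren Inr y))" by simp
  let ?phi = "map_sum id flip :: point + point \<Rightarrow> point + point"
  have o: "okp ?H ?T (stk (length b) @ ?clo)" unfolding okp_append using okp_stk oc by blast
  have "cren ?phi (cglues (stk (length b) @ ?clo) (cren Inl x * cren Inr y)) =
    cglues (map (map_prod ?phi ?phi) (stk (length b) @ ?clo)) (cren ?phi (cren Inl x * cren Inr y))"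
  proof (rule cren_cglues[OF w0 o])
    have "inj ?phi" by (intro sum.inj_map) (simp_all add: inj_on_id)
    then show "inj_on ?phi (?H \<union> ?T)" by (rule inj_on_subset) simp
  qed
  also have "map (map_prod ?phi ?phi) (stk (length b) @ ?clo) =
     map (\<lambda>p. (Inl p, Inr p)) (map Top [0..<length b] @ map Bot [0..<length a])"
    by (simp add: stk_def)
  also have "cren ?phi (cren Inl x * cren Inr y) = cren Inl x * cren Inr (cren flip y)"
    by (simp add: cren_mult cren_cren)
  finally have "eval_comb \<alpha> (cren ?phi (cglues (stk (length b) @ ?clo) (cren Inl x * cren Inr y))) =
    eval_comb \<alpha> (cglues (map (\<lambda>p. (Inl p, Inr p)) (map Top [0..<length b] @ map Bot [0..<length a]))
      (cren Inl x * cren Inr (cren flip y)))" by (simp only:)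
  then show ?thesis unfolding 1 eval_cren .
qed

text \<open>One direction is \<open>null_pairing\<close> with test diagrams flipped; the other holds
  because stacking and closing preserve null combinations. The ideal defining \<open>cat\<close>
  thus inherits all stability properties from the formulation with contexts.\<close>

lemma null_combs_eq: "null_combs S \<alpha> a b = null S \<alpha> (heads a b) (tails a b)"
proof (intro set_eqI iffI)
  fix x assume "x \<in> null_combs S \<alpha> a b"
  then have x: "x \<in> dcombs False S (heads a b) (tails a b)"
    and z: "\<And>D. D \<in> cobs S b a \<Longrightarrow>
      eval_comb \<alpha> (lin (diagram_closure (length a)) (bilin (stack (length b)) (gen D) x)) = 0"
    by (auto simp: null_combs_def cob_cat_def free_cat_def combs_def cobs_eq)
  show "x \<in> null S \<alpha> (heads a b) (tails a b)"
  proof (rule null_pairing[OF x, of "map Top [0..<length b] @ map Bot [0..<length a]"])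
    show "distinct (map Top [0..<length b] @ map Bot [0..<length a])" by (auto simp: distinct_map inj_on_def)
    show "set (map Top [0..<length b] @ map Bot [0..<length a]) = heads a b \<union> tails a b"
      by (auto simp: heads_tails_Un)
    fix E assume E: "E \<in> dgs False S (tails a b) (heads a b)"
    have D: "rename flip E \<in> cobs S b a"
      using dgs_rename[OF E, of flip] by (simp add: cobs_eq flip_heads)
    have "rename flip (rename flip E) = E" by (simp add: rename_rename rename_ident)
    then show "eval_comb \<alpha> (cglues (map (\<lambda>p. (Inl p, Inr p)) (map Top [0..<length b] @ map Bot [0..<length a]))
       (cren Inl x * gen (rename Inr E))) = 0"
      using z[OF D] closure_stack[OF x, of "gen (rename flip E)" \<alpha>] D by (simp add: cobs_eq)
  qed simp
next
  fix x assume x: "x \<in> null S \<alpha> (heads a b) (tails a b)"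
  show "x \<in> null_combs S \<alpha> a b" unfolding null_combs_def cob_cat_def free_cat_def
  proof (simp, intro conjI ballI)
    show "Poly_Mapping.keys x \<subseteq> cobs S a b" using null_in[OF x] by (simp add: combs_def cobs_eq)
    fix D assume "D \<in> cobs S b a"
    then have "gen D \<in> dcombs False S (heads b a) (tails b a)" by (simp add: cobs_eq)
    from null_closure[OF null_stack1[OF x this]]
    show "eval_comb \<alpha> (lin (diagram_closure (length a)) (bilin (stack (length b)) (gen D) x)) = 0"
      by (simp add: null_closed)
  qed
qed

subsection \<open>Permutation diagrams\<close>

lemma arc_at_Pos: "arc_at (s = Pos) p q = arc_at (s = Neg) q p"
  by (cases s) (simp_all add: arc_at_def)

lemma perm_diagram_arcs:
  "perm_diagram a \<pi> = mset (map (\<lambda>i. arc_at (a ! i = Pos) (Top (\<pi> i)) (Bot i)) [0..<length a])"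
  by (auto simp: perm_diagram_def arc_at_def arc_def split: sign.split intro!: image_mset_cong)

text \<open>A permutation diagram consists of undecorated arcs, so \<open>glues_arcs\<close> applies
  and only top points are renamed.\<close>

lemma stack_perm:
  assumes D: "D \<in> hdgs f S a b" and p: "inj_on \<pi> {..<length b}"
  shows "stack (length b) (perm_diagram b \<pi>) D =
    rename (\<lambda>q. case q of Bot i \<Rightarrow> Bot i | Top i \<Rightarrow> Top (\<pi> i)) D"
proof -
  let ?F = "case_sum (\<lambda>q. case q of Bot i \<Rightarrow> Inl (Bot i) | Top i \<Rightarrow> Inr (Top (\<pi> i))) Inr :: point + point \<Rightarrow> point + point"
  have D': "rename Inl D \<in> dgs f S (Inl ` heads a b) (Inl ` tails a b)" by (rule dgs_rename[OF D]) simp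
  have r: "rename Inr (perm_diagram b \<pi>) =
    mset (map (\<lambda>i. arc_at (b ! i = Pos) (Inr (Top (\<pi> i))) (Inr (Bot i) :: point + point)) [0..<length b])"
    unfolding perm_diagram_arcs by (simp add: rename_def multiset.map_comp o_def)
  have "glues (stk (length b)) (rename Inl D + rename Inr (perm_diagram b \<pi>)) = rename ?F (rename Inl D)"
    unfolding r stk_def
  proof (rule glues_arcs[OF D'])
    show "inj_on (\<lambda>i. Inr (Top (\<pi> i))) (set [0..<length b])"
      using p by (auto simp: inj_on_def)
    show "(\<lambda>i. Inl (Top i)) ` set [0..<length b] \<subseteq> Inl ` heads a b \<union> Inl ` tails a b"
      unfolding image_Un[symmetric] heads_tails_Un by auto
    show "?F x = x" if "x \<in> Inl ` heads a b \<union> Inl ` tails a b" "x \<notin> (\<lambda>i. Inl (Top i)) ` set [0..<length b]" for x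
      using that unfolding image_Un[symmetric] heads_tails_Un by (auto simp: image_iff)
    show "b ! i = Pos \<longleftrightarrow> Inl (Top i) \<in> Inl ` heads a b" if "i \<in> set [0..<length b]" for i
      using that by (auto simp: heads_def)
  qed (auto simp: inj_on_def)
  then have "stack (length b) (perm_diagram b \<pi>) D = rename (\<lambda>p. both (?F (Inl p))) D"
    by (simp add: stack_eq rename_rename)
  also have "\<dots> = rename (\<lambda>q. case q of Bot i \<Rightarrow> Bot i | Top i \<Rightarrow> Top (\<pi> i)) D"
    by (rule arg_cong[of _ _ "\<lambda>f. rename f D"]) (auto split: point.split)
  finally show ?thesis .
qed

lemma stack_id_left: "D \<in> hdgs f S a b \<Longrightarrow> stack (length b) (id_diagram b) D = D"
proof -
  assume D: "D \<in> hdgs f S a b"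
  have "(\<lambda>q. case q of Bot i \<Rightarrow> Bot i | Top i \<Rightarrow> Top i) = (\<lambda>q. q)" by (auto split: point.split)
  then show ?thesis using stack_perm[OF D, of "\<lambda>i. i"] by (simp add: id_diagram_def rename_ident)
qed

lemma stack_id_right:
  assumes D: "D \<in> hdgs f S a b"
  shows "stack (length a) D (id_diagram a) = D"
proof -
  let ?F = "case_sum Inl (\<lambda>q. case q of Bot i \<Rightarrow> Inl (Bot i) | Top i \<Rightarrow> Inr (Top i)) :: point + point \<Rightarrow> point + point"
  have D': "rename Inr D \<in> dgs f S (Inr ` heads a b) (Inr ` tails a b)" by (rule dgs_rename[OF D]) simp
  have r: "rename Inl (id_diagram a) =
    mset (map (\<lambda>i. arc_at (a ! i = Neg) (Inl (Bot i)) (Inl (Top i) :: point + point)) [0..<length a])"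
    unfolding id_diagram_def perm_diagram_arcs
    by (simp add: rename_def multiset.map_comp o_def arc_at_Pos)
  have sw: "stk (length a) = map prod.swap (map (\<lambda>i. (Inr (Bot i), Inl (Top i))) [0..<length a])"
    by (simp add: stk_def)
  have "glues (stk (length a)) (rename Inr D + rename Inl (id_diagram a)) = rename ?F (rename Inr D)"
    unfolding r sw glues_swap
  proof (rule glues_arcs[OF D'])
    show "(\<lambda>i. Inr (Bot i)) ` set [0..<length a] \<subseteq> Inr ` heads a b \<union> Inr ` tails a b"
      unfolding image_Un[symmetric] heads_tails_Un by auto
    show "?F x = x" if "x \<in> Inr ` heads a b \<union> Inr ` tails a b" "x \<notin> (\<lambda>i. Inr (Bot i)) ` set [0..<length a]" for x
      using that unfolding image_Un[symmetric] heads_tails_Un by (auto simp: image_iff)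
    show "a ! i = Neg \<longleftrightarrow> Inr (Bot i) \<in> Inr ` heads a b" if "i \<in> set [0..<length a]" for i
      using that by (auto simp: heads_def)
  qed (auto simp: inj_on_def)
  then have "stack (length a) D (id_diagram a) = rename (\<lambda>p. both (?F (Inr p))) D"
    by (simp add: stack_eq rename_rename add.commute)
  also have "\<dots> = rename (\<lambda>q. q) D"
    by (rule arg_cong[of _ _ "\<lambda>f. rename f D"]) (auto split: point.split)
  finally show ?thesis by (simp add: rename_ident)
qed

section \<open>Quotient categories\<close>

text \<open>Both \<open>cat\<close> and \<open>fb_cat\<close> are quotients of spans of diagrams by
  an ideal: null combinations in one case, local relations in the other. The locale collects what
  lets all operations be computed on representatives.\<close>

locale linear_quotient =
  fixes Q :: "sign list \<Rightarrow> sign list \<Rightarrow> (point, 's) diagram set"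
    and N :: "sign list \<Rightarrow> sign list \<Rightarrow> ('s, 'k::field) comb set"
  assumes N_sub: "x \<in> N a b \<Longrightarrow> x \<in> combs (Q a b)"
    and N_0: "0 \<in> N a b"
    and N_add: "x \<in> N a b \<Longrightarrow> y \<in> N a b \<Longrightarrow> x + y \<in> N a b"
    and N_scale: "x \<in> N a b \<Longrightarrow> scale r x \<in> N a b"
    and Q_stack: "D \<in> Q a b \<Longrightarrow> E \<in> Q b c \<Longrightarrow> stack (length b) E D \<in> Q a c"
    and Q_juxtapose: "D \<in> Q a b \<Longrightarrow> E \<in> Q c d \<Longrightarrow> juxtapose (length a) (length b) D E \<in> Q (a @ c) (b @ d)"
    and Q_id: "id_diagram a \<in> Q a a"
    and Q_swap: "swap_diagram a b \<in> Q (a @ b) (b @ a)"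
    and N_stack1: "x \<in> N a b \<Longrightarrow> y \<in> combs (Q b c) \<Longrightarrow> bilin (stack (length b)) y x \<in> N a c"
    and N_stack2: "x \<in> combs (Q a b) \<Longrightarrow> y \<in> N b c \<Longrightarrow> bilin (stack (length b)) y x \<in> N a c"
    and N_juxtapose1: "x \<in> N a b \<Longrightarrow> y \<in> combs (Q c d) \<Longrightarrow> bilin (juxtapose (length a) (length b)) x y \<in> N (a @ c) (b @ d)"
    and N_juxtapose2: "x \<in> combs (Q a b) \<Longrightarrow> y \<in> N c d \<Longrightarrow> bilin (juxtapose (length a) (length b)) x y \<in> N (a @ c) (b @ d)"
begin

definition C :: "(sign list, ('s, 'k) comb set, 'k) moncat" where "C = quot (free_cat Q) N"

definition c :: "sign list \<Rightarrow> sign list \<Rightarrow> ('s, 'k) comb \<Rightarrow> ('s, 'k) comb set"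
  where "c = coset (free_cat Q) N"

lemma c_eq: "c a b x = (+) x ` N a b"
  by (simp add: c_def coset_def free_cat_def)

lemma N_uminus: "x \<in> N a b \<Longrightarrow> - x \<in> N a b"
  using N_scale[of x a b "- 1"] by (simp add: scale_minus_one)

lemma N_diff: "x \<in> N a b \<Longrightarrow> y \<in> N a b \<Longrightarrow> x - y \<in> N a b"
  by (metis N_add N_uminus uminus_add_conv_diff add.commute)

lemma mem_c: "y \<in> c a b x \<longleftrightarrow> y - x \<in> N a b"
proof
  assume "y - x \<in> N a b"
  moreover have "y = x + (y - x)" by simp
  ultimately show "y \<in> c a b x" unfolding c_eq by blast
qed (auto simp: c_eq)

lemma c_self [simp]: "x \<in> c a b x" by (simp add: mem_c N_0)

lemma c_eq_iff: "c a b x = c a b y \<longleftrightarrow> x - y \<in> N a b"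
proof
  assume "c a b x = c a b y"
  then show "x - y \<in> N a b" using c_self[of x a b] by (simp add: mem_c)
next
  assume xy: "x - y \<in> N a b"
  have "z - x \<in> N a b \<longleftrightarrow> z - y \<in> N a b" for z
  proof -
    have "z - x = (z - y) - (x - y)" "z - y = (z - x) + (x - y)" by simp_all
    then show ?thesis using N_diff[OF _ xy] N_add[OF _ xy] by metis
  qed
  then show "c a b x = c a b y" by (auto simp: mem_c)
qed

lemma c_in_combs: "y \<in> c a b x \<Longrightarrow> x \<in> combs (Q a b) \<Longrightarrow> y \<in> combs (Q a b)"
  using N_sub combs_add[of x "Q a b" "y - x"] by (simp add: mem_c)

text \<open>The operations of \<open>quot\<close> are unions of cosets over all representatives;
  such a union collapses as soon as its members coincide.\<close>

lemma UN_c: "(\<Union>y\<in>c a b x. F y) = F x" if "\<And>y. y \<in> c a b x \<Longrightarrow> F y = F x" for F :: "_ \<Rightarrow> 'z set"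
  using that c_self[of x a b] by blast

lemma UN_c2: "(\<Union>y\<in>c a b x. \<Union>y'\<in>c a' b' x'. F y y') = F x x'"
  if "\<And>y y'. y \<in> c a b x \<Longrightarrow> y' \<in> c a' b' x' \<Longrightarrow> F y y' = F x x'" for F :: "_ \<Rightarrow> _ \<Rightarrow> 'z set"
  using that c_self[of x a b] c_self[of x' a' b'] by blast

lemma obj_C [simp]: "obj C = UNIV" and unito_C [simp]: "unito C = []" and tenso_C [simp]: "tenso C = (@)"
  by (simp_all add: C_def quot_def free_cat_def)

lemma hom_C: "hom C a b = c a b ` combs (Q a b)"
  by (simp add: C_def quot_def c_def) (simp add: free_cat_def combs_def)

lemma hom_CE: assumes "X \<in> hom C a b" obtains x where "x \<in> combs (Q a b)" "X = c a b x"
  using assms by (auto simp: hom_C)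

lemma c_in_hom [intro]: "x \<in> combs (Q a b) \<Longrightarrow> c a b x \<in> hom C a b"
  by (simp add: hom_C)

lemma idm_C: "idm C a = c a a (gen (id_diagram a))"
  and zerom_C: "zerom C a b = c a b 0"
  and symm_C: "symm C a b = c (a @ b) (b @ a) (gen (swap_diagram a b))"
  by (simp_all add: C_def quot_def c_def) (simp_all add: free_cat_def)

lemma stack_combs: "x \<in> combs (Q a b) \<Longrightarrow> y \<in> combs (Q b d) \<Longrightarrow> bilin (stack (length b)) y x \<in> combs (Q a d)"
proof (induct x rule: comb_induct)
  case (gen D)
  show ?case using gen(2) by (induct rule: comb_induct) (use gen(1) Q_stack in \<open>auto simp: bilin_add_left bilin_scale_left\<close>)
qed (auto simp: bilin_add_right bilin_scale_right)

lemma juxtapose_combs: "x \<in> combs (Q a b) \<Longrightarrow> y \<in> combs (Q a' b') \<Longrightarrow>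
  bilin (juxtapose (length a) (length b)) x y \<in> combs (Q (a @ a') (b @ b'))"
proof (induct x rule: comb_induct)
  case (gen D)
  show ?case using gen(2) by (induct rule: comb_induct) (use gen(1) Q_juxtapose in \<open>auto simp: bilin_add_right bilin_scale_right\<close>)
qed (auto simp: bilin_add_left bilin_scale_left)

lemma cmp_C:
  assumes x: "x \<in> combs (Q a b)" and y: "y \<in> combs (Q b d)"
  shows "cmp C a b d (c b d y) (c a b x) = c a d (bilin (stack (length b)) y x)"
proof -
  have "cmp C a b d (c b d y) (c a b x) =
    (\<Union>y'\<in>c b d y. \<Union>x'\<in>c a b x. c a d (bilin (stack (length b)) y' x'))"
    by (simp add: C_def quot_def c_def) (simp add: free_cat_def)
  also have "\<dots> = c a d (bilin (stack (length b)) y x)"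
  proof (rule UN_c2)
    fix y' x' assume y': "y' \<in> c b d y" and x': "x' \<in> c a b x"
    \<comment> \<open>Changing the representatives one argument at a time matches the two one-sided
      ideal properties.\<close>
    have "bilin (stack (length b)) y' x' - bilin (stack (length b)) y x =
      bilin (stack (length b)) (y' - y) x' + bilin (stack (length b)) y (x' - x)"
      using bilin_add_left[of "stack (length b)" "y' - y" y x'] bilin_add_right[of "stack (length b)" y "x' - x" x]
      by simp
    then show "c a d (bilin (stack (length b)) y' x') = c a d (bilin (stack (length b)) y x)"
      unfolding c_eq_iff using x y x' y'
      by (metis N_add N_stack1 N_stack2 c_in_combs mem_c)
  qed
  finally show ?thesis .
qed

lemma tensm_C:
  assumes x: "x \<in> combs (Q a b)" and y: "y \<in> combs (Q a' b')"
  shows "tensm C a b a' b' (c a b x) (c a' b' y) = c (a @ a') (b @ b') (bilin (juxtapose (length a) (length b)) x y)"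
proof -
  have "tensm C a b a' b' (c a b x) (c a' b' y) =
    (\<Union>x'\<in>c a b x. \<Union>y'\<in>c a' b' y. c (a @ a') (b @ b') (bilin (juxtapose (length a) (length b)) x' y'))"
    by (simp add: C_def quot_def c_def) (simp add: free_cat_def)
  also have "\<dots> = c (a @ a') (b @ b') (bilin (juxtapose (length a) (length b)) x y)"
  proof (rule UN_c2)
    let ?j = "juxtapose (length a) (length b)"
    fix x' y' assume x': "x' \<in> c a b x" and y': "y' \<in> c a' b' y"
    have "bilin ?j x' y' - bilin ?j x y = bilin ?j (x' - x) y' + bilin ?j x (y' - y)"
      using bilin_add_left[of ?j "x' - x" x y'] bilin_add_right[of ?j x "y' - y" y]
      by simp
    then show "c (a @ a') (b @ b') (bilin ?j x' y') = c (a @ a') (b @ b') (bilin ?j x y)"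
      unfolding c_eq_iff using x y x' y'
      by (metis N_add N_juxtapose1 N_juxtapose2 c_in_combs mem_c)
  qed
  finally show ?thesis .
qed

lemma plusm_C: "plusm C a b (c a b x) (c a b y) = c a b (x + y)"
proof -
  have "plusm C a b (c a b x) (c a b y) = (\<Union>x'\<in>c a b x. \<Union>y'\<in>c a b y. c a b (x' + y'))"
    by (simp add: C_def quot_def c_def) (simp add: free_cat_def)
  also have "\<dots> = c a b (x + y)"
  proof (rule UN_c2)
    fix x' y' assume "x' \<in> c a b x" "y' \<in> c a b y"
    then have "(x' - x) + (y' - y) \<in> N a b" unfolding mem_c by (rule N_add)
    then show "c a b (x' + y') = c a b (x + y)" by (simp add: c_eq_iff algebra_simps)
  qed
  finally show ?thesis .
qed

lemma scalm_C: "scalm C a b r (c a b x) = c a b (scale r x)"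
proof -
  have "scalm C a b r (c a b x) = (\<Union>x'\<in>c a b x. c a b (scale r x'))"
    by (simp add: C_def quot_def c_def) (simp add: free_cat_def)
  also have "\<dots> = c a b (scale r x)"
    by (rule UN_c) (metis N_scale c_eq_iff mem_c scale_diff)
  finally show ?thesis .
qed

lemma cmp_hom: "X \<in> hom C a b \<Longrightarrow> Y \<in> hom C b d \<Longrightarrow> cmp C a b d Y X \<in> hom C a d"
  by (elim hom_CE) (auto simp: cmp_C stack_combs)

lemma tensm_hom: "X \<in> hom C a b \<Longrightarrow> Y \<in> hom C a' b' \<Longrightarrow> tensm C a b a' b' X Y \<in> hom C (a @ a') (b @ b')"
  by (elim hom_CE) (auto simp: tensm_C juxtapose_combs)

lemma plusm_hom: "X \<in> hom C a b \<Longrightarrow> Y \<in> hom C a b \<Longrightarrow> plusm C a b X Y \<in> hom C a b"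
  by (elim hom_CE) (auto simp: plusm_C)

lemma scalm_hom: "X \<in> hom C a b \<Longrightarrow> scalm C a b r X \<in> hom C a b"
  by (elim hom_CE) (auto simp: scalm_C)

lemma idm_hom: "idm C a \<in> hom C a a"
  using Q_id by (auto simp: idm_C)

lemma symm_hom: "symm C a b \<in> hom C (a @ b) (b @ a)"
  using Q_swap by (auto simp: symm_C)

lemma plusm_zerom: "X \<in> hom C a b \<Longrightarrow> plusm C a b X (zerom C a b) = X"
  by (elim hom_CE) (simp add: zerom_C plusm_C)

end

section \<open>Identity and swap diagrams, and the category of an evaluation as a quotient\<close>

lemma id_diagram_in: "id_diagram a \<in> hdgs b S a a"
proof -
  have "id_diagram a \<in> dgs b S ((\<lambda>i. if a ! i = Pos then Top i else Bot i) ` set [0..<length a])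
    ((\<lambda>i. if a ! i = Pos then Bot i else Top i) ` set [0..<length a])"
    unfolding id_diagram_def perm_diagram_arcs by (rule arcs_dgs) (auto simp: inj_on_def)
  moreover have "(\<lambda>i. if a ! i = Pos then Top i else Bot i) ` set [0..<length a] = heads a a"
    "(\<lambda>i. if a ! i = Pos then Bot i else Top i) ` set [0..<length a] = tails a a"
  proof -
    let ?f = "\<lambda>i. if a ! i = Pos then Top i else Bot i" and ?g = "\<lambda>i. if a ! i = Pos then Bot i else Top i"
    have s: "set [0..<length a] = pos a \<union> neg a" unfolding pos_neg(1) by auto
    have "?f ` pos a = Top ` pos a" "?f ` neg a = Bot ` neg a"
      "?g ` pos a = Bot ` pos a" "?g ` neg a = Top ` neg a"
      by (rule image_cong; simp add: pos_def neg_def)+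
    then show "?f ` set [0..<length a] = heads a a" "?g ` set [0..<length a] = tails a a"
      unfolding s by (simp_all only: image_Un heads_eq tails_eq Un_commute)
  qed
  ultimately show ?thesis by simp
qed

definition swp :: "nat \<Rightarrow> nat \<Rightarrow> nat \<Rightarrow> nat"
  where "swp m n i = (if i < m then i + n else i - m)"

definition topswap :: "nat \<Rightarrow> nat \<Rightarrow> point \<Rightarrow> point"
  where "topswap m n q = (case q of Bot i \<Rightarrow> Bot i | Top i \<Rightarrow> Top (swp m n i))"

lemma inj_swp: "inj_on (swp m n) {..<m + n}"
  by (auto simp: inj_on_def swp_def split: if_splits)

lemma topswap_heads:
  "topswap (length a) (length b) ` heads c (a @ b) = heads c (b @ a)"
  "topswap (length a) (length b) ` tails c (a @ b) = tails c (b @ a)"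
  "inj_on (topswap (length a) (length b)) (heads c (a @ b) \<union> tails c (a @ b))"
proof -
  have *: "swp (length a) (length b) ` {i. i < length a + length b \<and> P ((a @ b) ! i)} =
    {i. i < length b + length a \<and> P ((b @ a) ! i)}" for P
  proof (intro set_eqI iffI)
    fix i assume "i \<in> {i. i < length b + length a \<and> P ((b @ a) ! i)}"
    then show "i \<in> swp (length a) (length b) ` {i. i < length a + length b \<and> P ((a @ b) ! i)}"
      by (intro image_eqI[of _ _ "if i < length b then i + length a else i - length b"])
        (auto simp: swp_def nth_append split: if_splits)
  qed (auto simp: swp_def nth_append split: if_splits)
  show "topswap (length a) (length b) ` heads c (a @ b) = heads c (b @ a)"
    "topswap (length a) (length b) ` tails c (a @ b) = tails c (b @ a)"
  proof -
    have p: "swp (length a) (length b) ` pos (a @ b) = pos (b @ a)"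
      "swp (length a) (length b) ` neg (a @ b) = neg (b @ a)"
      using *[of "\<lambda>s. s = Pos"] *[of "\<lambda>s. s = Neg"] by (simp_all only: pos_def neg_def length_append)
    have "topswap (length a) (length b) ` (Bot ` X \<union> Top ` Y) = Bot ` X \<union> Top ` swp (length a) (length b) ` Y" for X Y
      by (simp add: image_Un image_image topswap_def)
    then show "topswap (length a) (length b) ` heads c (a @ b) = heads c (b @ a)"
      "topswap (length a) (length b) ` tails c (a @ b) = tails c (b @ a)"
      by (simp_all only: heads_eq tails_eq p)
  qed
  show "inj_on (topswap (length a) (length b)) (heads c (a @ b) \<union> tails c (a @ b))"
    unfolding heads_tails_Un using inj_swp[of "length a" "length b"]
    by (auto simp: inj_on_def topswap_def)
qed

text \<open>As a renamed identity, the swap inherits its boundary and later its image under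
  \<open>Phi\<close> from the identity diagram.\<close>

lemma swap_diagram_eq: "swap_diagram a b = rename (topswap (length a) (length b)) (id_diagram (a @ b))"
  by (simp add: swap_diagram_def id_diagram_def perm_diagram_arcs rename_def multiset.map_comp o_def
      topswap_def swp_def)

lemma swap_diagram_in: "swap_diagram a b \<in> hdgs f S (a @ b) (b @ a)"
  unfolding swap_diagram_eq using dgs_rename[OF id_diagram_in topswap_heads(3)]
  by (simp add: topswap_heads)

lemma stack_swap:
  "D \<in> hdgs f S c (a @ b) \<Longrightarrow>
   stack (length (a @ b)) (swap_diagram a b) D = rename (topswap (length a) (length b)) D"
  unfolding swap_diagram_def
  by (subst stack_perm) (auto simp: swp_def[symmetric] inj_swp topswap_def[abs_def])

lemma stack_dgs: "D \<in> hdgs f S a b \<Longrightarrow> E \<in> hdgs f S b c \<Longrightarrow> stack (length b) E D \<in> hdgs f S a c"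
  using stack_in[of "gen D" f S a b "gen E" c] by simp

lemma juxtapose_dgs:
  "D \<in> hdgs f S a b \<Longrightarrow> E \<in> hdgs f S c d \<Longrightarrow> juxtapose (length a) (length b) D E \<in> hdgs f S (a @ c) (b @ d)"
  using juxtapose_in[of "gen D" f S a b "gen E" c d] by simp

text \<open>The rewrites make the facts of the locale speak about \<open>cat\<close> and
  \<open>cls\<close>; they rest on \<open>null_combs_eq\<close>.\<close>

interpretation cob: linear_quotient "\<lambda>a b. hdgs False S a b" "\<lambda>a b. null S \<alpha> (heads a b) (tails a b)"
  rewrites "linear_quotient.C (\<lambda>a b. hdgs False S a b) (\<lambda>a b. null S \<alpha> (heads a b) (tails a b)) = cat S \<alpha>"
    and "linear_quotient.c (\<lambda>a b. hdgs False S a b) (\<lambda>a b. null S \<alpha> (heads a b) (tails a b)) = cls S \<alpha>"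
  for S and \<alpha> :: "('s, 'k::field) evaluation"
proof -
  show q: "linear_quotient (\<lambda>a b. hdgs False S a b) (\<lambda>a b. null S \<alpha> (heads a b) (tails a b))"
    by unfold_locales
      (auto simp: null_in stack_dgs juxtapose_dgs id_diagram_in swap_diagram_in
        null_stack1 null_stack2 null_juxtapose1 null_juxtapose2)
  have "null_combs S \<alpha> = (\<lambda>a b. null S \<alpha> (heads a b) (tails a b))" "cobs S = (\<lambda>a b. hdgs False S a b)"
    by (intro HOL.ext; simp add: null_combs_eq cobs_eq)+
  then show "linear_quotient.C (\<lambda>a b. hdgs False S a b) (\<lambda>a b. null S \<alpha> (heads a b) (tails a b)) = cat S \<alpha>"
    "linear_quotient.c (\<lambda>a b. hdgs False S a b) (\<lambda>a b. null S \<alpha> (heads a b) (tails a b)) = cls S \<alpha>"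
    by (simp_all add: linear_quotient.C_def[OF q] linear_quotient.c_def[OF q] cat_def cls_def cob_cat_def)
qed

section \<open>One-object sums in the Karoubi envelope\<close>

lemma mk_mat_1: "mk_mat (Suc 0) (Suc 0) f = mat1 (f 0 0)"
  by (intro HOL.ext) (simp add: mat1_def mk_mat_def)

lemma mat1_00 [simp]: "mat1 x 0 0 = x"
  by (simp add: mat1_def mk_mat_def)

lemma mat1_inject [simp]: "mat1 x = mat1 y \<longleftrightarrow> x = y"
  by (metis mat1_00)

text \<open>For sums with one summand the matrix product is one composite plus the zero morphism.
  Removing that zero requires the composite to be a genuine coset, hence the two membership
  hypotheses.\<close>

lemma env_cmp:
  assumes "x \<in> hom (cat S \<alpha>) a b" "y \<in> hom (cat S \<alpha>) b d"
  shows "cmp (additive_envelope (cat S \<alpha>)) [a] [b] [d] (mat1 y) (mat1 x) = mat1 (cmp (cat S \<alpha>) a b d y x)"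
  using assms by (simp add: additive_envelope_def mk_mat_1 cob.plusm_zerom cob.cmp_hom)

lemma env_hom: "hom (additive_envelope C) [a] [b] = mat1 ` hom C a b"
proof -
  have "mat1 x = mk_mat (length [b]) (length [a]) (\<lambda>i j. x)" for x :: 'b by (simp add: mat1_def)
  then show ?thesis by (fastforce simp: additive_envelope_def mk_mat_1)
qed

lemma kar_cmp:
  assumes "x \<in> hom (cat S \<alpha>) a b" "y \<in> hom (cat S \<alpha>) b d"
  shows "cmp (karoubi (cat S \<alpha>)) ([a], e) ([b], f) ([d], g) (mat1 y) (mat1 x) = mat1 (cmp (cat S \<alpha>) a b d y x)"
  using env_cmp[OF assms] by (simp add: karoubi_def idempotent_completion_def)

lemma kar_hom:
  assumes "e \<in> hom (cat S \<alpha>) a a" "f \<in> hom (cat S \<alpha>) b b"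
  shows "hom (karoubi (cat S \<alpha>)) ([a], mat1 e) ([b], mat1 f) =
    mat1 ` {m \<in> hom (cat S \<alpha>) a b. cmp (cat S \<alpha>) a b b f (cmp (cat S \<alpha>) a a b m e) = m}"
  using assms by (auto simp: karoubi_def idempotent_completion_def env_hom env_cmp cob.cmp_hom)

lemma kar_obj_iff:
  assumes "e \<in> hom (cat S \<alpha>) a a"
  shows "([a], mat1 e) \<in> obj (karoubi (cat S \<alpha>)) \<longleftrightarrow> cmp (cat S \<alpha>) a a a e e = e"
  using assms by (auto simp: karoubi_def idempotent_completion_def env_hom env_cmp)
    (auto simp: additive_envelope_def)

lemma kar_simps:
  "idm (karoubi C) ([a], e) = e"
  "plusm (karoubi C) ([a], e) ([b], f) (mat1 x) (mat1 y) = mat1 (plusm C a b x y)"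
  "scalm (karoubi C) ([a], e) ([b], f) r (mat1 x) = mat1 (scalm C a b r x)"
  "zerom (karoubi C) ([a], e) ([b], f) = mat1 (zerom C a b)"
  "unito (karoubi C) = ([unito C], mat1 (idm C (unito C)))"
  "tenso (karoubi C) ([a], mat1 x) ([b], mat1 y) = ([tenso C a b], mat1 (tensm C a a b b x y))"
  "tensm (karoubi C) ([a], e) ([b], f) ([a'], e') ([b'], f') (mat1 x) (mat1 y) = mat1 (tensm C a b a' b' x y)"
  by (simp_all add: karoubi_def idempotent_completion_def additive_envelope_def mk_mat_1)

lemma kar_symm:
  assumes "x \<in> hom (cat S \<alpha>) a a" "y \<in> hom (cat S \<alpha>) b b"
  shows "symm (karoubi (cat S \<alpha>)) ([a], mat1 x) ([b], mat1 y) =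
    mat1 (cmp (cat S \<alpha>) (a @ b) (a @ b) (b @ a) (symm (cat S \<alpha>) a b) (tensm (cat S \<alpha>) a a b b x y))"
proof -
  let ?E = "additive_envelope (cat S \<alpha>)"
  have "symm ?E [a] [b] = mat1 (symm (cat S \<alpha>) a b)"
    "tensm ?E [a] [a] [b] [b] (mat1 x) (mat1 y) = mat1 (tensm (cat S \<alpha>) a a b b x y)"
    "tenso ?E [a] [b] = [a @ b]" "tenso ?E [b] [a] = [b @ a]"
    by (simp_all add: additive_envelope_def mk_mat_1)
  then show ?thesis
    using env_cmp[OF cob.tensm_hom[OF assms] cob.symm_hom[of S \<alpha> a b]]
    by (simp add: karoubi_def idempotent_completion_def)
qed

section \<open>The algebra of the state space\<close>

text \<open>Spelled like the renaming in \<open>bend_arc\<close>, so that bending is renaming by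
  \<open>sub h t\<close>. Every point other than \<open>Top 0\<close> is treated as the
  tail.\<close>

definition sub :: "'p \<Rightarrow> 'p \<Rightarrow> point \<Rightarrow> 'p"
  where "sub h t = (\<lambda>p. if p = Top 0 then h else t)"

lemma sub_simps [simp]: "sub h t (Top 0) = h" "sub h t (Top (Suc i)) = t" "sub h t (Bot i) = t"
  by (simp_all add: sub_def)

text \<open>Joining the tail \<open>Top 1\<close> of \<open>x\<close> to the head \<open>Top 0\<close> of \<open>y\<close>.  On \<open>A(+-)\<close> this is the product; if
  \<open>x\<close> lacks its head or \<open>y\<close> its tail, it is the action on \<open>A(+)\<close> or \<open>A(-)\<close> or the pairing.\<close>

definition mu :: "((point, 's) diagram \<Rightarrow>\<^sub>0 'k::field) \<Rightarrow> ((point, 's) diagram \<Rightarrow>\<^sub>0 'k) \<Rightarrow> ((point, 's) diagram \<Rightarrow>\<^sub>0 'k)"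
  where "mu x y = cren both (cglue (Inl (Top 1)) (Inr (Top 0)) (cren Inl x * cren Inr y))"

lemma mu_add_left: "mu (x + y) z = mu x z + mu y z"
  and mu_add_right: "mu z (x + y) = mu z x + mu z y"
  and mu_scale_left: "mu (scale r x) z = scale r (mu x z)"
  and mu_scale_right: "mu z (scale r x) = scale r (mu z x)"
  and mu_0_left [simp]: "mu 0 z = 0"
  and mu_0_right [simp]: "mu z 0 = 0"
  and mu_diff_left: "mu (x - y) z = mu x z - mu y z"
  and mu_diff_right: "mu z (x - y) = mu z x - mu z y"
  by (simp_all add: mu_def lin_add lin_diff lin_scale scale_mult_left scale_mult_right algebra_simps)

lemma mu_sum_left: "mu (sum f A) z = (\<Sum>i\<in>A. mu (f i) z)"
  and mu_sum_right: "mu z (sum f A) = (\<Sum>i\<in>A. mu z (f i))"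
  by (induct A rule: infinite_finite_induct) (simp_all add: mu_add_left mu_add_right)

abbreviation T0 :: point where "T0 \<equiv> Top 0"
abbreviation T1 :: point where "T1 \<equiv> Top (Suc 0)"

context
  fixes H T :: "point set"
  assumes H: "H \<subseteq> {T0}" and T: "T \<subseteq> {T1}"
begin

lemma HT_cases: "(H = {} \<or> H = {T0}) \<and> (T = {} \<or> T = {T1})"
  using H T by auto

lemma mu_pre:
  assumes "x \<in> dcombs b S H {T1}" "y \<in> dcombs b S {T0} T"
  shows "cren Inl x * cren Inr y \<in> dcombs b S (Inl ` H \<union> {Inr T0}) ({Inl T1} \<union> Inr ` T)"
proof -
  have "cren Inl x \<in> dcombs b S (Inl ` H) (Inl ` {T1})" "cren Inr y \<in> dcombs b S (Inr ` {T0}) (Inr ` T)"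
    by (rule cren_in, rule assms, simp add: inj_on_def)+
  from mult_in[OF this] show ?thesis by auto
qed

lemma mu_opp: "opp (Inl ` H \<union> {Inr T0}) ({Inl T1} \<union> Inr ` T) (Inl T1) (Inr T0)"
  by (auto simp: opp_def)

lemma mu_rest: "Inl ` H \<union> {Inr T0} - {Inl T1, Inr T0} = Inl ` H" "{Inl T1} \<union> Inr ` T - {Inl T1, Inr T0} = Inr ` T"
  using H T by auto

lemma mu_inj: "inj_on both (Inl ` H \<union> Inr ` T)"
  using H T by (auto simp: inj_on_def)

lemma mu_img: "both ` Inl ` H = H" "both ` Inr ` T = T"
  by (auto simp: image_image)

lemma mu_in:
  assumes "x \<in> dcombs b S H {T1}" "y \<in> dcombs b S {T0} T"
  shows "mu x y \<in> dcombs b S H T"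
  using cren_in[OF cglue_in[OF mu_pre[OF assms] mu_opp], unfolded mu_rest, OF mu_inj]
  by (simp add: mu_def mu_img)

lemma null_mu1:
  assumes "x \<in> null S \<alpha> H {T1}" "y \<in> dcombs False S {T0} T"
  shows "mu x y \<in> null S \<alpha> H T"
proof -
  have "cren Inl x \<in> null S \<alpha> (Inl ` H) (Inl ` {T1})" "cren Inr y \<in> dcombs False S (Inr ` {T0}) (Inr ` T)"
    by (rule null_cren[OF assms(1)], simp add: inj_on_def) (rule cren_in[OF assms(2)], simp add: inj_on_def)
  from null_mult[OF this] have "cren Inl x * cren Inr y \<in> null S \<alpha> (Inl ` H \<union> {Inr T0}) ({Inl T1} \<union> Inr ` T)"
    by auto
  from null_cren[OF null_cglue[OF this mu_opp], unfolded mu_rest, OF mu_inj]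
  show ?thesis by (simp add: mu_def mu_img)
qed

lemma null_mu2:
  assumes "x \<in> dcombs False S H {T1}" "y \<in> null S \<alpha> {T0} T"
  shows "mu x y \<in> null S \<alpha> H T"
proof -
  have "cren Inl x \<in> dcombs False S (Inl ` H) (Inl ` {T1})" "cren Inr y \<in> null S \<alpha> (Inr ` {T0}) (Inr ` T)"
    by (rule cren_in[OF assms(1)], simp add: inj_on_def) (rule null_cren[OF assms(2)], simp add: inj_on_def)
  from null_mult_right[OF this(2,1)]
  have "cren Inl x * cren Inr y \<in> null S \<alpha> (Inl ` H \<union> {Inr T0}) ({Inl T1} \<union> Inr ` T)"
    by auto
  from null_cren[OF null_cglue[OF this mu_opp], unfolded mu_rest, OF mu_inj]
  show ?thesis by (simp add: mu_def mu_img)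
qed

text \<open>\<open>mu\<close> uses fixed names for its points; an injective renaming transports the
  gluing to any distinct names. In this form products are recognized inside larger diagrams. If an
  end is absent, its name is a dummy.\<close>

lemma mu_glue:
  assumes x: "x \<in> dcombs b S H {T1}" and y: "y \<in> dcombs b S {T0} T" and d: "distinct [p, m, m', q]"
  shows "cglue m m' (cren (sub p m) x * cren (sub m' q) y) = cren (sub p q) (mu x y)"
proof -
  let ?k = "case_sum (sub p m) (sub m' q)"
  have i: "inj_on ?k ((Inl ` H \<union> {Inr T0}) \<union> ({Inl T1} \<union> Inr ` T))"
    using HT_cases d by auto
  note W = mu_pre[OF x y]
  have "cren (sub p q) (mu x y) = cren (\<lambda>r. sub p q (both r)) (cglue (Inl T1) (Inr T0) (cren Inl x * cren Inr y))"
    by (simp add: mu_def cren_cren)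
  also have "\<dots> = cren ?k (cglue (Inl T1) (Inr T0) (cren Inl x * cren Inr y))"
    by (rule cren_cong[OF cglue_in[OF W mu_opp], unfolded mu_rest]) (use H T in auto)
  also have "\<dots> = cglue m m' (cren ?k (cren Inl x * cren Inr y))"
    using cren_cglue[OF W mu_opp i] by simp
  finally show ?thesis by (simp add: cren_mult cren_cren)
qed

lemma sub_in:
  assumes "x \<in> dcombs b S H T" "p \<noteq> q"
  shows "cren (sub p q) x \<in> dcombs b S (sub p q ` H) (sub p q ` T)"
  by (rule cren_in[OF assms(1)]) (use HT_cases assms(2) in auto)

lemma null_sub:
  assumes "x \<in> null S \<alpha> H T" "p \<noteq> q"
  shows "cren (sub p q) x \<in> null S \<alpha> (sub p q ` H) (sub p q ` T)"
  by (rule null_cren[OF assms(1)]) (use HT_cases assms(2) in auto)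

lemma sub_sub: "x \<in> dcombs b S H T \<Longrightarrow> cren f (cren (sub p q) x) = cren (sub (f p) (f q)) x"
  unfolding cren_cren by (rule cren_cong, assumption) (use H T in auto)

lemma sub_self: "x \<in> dcombs b S H T \<Longrightarrow> cren (sub T0 T1) x = x"
  by (erule cren_cong_id) (use H T in auto)

end

text \<open>With natural numbers as points, both sides arise from strands 0-1, 2-3 and 4-5 by gluing
  1 to 2 and 3 to 4, in the two possible orders.\<close>

lemma mu_assoc:
  assumes HT: "H \<subseteq> {T0}" "T \<subseteq> {T1}"
    and x: "x \<in> dcombs b S H {T1}" and y: "y \<in> dcombs b S {T0} {T1}" and z: "z \<in> dcombs b S {T0} T"
  shows "mu (mu x y) z = mu x (mu y z)"
proof -
  let ?s = "\<lambda>i j. sub i j :: point \<Rightarrow> nat"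
  let ?X = "cren (?s 0 1) x" and ?Y = "cren (?s 2 3) y" and ?Z = "cren (?s 4 5) z"
  have t: "{T1} \<subseteq> {T1}" "{T0} \<subseteq> {T0}" by auto
  have X: "?X \<in> dcombs b S (?s 0 1 ` H) {1}" using sub_in[OF HT(1) t(1) x, of "0::nat" 1] by simp
  have Y: "?Y \<in> dcombs b S {2} {3}" using sub_in[OF t(2,1) y, of "2::nat" 3] by simp
  have Z: "?Z \<in> dcombs b S {4} (?s 4 5 ` T)" using sub_in[OF t(2) HT(2) z, of "4::nat" 5] by simp
  have XH: "?s 0 1 ` H = {} \<or> ?s 0 1 ` H = {0}" and ZT: "?s 4 5 ` T = {} \<or> ?s 4 5 ` T = {5}"
    using HT_cases[OF HT] by auto
  have XY: "?X * ?Y \<in> dcombs b S (?s 0 1 ` H \<union> {2}) ({1} \<union> {3})"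
    by (rule mult_in[OF X Y]) (use XH in \<open>elim disjE; simp\<close>)
  have YZ: "?Y * ?Z \<in> dcombs b S ({2} \<union> {4}) ({3} \<union> ?s 4 5 ` T)"
    by (rule mult_in[OF Y Z]) (use ZT in \<open>elim disjE; simp\<close>)
  have XYZ: "?X * ?Y * ?Z \<in> dcombs b S (?s 0 1 ` H \<union> {2} \<union> {4}) ({1} \<union> {3} \<union> ?s 4 5 ` T)"
    by (rule mult_in[OF XY Z]) (use XH ZT in \<open>elim disjE; simp\<close>)
  note xy = mu_in[OF HT(1) t(1) x y] and yz = mu_in[OF t(2) HT(2) y z]
  have 1: "cglue 1 2 (?X * ?Y) = cren (?s 0 3) (mu x y)"
    by (rule mu_glue[OF HT(1) t(1) x y]) simp
  have 2: "cglue 3 4 (?Y * ?Z) = cren (?s 2 5) (mu y z)"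
    by (rule mu_glue[OF t(2) HT(2) y z]) simp
  have "cren (?s 0 5) (mu (mu x y) z) = cglue 3 4 (cren (?s 0 3) (mu x y) * ?Z)"
    by (rule mu_glue[OF HT xy z, symmetric]) simp
  also have "\<dots> = cglue 3 4 (cglue 1 2 (?X * ?Y * ?Z))"
    unfolding 1[symmetric]
    by (rule arg_cong[of _ _ "cglue 3 4"], rule cglue_mult[OF XY _ Z, symmetric])
      (use XH ZT in \<open>elim disjE; simp add: opp_def\<close>)+
  also have "\<dots> = cglues [(1, 2), (3, 4)] (?X * ?Y * ?Z)"
    by (simp only: cglues_Cons cglues_single cglues_Nil)
  also have "\<dots> = cglues [(3, 4), (1, 2)] (?X * ?Y * ?Z)"
  proof (rule cglues_perm[OF XYZ])
    show "okp (?s 0 1 ` H \<union> {2} \<union> {4}) ({1} \<union> {3} \<union> ?s 4 5 ` T) [(3, 4), (1, 2)]"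
      unfolding okp_def using XH ZT by (elim disjE; simp add: opp_def)
  qed simp
  also have "\<dots> = cglue 1 2 (cglue 3 4 (?X * (?Y * ?Z)))"
    by (simp only: cglues_Cons cglues_single cglues_Nil mult.assoc)
  also have "cglue 3 4 (?X * (?Y * ?Z)) = ?X * cren (?s 2 5) (mu y z)"
    unfolding 2[symmetric] mult.commute[of ?X]
    by (rule cglue_mult[OF YZ _ X]) (use XH ZT in \<open>elim disjE; simp add: opp_def\<close>)+
  also have "cglue 1 2 \<dots> = cren (?s 0 5) (mu x (mu y z))"
    by (rule mu_glue[OF HT x yz]) simp
  finally have e: "cren (?s 0 5) (mu (mu x y) z) = cren (?s 0 5) (mu x (mu y z))" .
  \<comment> \<open>Undoes the renaming: \<open>0\<close> names the head and \<open>5\<close> the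
    tail of both products.\<close>
  let ?inv = "\<lambda>i. if i = (0::nat) then T0 else T1"
  have "mu (mu x y) z = cren ?inv (cren (?s 0 5) (mu (mu x y) z))"
    using sub_sub[OF HT mu_in[OF HT xy z], of ?inv "0::nat" 5] sub_self[OF HT mu_in[OF HT xy z]] by simp
  also have "\<dots> = mu x (mu y z)"
    unfolding e using sub_sub[OF HT mu_in[OF HT x yz], of ?inv "0::nat" 5] sub_self[OF HT mu_in[OF HT x yz]] by simp
  finally show ?thesis .
qed

section \<open>Trace, pairing and elements of rank one\<close>

definition tr :: "('s, 'k::field) evaluation \<Rightarrow> ((point, 's) diagram \<Rightarrow>\<^sub>0 'k) \<Rightarrow> 'k"
  where "tr \<alpha> x = eval_comb \<alpha> (cglue T0 T1 x)"

lemma tr_add: "tr \<alpha> (x + y) = tr \<alpha> x + tr \<alpha> y"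
  and tr_diff: "tr \<alpha> (x - y) = tr \<alpha> x - tr \<alpha> y"
  and tr_scale: "tr \<alpha> (scale r x) = r * tr \<alpha> x"
  by (simp_all add: tr_def lin_add lin_diff lin_scale eval_comb_add eval_comb_diff eval_comb_scale)

lemma opp_T01 [simp]: "opp {T0} {T1} T0 T1" "opp {T1} {T0} T0 T1"
  by (auto simp: opp_def)

lemma tr_null: "x \<in> null S \<alpha> {T0} {T1} \<Longrightarrow> tr \<alpha> x = 0"
  using null_cglue[of x S \<alpha> "{T0}" "{T1}" T0 T1] by (simp add: null_closed tr_def insert_Diff_if)

lemma cglue_sub:
  assumes "x \<in> dcombs b S {T0} {T1}" "p \<noteq> q"
  shows "cglue p q (cren (sub p q) x) = cren (sub p q) (cglue T0 T1 x)"
  using cren_cglue[OF assms(1), of T0 T1 "sub p q"] assms(2) by (simp add: inj_on_def)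

lemma tr_sub:
  assumes "x \<in> dcombs b S {T0} {T1}" "p \<noteq> q"
  shows "eval_comb \<alpha> (cglue p q (cren (sub p q) x)) = tr \<alpha> x"
  unfolding cglue_sub[OF assms] by (simp add: tr_def)

text \<open>Both sides glue the same two strands at the same two pairs of points; one gluing is the
  product and the other the closure, with the roles exchanged.\<close>

lemma tr_mu:
  assumes x: "x \<in> dcombs b S {T0} {T1}" and y: "y \<in> dcombs b S {T0} {T1}"
  shows "tr \<alpha> (mu x y) = tr \<alpha> (mu y x)"
proof -
  let ?s = "\<lambda>i j. sub i j :: point \<Rightarrow> nat"
  let ?X = "cren (?s 0 1) x" and ?Y = "cren (?s 2 3) y"
  have t: "{T1} \<subseteq> {T1}" "{T0} \<subseteq> {T0}" by auto
  have X: "?X \<in> dcombs b S {0} {1}" using sub_in[OF t(2,1) x, of "0::nat" 1] by simp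
  have Y: "?Y \<in> dcombs b S {2} {3}" using sub_in[OF t(2,1) y, of "2::nat" 3] by simp
  have XY: "?X * ?Y \<in> dcombs b S ({0} \<union> {2}) ({1} \<union> {3})" by (rule mult_in[OF X Y]) auto
  note xy = mu_in[OF t(2,1) x y] and yx = mu_in[OF t(2,1) y x]
  have 1: "cglue 1 2 (?X * ?Y) = cren (?s 0 3) (mu x y)"
    by (rule mu_glue[OF t(2,1) x y]) simp
  have 2: "cglue 3 0 (?Y * ?X) = cren (?s 2 1) (mu y x)"
    by (rule mu_glue[OF t(2,1) y x]) simp
  have "tr \<alpha> (mu x y) = eval_comb \<alpha> (cglue 0 3 (cren (?s 0 3) (mu x y)))"
    by (rule tr_sub[OF xy, symmetric]) simp
  also have "cglue 0 3 (cren (?s 0 3) (mu x y)) = cglues [(1, 2), (3, 0)] (?X * ?Y)"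
    unfolding 1[symmetric] by (simp only: cglues_Cons cglues_single cglues_Nil cglue_sym[of 0 3])
  also have "\<dots> = cglues [(3, 0), (1, 2)] (?X * ?Y)"
    by (rule cglues_perm[OF XY]) (auto simp: okp_def opp_def)
  also have "\<dots> = cglue 1 2 (cglue 3 0 (?Y * ?X))"
    by (simp only: cglues_Cons cglues_single cglues_Nil mult.commute)
  also have "\<dots> = cglue 2 1 (cren (?s 2 1) (mu y x))"
    unfolding 2 by (simp only: cglue_sym[of 1 2])
  also have "eval_comb \<alpha> \<dots> = tr \<alpha> (mu y x)"
    by (rule tr_sub[OF yx]) simp
  finally show ?thesis .
qed

text \<open>Representatives of A(+), A(-) and A(+-). For \<open>hw\<close> the tail is put at
  \<open>T1\<close> instead of the actual boundary point \<open>T0\<close> of \<open>[Neg]\<close>,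
  so that \<open>hv\<close> times \<open>hw\<close> lands in \<open>hA\<close> without renaming;
  \<open>shift 0 (Suc 0)\<close> translates.\<close>

abbreviation hv :: "'s set \<Rightarrow> ('s, 'k::field) comb set" where "hv S \<equiv> dcombs False S {T0} {}"
abbreviation hw :: "'s set \<Rightarrow> ('s, 'k::field) comb set" where "hw S \<equiv> dcombs False S {} {T1}"
abbreviation hA :: "'s set \<Rightarrow> ('s, 'k::field) comb set" where "hA S \<equiv> dcombs False S {T0} {T1}"

lemma hv_hw: "v \<in> hv S \<Longrightarrow> w \<in> hw S \<Longrightarrow> v * w \<in> hA S"
  using mult_in[of v False S "{T0}" "{}" w "{}" "{T1}"] by simp

text \<open>The factor \<open>v\<close> carries neither of the two glued points, so it can be pulled
  out of the gluing.\<close>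

lemma mu_rank1_left:
  assumes v: "v \<in> hv S" and w: "w \<in> hw S" and y: "y \<in> dcombs False S {T0} T" and T: "T \<subseteq> {T1}"
  shows "mu (v * w) y = v * mu w y"
proof -
  have t: "{} \<subseteq> {T0}" by simp
  have v': "cren Inl v \<in> dcombs False S {Inl T0} {}" for Inl :: "point \<Rightarrow> point + point"
    using cren_in[OF v, of Inl] by simp
  have "mu (v * w) y = cren both (cglue (Inl T1) (Inr T0) ((cren Inl w * cren Inr y) * cren Inl v))"
    by (simp add: mu_def cren_mult mult.commute mult.left_commute)
  also have "cglue (Inl T1) (Inr T0) ((cren Inl w * cren Inr y) * cren Inl v) =
     cglue (Inl T1) (Inr T0) (cren Inl w * cren Inr y) * cren Inl v"
    by (rule cglue_mult[OF mu_pre[OF t T w y] mu_opp[OF t T] v']) (use T in auto)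
  finally show ?thesis
    by (simp add: cren_mult cren_cren mult.commute cren_ident flip: mu_def)
      (simp add: mu_def)
qed

lemma mu_rank1_right:
  assumes v: "v \<in> hv S" and w: "w \<in> hw S" and x: "x \<in> dcombs False S H {T1}" and H: "H \<subseteq> {T0}"
  shows "mu x (v * w) = mu x v * w"
proof -
  have t: "{} \<subseteq> {T1}" by simp
  have w': "cren Inr w \<in> dcombs False S {} {Inr T1}" for Inr :: "point \<Rightarrow> point + point"
    using cren_in[OF w, of Inr] by simp
  have "mu x (v * w) = cren both (cglue (Inl T1) (Inr T0) ((cren Inl x * cren Inr v) * cren Inr w))"
    by (simp add: mu_def cren_mult mult.assoc)
  also have "cglue (Inl T1) (Inr T0) ((cren Inl x * cren Inr v) * cren Inr w) =
     cglue (Inl T1) (Inr T0) (cren Inl x * cren Inr v) * cren Inr w"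
    by (rule cglue_mult[OF mu_pre[OF H t x v] mu_opp[OF H t] w']) (use H in auto)
  finally show ?thesis
    by (simp add: cren_mult cren_cren mult.commute cren_ident flip: mu_def)
      (simp add: mu_def)
qed

definition pr :: "('s, 'k::field) evaluation \<Rightarrow> ('s, 'k) comb \<Rightarrow> ('s, 'k) comb \<Rightarrow> 'k"
  where "pr \<alpha> w v = eval_comb \<alpha> (mu w v)"

lemma pr_linear:
  "pr \<alpha> (w + w') v = pr \<alpha> w v + pr \<alpha> w' v" "pr \<alpha> w (v + v') = pr \<alpha> w v + pr \<alpha> w v'"
  "pr \<alpha> (w - w') v = pr \<alpha> w v - pr \<alpha> w' v" "pr \<alpha> w (v - v') = pr \<alpha> w v - pr \<alpha> w v'"
  "pr \<alpha> (scale r w) v = r * pr \<alpha> w v" "pr \<alpha> w (scale r v) = r * pr \<alpha> w v"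
  "pr \<alpha> (sum f A) v = (\<Sum>i\<in>A. pr \<alpha> (f i) v)" "pr \<alpha> w (sum f A) = (\<Sum>i\<in>A. pr \<alpha> w (f i))"
  by (simp_all add: pr_def mu_add_left mu_add_right mu_diff_left mu_diff_right mu_scale_left mu_scale_right
      mu_sum_left mu_sum_right eval_comb_add eval_comb_diff eval_comb_scale eval_comb_sum)

text \<open>Closing up joins the tail of \<open>w\<close> to the head of \<open>v\<close>, which is
  also how \<open>mu w v\<close> is formed; \<open>Bot 0\<close> and \<open>Bot 1\<close> only name
  the absent ends.\<close>

lemma tr_rank1:
  assumes "v \<in> hv S" "w \<in> hw S"
  shows "tr \<alpha> (v * w) = pr \<alpha> w v"
proof -
  have t: "{} \<subseteq> {T0}" "{} \<subseteq> {T1}" by auto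
  have "cglue T1 T0 (cren (sub (Bot 0) T1) w * cren (sub T0 (Bot 1)) v) = cren (sub (Bot 0) (Bot 1)) (mu w v)"
    by (rule mu_glue[OF t assms(2,1)]) simp
  moreover have "cren (sub (Bot 0) T1) w = w" "cren (sub T0 (Bot 1)) v = v"
    by (rule cren_cong_id[OF assms(2)]; simp) (rule cren_cong_id[OF assms(1)]; simp)
  ultimately show ?thesis
    unfolding tr_def pr_def by (metis cglue_sym eval_cren mult.commute)
qed

lemma one_in: "1 \<in> dcombs b S {} {}"
  using combs_gen[of "{#}" "dgs b S {} {}"] by (simp add: gen_0)

text \<open>A closed combination differs from its value times the empty diagram by a null
  combination, and the latter stay null in products.\<close>

lemma closed_scalar:
  assumes "x \<in> dcombs False S H T" "z \<in> dcombs False S {} {}"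
  shows "x * z - scale (eval_comb \<alpha> z) x \<in> null S \<alpha> H T"
proof -
  have "z - scale (eval_comb \<alpha> z) 1 \<in> null S \<alpha> {} {}"
    unfolding null_closed using assms(2) one_in[of False S]
    by (auto simp: eval_comb_diff eval_comb_scale)
  from null_mult_right[OF this assms(1)] show ?thesis
    by (simp add: algebra_simps scale_mult_right)
qed

lemma null_mu_pr: "x \<in> null S \<alpha> {} {T1} \<Longrightarrow> v \<in> hv S \<Longrightarrow> pr \<alpha> x v = 0"
  "w \<in> hw S \<Longrightarrow> v \<in> null S \<alpha> {T0} {} \<Longrightarrow> pr \<alpha> w v = 0"
  using null_mu1[of "{}" "{}" x S \<alpha> v] null_mu2[of "{}" "{}" w S v \<alpha>]
  by (simp_all add: null_closed pr_def)

text \<open>For a single outer point the diagrams with exchanged boundary are those of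
  \<open>hw\<close> up to the name of the point. The criterion \<open>null_pairing\<close> thus
  becomes nondegeneracy of the pairing on the side of A(+).\<close>

lemma null_hvI:
  assumes v: "v \<in> hv S" and z: "\<And>w. w \<in> hw S \<Longrightarrow> pr \<alpha> w v = 0"
  shows "v \<in> null S \<alpha> {T0} {}"
proof (rule null_pairing[OF v, of "[T0]"])
  fix E assume E: "E \<in> dgs False S {} {T0}"
  let ?w = "gen (rename (\<lambda>_. T1) E)"
  have w: "?w \<in> hw S" using dgs_rename[OF E, of "\<lambda>_. T1"] by simp
  have t: "{} \<subseteq> {T0}" "{} \<subseteq> {T1}" by auto
  let ?Il = "Inl :: point \<Rightarrow> point + point" and ?Ir = "Inr :: point \<Rightarrow> point + point"
  have "cglue (?Ir T0) (?Il T0) (cren (sub (?Il (Bot 0)) (?Ir T0)) ?w * cren (sub (?Il T0) (?Ir (Bot 1))) v)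
    = cren (sub (?Il (Bot 0)) (?Ir (Bot 1))) (mu ?w v)"
    by (rule mu_glue[OF t w v]) simp
  moreover have "cren (sub (?Il T0) (?Ir (Bot 1))) v = cren ?Il v"
    by (rule cren_cong[OF v]) simp
  moreover have "cren (sub (?Il (Bot 0)) (?Ir T0)) ?w = gen (rename ?Ir E)"
    using rename_cong[OF E, of "\<lambda>_. ?Ir T0" ?Ir] by (simp add: rename_rename)
  ultimately have "eval_comb \<alpha> (cglue (?Il T0) (?Ir T0) (cren ?Il v * gen (rename ?Ir E))) = pr \<alpha> ?w v"
    unfolding pr_def by (metis cglue_sym eval_cren mult.commute)
  then show "eval_comb \<alpha> (cglues (map (\<lambda>p. (Inl p, Inr p)) [T0]) (cren Inl v * gen (rename Inr E))) = 0"
    using z[OF w] by (simp only: list.map cglues_single)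
qed auto

lemma null_hwI:
  assumes w: "w \<in> hw S" and z: "\<And>v. v \<in> hv S \<Longrightarrow> pr \<alpha> w v = 0"
  shows "w \<in> null S \<alpha> {} {T1}"
proof (rule null_pairing[OF w, of "[T1]"])
  fix E assume E: "E \<in> dgs False S {T1} {}"
  let ?v = "gen (rename (\<lambda>_. T0) E)"
  have v: "?v \<in> hv S" using dgs_rename[OF E, of "\<lambda>_. T0"] by simp
  have t: "{} \<subseteq> {T0}" "{} \<subseteq> {T1}" by auto
  let ?Il = "Inl :: point \<Rightarrow> point + point" and ?Ir = "Inr :: point \<Rightarrow> point + point"
  have "cglue (?Il T1) (?Ir T1) (cren (sub (?Il (Bot 0)) (?Il T1)) w * cren (sub (?Ir T1) (?Ir (Bot 1))) ?v)
    = cren (sub (?Il (Bot 0)) (?Ir (Bot 1))) (mu w ?v)"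
    by (rule mu_glue[OF t w v]) simp
  moreover have "cren (sub (?Il (Bot 0)) (?Il T1)) w = cren ?Il w"
    by (rule cren_cong[OF w]) simp
  moreover have "cren (sub (?Ir T1) (?Ir (Bot 1))) ?v = gen (rename ?Ir E)"
    using rename_cong[OF E, of "\<lambda>_. ?Ir T1" ?Ir] by (simp add: rename_rename)
  ultimately have "eval_comb \<alpha> (cglue (?Il T1) (?Ir T1) (cren ?Il w * gen (rename ?Ir E))) = pr \<alpha> w ?v"
    unfolding pr_def by (metis eval_cren)
  then show "eval_comb \<alpha> (cglues (map (\<lambda>p. (Inl p, Inr p)) [T1]) (cren Inl w * gen (rename Inr E))) = 0"
    using z[OF v] by (simp only: list.map cglues_single)
qed auto

definition unit_arc :: "('s, 'k::field) comb" where "unit_arc = gen {#arc T0 T1#}"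

lemma unit_arc_in: "unit_arc \<in> dcombs b S {T0} {T1}"
  unfolding unit_arc_def combs_gen by (simp add: dgs_add arc_def)

lemma mu_unit_left:
  assumes y: "y \<in> dcombs b S {T0} T" and T: "T \<subseteq> {T1}"
  shows "mu unit_arc y = y"
  using y
proof (induct rule: comb_induct)
  case (gen D)
  let ?D = "rename Inr D :: (point + point, 'a) diagram"
  have D: "?D \<in> dgs b S {Inr T0} (Inr ` T)"
  proof -
    have "inj_on Inr ({T0} \<union> T)" by (simp add: inj_on_def)
    from dgs_rename[OF gen this] show ?thesis by simp
  qed
  have a: "{#arc (Inl T0) (Inl T1)#} \<in> dgs b S {Inl T0} {Inl T1}" by (simp add: dgs_add arc_def)
  have "add_mset (arc (Inl T0) (Inl T1)) ?D \<in> dgs b S ({Inl T0} \<union> {Inr T0}) ({Inl T1} \<union> Inr ` T)"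
    using dgs_plus[OF a D] by auto
  from glue_arc(1)[OF D this, of "Inr T0"]
  have 1: "glue (Inl T1) (Inr T0) (add_mset (arc (Inl T0) (Inl T1)) ?D) = rename (id(Inr T0 := Inl T0)) ?D"
    by (simp add: glue_sym[of "Inl T1"])
  have "mu unit_arc (gen D) = gen (rename both (glue (Inl T1) (Inr T0) (add_mset (arc (Inl T0) (Inl T1)) ?D)))"
    by (simp add: mu_def unit_arc_def gen_mult_gen arc_def del: mult_single)
  also have "\<dots> = gen (rename (\<lambda>p. p) D)"
    unfolding 1 rename_rename by (intro arg_cong[of _ _ gen] rename_cong[OF gen]) auto
  finally show ?case by (simp add: rename_ident)
qed (auto simp: mu_add_right mu_scale_right)

lemma mu_unit_right:
  assumes x: "x \<in> dcombs b S H {T1}" and H: "H \<subseteq> {T0}"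
  shows "mu x unit_arc = x"
  using x
proof (induct rule: comb_induct)
  case (gen D)
  let ?D = "rename Inl D :: (point + point, 'a) diagram"
  have D: "?D \<in> dgs b S (Inl ` H) {Inl T1}"
  proof -
    have "inj_on Inl (H \<union> {T1})" by (simp add: inj_on_def)
    from dgs_rename[OF gen this] show ?thesis by simp
  qed
  have a: "{#arc (Inr T0) (Inr T1)#} \<in> dgs b S {Inr T0} {Inr T1}" by (simp add: dgs_add arc_def)
  have "add_mset (arc (Inr T0) (Inr T1)) ?D \<in> dgs b S ({Inr T0} \<union> Inl ` H) ({Inr T1} \<union> {Inl T1})"
    using dgs_plus[OF a D] by auto
  from glue_arc(2)[OF D this, of "Inl T1"]
  have 1: "glue (Inl T1) (Inr T0) (add_mset (arc (Inr T0) (Inr T1)) ?D) = rename (id(Inl T1 := Inr T1)) ?D"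
    by simp
  have "mu (gen D) unit_arc = gen (rename both (glue (Inl T1) (Inr T0) (add_mset (arc (Inr T0) (Inr T1)) ?D)))"
    by (simp add: mu_def unit_arc_def gen_mult_gen arc_def del: mult_single)
  also have "\<dots> = gen (rename (\<lambda>p. p) D)"
    unfolding 1 rename_rename using H by (intro arg_cong[of _ _ gen] rename_cong[OF gen]) auto
  finally show ?case by (simp add: rename_ident)
qed (auto simp: mu_add_left mu_scale_left)

section \<open>From combinations to classes: bending, product, action, closure, tensor and
  pairing\<close>

lemma pos_Cons: "pos (s # a) = (if s = Pos then {0} else {}) \<union> Suc ` pos a"
  and neg_Cons: "neg (s # a) = (if s = Neg then {0} else {}) \<union> Suc ` neg a"
  and pos_Nil [simp]: "pos [] = {}" and neg_Nil [simp]: "neg [] = {}"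
  by (auto simp: pos_def neg_def less_Suc_eq_0_disj)

lemma boundary_simps:
  "heads [] [Pos, Neg] = {T0}" "tails [] [Pos, Neg] = {T1}"
  "heads [] [Pos] = {T0}" "tails [] [Pos] = {}"
  "heads [] [Neg] = {}" "tails [] [Neg] = {T0}"
  "heads [Pos] [Pos] = {T0}" "tails [Pos] [Pos] = {Bot 0}"
  "heads [Neg] [Neg] = {Bot 0}" "tails [Neg] [Neg] = {T0}"
  by (simp_all add: heads_eq tails_eq pos_Cons neg_Cons)

lemma bend_cls:
  assumes "x \<in> dcombs False S (heads a' b') (tails a' b')" "inj_on f (heads a' b' \<union> tails a' b')"
    "f ` heads a' b' = heads a b" "f ` tails a' b' = tails a b"
  shows "bend S \<alpha> f a b (cls S \<alpha> a' b' x) = cls S \<alpha> a b (cren f x)"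
  unfolding bend_def
proof (rule cob.UN_c)
  fix y assume "y \<in> cls S \<alpha> a' b' x"
  then have "y - x \<in> null S \<alpha> (heads a' b') (tails a' b')" by (simp add: cob.mem_c)
  from null_cren[OF this assms(2)] show "cls S \<alpha> a b (cren f y) = cls S \<alpha> a b (cren f x)"
    by (simp add: cob.c_eq_iff lin_diff assms(3,4))
qed

lemma bend_arc_cls:
  assumes "x \<in> hA S" "heads a b = {h}" "tails a b = {t}"
  shows "bend_arc S \<alpha> h t a b (cls S \<alpha> [] [Pos, Neg] x) = cls S \<alpha> a b (cren (sub h t) x)"
proof -
  have "h \<noteq> t" using heads_tails_disjoint[of a b] assms by auto
  then show ?thesis unfolding bend_arc_def sub_def[symmetric]
    by (intro bend_cls) (use assms in \<open>auto simp: boundary_simps\<close>)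
qed

lemma to_end_pos_cls: "x \<in> hA S \<Longrightarrow>
  to_end_pos S \<alpha> (cls S \<alpha> [] [Pos, Neg] x) = cls S \<alpha> [Pos] [Pos] (cren (sub T0 (Bot 0)) x)"
  unfolding to_end_pos_def by (rule bend_arc_cls) (auto simp: boundary_simps)

lemma to_end_neg_cls: "x \<in> hA S \<Longrightarrow>
  to_end_neg S \<alpha> (cls S \<alpha> [] [Pos, Neg] x) = cls S \<alpha> [Neg] [Neg] (cren (sub (Bot 0) T0) x)"
  unfolding to_end_neg_def by (rule bend_arc_cls) (auto simp: boundary_simps)

lemma of_end_pos_cls: "x \<in> hA S \<Longrightarrow>
  of_end_pos S \<alpha> (cls S \<alpha> [Pos] [Pos] (cren (sub T0 (Bot 0)) x)) = cls S \<alpha> [] [Pos, Neg] x"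
proof -
  assume x: "x \<in> hA S"
  have t: "{T0} \<subseteq> {T0}" "{T1} \<subseteq> {T1}" by auto
  have "cren (sub T0 (Bot 0)) x \<in> dcombs False S {T0} {Bot 0}"
    using sub_in[OF t x, of T0 "Bot 0"] by simp
  then have "of_end_pos S \<alpha> (cls S \<alpha> [Pos] [Pos] (cren (sub T0 (Bot 0)) x)) =
    cls S \<alpha> [] [Pos, Neg] (cren (\<lambda>p. if p = T0 then T0 else Top 1) (cren (sub T0 (Bot 0)) x))"
    unfolding of_end_pos_def by (intro bend_cls) (auto simp: boundary_simps)
  also have "cren (\<lambda>p. if p = T0 then T0 else Top 1) (cren (sub T0 (Bot 0)) x) = cren (sub T0 T1) x"
    by (subst sub_sub[OF t x]) simp
  finally show ?thesis by (simp add: sub_self[OF t x])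
qed

text \<open>Stacking glues the tail of \<open>x\<close> at the bottom to the head of
  \<open>y\<close> at the top, as \<open>mu x y\<close> does. Taking \<open>T\<close> empty gives
  the action on A(+), taking it to be \<open>{T1}\<close> the product of A(+-).\<close>

lemma cmp_end_pos:
  assumes x: "x \<in> hA S" and y: "y \<in> dcombs False S {T0} T" and T: "T \<subseteq> {T1}"
  shows "bilin (stack (length [Pos])) (cren (sub T0 (Bot 0)) x) (cren (sub T0 (Bot 0)) y) =
    cren (sub T0 (Bot 0)) (mu x y)"
proof -
  let ?Il = "Inl :: point \<Rightarrow> point + point" and ?Ir = "Inr :: point \<Rightarrow> point + point"
  have t: "{T0} \<subseteq> {T0}" "{T1} \<subseteq> {T1}" by auto
  have s: "stk (length [Pos]) = [(?Il T0, ?Ir (Bot 0))]" by (simp add: stk_def)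
  have "bilin (stack (length [Pos])) (cren (sub T0 (Bot 0)) x) (cren (sub T0 (Bot 0)) y) =
    cren both (cglue (?Il T0) (?Ir (Bot 0)) (cren (sub (?Il T0) (?Il (Bot 0))) y * cren (sub (?Ir T0) (?Ir (Bot 0))) x))"
    unfolding bilin_stack s cglues_single sub_sub[OF t(1) T y] sub_sub[OF t x] ..
  also have "\<dots> = cren both (cren (sub (?Ir T0) (?Il (Bot 0))) (mu x y))"
    by (subst mu_glue[OF t(1) T x y, symmetric, of _ "?Ir (Bot 0)" "?Il T0"])
      (simp_all add: mult.commute cglue_sym[of "?Il T0"])
  also have "\<dots> = cren (sub T0 (Bot 0)) (mu x y)"
    by (subst sub_sub[OF t(1) T mu_in[OF t(1) T x y]]) simp
  finally show ?thesis .
qed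

lemma mult_A_cls:
  assumes x: "x \<in> hA S" and y: "y \<in> hA S"
  shows "mult_A S \<alpha> (cls S \<alpha> [] [Pos, Neg] x) (cls S \<alpha> [] [Pos, Neg] y) = cls S \<alpha> [] [Pos, Neg] (mu x y)"
proof -
  have t: "{T0} \<subseteq> {T0}" "{T1} \<subseteq> {T1}" by auto
  have i: "cren (sub T0 (Bot 0)) z \<in> dcombs False S (heads [Pos] [Pos]) (tails [Pos] [Pos])" if "z \<in> hA S" for z :: "('a, 'b) comb"
    using sub_in[OF t that, of T0 "Bot 0"] by (simp add: boundary_simps)
  show ?thesis
    unfolding mult_A_def to_end_pos_cls[OF x] to_end_pos_cls[OF y] cob.cmp_C[OF i[OF y] i[OF x]]
      cmp_end_pos[OF x y t(2)]
    by (rule of_end_pos_cls[OF mu_in[OF t x y]])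
qed

lemma act_A_cls:
  assumes x: "x \<in> hA S" and v: "v \<in> hv S"
  shows "act_A S \<alpha> (cls S \<alpha> [] [Pos, Neg] x) (cls S \<alpha> [] [Pos] v) = cls S \<alpha> [] [Pos] (mu x v)"
proof -
  have t: "{T0} \<subseteq> {T0}" "{T1} \<subseteq> {T1}" "{} \<subseteq> {T1}" by auto
  have i: "cren (sub T0 (Bot 0)) x \<in> dcombs False S (heads [Pos] [Pos]) (tails [Pos] [Pos])"
    using sub_in[OF t(1,2) x, of T0 "Bot 0"] by (simp add: boundary_simps)
  have v': "v \<in> dcombs False S (heads [] [Pos]) (tails [] [Pos])" using v by (simp add: boundary_simps)
  have v1: "cren (sub T0 (Bot 0)) v = v" by (rule cren_cong_id[OF v]) simp
  have v2: "cren (sub T0 (Bot 0)) (mu x v) = mu x v"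
    by (rule cren_cong_id[OF mu_in[OF t(1,3) x v]]) simp
  show ?thesis
    unfolding act_A_def to_end_pos_cls[OF x] cob.cmp_C[OF v' i] cmp_end_pos[OF x v t(3), unfolded v1 v2] ..
qed

text \<open>The trace vanishes on null combinations, so the set of values on a class is a singleton,
  as \<open>the_elem\<close> requires.\<close>

lemma circular_closure_cls:
  assumes "x \<in> hA S"
  shows "circular_closure \<alpha> (cls S \<alpha> [] [Pos, Neg] x) = tr \<alpha> x"
proof -
  have "(\<lambda>x. eval_comb \<alpha> (cglue T0 (Top 1) x)) ` cls S \<alpha> [] [Pos, Neg] x = {tr \<alpha> x}"
  proof -
    have "tr \<alpha> y = tr \<alpha> x" if "y \<in> cls S \<alpha> [] [Pos, Neg] x" for y
      using tr_null[of "y - x" S \<alpha>] that by (simp add: cob.mem_c boundary_simps tr_diff)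
    then have "tr \<alpha> ` cls S \<alpha> [] [Pos, Neg] x = {tr \<alpha> x}"
      using cob.c_self[of x S \<alpha> "[]" "[Pos, Neg]"] by (intro equalityI subsetI) blast+
    then show ?thesis by (simp add: tr_def[abs_def])
  qed
  then show ?thesis by (simp add: circular_closure_def)
qed

lemma shift1: "w \<in> dcombs False S {} {T0} \<Longrightarrow> cren (shift 0 (Suc 0)) w \<in> hw S"
  using cren_in[of w False S "{}" "{T0}" "shift 0 (Suc 0)"] by simp

lemma unshift1: "w \<in> hw S \<Longrightarrow> \<exists>w'. w' \<in> dcombs False S {} {T0} \<and> cren (shift 0 (Suc 0)) w' = w"
proof (intro exI conjI)
  assume w: "w \<in> hw S"
  show "cren (\<lambda>_. T0) w \<in> dcombs False S {} {T0}" using cren_in[OF w, of "\<lambda>_. T0"] by simp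
  show "cren (shift 0 (Suc 0)) (cren (\<lambda>_. T0) w) = w"
    unfolding cren_cren by (rule cren_cong_id[OF w]) simp
qed

lemma tens_A_cls:
  assumes "v \<in> hv S" "w \<in> dcombs False S {} {T0}"
  shows "tens_A S \<alpha> (cls S \<alpha> [] [Pos] v) (cls S \<alpha> [] [Neg] w) =
    cls S \<alpha> [] [Pos, Neg] (v * cren (shift 0 (Suc 0)) w)"
  unfolding tens_A_def using cob.tensm_C[of v S "[]" "[Pos]" w "[]" "[Neg]" \<alpha>] assms
  by (simp add: boundary_simps bilin_juxtapose)

lemma pairing_A_cls:
  assumes "v \<in> hv S" "w \<in> dcombs False S {} {T0}"
  shows "pairing_A S \<alpha> (cls S \<alpha> [] [Neg] w) (cls S \<alpha> [] [Pos] v) = pr \<alpha> (cren (shift 0 (Suc 0)) w) v"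
  unfolding pairing_A_def tens_A_cls[OF assms]
  by (simp add: circular_closure_cls[OF hv_hw[OF assms(1) shift1[OF assms(2)]]]
      tr_rank1[OF assms(1) shift1[OF assms(2)]])

lemma lincomb_cls:
  "length cs = length zs \<Longrightarrow> lincomb (cat S \<alpha>) a b cs (map (cls S \<alpha> a b) zs) =
    cls S \<alpha> a b (\<Sum>i<length zs. scale (cs ! i) (zs ! i))"
proof (induct cs zs rule: list_induct2)
  case Nil
  then show ?case by (simp add: lincomb_def cob.zerom_C)
next
  case (Cons r cs z zs)
  then show ?case
    by (simp add: lincomb_def cob.scalm_C cob.plusm_C sum.lessThan_Suc_shift del: sum.lessThan_Suc)
qed

subsection \<open>Dual bases\<close>

definition biorth :: "'s set \<Rightarrow> ('s, 'k::field) evaluation \<Rightarrow> nat \<Rightarrow> (nat \<Rightarrow> ('s, 'k) comb) \<Rightarrow> (nat \<Rightarrow> ('s, 'k) comb) \<Rightarrow> bool"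
  where "biorth S \<alpha> n x y \<longleftrightarrow> (\<forall>i<n. x i \<in> hv S \<and> y i \<in> hw S) \<and>
    (\<forall>i<n. \<forall>j<n. pr \<alpha> (y j) (x i) = (if i = j then 1 else 0))"

lemma vector_space_scale: "vector_space (scale :: 'k::field \<Rightarrow> ('a \<Rightarrow>\<^sub>0 'k) \<Rightarrow> ('a \<Rightarrow>\<^sub>0 'k))"
  by unfold_locales (simp_all add: scale_add scale_left_distrib)

text \<open>An identity matrix of size \<open>n\<close> that factors through dimension
  \<open>m\<close> forces \<open>n\<close> \<le> \<open>m\<close>: the columns of \<open>B\<close>
  give functionals dual to the rows of \<open>A\<close>, so these rows are independent in a space
  spanned by \<open>m\<close> vectors.\<close>

lemma right_inverse_bound:
  fixes A B :: "nat \<Rightarrow> nat \<Rightarrow> 'k::field"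
  assumes AB: "\<And>i j. i < n \<Longrightarrow> j < n \<Longrightarrow> (\<Sum>l<m. A i l * B l j) = (if i = j then 1 else 0)"
  shows "n \<le> m"
proof -
  interpret V: vector_space "scale :: 'k \<Rightarrow> (nat \<Rightarrow>\<^sub>0 'k) \<Rightarrow> (nat \<Rightarrow>\<^sub>0 'k)" by (rule vector_space_scale)
  define a where "a i = (\<Sum>l<m. scale (A i l) (gen l))" for i
  define f where "f j v = (\<Sum>l<m. Poly_Mapping.lookup v l * B l j)" for j and v :: "nat \<Rightarrow>\<^sub>0 'k"
  have f_sum: "f j (sum g X) = (\<Sum>x\<in>X. f j (g x))" for j X and g :: "'z \<Rightarrow> _"
    unfolding f_def lookup_sum sum_distrib_right by (rule sum.swap)
  have f_scale: "f j (scale r v) = r * f j v" for j r v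
    by (simp add: f_def lookup_scale sum_distrib_left mult.assoc)
  have la: "Poly_Mapping.lookup (a i) l = A i l" if "l < m" for i l
    using that by (simp add: a_def lookup_sum lookup_scale lookup_single when_def sum.delta' if_distrib cong: if_cong)
  have fa: "f j (a i) = (if i = j then 1 else 0)" if "i < n" "j < n" for i j
    unfolding f_def using AB[OF that] by (simp add: la)
  have inj: "inj_on a {..<n}"
  proof (rule inj_onI)
    fix i j assume ij: "i \<in> {..<n}" "j \<in> {..<n}" "a i = a j"
    then have "f i (a i) = 1" "f i (a i) = (if j = i then 1 else 0)"
      using fa[of i i] fa[of j i] by simp_all
    then show "i = j" by (auto split: if_splits)
  qed
  have "V.independent (a ` {..<n})"
  proof (rule V.independent_if_scalars_zero)
    fix g x assume z: "(\<Sum>x\<in>a ` {..<n}. scale (g x) x) = 0" and "x \<in> a ` {..<n}"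
    then obtain j where j: "j < n" "x = a j" by auto
    have "0 = f j (\<Sum>x\<in>a ` {..<n}. scale (g x) x)" unfolding z by (simp add: f_def)
    also have "\<dots> = (\<Sum>i<n. g (a i) * f j (a i))"
      unfolding f_sum f_scale by (rule sum.reindex_cong[OF inj]) auto
    also have "\<dots> = g x" using j by (simp add: fa if_distrib cong: if_cong)
    finally show "g x = 0" by simp
  qed simp
  moreover have "a ` {..<n} \<subseteq> V.span (gen ` {..<m})"
    unfolding a_def by (intro image_subsetI V.span_sum V.span_scale V.span_base) auto
  ultimately have "card (a ` {..<n}) \<le> card (gen ` {..<m} :: (nat \<Rightarrow>\<^sub>0 'k) set)"
    using V.independent_span_bound[of "gen ` {..<m}" "a ` {..<n}"] by simp
  also have "\<dots> \<le> m" using card_image_le[of "{..<m}" gen] by simp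
  finally show ?thesis using card_image[OF inj] by simp
qed

text \<open>\<open>mu y v\<close> is closed, so it multiplies \<open>w\<close> by the scalar
  \<open>pr \<alpha> y v\<close>.\<close>

lemma mu_vw:
  assumes "v \<in> hv S" "w \<in> hw S" "y \<in> hw S" "x \<in> hv S"
  shows "pr \<alpha> (mu y (v * w)) x = pr \<alpha> y v * pr \<alpha> w x"
proof -
  have t: "{} \<subseteq> {T0}" "{} \<subseteq> {T1}" by auto
  have c: "mu y v \<in> dcombs False S {} {}" by (rule mu_in[OF t assms(3,1)])
  have e: "mu y (v * w) = mu y v * w" by (rule mu_rank1_right[OF assms(1,2,3) t(1)])
  have "mu y v * w - scale (pr \<alpha> y v) w \<in> null S \<alpha> {} {T1}"
    using closed_scalar[OF assms(2) c, of \<alpha>] by (simp add: pr_def mult.commute)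
  from null_mu_pr(1)[OF this assms(4)] show ?thesis by (simp add: e pr_linear)
qed

text \<open>Finiteness is available for A(+-) only, so the tensors \<open>x i * y i\<close> are
  tested by the functionals taking \<open>z\<close> to
  \<open>pr \<alpha> (mu (y j) z) (x j)\<close>. The values are products of two Kronecker deltas;
  expanding the tensors in a spanning list factors the identity matrix through the length of that
  list.\<close>

lemma biorth_bounded:
  assumes "rational S \<alpha>"
  shows "\<exists>N. \<forall>n x y. biorth S \<alpha> n x y \<longrightarrow> n \<le> N"
proof -
  from assms obtain vs where vs: "set vs \<subseteq> hom (cat S \<alpha>) [] [Pos, Neg]"
    and sp: "\<And>X. X \<in> hom (cat S \<alpha>) [] [Pos, Neg] \<Longrightarrow>
      \<exists>cs. length cs = length vs \<and> X = lincomb (cat S \<alpha>) [] [Pos, Neg] cs vs"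
    unfolding rational_def fin_dim_hom_def by blast
  have "vs \<in> lists (cls S \<alpha> [] [Pos, Neg] ` hA S)"
    using vs by (auto simp: cob.hom_C boundary_simps)
  then obtain zs where zs: "zs \<in> lists (hA S)" "vs = map (cls S \<alpha> [] [Pos, Neg]) zs"
    unfolding lists_image by auto
  have "n \<le> length zs" if B: "biorth S \<alpha> n x y" for n x y
  proof -
    have xy: "x i \<in> hv S" "y i \<in> hw S" if "i < n" for i using B that by (auto simp: biorth_def)
    have "\<exists>cs. length cs = length zs \<and>
        x i * y i - (\<Sum>l<length zs. scale (cs ! l) (zs ! l)) \<in> null S \<alpha> {T0} {T1}" if i: "i < n" for i
    proof -
      have "cls S \<alpha> [] [Pos, Neg] (x i * y i) \<in> hom (cat S \<alpha>) [] [Pos, Neg]"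
        using hv_hw[OF xy[OF i]] by (auto simp: boundary_simps)
      from sp[OF this] obtain cs where "length cs = length zs"
        "cls S \<alpha> [] [Pos, Neg] (x i * y i) = lincomb (cat S \<alpha>) [] [Pos, Neg] cs vs"
        using zs(2) by auto
      then show ?thesis by (auto simp: zs(2) lincomb_cls cob.c_eq_iff boundary_simps)
    qed
    then have "\<forall>i. \<exists>cs. i < n \<longrightarrow> x i * y i - (\<Sum>l<length zs. scale (cs ! l) (zs ! l)) \<in> null S \<alpha> {T0} {T1}"
      by blast
    from choice[OF this]
    obtain cs where cs: "\<And>i. i < n \<Longrightarrow> x i * y i - (\<Sum>l<length zs. scale (cs i ! l) (zs ! l)) \<in> null S \<alpha> {T0} {T1}"
      by blast
    show ?thesis
    proof (rule right_inverse_bound)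
      fix i j assume ij: "i < n" "j < n"
      have t: "{} \<subseteq> {T0}" "{} \<subseteq> {T1}" "{T1} \<subseteq> {T1}" by auto
      have "mu (y j) (x i * y i - (\<Sum>l<length zs. scale (cs i ! l) (zs ! l))) \<in> null S \<alpha> {} {T1}"
        by (rule null_mu2[OF t(1,3) xy(2)[OF ij(2)] cs[OF ij(1)]])
      from null_mu_pr(1)[OF this xy(1)[OF ij(2)]]
      have "(\<Sum>l<length zs. (cs i ! l) * pr \<alpha> (mu (y j) (zs ! l)) (x j)) = pr \<alpha> (mu (y j) (x i * y i)) (x j)"
        by (simp add: mu_diff_right mu_sum_right mu_scale_right pr_linear)
      also have "\<dots> = pr \<alpha> (y j) (x i) * pr \<alpha> (y i) (x j)"
        by (rule mu_vw) (use xy ij in auto)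
      also have "\<dots> = (if i = j then 1 else 0)" using B ij by (auto simp: biorth_def)
      finally show "(\<Sum>l<length zs. (cs i ! l) * pr \<alpha> (mu (y j) (zs ! l)) (x j)) = (if i = j then 1 else 0)" .
    qed
  qed
  then show ?thesis by blast
qed

definition complete :: "'s set \<Rightarrow> ('s, 'k::field) evaluation \<Rightarrow> nat \<Rightarrow> (nat \<Rightarrow> ('s, 'k) comb) \<Rightarrow> (nat \<Rightarrow> ('s, 'k) comb) \<Rightarrow> bool"
  where "complete S \<alpha> n x y \<longleftrightarrow> biorth S \<alpha> n x y \<and>
    (\<forall>v\<in>hv S. v - (\<Sum>i<n. scale (pr \<alpha> (y i) v) (x i)) \<in> null S \<alpha> {T0} {}) \<and>
    (\<forall>w\<in>hw S. w - (\<Sum>i<n. scale (pr \<alpha> w (x i)) (y i)) \<in> null S \<alpha> {} {T1})"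

lemma biorth_sums:
  assumes "biorth S \<alpha> n x y"
  shows "j < n \<Longrightarrow> pr \<alpha> (y j) (\<Sum>i<n. scale (r i) (x i)) = r j"
    and "j < n \<Longrightarrow> pr \<alpha> (\<Sum>i<n. scale (r i) (y i)) (x j) = r j"
    and "(\<Sum>i<n. scale (r i) (x i)) \<in> hv S" and "(\<Sum>i<n. scale (r i) (y i)) \<in> hw S"
proof -
  show "pr \<alpha> (y j) (\<Sum>i<n. scale (r i) (x i)) = r j" if j: "j < n"
  proof -
    have "pr \<alpha> (y j) (\<Sum>i<n. scale (r i) (x i)) = (\<Sum>i<n. if i = j then r i else 0)"
      unfolding pr_linear by (rule sum.cong) (use assms j in \<open>auto simp: biorth_def\<close>)
    then show ?thesis using j by simp
  qed
  show "pr \<alpha> (\<Sum>i<n. scale (r i) (y i)) (x j) = r j" if j: "j < n"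
  proof -
    have "pr \<alpha> (\<Sum>i<n. scale (r i) (y i)) (x j) = (\<Sum>i<n. if i = j then r i else 0)"
      unfolding pr_linear by (rule sum.cong) (use assms j in \<open>auto simp: biorth_def\<close>)
    then show ?thesis using j by simp
  qed
qed (use assms in \<open>auto simp: biorth_def intro!: combs_sum\<close>)

text \<open>A biorthogonal system of maximal size is complete: a vector orthogonal to it that is not null
  would enlarge it.\<close>

lemma complete_exists:
  assumes "rational S \<alpha>"
  shows "\<exists>n x y. complete S \<alpha> n x y"
proof -
  obtain N where N: "\<And>n x y. biorth S \<alpha> n x y \<Longrightarrow> n \<le> N" using biorth_bounded[OF assms] by blast
  let ?P = "\<lambda>n. \<exists>x y. biorth S \<alpha> n x y"
  have "?P 0" by (simp add: biorth_def)
  then obtain n where "?P n" and mx: "\<And>m. ?P m \<Longrightarrow> m \<le> n"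
    using Nat.ex_has_greatest_nat[of ?P 0 N] N by blast
  then obtain x y where B: "biorth S \<alpha> n x y" by blast
  have v: "v - (\<Sum>i<n. scale (pr \<alpha> (y i) v) (x i)) \<in> null S \<alpha> {T0} {}" if "v \<in> hv S" for v
  proof (rule ccontr)
    let ?v = "v - (\<Sum>i<n. scale (pr \<alpha> (y i) v) (x i))"
    have v': "?v \<in> hv S" by (rule combs_diff[OF that biorth_sums(3)[OF B]])
    have vy: "pr \<alpha> (y j) ?v = 0" if "j < n" for j using biorth_sums(1)[OF B that] by (simp add: pr_linear)
    assume "?v \<notin> null S \<alpha> {T0} {}"
    then obtain w where w: "w \<in> hw S" and c: "pr \<alpha> w ?v \<noteq> 0" using null_hvI[OF v'] by blast
    \<comment> \<open>Subtracting the projection makes the new vector orthogonal to all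
      \<open>x i\<close>. It does not change the pairing with \<open>?v\<close>, because
      \<open>?v\<close> is orthogonal to all \<open>y i\<close>; so the factor normalizes that
      pairing to 1.\<close>
    let ?w = "scale (inverse (pr \<alpha> w ?v)) (w - (\<Sum>i<n. scale (pr \<alpha> w (x i)) (y i)))"
    have w': "?w \<in> hw S" by (rule combs_scale[OF combs_diff[OF w biorth_sums(4)[OF B]]])
    have wx: "pr \<alpha> ?w (x j) = 0" if "j < n" for j using biorth_sums(2)[OF B that] by (simp add: pr_linear)
    have "pr \<alpha> (\<Sum>i<n. scale (pr \<alpha> w (x i)) (y i)) ?v = 0"
      unfolding pr_linear(5,7) by (rule sum.neutral) (use vy in auto)
    then have "pr \<alpha> ?w ?v = 1" using c by (simp only: pr_linear(3,5)) simp
    then have "biorth S \<alpha> (Suc n) (x(n := ?v)) (y(n := ?w))"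
      using B v' w' vy wx unfolding biorth_def by (auto simp: less_Suc_eq)
    then show False using mx[of "Suc n"] by auto
  qed
  \<comment> \<open>The statement for A(-) is deduced from the one for A(+): modulo null
    combinations \<open>u\<close> lies in the span of the \<open>x i\<close>, and there the
    corrected functional vanishes.\<close>
  have w: "w - (\<Sum>i<n. scale (pr \<alpha> w (x i)) (y i)) \<in> null S \<alpha> {} {T1}" if "w \<in> hw S" for w :: "('a, 'b) comb"
  proof (rule null_hwI)
    let ?w = "w - (\<Sum>i<n. scale (pr \<alpha> w (x i)) (y i))"
    show w': "?w \<in> hw S" by (rule combs_diff[OF that biorth_sums(4)[OF B]])
    fix u :: "('a, 'b) comb" assume u: "u \<in> hv S"
    have "pr \<alpha> ?w (\<Sum>i<n. scale (pr \<alpha> (y i) u) (x i)) = 0"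
      unfolding pr_linear(6,8) by (rule sum.neutral) (use biorth_sums(2)[OF B] in \<open>auto simp: pr_linear(3)\<close>)
    moreover have "pr \<alpha> ?w (u - (\<Sum>i<n. scale (pr \<alpha> (y i) u) (x i))) = 0"
      by (rule null_mu_pr(2)[OF w' v[OF u]])
    ultimately show "pr \<alpha> ?w u = 0" by (simp only: pr_linear(4)) simp
  qed
  show ?thesis using B v w unfolding complete_def by blast
qed

lemma complete_coords:
  assumes "complete S \<alpha> n x y"
  shows "v \<in> hv S \<Longrightarrow> v - (\<Sum>i<n. scale (r i) (x i)) \<in> null S \<alpha> {T0} {} \<Longrightarrow> j < n \<Longrightarrow> r j = pr \<alpha> (y j) v"
    and "w \<in> hw S \<Longrightarrow> w - (\<Sum>i<n. scale (r i) (y i)) \<in> null S \<alpha> {} {T1} \<Longrightarrow> j < n \<Longrightarrow> r j = pr \<alpha> w (x j)"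
proof -
  have B: "biorth S \<alpha> n x y" using assms by (simp add: complete_def)
  assume j: "j < n"
  then have xy: "x j \<in> hv S" "y j \<in> hw S" using B by (auto simp: biorth_def)
  show "r j = pr \<alpha> (y j) v" if "v - (\<Sum>i<n. scale (r i) (x i)) \<in> null S \<alpha> {T0} {}"
    using null_mu_pr(2)[OF xy(2) that] biorth_sums(1)[OF B j, of r] by (simp add: pr_linear(4))
  show "r j = pr \<alpha> w (x j)" if "w - (\<Sum>i<n. scale (r i) (y i)) \<in> null S \<alpha> {} {T1}"
    using null_mu_pr(1)[OF that xy(1)] biorth_sums(2)[OF B j, of r] by (simp add: pr_linear(3))
qed

lemma hom_basis_iff:
  assumes zs: "\<And>i. i < n \<Longrightarrow> z i \<in> dcombs False S (heads a b) (tails a b)"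
  shows "hom_basis (cat S \<alpha>) a b (map (\<lambda>i. cls S \<alpha> a b (z i)) [0..<n]) \<longleftrightarrow>
    (\<forall>v\<in>dcombs False S (heads a b) (tails a b). \<exists>!cs. length cs = n \<and>
      v - (\<Sum>i<n. scale (cs ! i) (z i)) \<in> null S \<alpha> (heads a b) (tails a b))"
proof -
  have m: "map (\<lambda>i. cls S \<alpha> a b (z i)) [0..<n] = map (cls S \<alpha> a b) (map z [0..<n])" by simp
  have l: "length cs = n \<and> cls S \<alpha> a b v = lincomb (cat S \<alpha>) a b cs (map (\<lambda>i. cls S \<alpha> a b (z i)) [0..<n]) \<longleftrightarrow>
    length cs = n \<and> v - (\<Sum>i<n. scale (cs ! i) (z i)) \<in> null S \<alpha> (heads a b) (tails a b)" for cs v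
  proof (rule conj_cong[OF refl])
    assume len: "length cs = n"
    have "(\<Sum>i<n. scale (cs ! i) (map z [0..<n] ! i)) = (\<Sum>i<n. scale (cs ! i) (z i))"
      by (rule sum.cong) auto
    with len have "lincomb (cat S \<alpha>) a b cs (map (cls S \<alpha> a b) (map z [0..<n])) = cls S \<alpha> a b (\<Sum>i<n. scale (cs ! i) (z i))"
      by (subst lincomb_cls) simp_all
    then show "cls S \<alpha> a b v = lincomb (cat S \<alpha>) a b cs (map (\<lambda>i. cls S \<alpha> a b (z i)) [0..<n]) \<longleftrightarrow>
      v - (\<Sum>i<n. scale (cs ! i) (z i)) \<in> null S \<alpha> (heads a b) (tails a b)"
      unfolding m by (simp only: cob.c_eq_iff)
  qed
  show ?thesis
    unfolding hom_basis_def cob.hom_C ball_simps length_map length_upt minus_nat.diff_0 l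
    using zs by auto
qed

lemma list_ex1I:
  assumes "P (map f [0..<n])" "\<And>cs. length cs = n \<Longrightarrow> P cs \<Longrightarrow> (\<forall>i<n. cs ! i = f i)"
  shows "\<exists>!cs. length cs = n \<and> P cs"
proof (rule ex1I[of _ "map f [0..<n]"])
  show "cs = map f [0..<n]" if "length cs = n \<and> P cs" for cs
    using assms(2)[of cs] that by (intro nth_equalityI) auto
qed (use assms(1) in simp)

lemma null_shift: "z \<in> null S \<alpha> {} {T0} \<Longrightarrow> cren (shift 0 (Suc 0)) z \<in> null S \<alpha> {} {T1}"
  using null_cren[of z S \<alpha> "{}" "{T0}" "shift 0 (Suc 0)"] by simp

lemma null_shift_iff:
  assumes "z \<in> dcombs False S {} {T0}"
  shows "z \<in> null S \<alpha> {} {T0} \<longleftrightarrow> cren (shift 0 (Suc 0)) z \<in> null S \<alpha> {} {T1}"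
proof
  assume "cren (shift 0 (Suc 0)) z \<in> null S \<alpha> {} {T1}"
  then have "cren (\<lambda>_. T0) (cren (shift 0 (Suc 0)) z) \<in> null S \<alpha> {} {T0}"
    using null_cren[of _ S \<alpha> "{}" "{T1}" "\<lambda>_. T0"] by fastforce
  moreover have "cren (\<lambda>_. T0) (cren (shift 0 (Suc 0)) z) = z"
    unfolding cren_cren by (rule cren_cong_id[OF assms]) simp
  ultimately show "z \<in> null S \<alpha> {} {T0}" by simp
qed (rule null_shift)

lemma lin_sum_scale: "lin f (v - (\<Sum>i<n. scale (r i) (z i))) = lin f v - (\<Sum>i<n. scale (r i) (lin f (z i)))"
  by (simp add: lin_diff lin_sum lin_scale)

text \<open>Ensures that the choice in \<open>one_K\<close> does pick dual bases. They come from a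
  complete biorthogonal system, with the second half moved from \<open>T1\<close> back to the
  boundary point \<open>T0\<close> of \<open>[Neg]\<close>.\<close>

lemma dual_bases_exist:
  assumes "rational S \<alpha>"
  shows "\<exists>vs ws. dual_bases S \<alpha> vs ws"
proof -
  obtain n x y where C: "complete S \<alpha> n x y" using complete_exists[OF assms] by blast
  then have B: "biorth S \<alpha> n x y" by (simp add: complete_def)
  have xy: "x i \<in> hv S" "y i \<in> hw S" if "i < n" for i using B that by (auto simp: biorth_def)
  let ?sh = "cren (shift 0 (Suc 0)) :: ('a, 'b) comb \<Rightarrow> ('a, 'b) comb"
  have "\<forall>i. \<exists>w. i < n \<longrightarrow> w \<in> dcombs False S {} {T0} \<and> ?sh w = y i" using unshift1[OF xy(2)] by blast
  from choice[OF this] obtain w where w: "\<And>i. i < n \<Longrightarrow> w i \<in> dcombs False S {} {T0}"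
    and sw: "\<And>i. i < n \<Longrightarrow> ?sh (w i) = y i" by blast
  let ?vs = "map (\<lambda>i. cls S \<alpha> [] [Pos] (x i)) [0..<n]"
  let ?ws = "map (\<lambda>i. cls S \<alpha> [] [Neg] (w i)) [0..<n]"
  have "hom_basis (cat S \<alpha>) [] [Pos] ?vs"
  proof (subst hom_basis_iff, simp add: boundary_simps xy, intro ballI)
    fix v :: "('a, 'b) comb" assume "v \<in> dcombs False S (heads [] [Pos]) (tails [] [Pos])"
    then have v: "v \<in> hv S" by (simp add: boundary_simps)
    show "\<exists>!cs. length cs = n \<and> v - (\<Sum>i<n. scale (cs ! i) (x i)) \<in> null S \<alpha> (heads [] [Pos]) (tails [] [Pos])"
      unfolding boundary_simps
    proof (rule list_ex1I)
      have "(\<Sum>i<n. scale (map (\<lambda>i. pr \<alpha> (y i) v) [0..<n] ! i) (x i)) = (\<Sum>i<n. scale (pr \<alpha> (y i) v) (x i))"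
        by (rule sum.cong) auto
      then show "v - (\<Sum>i<n. scale (map (\<lambda>i. pr \<alpha> (y i) v) [0..<n] ! i) (x i)) \<in> null S \<alpha> {T0} {}"
        using C v by (simp add: complete_def)
    qed (use complete_coords(1)[OF C v] in blast)
  qed
  moreover have "hom_basis (cat S \<alpha>) [] [Neg] ?ws"
  proof (subst hom_basis_iff, simp add: boundary_simps w, intro ballI)
    fix u :: "('a, 'b) comb" assume "u \<in> dcombs False S (heads [] [Neg]) (tails [] [Neg])"
    then have u: "u \<in> dcombs False S {} {T0}" by (simp add: boundary_simps)
    have su: "?sh u \<in> hw S" by (rule shift1[OF u])
    have e: "u - (\<Sum>i<n. scale (cs ! i) (w i)) \<in> null S \<alpha> {} {T0} \<longleftrightarrow>
        ?sh u - (\<Sum>i<n. scale (cs ! i) (y i)) \<in> null S \<alpha> {} {T1}" for cs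
    proof -
      have "u - (\<Sum>i<n. scale (cs ! i) (w i)) \<in> dcombs False S {} {T0}"
        using u w by (intro combs_diff combs_sum combs_scale) auto
      moreover have "?sh (u - (\<Sum>i<n. scale (cs ! i) (w i))) = ?sh u - (\<Sum>i<n. scale (cs ! i) (y i))"
        unfolding lin_sum_scale using sw by simp
      ultimately show ?thesis using null_shift_iff[of "u - (\<Sum>i<n. scale (cs ! i) (w i))" S \<alpha>]
        by (simp only:)
    qed
    show "\<exists>!cs. length cs = n \<and> u - (\<Sum>i<n. scale (cs ! i) (w i)) \<in> null S \<alpha> (heads [] [Neg]) (tails [] [Neg])"
      unfolding boundary_simps e
    proof (rule list_ex1I)
      have "(\<Sum>i<n. scale (map (\<lambda>i. pr \<alpha> (?sh u) (x i)) [0..<n] ! i) (y i)) = (\<Sum>i<n. scale (pr \<alpha> (?sh u) (x i)) (y i))"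
        by (rule sum.cong) auto
      then show "?sh u - (\<Sum>i<n. scale (map (\<lambda>i. pr \<alpha> (?sh u) (x i)) [0..<n] ! i) (y i)) \<in> null S \<alpha> {} {T1}"
        using C su by (simp add: complete_def)
    qed (use complete_coords(2)[OF C su] in blast)
  qed
  moreover have "pairing_A S \<alpha> (?ws ! j) (?vs ! i) = (if i = j then 1 else 0)" if "i < n" "j < n" for i j
    using that pairing_A_cls[OF xy(1) w] sw B by (simp add: biorth_def)
  ultimately have "dual_bases S \<alpha> ?vs ?ws" by (simp add: dual_bases_def)
  then show ?thesis by blast
qed

text \<open>About the bases picked by \<open>SOME\<close> nothing is known except
  \<open>dual_bases\<close>. Pairing an expansion with the dual basis forces its coefficients, so
  arbitrary representatives of the two bases form a complete system.\<close>

lemma dual_bases_complete: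
  assumes D: "dual_bases S \<alpha> vs ws"
  shows "\<exists>n x w. complete S \<alpha> n x (\<lambda>i. cren (shift 0 (Suc 0)) (w i)) \<and>
    (\<forall>i<n. x i \<in> hv S \<and> w i \<in> dcombs False S {} {T0}) \<and>
    vs = map (\<lambda>i. cls S \<alpha> [] [Pos] (x i)) [0..<n] \<and> ws = map (\<lambda>i. cls S \<alpha> [] [Neg] (w i)) [0..<n]"
proof -
  let ?n = "length vs"
  let ?sh = "cren (shift 0 (Suc 0)) :: ('a, 'b) comb \<Rightarrow> ('a, 'b) comb"
  have hv: "hom_basis (cat S \<alpha>) [] [Pos] vs" and hw: "hom_basis (cat S \<alpha>) [] [Neg] ws"
    and l: "length ws = ?n" using D by (auto simp: dual_bases_def)
  have "\<forall>i. \<exists>x. i < ?n \<longrightarrow> x \<in> hv S \<and> vs ! i = cls S \<alpha> [] [Pos] x"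
  proof
    fix i show "\<exists>x. i < ?n \<longrightarrow> x \<in> hv S \<and> vs ! i = cls S \<alpha> [] [Pos] x"
    proof (cases "i < ?n")
      case True
      then have "vs ! i \<in> cls S \<alpha> [] [Pos] ` hv S"
        using hv nth_mem[OF True] by (auto simp: hom_basis_def cob.hom_C boundary_simps)
      then show ?thesis by auto
    qed simp
  qed
  from choice[OF this] obtain x where x: "\<And>i. i < ?n \<Longrightarrow> x i \<in> hv S"
    and vx: "\<And>i. i < ?n \<Longrightarrow> vs ! i = cls S \<alpha> [] [Pos] (x i)" by blast
  have "\<forall>i. \<exists>x. i < ?n \<longrightarrow> x \<in> dcombs False S {} {T0} \<and> ws ! i = cls S \<alpha> [] [Neg] x"
  proof
    fix i show "\<exists>x. i < ?n \<longrightarrow> x \<in> dcombs False S {} {T0} \<and> ws ! i = cls S \<alpha> [] [Neg] x"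
    proof (cases "i < ?n")
      case True
      then have "ws ! i \<in> cls S \<alpha> [] [Neg] ` dcombs False S {} {T0}"
        using hw nth_mem[of i ws] l by (auto simp: hom_basis_def cob.hom_C boundary_simps)
      then show ?thesis by auto
    qed simp
  qed
  from choice[OF this] obtain w where w: "\<And>i. i < ?n \<Longrightarrow> w i \<in> dcombs False S {} {T0}"
    and ww: "\<And>i. i < ?n \<Longrightarrow> ws ! i = cls S \<alpha> [] [Neg] (w i)" by blast
  have vs: "vs = map (\<lambda>i. cls S \<alpha> [] [Pos] (x i)) [0..<?n]" using vx by (intro nth_equalityI) auto
  have ws: "ws = map (\<lambda>i. cls S \<alpha> [] [Neg] (w i)) [0..<?n]" using ww l by (intro nth_equalityI) auto
  have B: "biorth S \<alpha> ?n x (\<lambda>i. ?sh (w i))"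
    unfolding biorth_def using x w shift1 D vx ww
    by (auto simp: dual_bases_def pairing_A_cls)
  have "v - (\<Sum>i<?n. scale (pr \<alpha> (?sh (w i)) v) (x i)) \<in> null S \<alpha> {T0} {}" if v: "v \<in> hv S" for v :: "('a, 'b) comb"
  proof -
    have "\<exists>!cs. length cs = ?n \<and> v - (\<Sum>i<?n. scale (cs ! i) (x i)) \<in> null S \<alpha> (heads [] [Pos]) (tails [] [Pos])"
      using hv[unfolded arg_cong[OF vs, of "hom_basis (cat S \<alpha>) [] [Pos]"]] x v
      by (subst (asm) hom_basis_iff) (auto simp: boundary_simps)
    then obtain cs where cs: "v - (\<Sum>i<?n. scale (cs ! i) (x i)) \<in> null S \<alpha> {T0} {}"
      by (auto simp: boundary_simps)
    have "cs ! j = pr \<alpha> (?sh (w j)) v" if "j < ?n" for j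
      using null_mu_pr(2)[OF shift1[OF w[OF that]] cs] biorth_sums(1)[OF B that, of "(!) cs"]
      by (simp add: pr_linear(4))
    then show ?thesis using cs by simp
  qed
  moreover have "u - (\<Sum>i<?n. scale (pr \<alpha> u (x i)) (?sh (w i))) \<in> null S \<alpha> {} {T1}" if u: "u \<in> hw S" for u :: "('a, 'b) comb"
  proof -
    obtain u' where u': "u' \<in> dcombs False S {} {T0}" "?sh u' = u" using unshift1[OF u] by blast
    have "\<exists>!cs. length cs = ?n \<and> u' - (\<Sum>i<?n. scale (cs ! i) (w i)) \<in> null S \<alpha> (heads [] [Neg]) (tails [] [Neg])"
      using hw[unfolded arg_cong[OF ws, of "hom_basis (cat S \<alpha>) [] [Neg]"]] w u'
      by (subst (asm) hom_basis_iff) (auto simp: boundary_simps)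
    then obtain cs where cs: "u' - (\<Sum>i<?n. scale (cs ! i) (w i)) \<in> null S \<alpha> {} {T0}"
      by (auto simp: boundary_simps)
    have cs': "u - (\<Sum>i<?n. scale (cs ! i) (?sh (w i))) \<in> null S \<alpha> {} {T1}"
      using null_shift[OF cs] u' by (simp add: lin_sum_scale)
    have "cs ! j = pr \<alpha> u (x j)" if "j < ?n" for j
      using null_mu_pr(1)[OF cs' x[OF that]] biorth_sums(2)[OF B that, of "(!) cs"]
      by (simp add: pr_linear(3))
    then show ?thesis using cs' by simp
  qed
  ultimately have "complete S \<alpha> ?n x (\<lambda>i. ?sh (w i))" using B by (simp add: complete_def)
  then show ?thesis using vs ws x w by blast
qed

lemma one_K_complete:
  assumes "rational S \<alpha>"
  shows "\<exists>n x y. complete S \<alpha> n x y \<and> one_K S \<alpha> = cls S \<alpha> [] [Pos, Neg] (unit_arc - (\<Sum>i<n. x i * y i))"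
proof -
  obtain vs ws where e: "(SOME (vs, ws). dual_bases S \<alpha> vs ws) = (vs, ws)" by fastforce
  have "\<exists>p. case_prod (dual_bases S \<alpha>) p" using dual_bases_exist[OF assms] by auto
  from someI_ex[OF this] have D: "dual_bases S \<alpha> vs ws" unfolding e by simp
  from dual_bases_complete[OF D] obtain n x w where
    C: "complete S \<alpha> n x (\<lambda>i. cren (shift 0 (Suc 0)) (w i))"
    and xw: "\<And>i. i < n \<Longrightarrow> x i \<in> hv S \<and> w i \<in> dcombs False S {} {T0}"
    and vs: "vs = map (\<lambda>i. cls S \<alpha> [] [Pos] (x i)) [0..<n]"
    and ws: "ws = map (\<lambda>i. cls S \<alpha> [] [Neg] (w i)) [0..<n]" by blast
  have m: "map2 (tens_A S \<alpha>) vs ws = map (cls S \<alpha> [] [Pos, Neg]) (map (\<lambda>i. x i * cren (shift 0 (Suc 0)) (w i)) [0..<n])"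
    unfolding vs ws using xw by (intro nth_equalityI) (auto simp: tens_A_cls)
  have s: "(\<Sum>i<n. scale (replicate n 1 ! i) (map (\<lambda>i. x i * cren (shift 0 (Suc 0)) (w i)) [0..<n] ! i)) =
    (\<Sum>i<n. x i * cren (shift 0 (Suc 0)) (w i))" by (rule sum.cong) auto
  have "one_K S \<alpha> = plusm (cat S \<alpha>) [] [Pos, Neg] (one_A S \<alpha>) (scalm (cat S \<alpha>) [] [Pos, Neg] (- 1)
    (lincomb (cat S \<alpha>) [] [Pos, Neg] (replicate (length vs) 1) (map2 (tens_A S \<alpha>) vs ws)))"
    unfolding one_K_def e by simp
  also have "lincomb (cat S \<alpha>) [] [Pos, Neg] (replicate (length vs) 1) (map2 (tens_A S \<alpha>) vs ws) =
    cls S \<alpha> [] [Pos, Neg] (\<Sum>i<n. x i * cren (shift 0 (Suc 0)) (w i))"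
    unfolding m by (subst lincomb_cls) (simp_all add: vs s)
  finally have "one_K S \<alpha> = cls S \<alpha> [] [Pos, Neg] (unit_arc - (\<Sum>i<n. x i * cren (shift 0 (Suc 0)) (w i)))"
    by (simp add: one_A_def cob.scalm_C cob.plusm_C scale_minus_one unit_arc_def arc_def)
  then show ?thesis using C by blast
qed

section \<open>The local relations\<close>

text \<open>A copy of \<open>strand_shapes\<close> for arbitrary outer points, because stacking
  passes through diagrams over \<open>point + point\<close>.\<close>

definition shapes :: "('b list \<Rightarrow> ('p, 'b) strand) set" where
  "shapes = {(\<lambda>w. Seg (Some p) w (Some q)) |p q. True} \<union> {\<lambda>w. Circ (cyc w)}"

lemma shapes_Seg: "(\<lambda>w. Seg (Some p) w (Some q)) \<in> shapes"
  and shapes_Circ: "(\<lambda>w. Circ (cyc w)) \<in> shapes"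
  by (auto simp: shapes_def)

lemma shapesE:
  assumes "s \<in> shapes"
  obtains p q where "s = (\<lambda>w. Seg (Some p) w (Some q))" | "s = (\<lambda>w. Circ (cyc w))"
  using assms by (auto simp: shapes_def)

lemma word_exI:
  "s' \<in> shapes \<Longrightarrow> (\<And>w. set w \<subseteq> K \<Longrightarrow> F w = add_mset (s' (u @ w @ v)) D') \<Longrightarrow>
    \<exists>s'\<in>shapes. \<exists>u v D'. \<forall>w. set w \<subseteq> K \<longrightarrow> F w = add_mset (s' (u @ w @ v)) D'"
  by blast

text \<open>The generators of \<open>fb_rels\<close> over any type of points and any set of
  diagrams, so that they can be followed through renaming, disjoint union and gluing.\<close>

inductive_set frels :: "('b, 'k::field) frobenius \<Rightarrow> ('p, 'b) diagram set \<Rightarrow> (('p, 'b) diagram \<Rightarrow>\<^sub>0 'k) set"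
  for B Q where
  zero: "0 \<in> frels B Q"
| plus: "x \<in> frels B Q \<Longrightarrow> y \<in> frels B Q \<Longrightarrow> x + y \<in> frels B Q"
| scal: "x \<in> frels B Q \<Longrightarrow> scale c x \<in> frels B Q"
| label_plus: "s \<in> shapes \<Longrightarrow> x \<in> carr B \<Longrightarrow> y \<in> carr B \<Longrightarrow> add_mset (s (u @ [x] @ v)) D \<in> Q \<Longrightarrow>
     gen (add_mset (s (u @ [fplus B x y] @ v)) D)
       - (gen (add_mset (s (u @ [x] @ v)) D) + gen (add_mset (s (u @ [y] @ v)) D)) \<in> frels B Q"
| label_scal: "s \<in> shapes \<Longrightarrow> x \<in> carr B \<Longrightarrow> add_mset (s (u @ [x] @ v)) D \<in> Q \<Longrightarrow>
     gen (add_mset (s (u @ [fscal B c x] @ v)) D) - scale c (gen (add_mset (s (u @ [x] @ v)) D)) \<in> frels B Q"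
| label_mult: "s \<in> shapes \<Longrightarrow> add_mset (s (u @ [x, y] @ v)) D \<in> Q \<Longrightarrow>
     gen (add_mset (s (u @ [x, y] @ v)) D) - gen (add_mset (s (u @ [fmult B x y] @ v)) D) \<in> frels B Q"
| label_one: "s \<in> shapes \<Longrightarrow> add_mset (s (u @ v)) D \<in> Q \<Longrightarrow>
     gen (add_mset (s (u @ [fone B] @ v)) D) - gen (add_mset (s (u @ v)) D) \<in> frels B Q"
| circle: "add_mset (Circ (cyc [x])) D \<in> Q \<Longrightarrow>
     gen (add_mset (Circ (cyc [x])) D) - scale (ftrace B x) (gen D) \<in> frels B Q"

lemma fb_rels_eq: "fb_rels B a b = frels B (cobs_no_inner (carr B) a b)"
proof -
  have s: "strand_shapes = shapes" by (simp add: strand_shapes_def shapes_def)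
  show ?thesis
  proof (intro set_eqI iffI)
    fix x assume "x \<in> fb_rels B a b"
    then show "x \<in> frels B (cobs_no_inner (carr B) a b)"
      by (induct rule: fb_rels.induct) (auto simp: s intro: frels.intros[simplified])
  next
    fix x assume "x \<in> frels B (cobs_no_inner (carr B) a b)"
    then show "x \<in> fb_rels B a b"
      by (induct rule: frels.induct) (auto simp: s intro: fb_rels.intros[simplified])
  qed
qed

lemma frels_uminus: "x \<in> frels B Q \<Longrightarrow> - x \<in> frels B Q"
  using frels.scal[of x B Q "- 1"] by (simp add: scale_minus_one)

lemma frels_diff: "x \<in> frels B Q \<Longrightarrow> y \<in> frels B Q \<Longrightarrow> x - y \<in> frels B Q"
  by (metis frels.plus frels_uminus uminus_add_conv_diff add.commute)

text \<open>A map of diagrams preserves the relations if it is uniform in the word of each component.\<close>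

definition uniform :: "'b set \<Rightarrow> ('p, 'b) diagram set \<Rightarrow> ('q, 'b) diagram set \<Rightarrow> (('p, 'b) diagram \<Rightarrow> ('q, 'b) diagram) \<Rightarrow> bool"
  where "uniform K Q Q' g \<longleftrightarrow>
    (\<forall>s\<in>shapes. \<forall>w D. add_mset (s w) D \<in> Q \<longrightarrow>
      (\<exists>s'\<in>shapes. \<exists>u v D'. \<forall>w'. set w' \<subseteq> K \<longrightarrow> g (add_mset (s w') D) = add_mset (s' (u @ w' @ v)) D' \<and>
          add_mset (s' (u @ w' @ v)) D' \<in> Q')) \<and>
    (\<forall>x D. add_mset (Circ (cyc [x])) D \<in> Q \<longrightarrow>
      g (add_mset (Circ (cyc [x])) D) = add_mset (Circ (cyc [x])) (g D) \<and> add_mset (Circ (cyc [x])) (g D) \<in> Q')"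

text \<open>Guarantees that replacing labels by sums, multiples, products or the unit stays within
  diagrams labelled by the carrier.\<close>

definition frob_closed :: "('b, 'k) frobenius \<Rightarrow> bool" where
  "frob_closed B \<longleftrightarrow> fone B \<in> carr B \<and> (\<forall>x\<in>carr B. \<forall>c. fscal B c x \<in> carr B) \<and>
     (\<forall>x\<in>carr B. \<forall>y\<in>carr B. fplus B x y \<in> carr B \<and> fmult B x y \<in> carr B)"

lemma shape_letters: "s \<in> shapes \<Longrightarrow> letters (s w) = set w"
  by (auto simp: shapes_def)

text \<open>A relation compares diagrams that differ in the word of one component. A uniform map
  sends them to diagrams differing in the same way, with the words \<open>u'\<close> and
  \<open>v'\<close> added around; so the image is a relation of the same kind with longer fixed
  parts.\<close>

lemma frels_uniform:
  assumes x: "x \<in> frels B Q" and u: "uniform (carr B) Q Q' g" and c: "frob_closed B"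
    and Q: "\<And>D s. D \<in> Q \<Longrightarrow> s \<in># D \<Longrightarrow> letters s \<subseteq> carr B"
  shows "lin g x \<in> frels B Q'"
  using x
proof (induct rule: frels.induct)
  case zero
  then show ?case by (simp add: frels.zero)
next
  case (plus x y)
  then show ?case by (simp add: lin_add frels.plus)
next
  case (scal x r)
  then show ?case by (simp add: lin_scale frels.scal)
next
  case (label_plus s x y u v D)
  from u label_plus(1,4) obtain s' u' v' D' where s': "s' \<in> shapes"
    and g: "\<And>w'. set w' \<subseteq> carr B \<Longrightarrow> g (add_mset (s w') D) = add_mset (s' (u' @ w' @ v')) D' \<and>
       add_mset (s' (u' @ w' @ v')) D' \<in> Q'" unfolding uniform_def by blast
  have l: "set u \<subseteq> carr B" "set v \<subseteq> carr B" using Q[OF label_plus(4), of "s (u @ [x] @ v)"] label_plus(1) by (auto simp: shape_letters)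
  have l': "fplus B x y \<in> carr B" using c label_plus by (simp add: frob_closed_def)
  show ?case
    using frels.label_plus[OF s' label_plus(2,3), of "u' @ u" "v @ v'" D' Q'] g[of "u @ [x] @ v"] g[of "u @ [y] @ v"]
      g[of "u @ [fplus B x y] @ v"] l l' label_plus(2,3) by (simp add: lin_add lin_diff)
next
  case (label_scal s x u v D r)
  from u label_scal(1,3) obtain s' u' v' D' where s': "s' \<in> shapes"
    and g: "\<And>w'. set w' \<subseteq> carr B \<Longrightarrow> g (add_mset (s w') D) = add_mset (s' (u' @ w' @ v')) D' \<and>
       add_mset (s' (u' @ w' @ v')) D' \<in> Q'" unfolding uniform_def by blast
  have l: "set u \<subseteq> carr B" "set v \<subseteq> carr B" using Q[OF label_scal(3), of "s (u @ [x] @ v)"] label_scal(1) by (auto simp: shape_letters)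
  have l': "fscal B r x \<in> carr B" using c label_scal by (simp add: frob_closed_def)
  show ?case
    using frels.label_scal[OF s' label_scal(2), of "u' @ u" "v @ v'" D' Q'] g[of "u @ [x] @ v"]
      g[of "u @ [fscal B r x] @ v"] l l' label_scal(2) by (simp add: lin_scale lin_diff)
next
  case (label_mult s u x y v D)
  from u label_mult(1,2) obtain s' u' v' D' where s': "s' \<in> shapes"
    and g: "\<And>w'. set w' \<subseteq> carr B \<Longrightarrow> g (add_mset (s w') D) = add_mset (s' (u' @ w' @ v')) D' \<and>
       add_mset (s' (u' @ w' @ v')) D' \<in> Q'" unfolding uniform_def by blast
  have l: "set u \<subseteq> carr B" "set v \<subseteq> carr B" "x \<in> carr B" "y \<in> carr B"
    using Q[OF label_mult(2), of "s (u @ [x, y] @ v)"] label_mult(1) by (auto simp: shape_letters)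
  have l': "fmult B x y \<in> carr B" using c l by (simp add: frob_closed_def)
  show ?case
    using frels.label_mult[OF s', where u = "u' @ u" and x = x and y = y and v = "v @ v'" and D = D' and Q = Q' and B = B] g[of "u @ [x, y] @ v"]
      g[of "u @ [fmult B x y] @ v"] l l' by (simp add: lin_diff)
next
  case (label_one s u v D)
  from u label_one(1,2) obtain s' u' v' D' where s': "s' \<in> shapes"
    and g: "\<And>w'. set w' \<subseteq> carr B \<Longrightarrow> g (add_mset (s w') D) = add_mset (s' (u' @ w' @ v')) D' \<and>
       add_mset (s' (u' @ w' @ v')) D' \<in> Q'" unfolding uniform_def by blast
  have l: "set u \<subseteq> carr B" "set v \<subseteq> carr B" "fone B \<in> carr B"
    using Q[OF label_one(2), of "s (u @ v)"] label_one(1) c by (auto simp: shape_letters frob_closed_def)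
  show ?case
    using frels.label_one[OF s', where u = "u' @ u" and v = "v @ v'" and D = D' and Q = Q' and B = B] g[of "u @ v"]
      g[of "u @ [fone B] @ v"] l by (simp add: lin_diff)
next
  case (circle x D)
  then have "g (add_mset (Circ (cyc [x])) D) = add_mset (Circ (cyc [x])) (g D)"
    "add_mset (Circ (cyc [x])) (g D) \<in> Q'" using u unfolding uniform_def by blast+
  then show ?case using frels.circle[where x = x and D = "g D" and Q = Q' and B = B] by (simp add: lin_diff lin_scale)
qed

lemma dgs_letters: "D \<in> dgs b K H T \<Longrightarrow> s \<in># D \<Longrightarrow> letters s \<subseteq> K"
  by (auto simp: dgs_def)

lemma shape_ends:
  assumes "s \<in> shapes"
  shows "head_end (s w) = head_end (s w')" "tail_end (s w) = tail_end (s w')" "no_inner (s w)"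
  using assms by (auto simp: shapes_def)

lemma dgs_shape_word:
  assumes "s \<in> shapes" "add_mset (s w) D \<in> dgs b K H T" "set w' \<subseteq> K"
  shows "add_mset (s w') D \<in> dgs b K H T"
  using assms shape_ends(1,2)[OF assms(1), of w w'] shape_ends(3)[OF assms(1), of w'] by (simp add: dgs_add shape_letters)

lemma uniform_plus:
  assumes E: "E \<in> dgs True K H' T'" and d: "(H \<union> T) \<inter> (H' \<union> T') = {}"
  shows "uniform K (dgs True K H T) (dgs True K (H \<union> H') (T \<union> T')) (\<lambda>D. D + E)"
  unfolding uniform_def
proof (intro conjI ballI allI impI)
  fix s w D assume s: "s \<in> shapes" and D: "add_mset (s w) D \<in> dgs True K H T"
  have "add_mset (s w') D + E = add_mset (s ([] @ w' @ [])) (D + E) \<and>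
     add_mset (s ([] @ w' @ [])) (D + E) \<in> dgs True K (H \<union> H') (T \<union> T')" if "set w' \<subseteq> K" for w'
    using dgs_plus[OF dgs_shape_word[OF s D that] E d] by simp
  with s show "\<exists>s'\<in>shapes. \<exists>u v D'. \<forall>w'. set w' \<subseteq> K \<longrightarrow> add_mset (s w') D + E = add_mset (s' (u @ w' @ v)) D' \<and>
     add_mset (s' (u @ w' @ v)) D' \<in> dgs True K (H \<union> H') (T \<union> T')" by blast
next
  fix x D assume D: "add_mset (Circ (cyc [x])) D \<in> dgs True K H T"
  show "add_mset (Circ (cyc [x])) D + E = add_mset (Circ (cyc [x])) (D + E)" by simp
  show "add_mset (Circ (cyc [x])) (D + E) \<in> dgs True K (H \<union> H') (T \<union> T')"
    using dgs_plus[OF D E d] by simp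
qed

lemma uniform_rename:
  assumes i: "inj_on f (H \<union> T)"
  shows "uniform K (dgs True K H T) (dgs True K (f ` H) (f ` T)) (rename f)"
  unfolding uniform_def
proof (intro conjI ballI allI impI)
  fix s w D assume s: "s \<in> shapes" and D: "add_mset (s w) D \<in> dgs True K H T"
  have "(\<lambda>w. rename_strand f (s w)) \<in> shapes"
    using s by (rule shapesE) (simp_all add: shapes_Seg shapes_Circ)
  moreover have "rename f (add_mset (s w') D) = add_mset (rename_strand f (s ([] @ w' @ []))) (rename f D)" for w'
    by simp
  ultimately have "\<exists>s'\<in>shapes. \<exists>u v D'. \<forall>w'. set w' \<subseteq> K \<longrightarrow> rename f (add_mset (s w') D) = add_mset (s' (u @ w' @ v)) D'"
    by (rule word_exI)
  then show "\<exists>s'\<in>shapes. \<exists>u v D'. \<forall>w'. set w' \<subseteq> K \<longrightarrow> rename f (add_mset (s w') D) = add_mset (s' (u @ w' @ v)) D' \<and>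
     add_mset (s' (u @ w' @ v)) D' \<in> dgs True K (f ` H) (f ` T)"
    using dgs_rename[OF dgs_shape_word[OF s D] i] by metis
next
  fix x D assume D: "add_mset (Circ (cyc [x])) D \<in> dgs True K H T"
  show "rename f (add_mset (Circ (cyc [x])) D) = add_mset (Circ (cyc [x])) (rename f D)" by simp
  show "add_mset (Circ (cyc [x])) (rename f D) \<in> dgs True K (f ` H) (f ` T)"
    using dgs_rename[OF D i] by simp
qed

lemma glue_add_other:
  assumes "add_mset c D \<in> dgs b K H T" "h \<in> H - set_mset (head_end c)" "t \<in> T - set_mset (tail_end c)"
  shows "glue h t (add_mset c D) = add_mset c (glue h t D)"
proof -
  have D: "D \<in> dgs b K (H - set_mset (head_end c)) (T - set_mset (tail_end c))"
    using assms(1) by (simp add: dgs_add)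
  have "glue h t (D + {#c#}) = glue h t D + {#c#}"
    by (rule glue_plus[OF D]) (use assms in \<open>auto simp: opp_def\<close>)
  then show ?thesis by simp
qed

text \<open>The distinguished component may have both glued points and become a circle, have one of
  them and be prolonged by the word of another component, or have neither. In each case its word
  enters the result between a fixed prefix and a fixed suffix.\<close>

lemma uniform_glue1:
  assumes h: "h \<in> H" and t: "t \<in> T"
  shows "uniform K (dgs True K H T) (dgs True K (H - {h}) (T - {t})) (glue h t)"
  unfolding uniform_def
proof (intro conjI ballI allI impI)
  fix s w D assume s: "s \<in> shapes" and D: "add_mset (s w) D \<in> dgs True K H T"
  note sw = dgs_shape_word[OF s D]
  have "\<exists>s'\<in>shapes. \<exists>u v D'. \<forall>w'. set w' \<subseteq> K \<longrightarrow> glue h t (add_mset (s w') D) = add_mset (s' (u @ w' @ v)) D'"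
  proof (cases "h \<in># head_end (s w)"; cases "t \<in># tail_end (s w)")
    assume "h \<in># head_end (s w)" "t \<in># tail_end (s w)"
    then have "s = (\<lambda>w. Seg (Some h) w (Some t))" using s by (auto simp: shapes_def)
    then have "glue h t (add_mset (s w') D) = add_mset ((\<lambda>w. Circ (cyc w)) ([] @ w' @ [])) D" if "set w' \<subseteq> K" for w'
      using glue_circ[OF sw[OF that]] by simp
    then show ?thesis by (rule word_exI[OF shapes_Circ])
  next
    assume a: "h \<in># head_end (s w)" "t \<notin># tail_end (s w)"
    then obtain q where q: "s = (\<lambda>w. Seg (Some h) w (Some q))" using s by (auto simp: shapes_def)
    have d: "D \<in> dgs True K (H - {h}) (T - {q})" and tq: "t \<in> T - {q}" using D a q t by (auto simp: dgs_add)
    obtain r v D0 where D0: "D = add_mset (Seg r v (Some t)) D0" using dgs_tailE[OF d tq] by blast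
    then obtain r' where r': "r = Some r'" using d by (auto simp: dgs_add)
    have "glue h t (add_mset (s w') D) = add_mset ((\<lambda>w. Seg (Some r') w (Some q)) (v @ w' @ [])) D0" if "set w' \<subseteq> K" for w'
      using glue_join[OF sw[OF that], of r v t h w' "Some q" D0] by (simp add: q D0 r' add_mset_commute)
    then show ?thesis by (rule word_exI[OF shapes_Seg])
  next
    assume a: "h \<notin># head_end (s w)" "t \<in># tail_end (s w)"
    then obtain p where p: "s = (\<lambda>w. Seg (Some p) w (Some t))" using s by (auto simp: shapes_def)
    have d: "D \<in> dgs True K (H - {p}) (T - {t})" and hp: "h \<in> H - {p}" using D a p h by (auto simp: dgs_add)
    obtain r v D0 where D0: "D = add_mset (Seg (Some h) v r) D0" using dgs_headE[OF d hp] by blast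
    then obtain r' where r': "r = Some r'" using d by (auto simp: dgs_add)
    have "glue h t (add_mset (s w') D) = add_mset ((\<lambda>w. Seg (Some p) w (Some r')) ([] @ w' @ v)) D0" if "set w' \<subseteq> K" for w'
      using glue_join[OF sw[OF that], of "Some p" w' t h v r D0] by (simp add: p D0 r')
    then show ?thesis by (rule word_exI[OF shapes_Seg])
  next
    assume a: "h \<notin># head_end (s w)" "t \<notin># tail_end (s w)"
    have "glue h t (add_mset (s w') D) = add_mset (s ([] @ w' @ [])) (glue h t D)" if "set w' \<subseteq> K" for w'
      using glue_add_other[OF sw[OF that], of h t] h t a shape_ends(1,2)[OF s, of w w'] by simp
    then show ?thesis by (rule word_exI[OF s])
  qed
  then show "\<exists>s'\<in>shapes. \<exists>u v D'. \<forall>w'. set w' \<subseteq> K \<longrightarrow> glue h t (add_mset (s w') D) = add_mset (s' (u @ w' @ v)) D' \<and>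
     add_mset (s' (u @ w' @ v)) D' \<in> dgs True K (H - {h}) (T - {t})"
    using glue_dgs1[OF sw h t] by metis
next
  fix x D assume D: "add_mset (Circ (cyc [x])) D \<in> dgs True K H T"
  show e: "glue h t (add_mset (Circ (cyc [x])) D) = add_mset (Circ (cyc [x])) (glue h t D)"
    by (rule glue_add_other[OF D]) (use h t in auto)
  show "add_mset (Circ (cyc [x])) (glue h t D) \<in> dgs True K (H - {h}) (T - {t})"
    using glue_dgs1[OF D h t] by (simp add: e)
qed

section \<open>The span of the local relations is an ideal\<close>

context
  fixes B :: "('b, 'k::field) frobenius"
  assumes closed: "frob_closed B"
begin

abbreviation fr :: "'p set \<Rightarrow> 'p set \<Rightarrow> (('p, 'b) diagram \<Rightarrow>\<^sub>0 'k) set"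
  where "fr H T \<equiv> frels B (dgs True (carr B) H T)"

lemma frels_cren: "x \<in> fr H T \<Longrightarrow> inj_on f (H \<union> T) \<Longrightarrow> cren f x \<in> fr (f ` H) (f ` T)"
  by (rule frels_uniform[OF _ uniform_rename closed dgs_letters])

lemma frels_cglue1: "x \<in> fr H T \<Longrightarrow> h \<in> H \<Longrightarrow> t \<in> T \<Longrightarrow> cglue h t x \<in> fr (H - {h}) (T - {t})"
  by (rule frels_uniform[OF _ uniform_glue1 closed dgs_letters])

lemma frels_cglue:
  assumes x: "x \<in> fr H T" and o: "opp H T p q" and d: "H \<inter> T = {}"
  shows "cglue p q x \<in> fr (H - {p, q}) (T - {p, q})"
proof -
  have *: "cglue h t x \<in> fr (H - {h, t}) (T - {h, t})" if "h \<in> H" "t \<in> T" for h t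
  proof -
    have "H - {h, t} = H - {h}" "T - {h, t} = T - {t}" using that d by auto
    then show ?thesis using frels_cglue1[OF x that] by (simp only:)
  qed
  from o *[of p q] *[of q p] show ?thesis
    by (auto simp: opp_def cglue_sym[of q p] insert_commute)
qed

lemma frels_cglues: "x \<in> fr H T \<Longrightarrow> okp H T ps \<Longrightarrow> cglues ps x \<in> fr (H - pts ps) (T - pts ps)"
proof (induct ps arbitrary: x H T)
  case (Cons u ps)
  obtain p q where u: "u = (p, q)" by (cases u)
  have e: "A - ({p, q} \<union> pts ps) = A - {p, q} - pts ps" for A by auto
  have "cglue p q x \<in> fr (H - {p, q}) (T - {p, q})"
    by (rule frels_cglue[OF Cons(2)]) (use Cons(3) u in \<open>auto simp: okp_Cons\<close>)
  from Cons(1)[OF this] show ?case using Cons(3)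
    unfolding u cglues_Cons okp_Cons pts_Cons e by blast
qed simp

lemma frels_mult:
  assumes x: "x \<in> fr H T" and y: "y \<in> dcombs True (carr B) H' T'" and d: "(H \<union> T) \<inter> (H' \<union> T') = {}"
  shows "x * y \<in> fr (H \<union> H') (T \<union> T')"
  using y
proof (induct rule: comb_induct)
  case (gen E)
  have "lin (\<lambda>D. D + E) x \<in> fr (H \<union> H') (T \<union> T')"
    by (rule frels_uniform[OF x uniform_plus[OF gen d] closed dgs_letters])
  moreover have "lin (\<lambda>D. D + E) x = x * gen E"
    using combs_UNIV[of x]
    by (induct rule: comb_induct) (auto simp: gen_mult_gen lin_add lin_scale distrib_right scale_mult_left simp del: mult_single)
  ultimately show ?case by simp
qed (auto simp: distrib_left scale_mult_right frels.intros)

lemma frels_in: "x \<in> fr H T \<Longrightarrow> x \<in> dcombs True (carr B) H T"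
proof (induct rule: frels.induct)
  case (label_plus s x y u v D)
  have l: "set u \<subseteq> carr B" "set v \<subseteq> carr B"
    using dgs_letters[OF label_plus(4), of "s (u @ [x] @ v)"] label_plus(1) by (auto simp: shape_letters)
  then show ?case using label_plus closed dgs_shape_word[OF label_plus(1,4)]
    by (auto simp: frob_closed_def intro!: combs_diff combs_add)
next
  case (label_scal s x u v D r)
  have l: "set u \<subseteq> carr B" "set v \<subseteq> carr B"
    using dgs_letters[OF label_scal(3), of "s (u @ [x] @ v)"] label_scal(1) by (auto simp: shape_letters)
  then show ?case using label_scal closed dgs_shape_word[OF label_scal(1,3)]
    by (auto simp: frob_closed_def intro!: combs_diff combs_scale)
next
  case (label_mult s u x y v D)
  have l: "set u \<subseteq> carr B" "set v \<subseteq> carr B" "x \<in> carr B" "y \<in> carr B"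
    using dgs_letters[OF label_mult(2), of "s (u @ [x, y] @ v)"] label_mult(1) by (auto simp: shape_letters)
  then show ?case using label_mult closed dgs_shape_word[OF label_mult(1,2)]
    by (auto simp: frob_closed_def intro!: combs_diff combs_scale)
next
  case (label_one s u v D)
  have l: "set u \<subseteq> carr B" "set v \<subseteq> carr B"
    using dgs_letters[OF label_one(2), of "s (u @ v)"] label_one(1) by (auto simp: shape_letters)
  then show ?case using label_one closed dgs_shape_word[OF label_one(1,2)]
    by (auto simp: frob_closed_def intro!: combs_diff combs_scale)
next
  case (circle x D)
  then have "D \<in> dgs True (carr B) H T" by (simp add: dgs_add)
  then show ?case using circle by (auto intro!: combs_diff combs_scale)
qed auto

lemma frels_mult_right:
  assumes "x \<in> fr H T" "y \<in> dcombs True (carr B) H' T'" "(H \<union> T) \<inter> (H' \<union> T') = {}"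
  shows "y * x \<in> fr (H' \<union> H) (T' \<union> T)"
  using frels_mult[OF assms] by (simp add: mult.commute Un_commute)

lemma frels_stack1:
  assumes "x \<in> fr (heads a b) (tails a b)" "y \<in> dcombs True (carr B) (heads b c) (tails b c)"
  shows "bilin (stack (length b)) y x \<in> fr (heads a c) (tails a c)"
proof -
  have "cren Inl x * cren Inr y \<in> fr (sH a b c) (sT a b c)"
    by (rule frels_mult[OF frels_cren[OF assms(1)] cren_in[OF assms(2)]]) auto
  from frels_cren[OF frels_cglues[OF this okp_stk] stk_both(1)] show ?thesis
    unfolding bilin_stack by (simp only: stk_both)
qed

lemma frels_stack2:
  assumes "x \<in> dcombs True (carr B) (heads a b) (tails a b)" "y \<in> fr (heads b c) (tails b c)"
  shows "bilin (stack (length b)) y x \<in> fr (heads a c) (tails a c)"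
proof -
  have "cren Inl x * cren Inr y \<in> fr (sH a b c) (sT a b c)"
    by (rule frels_mult_right[OF frels_cren[OF assms(2)] cren_in[OF assms(1)]]) auto
  from frels_cren[OF frels_cglues[OF this okp_stk] stk_both(1)] show ?thesis
    unfolding bilin_stack by (simp only: stk_both)
qed

lemma frels_juxtapose1:
  assumes "x \<in> fr (heads a c) (tails a c)" "y \<in> dcombs True (carr B) (heads b d) (tails b d)"
  shows "bilin (juxtapose (length a) (length c)) x y \<in> fr (heads (a @ b) (c @ d)) (tails (a @ b) (c @ d))"
  unfolding bilin_juxtapose shift_image
  by (rule frels_mult[OF assms(1) cren_in[OF assms(2)] shift_disjoint]) simp

lemma frels_juxtapose2:
  assumes "x \<in> dcombs True (carr B) (heads a c) (tails a c)" "y \<in> fr (heads b d) (tails b d)"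
  shows "bilin (juxtapose (length a) (length c)) x y \<in> fr (heads (a @ b) (c @ d)) (tails (a @ b) (c @ d))"
  unfolding bilin_juxtapose shift_image
proof (rule frels_mult_right[OF frels_cren[OF assms(2)] assms(1)])
  show "(shift (length a) (length c) ` heads b d \<union> shift (length a) (length c) ` tails b d) \<inter>
    (heads a c \<union> tails a c) = {}"
    using shift_disjoint[of a c "heads b d" "tails b d"] by (simp only: Int_commute)
qed simp

lemma frels_closure: "x \<in> fr (heads a a) (tails a a) \<Longrightarrow> lin (diagram_closure (length a)) x \<in> fr {} {}"
  using frels_cglues[OF _ okp_clo] by (simp add: diagram_closure_eq pts_clo)

lemma fb_quotient:
  "linear_quotient (\<lambda>a b. hdgs True (carr B) a b) (\<lambda>a b. fr (heads a b) (tails a b))"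
  "linear_quotient.C (\<lambda>a b. hdgs True (carr B) a b) (\<lambda>a b. fr (heads a b) (tails a b)) = fb_cat B"
  "linear_quotient.c (\<lambda>a b. hdgs True (carr B) a b) (\<lambda>a b. fr (heads a b) (tails a b)) = fb_cls B"
proof -
  show q: "linear_quotient (\<lambda>a b. hdgs True (carr B) a b) (\<lambda>a b. fr (heads a b) (tails a b))"
    by unfold_locales
      (auto simp: frels_in stack_dgs juxtapose_dgs id_diagram_in swap_diagram_in frels.intros
        frels_stack1 frels_stack2 frels_juxtapose1 frels_juxtapose2)
  have "fb_rels B = (\<lambda>a b. fr (heads a b) (tails a b))"
    "cobs_no_inner (carr B) = (\<lambda>a b. hdgs True (carr B) a b)"
    by (intro HOL.ext; simp add: fb_rels_eq cobs_no_inner_eq)+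
  then show "linear_quotient.C (\<lambda>a b. hdgs True (carr B) a b) (\<lambda>a b. fr (heads a b) (tails a b)) = fb_cat B"
    "linear_quotient.c (\<lambda>a b. hdgs True (carr B) a b) (\<lambda>a b. fr (heads a b) (tails a b)) = fb_cls B"
    by (simp_all add: linear_quotient.C_def[OF q] linear_quotient.c_def[OF q] fb_cat_def fb_cls_def fb_free_cat_def)
qed

end

section \<open>From labelled diagrams to decorated diagrams\<close>

definition ceq :: "'s set \<Rightarrow> ('s, 'k::field) evaluation \<Rightarrow> 'p set \<Rightarrow> 'p set \<Rightarrow> (('p, 's) diagram \<Rightarrow>\<^sub>0 'k) \<Rightarrow> (('p, 's) diagram \<Rightarrow>\<^sub>0 'k) \<Rightarrow> bool"
  where "ceq S \<alpha> H T x y \<longleftrightarrow> x - y \<in> null S \<alpha> H T"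

lemma ceq_refl [simp]: "ceq S \<alpha> H T x x"
  by (simp add: ceq_def)

lemma ceq_sym: "ceq S \<alpha> H T x y \<Longrightarrow> ceq S \<alpha> H T y x"
  using null_uminus[of "x - y" S \<alpha> H T] by (simp add: ceq_def)

lemma ceq_trans [trans]: "ceq S \<alpha> H T x y \<Longrightarrow> ceq S \<alpha> H T y z \<Longrightarrow> ceq S \<alpha> H T x z"
  using null_add[of "x - y" S \<alpha> H T "y - z"] by (simp add: ceq_def)

lemma ceq_add: "ceq S \<alpha> H T x y \<Longrightarrow> ceq S \<alpha> H T x' y' \<Longrightarrow> ceq S \<alpha> H T (x + x') (y + y')"
  using null_add[of "x - y" S \<alpha> H T "x' - y'"] by (simp add: ceq_def algebra_simps)

lemma ceq_scale: "ceq S \<alpha> H T x y \<Longrightarrow> ceq S \<alpha> H T (scale r x) (scale r y)"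
  using null_scale[of "x - y" S \<alpha> H T r] by (simp add: ceq_def scale_diff)

lemma ceq_mult1:
  "ceq S \<alpha> H T x y \<Longrightarrow> z \<in> dcombs False S H' T' \<Longrightarrow> (H \<union> T) \<inter> (H' \<union> T') = {} \<Longrightarrow>
    ceq S \<alpha> (H \<union> H') (T \<union> T') (x * z) (y * z)"
  unfolding ceq_def left_diff_distrib[symmetric] by (rule null_mult)

lemma ceq_mult2:
  "ceq S \<alpha> H T x y \<Longrightarrow> z \<in> dcombs False S H' T' \<Longrightarrow> (H \<union> T) \<inter> (H' \<union> T') = {} \<Longrightarrow>
    ceq S \<alpha> (H' \<union> H) (T' \<union> T) (z * x) (z * y)"
  unfolding ceq_def right_diff_distrib[symmetric] by (rule null_mult_right)

lemma ceq_cren: "ceq S \<alpha> H T x y \<Longrightarrow> inj_on f (H \<union> T) \<Longrightarrow> ceq S \<alpha> (f ` H) (f ` T) (cren f x) (cren f y)"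
  unfolding ceq_def lin_diff[symmetric] by (rule null_cren)

lemma ceq_cglues: "ceq S \<alpha> H T x y \<Longrightarrow> okp H T ps \<Longrightarrow> ceq S \<alpha> (H - pts ps) (T - pts ps) (cglues ps x) (cglues ps y)"
  unfolding ceq_def lin_diff[symmetric] by (rule null_cglues)

lemma ceq_mu1: "H \<subseteq> {T0} \<Longrightarrow> T \<subseteq> {T1} \<Longrightarrow> ceq S \<alpha> H {T1} x y \<Longrightarrow> z \<in> dcombs False S {T0} T \<Longrightarrow>
    ceq S \<alpha> H T (mu x z) (mu y z)"
  unfolding ceq_def mu_diff_left[symmetric] by (rule null_mu1)

lemma ceq_mu2: "H \<subseteq> {T0} \<Longrightarrow> T \<subseteq> {T1} \<Longrightarrow> ceq S \<alpha> {T0} T x y \<Longrightarrow> z \<in> dcombs False S H {T1} \<Longrightarrow>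
    ceq S \<alpha> H T (mu z x) (mu z y)"
  unfolding ceq_def mu_diff_right[symmetric] by (rule null_mu2)

lemma ceq_tr: "ceq S \<alpha> {T0} {T1} x y \<Longrightarrow> tr \<alpha> x = tr \<alpha> y"
  unfolding ceq_def by (drule tr_null) (simp add: tr_diff)

lemma ceq_eval: "ceq S \<alpha> {} {} x y \<Longrightarrow> eval_comb \<alpha> x = eval_comb \<alpha> y"
  by (simp add: ceq_def null_closed eval_comb_diff)

lemma cls_eq_ceq: "cls S \<alpha> a b x = cls S \<alpha> a b y \<longleftrightarrow> ceq S \<alpha> (heads a b) (tails a b) x y"
  by (simp add: cob.c_eq_iff ceq_def)

lemma triv: "{T0} \<subseteq> {T0}" "{T1} \<subseteq> {T1}" "{} \<subseteq> {T0}" "{} \<subseteq> {T1}" by auto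

lemmas mu_AA = mu_in[OF triv(1,2)]

section \<open>Representatives of elements of the kernel algebra\<close>

definition Kc :: "'s set \<Rightarrow> ('s, 'k::field) evaluation \<Rightarrow> ('s, 'k) comb set"
  where "Kc S \<alpha> = {x \<in> hA S. \<forall>v\<in>hv S. mu x v \<in> null S \<alpha> {T0} {}}"

lemma Kc_in: "x \<in> Kc S \<alpha> \<Longrightarrow> x \<in> hA S"
  by (simp add: Kc_def)

lemma Kc_add: "x \<in> Kc S \<alpha> \<Longrightarrow> y \<in> Kc S \<alpha> \<Longrightarrow> x + y \<in> Kc S \<alpha>"
  by (auto simp: Kc_def mu_add_left)

lemma Kc_scale: "x \<in> Kc S \<alpha> \<Longrightarrow> scale r x \<in> Kc S \<alpha>"
  by (auto simp: Kc_def mu_scale_left)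

lemma Kc_mu: "x \<in> Kc S \<alpha> \<Longrightarrow> y \<in> hA S \<Longrightarrow> mu x y \<in> Kc S \<alpha>"
  unfolding Kc_def
  by (auto simp: mu_assoc[OF triv(1,4)] mu_in[OF triv(1,4)] mu_AA)

lemma Kc_ceq: "x \<in> Kc S \<alpha> \<Longrightarrow> ceq S \<alpha> {T0} {T1} y x \<Longrightarrow> y \<in> hA S \<Longrightarrow> y \<in> Kc S \<alpha>"
  unfolding Kc_def ceq_def
proof safe
  fix v :: "('a, 'b) comb" assume x: "\<forall>v\<in>hv S. mu x v \<in> null S \<alpha> {T0} {}" and d: "y - x \<in> null S \<alpha> {T0} {T1}" and v: "v \<in> hv S"
  have "mu (y - x) v \<in> null S \<alpha> {T0} {}" by (rule null_mu1[OF triv(1,4) d v])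
  then have "mu x v + mu (y - x) v \<in> null S \<alpha> {T0} {}" using x v by blast
  then show "mu y v \<in> null S \<alpha> {T0} {}" by (simp add: mu_diff_left)
qed

lemma K_carrier_cls: "x \<in> hA S \<Longrightarrow> cls S \<alpha> [] [Pos, Neg] x \<in> K_carrier S \<alpha> \<longleftrightarrow> x \<in> Kc S \<alpha>"
  unfolding K_carrier_def Kc_def state_space_def
  by (auto simp: cob.hom_C boundary_simps act_A_cls cob.zerom_C cob.c_eq_iff)

lemma cls_K: "x \<in> Kc S \<alpha> \<Longrightarrow> cls S \<alpha> [] [Pos, Neg] x \<in> K_carrier S \<alpha>"
  by (simp add: K_carrier_cls Kc_in)

lemma K_carrier_E:
  assumes "X \<in> K_carrier S \<alpha>"
  obtains x where "x \<in> Kc S \<alpha>" "X = cls S \<alpha> [] [Pos, Neg] x"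
proof -
  obtain x where x: "x \<in> hA S" "X = cls S \<alpha> [] [Pos, Neg] x"
    using assms by (auto simp: K_carrier_def state_space_def cob.hom_C boundary_simps)
  with assms show thesis using that K_carrier_cls by blast
qed

text \<open>The labels of a labelled diagram are classes; to translate the diagram, each label is
  replaced by one of its members.\<close>

definition rep :: "('s, 'k) comb set \<Rightarrow> ('s, 'k::field) comb"
  where "rep X = (SOME x. x \<in> X)"

lemma rep_cls:
  assumes "x \<in> Kc S \<alpha>"
  shows "ceq S \<alpha> {T0} {T1} (rep (cls S \<alpha> [] [Pos, Neg] x)) x"
proof -
  have "rep (cls S \<alpha> [] [Pos, Neg] x) \<in> cls S \<alpha> [] [Pos, Neg] x"
    unfolding rep_def by (rule someI[of _ x]) simp
  then show ?thesis by (simp add: cob.mem_c boundary_simps ceq_def)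
qed

lemma rep_Kc: "X \<in> K_carrier S \<alpha> \<Longrightarrow> rep X \<in> Kc S \<alpha>"
proof (erule K_carrier_E)
  fix x assume x: "x \<in> Kc S \<alpha>" "X = cls S \<alpha> [] [Pos, Neg] x"
  have c: "ceq S \<alpha> {T0} {T1} (rep X) x" using rep_cls[OF x(1)] x(2) by simp
  have "rep X - x \<in> hA S" using c null_in unfolding ceq_def by blast
  then have "rep X - x + x \<in> hA S" using Kc_in[OF x(1)] by (rule combs_add)
  then show "rep X \<in> Kc S \<alpha>" using Kc_ceq[OF x(1) c] by simp
qed

lemma cls_rep: "X \<in> K_carrier S \<alpha> \<Longrightarrow> cls S \<alpha> [] [Pos, Neg] (rep X) = X"
  by (erule K_carrier_E) (simp add: cls_eq_ceq boundary_simps rep_cls)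

text \<open>Makes the dual bases behind \<open>one_K\<close> explicit, so that the unit of the
  kernel algebra has a concrete representative.\<close>

locale frob_eval =
  fixes S :: "'s set" and \<alpha> :: "('s, 'k::field) evaluation"
    and n :: nat and bx bw :: "nat \<Rightarrow> ('s, 'k) comb"
  assumes complete: "complete S \<alpha> n bx bw"
    and one_K: "one_K S \<alpha> = cls S \<alpha> [] [Pos, Neg] (unit_arc - (\<Sum>i<n. bx i * bw i))"
begin

abbreviation K :: "('s, 'k) comb set set" where "K \<equiv> K_carrier S \<alpha>"
abbreviation eqA :: "('s, 'k) comb \<Rightarrow> ('s, 'k) comb \<Rightarrow> bool" where "eqA \<equiv> ceq S \<alpha> {T0} {T1}"

definition eps :: "('s, 'k) comb" where "eps = unit_arc - (\<Sum>i<n. bx i * bw i)"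

lemma b_in: "i < n \<Longrightarrow> bx i \<in> hv S" "i < n \<Longrightarrow> bw i \<in> hw S"
  using complete by (auto simp: complete_def biorth_def)

lemma eps_in: "eps \<in> hA S"
  unfolding eps_def using b_in by (intro combs_diff unit_arc_in combs_sum hv_hw) auto

lemma null_chain: "a - b \<in> null S \<alpha> H T \<Longrightarrow> v - b \<in> null S \<alpha> H T \<Longrightarrow> v - a \<in> null S \<alpha> H T"
  using null_diff[of "v - b" S \<alpha> H T "a - b"] by simp

text \<open>The closed factor \<open>mu (bw i) v\<close> is the i-th coordinate of \<open>v\<close>,
  so the rank-one terms reproduce \<open>v\<close> and cancel the contribution of the arc.\<close>

lemma eps_v: assumes v: "v \<in> hv S" shows "mu eps v \<in> null S \<alpha> {T0} {}"
proof -
  have 1: "mu eps v = v - (\<Sum>i<n. bx i * mu (bw i) v)"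
    unfolding eps_def mu_diff_left mu_sum_left mu_unit_left[OF v triv(4)]
    using mu_rank1_left[OF b_in v triv(4)] by simp
  have "(\<Sum>i<n. bx i * mu (bw i) v - scale (pr \<alpha> (bw i) v) (bx i)) \<in> null S \<alpha> {T0} {}"
    unfolding pr_def by (rule null_sum, rule closed_scalar) (use b_in mu_in[OF triv(3,4) _ v] in auto)
  moreover have "v - (\<Sum>i<n. scale (pr \<alpha> (bw i) v) (bx i)) \<in> null S \<alpha> {T0} {}"
    using complete v by (simp add: complete_def)
  ultimately show ?thesis unfolding 1 sum_subtractf
    by (rule null_chain)
qed

lemma eps_Kc: "eps \<in> Kc S \<alpha>"
  by (simp add: Kc_def eps_in eps_v)

text \<open>By associativity, pairing \<open>mu w x\<close> with \<open>v\<close> is pairing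
  \<open>w\<close> with \<open>mu x v\<close>, which is null; nondegeneracy concludes. So the kernel
  of the action on A(+) annihilates A(-) as well, and half-intervals of both orientations will be
  killed.\<close>

lemma Kc_w: assumes x: "x \<in> Kc S \<alpha>" and w: "w \<in> hw S" shows "mu w x \<in> null S \<alpha> {} {T1}"
proof (rule null_hwI)
  note xA = Kc_in[OF x]
  show "mu w x \<in> hw S" by (rule mu_in[OF triv(3,2) w xA])
  fix v :: "('s, 'k) comb" assume v: "v \<in> hv S"
  have "pr \<alpha> (mu w x) v = pr \<alpha> w (mu x v)"
    unfolding pr_def by (simp add: mu_assoc[OF triv(3,4) w xA v])
  also have "\<dots> = 0" by (rule null_mu_pr(2)[OF w]) (use x v in \<open>simp add: Kc_def\<close>)
  finally show "pr \<alpha> (mu w x) v = 0" .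
qed

text \<open>\<open>eps\<close> differs from the undecorated arc by rank-one terms, and
  \<open>x\<close> kills the factors \<open>bx i\<close>. On the other side the factors
  \<open>bw i\<close> are killed through \<open>Kc_w\<close>.\<close>

lemma mu_eps_right: assumes x: "x \<in> Kc S \<alpha>" shows "eqA (mu x eps) x"
proof -
  note xA = Kc_in[OF x]
  have 1: "mu x eps = x - (\<Sum>i<n. mu x (bx i) * bw i)"
    unfolding eps_def mu_diff_right mu_sum_right mu_unit_right[OF xA triv(1)]
    using mu_rank1_right[OF b_in xA triv(1)] by simp
  have "(\<Sum>i<n. mu x (bx i) * bw i) \<in> null S \<alpha> ({T0} \<union> {}) ({} \<union> {T1})"
    by (rule null_sum, rule null_mult) (use x b_in in \<open>auto simp: Kc_def\<close>)
  from null_uminus[OF this] show ?thesis by (simp add: ceq_def 1)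
qed

lemma mu_eps_left: assumes x: "x \<in> Kc S \<alpha>" shows "eqA (mu eps x) x"
proof -
  note xA = Kc_in[OF x]
  have 1: "mu eps x = x - (\<Sum>i<n. bx i * mu (bw i) x)"
    unfolding eps_def mu_diff_left mu_sum_left mu_unit_left[OF xA triv(2)]
    using mu_rank1_left[OF b_in xA triv(2)] by simp
  have "(\<Sum>i<n. bx i * mu (bw i) x) \<in> null S \<alpha> ({T0} \<union> {}) ({} \<union> {T1})"
    by (rule null_sum, rule null_mult_right) (use b_in Kc_w[OF x] in auto)
  from null_uminus[OF this] show ?thesis by (simp add: ceq_def 1)
qed

lemma one_K_eps: "one_K S \<alpha> = cls S \<alpha> [] [Pos, Neg] eps"
  by (simp add: one_K eps_def)

lemma K_closed: "frob_closed (K_alg S \<alpha>)"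
  unfolding frob_closed_def K_alg_def
proof (simp, intro conjI ballI allI)
  show "one_K S \<alpha> \<in> K" by (simp add: one_K_eps K_carrier_cls eps_in eps_Kc)
next
  fix X r assume "X \<in> K"
  then show "scalm (cat S \<alpha>) [] [Pos, Neg] r X \<in> K"
    by (elim K_carrier_E) (simp add: cob.scalm_C cls_K Kc_scale)
next
  fix X Y assume "X \<in> K" "Y \<in> K"
  then show "plusm (cat S \<alpha>) [] [Pos, Neg] X Y \<in> K" "mult_A S \<alpha> X Y \<in> K"
    by (elim K_carrier_E; simp add: cob.plusm_C mult_A_cls cls_K Kc_in Kc_add Kc_mu)+
qed

lemma rep_one: "eqA (rep (one_K S \<alpha>)) eps"
  unfolding one_K_eps by (rule rep_cls[OF eps_Kc])

lemma rep_plus: "X \<in> K \<Longrightarrow> Y \<in> K \<Longrightarrow> eqA (rep (plusm (cat S \<alpha>) [] [Pos, Neg] X Y)) (rep X + rep Y)"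
  using rep_cls[OF Kc_add[OF rep_Kc rep_Kc], of X S \<alpha> Y] cob.plusm_C[of S \<alpha> "[]" "[Pos, Neg]" "rep X" "rep Y"]
  by (simp add: cls_rep)

lemma rep_scal: "X \<in> K \<Longrightarrow> eqA (rep (scalm (cat S \<alpha>) [] [Pos, Neg] r X)) (scale r (rep X))"
  using rep_cls[OF Kc_scale[OF rep_Kc], of X S \<alpha> r] cob.scalm_C[of S \<alpha> "[]" "[Pos, Neg]" r "rep X"]
  by (simp add: cls_rep)

lemma rep_mult: "X \<in> K \<Longrightarrow> Y \<in> K \<Longrightarrow> eqA (rep (mult_A S \<alpha> X Y)) (mu (rep X) (rep Y))"
  using rep_cls[OF Kc_mu[OF rep_Kc Kc_in[OF rep_Kc]], of X S \<alpha> Y \<alpha>]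
    mult_A_cls[OF Kc_in[OF rep_Kc] Kc_in[OF rep_Kc], of X S \<alpha> Y \<alpha> \<alpha>]
  by (simp add: cls_rep)

text \<open>Ending the product with \<open>eps\<close> gives the empty word the value
  \<open>eps\<close> instead of the undecorated arc, so every strand is compressed, labelled or not.
  For nonempty words this changes the value by a null combination only.\<close>

fun rho :: "('s, 'k) comb set list \<Rightarrow> ('s, 'k) comb" where
  "rho [] = eps"
| "rho (X # w) = mu (rep X) (rho w)"

lemma rho_Kc: "set w \<subseteq> K \<Longrightarrow> rho w \<in> Kc S \<alpha>"
  by (induct w) (auto simp: eps_Kc Kc_mu rep_Kc Kc_in)

lemma rho_in: "set w \<subseteq> K \<Longrightarrow> rho w \<in> hA S"
  by (rule Kc_in) (rule rho_Kc)

text \<open>The \<open>eps\<close> that ends the first word is absorbed, being a unit for the kernel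
  algebra modulo null combinations.\<close>

lemma rho_append: "set u \<subseteq> K \<Longrightarrow> set w \<subseteq> K \<Longrightarrow> eqA (rho (u @ w)) (mu (rho u) (rho w))"
proof (induct u)
  case Nil
  then show ?case using ceq_sym[OF mu_eps_left[OF rho_Kc[OF Nil(2)]]] by simp
next
  case (Cons X u)
  have r: "rep X \<in> hA S" using Cons by (auto intro: Kc_in rep_Kc)
  have "eqA (rho ((X # u) @ w)) (mu (rep X) (mu (rho u) (rho w)))"
    using ceq_mu2[OF triv(1,2) Cons(1) r] Cons by simp
  also have "mu (rep X) (mu (rho u) (rho w)) = mu (rho (X # u)) (rho w)"
    using mu_assoc[OF triv(1,2) r rho_in rho_in] Cons by simp
  finally show ?case .
qed

lemma rho_mid:
  assumes "set u \<subseteq> K" "X \<in> K" "set w \<subseteq> K"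
  shows "eqA (rho (u @ [X] @ w)) (mu (rho u) (mu (rep X) (rho w)))"
  using rho_append[of u "X # w"] assms by simp

lemma mu_mid_cong:
  assumes "eqA x y" "set u \<subseteq> K" "set w \<subseteq> K"
  shows "eqA (mu (rho u) (mu x (rho w))) (mu (rho u) (mu y (rho w)))"
  by (intro ceq_mu2[OF triv(1,2)] ceq_mu1[OF triv(1,2)] assms(1) rho_in assms(2,3))

lemma rho_single: "X \<in> K \<Longrightarrow> eqA (rho [X]) (rep X)"
  using mu_eps_right[OF rep_Kc] by simp

lemma tr_rho_rotate: "set u \<subseteq> K \<Longrightarrow> set w \<subseteq> K \<Longrightarrow> tr \<alpha> (rho (u @ w)) = tr \<alpha> (rho (w @ u))"
  using ceq_tr[OF rho_append[of u w]] ceq_tr[OF rho_append[of w u]] tr_mu[OF rho_in rho_in, of u w \<alpha>] by simp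

definition kap :: "('s, 'k) comb set cword \<Rightarrow> 'k"
  where "kap c = tr \<alpha> (rho (SOME w. cyc w = c))"

text \<open>The word picked in \<open>kap\<close> is a rotation of \<open>w\<close>, and the trace
  is cyclic.\<close>

lemma kap_cyc: assumes "set w \<subseteq> K" shows "kap (cyc w) = tr \<alpha> (rho w)"
proof -
  let ?w = "SOME w'. cyc w' = cyc w"
  have "cyc ?w = cyc w" by (rule someI[of _ w]) simp
  then have "cyc_eq ?w w" by (metis cword.abs_eq_iff cyc.abs_eq)
  then obtain x y where "?w = x @ y" "w = y @ x" by (auto simp: cyc_eq_def)
  then show ?thesis unfolding kap_def using tr_rho_rotate[of x y] assms by simp
qed

text \<open>A circle contributes the scalar of its trace, as a cyclic word has no preferred place to
  cut. The last clause is a default: components with an inner endpoint do not occur in labelled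
  diagrams.\<close>

fun phi :: "('p, ('s, 'k) comb set) strand \<Rightarrow> (('p, 's) diagram \<Rightarrow>\<^sub>0 'k)" where
  "phi (Seg (Some h) w (Some t)) = cren (sub h t) (rho w)"
| "phi (Circ c) = scale (kap c) 1"
| "phi _ = 0"

definition Phi :: "('p, ('s, 'k) comb set) diagram \<Rightarrow> (('p, 's) diagram \<Rightarrow>\<^sub>0 'k)"
  where "Phi D = (\<Prod>c\<in>#D. phi c)"

lemma Phi_empty [simp]: "Phi {#} = 1" and Phi_add [simp]: "Phi (add_mset c D) = phi c * Phi D"
  and Phi_plus: "Phi (D + E) = Phi D * Phi E"
  by (simp_all add: Phi_def)

lemma hA_sub: "x \<in> hA S \<Longrightarrow> h \<noteq> t \<Longrightarrow> cren (sub h t) x \<in> dcombs False S {h} {t}"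
  using sub_in[OF triv(1,2), of x False S h t] by simp

lemma phi_in:
  assumes "letters c \<subseteq> K" "no_inner c" "set_mset (head_end c) \<inter> set_mset (tail_end c) = {}"
  shows "phi c \<in> dcombs False S (set_mset (head_end c)) (set_mset (tail_end c))"
  using assms
proof (cases c rule: phi.cases)
  case (1 h w t)
  then show ?thesis using assms by (simp add: hA_sub rho_in)
qed (auto intro: combs_scale one_in)

lemma Phi_in: "D \<in> dgs True K H T \<Longrightarrow> Phi D \<in> dcombs False S H T"
proof (induct D arbitrary: H T)
  case empty
  then show ?case using one_in by simp
next
  case (add c D)
  let ?h = "set_mset (head_end c)" and ?t = "set_mset (tail_end c)"
  have d: "?h \<subseteq> H" "?t \<subseteq> T" "H \<inter> T = {}" "D \<in> dgs True K (H - ?h) (T - ?t)" "letters c \<subseteq> K" "no_inner c"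
    using add(2) by (auto simp: dgs_add)
  have "phi c * Phi D \<in> dcombs False S (?h \<union> (H - ?h)) (?t \<union> (T - ?t))"
    by (rule mult_in[OF phi_in add(1)]) (use d in auto)
  moreover have "?h \<union> (H - ?h) = H" "?t \<union> (T - ?t) = T" using d by auto
  ultimately show ?case by simp
qed

lemma phi_rename: "phi (rename_strand f c) = cren f (phi c)"
proof (cases c rule: phi.cases)
  case (1 h w t)
  have "sub (f h) (f t) = (\<lambda>p. f (sub h t p))" by (auto simp: sub_def)
  then show ?thesis using 1 by (simp add: cren_cren)
qed (auto simp: lin_scale)

lemma Phi_rename: "Phi (rename f D) = cren f (Phi D)"
  by (induct D) (auto simp: phi_rename cren_mult)

text \<open>Joining two strands multiplies their values by \<open>mu_glue\<close>, and the product
  is congruent to the value of the concatenated word by \<open>rho_append\<close>. Closing a strand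
  produces a closed factor, which may be replaced by its evaluation, the trace.\<close>

lemma Phi_glue1:
  assumes D: "D \<in> dgs True K H T" and h: "h \<in> H" and t: "t \<in> T"
  shows "ceq S \<alpha> (H - {h}) (T - {t}) (Phi (glue h t D)) (cglue h t (Phi D))"
  using D h t
proof (cases rule: dgs_cases)
  case (circ w D')
  have ht: "h \<noteq> t" using D circ by (auto simp: dgs_add)
  have w: "set w \<subseteq> K" and D': "D' \<in> dgs True K (H - {h}) (T - {t})"
    using D circ by (auto simp: dgs_add)
  have r: "cren (sub h t) (rho w) \<in> dcombs False S {h} {t}" by (rule hA_sub[OF rho_in[OF w] ht])
  have "cglue h t (Phi D) = cglue h t (cren (sub h t) (rho w)) * Phi D'"
    unfolding circ Phi_add phi.simps
    by (rule cglue_mult[OF r _ Phi_in[OF D']]) (use dgs_disjoint[OF D] h t in \<open>auto simp: opp_def\<close>)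
  moreover have "cglue h t (cren (sub h t) (rho w)) \<in> dcombs False S {} {}"
    using cglue_in[OF r, of h t] by (simp add: opp_def insert_Diff_if)
  from closed_scalar[OF Phi_in[OF D'] this, of \<alpha>]
  have "ceq S \<alpha> (H - {h}) (T - {t}) (cglue h t (cren (sub h t) (rho w)) * Phi D') (scale (tr \<alpha> (rho w)) (Phi D'))"
    by (simp add: ceq_def tr_sub[OF rho_in[OF w] ht] mult.commute)
  moreover have "Phi (glue h t D) = scale (tr \<alpha> (rho w)) (Phi D')"
    unfolding glue_circ[OF D circ] by (simp add: kap_cyc[OF w] scale_mult_left)
  ultimately show ?thesis using ceq_sym by metis
next
  case (join p u w q D')
  obtain p' q' where pq: "p = Some p'" "q = Some q'"
    using D join by (auto simp: dgs_add)
  have w: "set u \<subseteq> K" "set w \<subseteq> K" and D': "D' \<in> dgs True K (H - {p'} - {h}) (T - {t} - {q'})"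
    and mem: "p' \<in> H" "q' \<in> T" "p' \<noteq> h" "q' \<noteq> t" using D join pq by (auto simp: dgs_add)
  have d: "distinct [p', t, h, q']" using mem h t dgs_disjoint[OF D] by auto
  have r1: "cren (sub p' t) (rho u) \<in> dcombs False S {p'} {t}" by (rule hA_sub[OF rho_in[OF w(1)]]) (use d in auto)
  have r2: "cren (sub h q') (rho w) \<in> dcombs False S {h} {q'}" by (rule hA_sub[OF rho_in[OF w(2)]]) (use d in auto)
  have r: "cren (sub p' t) (rho u) * cren (sub h q') (rho w) \<in> dcombs False S ({p'} \<union> {h}) ({t} \<union> {q'})"
    by (rule mult_in[OF r1 r2]) (use d in auto)
  have "cglue h t (Phi D) = cglue h t (cren (sub p' t) (rho u) * cren (sub h q') (rho w)) * Phi D'"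
    unfolding join Phi_add phi.simps pq mult.assoc[symmetric]
    by (rule cglue_mult[OF r _ Phi_in[OF D']]) (use dgs_disjoint[OF D] h t mem in \<open>auto simp: opp_def\<close>)
  also have "cglue h t (cren (sub p' t) (rho u) * cren (sub h q') (rho w)) = cren (sub p' q') (mu (rho u) (rho w))"
    unfolding cglue_sym[of h t] by (rule mu_glue[OF triv(1,2) rho_in[OF w(1)] rho_in[OF w(2)] d])
  finally have 1: "cglue h t (Phi D) = cren (sub p' q') (mu (rho u) (rho w)) * Phi D'" .
  have 2: "Phi (glue h t D) = cren (sub p' q') (rho (u @ w)) * Phi D'"
    unfolding glue_join[OF D join(1)] pq by simp
  have "ceq S \<alpha> ({p'} \<union> (H - {p'} - {h})) ({q'} \<union> (T - {t} - {q'})) (Phi (glue h t D)) (cglue h t (Phi D))"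
    unfolding 1 2
  proof (rule ceq_mult1[OF _ Phi_in[OF D']])
    show "ceq S \<alpha> {p'} {q'} (cren (sub p' q') (rho (u @ w))) (cren (sub p' q') (mu (rho u) (rho w)))"
      using ceq_cren[OF rho_append[OF w], of "sub p' q'"] d by (auto simp: inj_on_def)
  qed (use dgs_disjoint[OF D] mem in auto)
  moreover have "{p'} \<union> (H - {p'} - {h}) = H - {h}" "{q'} \<union> (T - {t} - {q'}) = T - {t}" using mem by auto
  ultimately show ?thesis by simp
qed

lemma Phi_glue:
  assumes D: "D \<in> dgs True K H T" and o: "opp H T p q"
  shows "ceq S \<alpha> (H - {p, q}) (T - {p, q}) (Phi (glue p q D)) (cglue p q (Phi D))"
proof -
  have *: "ceq S \<alpha> (H - {h, t}) (T - {h, t}) (Phi (glue h t D)) (cglue h t (Phi D))" if "h \<in> H" "t \<in> T" for h t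
  proof -
    have "H - {h, t} = H - {h}" "T - {h, t} = T - {t}" using that dgs_disjoint[OF D] by auto
    then show ?thesis using Phi_glue1[OF D that] by (simp only:)
  qed
  from o *[of p q] *[of q p] show ?thesis
    by (auto simp: opp_def glue_sym[of q p] insert_commute)
qed

lemma Phi_glues:
  "D \<in> dgs True K H T \<Longrightarrow> okp H T ps \<Longrightarrow> ceq S \<alpha> (H - pts ps) (T - pts ps) (Phi (glues ps D)) (cglues ps (Phi D))"
proof (induct ps arbitrary: D H T)
  case (Cons u ps)
  obtain p q where u: "u = (p, q)" by (cases u)
  have o: "opp H T p q" "okp (H - {p, q}) (T - {p, q}) ps" using Cons(3) by (auto simp: u okp_Cons)
  have e: "A - ({p, q} \<union> pts ps) = A - {p, q} - pts ps" for A by auto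
  have "ceq S \<alpha> (H - {p, q} - pts ps) (T - {p, q} - pts ps) (Phi (glues ps (glue p q D))) (cglues ps (Phi (glue p q D)))"
    by (rule Cons(1)[OF glue_dgs[OF Cons(2) o(1)] o(2)])
  also have "ceq S \<alpha> (H - {p, q} - pts ps) (T - {p, q} - pts ps) (cglues ps (Phi (glue p q D))) (cglues ps (cglue p q (Phi D)))"
    by (rule ceq_cglues[OF Phi_glue[OF Cons(2) o(1)] o(2)])
  finally show ?case unfolding u pts_Cons e cglues_Cons unfolding glues_Cons .
qed simp

abbreviation PhiL :: "(('p, ('s, 'k) comb set) diagram \<Rightarrow>\<^sub>0 'k) \<Rightarrow> (('p, 's) diagram \<Rightarrow>\<^sub>0 'k)"
  where "PhiL \<equiv> ext Phi"

lemma PhiL_in: "x \<in> dcombs True K H T \<Longrightarrow> PhiL x \<in> dcombs False S H T"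
  by (erule ext_in_combs) (rule Phi_in)

lemma PhiL_mult: "PhiL (x * y) = PhiL x * PhiL y"
  using combs_UNIV[of x]
proof (induct rule: comb_induct)
  case (gen D)
  show ?case using combs_UNIV[of y]
    by (induct rule: comb_induct)
      (auto simp: gen_mult_gen Phi_plus distrib_left ext_add ext_scale scale_mult_right simp del: mult_single)
qed (auto simp: distrib_right ext_add ext_scale scale_mult_left)

lemma PhiL_cren: "PhiL (cren f x) = cren f (PhiL x)"
  using combs_UNIV[of x]
  by (induct rule: comb_induct) (auto simp: lin_add lin_scale ext_add ext_scale Phi_rename)

lemma PhiL_cglues:
  assumes x: "x \<in> dcombs True K H T" and o: "okp H T ps"
  shows "ceq S \<alpha> (H - pts ps) (T - pts ps) (PhiL (cglues ps x)) (cglues ps (PhiL x))"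
  using x
  by (induct rule: comb_induct) (auto simp: lin_add lin_scale ext_add ext_scale Phi_glues[OF _ o] ceq_add ceq_scale)

lemma PhiL_stack:
  assumes x: "x \<in> dcombs True K (heads a b) (tails a b)" and y: "y \<in> dcombs True K (heads b c) (tails b c)"
  shows "ceq S \<alpha> (heads a c) (tails a c) (PhiL (bilin (stack (length b)) y x))
    (bilin (stack (length b)) (PhiL y) (PhiL x))"
proof -
  have "ceq S \<alpha> (sH a b c - pts (stk (length b))) (sT a b c - pts (stk (length b)))
    (PhiL (cglues (stk (length b)) (cren Inl x * cren Inr y))) (cglues (stk (length b)) (PhiL (cren Inl x * cren Inr y)))"
    by (rule PhiL_cglues[OF Inl_Inr_in[OF x y] okp_stk])
  from ceq_cren[OF this stk_both(1)]
  show ?thesis unfolding bilin_stack stk_both PhiL_cren PhiL_mult .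
qed

lemma PhiL_closure:
  assumes "x \<in> dcombs True K (heads a a) (tails a a)"
  shows "ceq S \<alpha> {} {} (PhiL (lin (diagram_closure (length a)) x)) (lin (diagram_closure (length a)) (PhiL x))"
  using PhiL_cglues[OF assms okp_clo] unfolding pts_clo diagram_closure_eq .

text \<open>\<open>L\<close> turns an element of A(+-) into the contribution of one component:
  placing it between the ends of an arc, or taking its trace for a circle. It lets a relation be
  verified once for \<open>rho\<close> and then carried to both kinds of component.\<close>

definition strand_map where
  "strand_map s D H T L \<longleftrightarrow> (\<forall>x y. L (x + y) = L x + L y) \<and> (\<forall>x y. L (x - y) = L x - L y) \<and>
    (\<forall>r x. L (scale r x) = scale r (L x)) \<and> (\<forall>w. set w \<subseteq> K \<longrightarrow> phi (s w) = L (rho w)) \<and>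
    (\<forall>z\<in>null S \<alpha> {T0} {T1}. L z * Phi D \<in> null S \<alpha> H T)"

lemma strand_mapD:
  assumes "strand_map s D H T L"
  shows "L (x + y) = L x + L y" "L (x - y) = L x - L y" "L (scale r x) = scale r (L x)"
    "set w \<subseteq> K \<Longrightarrow> phi (s w) = L (rho w)" "z \<in> null S \<alpha> {T0} {T1} \<Longrightarrow> L z * Phi D \<in> null S \<alpha> H T"
  using assms by (simp_all add: strand_map_def)

lemma scale_left_diff: "scale (r - r') x = scale r x - scale r' x"
  by (rule poly_mapping_eqI) (simp add: lookup_scale lookup_minus algebra_simps)

lemma shape_phi:
  assumes s: "s \<in> shapes" and D: "add_mset (s w0) D \<in> dgs True K H T"
  shows "\<exists>L. strand_map s D H T L"
  using s
proof (cases rule: shapesE)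
  case (1 p q)
  have d: "p \<noteq> q" "p \<in> H" "q \<in> T" "H \<inter> T = {}" and D': "D \<in> dgs True K (H - {p}) (T - {q})"
    using D 1 by (auto simp: dgs_add)
  have "strand_map s D H T (cren (sub p q))"
    unfolding strand_map_def
  proof (intro conjI allI ballI impI)
    fix z assume "z \<in> null S \<alpha> {T0} {T1}"
    from null_sub[OF triv(1,2) this d(1)] have "cren (sub p q) z \<in> null S \<alpha> {p} {q}" by simp
    from null_mult[OF this Phi_in[OF D']] have "cren (sub p q) z * Phi D \<in> null S \<alpha> ({p} \<union> (H - {p})) ({q} \<union> (T - {q}))"
      using d by auto
    moreover have "{p} \<union> (H - {p}) = H" "{q} \<union> (T - {q}) = T" using d by auto
    ultimately show "cren (sub p q) z * Phi D \<in> null S \<alpha> H T" by simp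
  qed (simp_all add: 1 lin_add lin_diff lin_scale)
  then show ?thesis by blast
next
  case 2
  have "strand_map s D H T (\<lambda>z. scale (tr \<alpha> z) 1)"
    unfolding strand_map_def
  proof (intro conjI allI ballI impI)
    fix z assume "z \<in> null S \<alpha> {T0} {T1}"
    then show "scale (tr \<alpha> z) 1 * Phi D \<in> null S \<alpha> H T" by (simp add: tr_null)
  qed (simp_all add: 2 tr_add tr_diff tr_scale scale_left_distrib scale_left_diff kap_cyc)
  then show ?thesis by blast
qed

text \<open>For relations inside one component the congruence is shown between values of
  \<open>rho\<close>, where it reduces to the behaviour of \<open>rep\<close>, and transported by
  the map from \<open>shape_phi\<close>. For the circle relation both scalars are the trace of
  \<open>rep X\<close>.\<close>

lemma PhiL_frels:
  assumes "x \<in> frels (K_alg S \<alpha>) (dgs True K H T)"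
  shows "PhiL x \<in> null S \<alpha> H T"
  using assms
proof (induct rule: frels.induct)
  case (label_plus s X Y u v D)
  from label_plus have XY: "X \<in> K" "Y \<in> K" by (auto simp: K_alg_def)
  have l: "set u \<subseteq> K" "set v \<subseteq> K" using dgs_letters[OF label_plus(4), of "s (u @ [X] @ v)"] label_plus(1) by (auto simp: shape_letters)
  let ?P = "plusm (cat S \<alpha>) [] [Pos, Neg] X Y"
  have P: "?P \<in> K" using K_closed XY by (simp add: frob_closed_def K_alg_def)
  obtain L where "strand_map s D H T L" using shape_phi[OF label_plus(1,4)] by blast
  note L = strand_mapD[OF this]
  have "eqA (rho (u @ [?P] @ v)) (mu (rho u) (mu (rep ?P) (rho v)))" by (rule rho_mid[OF l(1) P l(2)])
  also have "eqA (mu (rho u) (mu (rep ?P) (rho v))) (mu (rho u) (mu (rep X + rep Y) (rho v)))"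
    by (rule mu_mid_cong[OF rep_plus[OF XY] l])
  also have "eqA (mu (rho u) (mu (rep X + rep Y) (rho v))) (rho (u @ [X] @ v) + rho (u @ [Y] @ v))"
    unfolding mu_add_left mu_add_right
    by (intro ceq_add ceq_sym[OF rho_mid] l XY)
  finally have "rho (u @ [?P] @ v) - (rho (u @ [X] @ v) + rho (u @ [Y] @ v)) \<in> null S \<alpha> {T0} {T1}" by (simp add: ceq_def)
  from L(5)[OF this] show ?case
    using L(4)[of "u @ [?P] @ v"] L(4)[of "u @ [X] @ v"] L(4)[of "u @ [Y] @ v"] l P XY
    by (simp add: ext_diff ext_add L(1,2) K_alg_def algebra_simps)
next
  case (label_scal s X u v D r)
  from label_scal have X: "X \<in> K" by (auto simp: K_alg_def)
  have l: "set u \<subseteq> K" "set v \<subseteq> K" using dgs_letters[OF label_scal(3), of "s (u @ [X] @ v)"] label_scal(1) by (auto simp: shape_letters)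
  let ?P = "scalm (cat S \<alpha>) [] [Pos, Neg] r X"
  have P: "?P \<in> K" using K_closed X by (simp add: frob_closed_def K_alg_def)
  obtain L where "strand_map s D H T L" using shape_phi[OF label_scal(1,3)] by blast
  note L = strand_mapD[OF this]
  have "eqA (rho (u @ [?P] @ v)) (mu (rho u) (mu (rep ?P) (rho v)))" by (rule rho_mid[OF l(1) P l(2)])
  also have "eqA (mu (rho u) (mu (rep ?P) (rho v))) (mu (rho u) (mu (scale r (rep X)) (rho v)))"
    by (rule mu_mid_cong[OF rep_scal[OF X] l])
  also have "eqA (mu (rho u) (mu (scale r (rep X)) (rho v))) (scale r (rho (u @ [X] @ v)))"
    unfolding mu_scale_left mu_scale_right
    by (intro ceq_scale ceq_sym[OF rho_mid] l X)
  finally have "rho (u @ [?P] @ v) - scale r (rho (u @ [X] @ v)) \<in> null S \<alpha> {T0} {T1}" by (simp add: ceq_def)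
  from L(5)[OF this] show ?case
    using L(4)[of "u @ [?P] @ v"] L(4)[of "u @ [X] @ v"] l P X
    by (simp add: ext_diff ext_scale L(2,3) K_alg_def algebra_simps scale_mult_left scale_mult_right)
next
  case (label_mult s u X Y v D)
  have l: "set u \<subseteq> K" "set v \<subseteq> K" and XY: "X \<in> K" "Y \<in> K"
    using dgs_letters[OF label_mult(2), of "s (u @ [X, Y] @ v)"] label_mult(1) by (auto simp: shape_letters)
  let ?P = "mult_A S \<alpha> X Y"
  have P: "?P \<in> K" using K_closed XY by (simp add: frob_closed_def K_alg_def)
  obtain L where "strand_map s D H T L" using shape_phi[OF label_mult(1,2)] by blast
  note L = strand_mapD[OF this]
  have "eqA (rho (u @ [?P] @ v)) (mu (rho u) (mu (rep ?P) (rho v)))" by (rule rho_mid[OF l(1) P l(2)])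
  also have "eqA (mu (rho u) (mu (rep ?P) (rho v))) (mu (rho u) (mu (mu (rep X) (rep Y)) (rho v)))"
    by (rule mu_mid_cong[OF rep_mult[OF XY] l])
  also have "mu (mu (rep X) (rep Y)) (rho v) = rho (X # Y # v)"
    using mu_assoc[OF triv(1,2) Kc_in[OF rep_Kc[OF XY(1)]] Kc_in[OF rep_Kc[OF XY(2)]] rho_in[OF l(2)]] by simp
  also have "eqA (mu (rho u) (rho (X # Y # v))) (rho (u @ [X, Y] @ v))"
    using ceq_sym[OF rho_append[of u "X # Y # v"]] l XY by simp
  finally have "eqA (rho (u @ [?P] @ v)) (rho (u @ [X, Y] @ v))" .
  from ceq_sym[OF this] have "rho (u @ [X, Y] @ v) - rho (u @ [?P] @ v) \<in> null S \<alpha> {T0} {T1}"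
    by (simp only: ceq_def)
  from L(5)[OF this] show ?case
    using L(4)[of "u @ [?P] @ v"] L(4)[of "u @ [X, Y] @ v"] l P XY
    by (simp add: ext_diff L(2) K_alg_def algebra_simps)
next
  case (label_one s u v D)
  have l: "set u \<subseteq> K" "set v \<subseteq> K"
    using dgs_letters[OF label_one(2), of "s (u @ v)"] label_one(1) by (auto simp: shape_letters)
  let ?P = "one_K S \<alpha>"
  have P: "?P \<in> K" using K_closed by (simp add: frob_closed_def K_alg_def)
  obtain L where "strand_map s D H T L" using shape_phi[OF label_one(1,2)] by blast
  note L = strand_mapD[OF this]
  have "eqA (rho (u @ [?P] @ v)) (mu (rho u) (mu (rep ?P) (rho v)))" by (rule rho_mid[OF l(1) P l(2)])
  also have "eqA (mu (rho u) (mu (rep ?P) (rho v))) (mu (rho u) (mu eps (rho v)))"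
    by (rule mu_mid_cong[OF rep_one l])
  also have "eqA (mu (rho u) (mu eps (rho v))) (mu (rho u) (rho v))"
    by (rule ceq_mu2[OF triv(1,2) mu_eps_left[OF rho_Kc[OF l(2)]] rho_in[OF l(1)]])
  also have "eqA (mu (rho u) (rho v)) (rho (u @ v))"
    by (rule ceq_sym[OF rho_append[OF l]])
  finally have "rho (u @ [?P] @ v) - rho (u @ v) \<in> null S \<alpha> {T0} {T1}" by (simp add: ceq_def)
  from L(5)[OF this] show ?case
    using L(4)[of "u @ [?P] @ v"] L(4)[of "u @ v"] l P
    by (simp add: ext_diff L(2) K_alg_def algebra_simps)
next
  case (circle X D)
  have X: "X \<in> K" using dgs_letters[OF circle, of "Circ (cyc [X])"] by simp
  have "circular_closure \<alpha> X = tr \<alpha> (rep X)"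
    using circular_closure_cls[OF Kc_in[OF rep_Kc[OF X]], of \<alpha>] cls_rep[OF X] by simp
  moreover have "kap (cyc [X]) = tr \<alpha> (rep X)"
    using kap_cyc[of "[X]"] ceq_tr[OF rho_single[OF X]] X by simp
  ultimately show ?case by (simp add: ext_diff ext_scale K_alg_def scale_mult_left)
qed (auto simp: ext_add ext_scale)

end

lemma bilin_id_left: "x \<in> dcombs f S (heads a b) (tails a b) \<Longrightarrow> bilin (stack (length b)) (gen (id_diagram b)) x = x"
  by (induct rule: comb_induct) (auto simp: stack_id_left bilin_add_right bilin_scale_right)

lemma bilin_id_right: "x \<in> dcombs f S (heads a b) (tails a b) \<Longrightarrow> bilin (stack (length a)) x (gen (id_diagram a)) = x"
  by (induct rule: comb_induct) (auto simp: stack_id_right bilin_add_left bilin_scale_left)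

lemma bilin_swap: "x \<in> dcombs f S (heads c (a @ b)) (tails c (a @ b)) \<Longrightarrow>
  bilin (stack (length (a @ b))) (gen (swap_diagram a b)) x = cren (topswap (length a) (length b)) x"
proof (induct rule: comb_induct)
  case (gen D)
  then show ?case by (simp only: bilin_gen lin_gen stack_swap)
qed (simp_all only: bilin_add_right bilin_scale_right lin_add lin_scale bilin_0_right lin_0)

lemma id_diagram_append: "id_diagram (a @ b) = juxtapose (length a) (length a) (id_diagram a) (id_diagram b)"
proof -
  let ?m = "length a" and ?n = "length b"
  let ?f = "\<lambda>i. arc_at ((a @ b) ! i = Pos) (Top i) (Bot i) :: (point, 'a) strand"
  have u: "[0..<?m + ?n] = [0..<?m] @ map (\<lambda>i. i + ?m) [0..<?n]"
    by (simp only: upt_add_eq_append[of 0, simplified] map_add_upt add.commute)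
  have "id_diagram (a @ b) = mset (map ?f [0..<?m]) + mset (map ?f (map (\<lambda>i. i + ?m) [0..<?n]))"
    unfolding id_diagram_def perm_diagram_arcs length_append u by simp
  also have "map ?f [0..<?m] = map (\<lambda>i. arc_at (a ! i = Pos) (Top i) (Bot i)) [0..<?m]"
    by (rule map_cong) (auto simp: nth_append)
  also have "map ?f (map (\<lambda>i. i + ?m) [0..<?n]) =
    map (rename_strand (shift ?m ?m)) (map (\<lambda>i. arc_at (b ! i = Pos) (Top i) (Bot i)) [0..<?n])"
    by (simp add: nth_append add.commute)
  finally show ?thesis
    unfolding juxtapose_def id_diagram_def perm_diagram_arcs rename_def mset_map .
qed

lemma id_diagram_single: "id_diagram [s] = {#if s = Pos then arc T0 (Bot 0) else arc (Bot 0) T0#}"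
  by (simp add: id_diagram_def perm_diagram_arcs arc_at_def)

lemma id_diagram_Nil [simp]: "id_diagram [] = {#}"
  by (simp add: id_diagram_def perm_diagram_arcs)

section \<open>The functor on labelled diagrams\<close>

context frob_eval
begin

abbreviation fbB :: "(('s, 'k) comb set, 'k) frobenius" where "fbB \<equiv> K_alg S \<alpha>"

lemma carr_K [simp]: "carr fbB = K"
  by (simp add: K_alg_def)

abbreviation frK :: "'p set \<Rightarrow> 'p set \<Rightarrow> (('p, ('s, 'k) comb set) diagram \<Rightarrow>\<^sub>0 'k) set"
  where "frK H T \<equiv> frels fbB (dgs True K H T)"

sublocale fb: linear_quotient "\<lambda>a b. hdgs True K a b" "\<lambda>a b. frK (heads a b) (tails a b)"
  rewrites "linear_quotient.C (\<lambda>a b. hdgs True K a b) (\<lambda>a b. frK (heads a b) (tails a b)) = fb_cat fbB"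
    and "linear_quotient.c (\<lambda>a b. hdgs True K a b) (\<lambda>a b. frK (heads a b) (tails a b)) = fb_cls fbB"
  using fb_quotient[OF K_closed] by simp_all

abbreviation kC where "kC \<equiv> karoubi (cat S \<alpha>)"

text \<open>Undecorated strands have the value \<open>eps\<close>, so this is the tensor product of
  the idempotents belonging to the signs in \<open>a\<close>.\<close>

definition E :: "sign list \<Rightarrow> ('s, 'k) comb set" where
  "E a = cls S \<alpha> a a (Phi (id_diagram a))"

definition Fm :: "sign list \<Rightarrow> sign list \<Rightarrow> (('s, 'k) comb set, 'k) comb set \<Rightarrow> ('s, 'k) comb set"
  where "Fm a b X = (\<Union>x\<in>X. cls S \<alpha> a b (PhiL x))"

definition F0 where "F0 = \<lparr>on_obj = (\<lambda>a. ([a], mat1 (E a))), on_hom = (\<lambda>a b X. mat1 (Fm a b X))\<rparr>"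

lemma Fm_cls: "Fm a b (fb_cls fbB a b x) = cls S \<alpha> a b (PhiL x)"
  unfolding Fm_def
proof (rule fb.UN_c)
  fix y assume "y \<in> fb_cls fbB a b x"
  then have "PhiL (y - x) \<in> null S \<alpha> (heads a b) (tails a b)" by (intro PhiL_frels) (simp add: fb.mem_c)
  then show "cls S \<alpha> a b (PhiL y) = cls S \<alpha> a b (PhiL x)" by (simp add: cls_eq_ceq ceq_def ext_diff)
qed

lemma Phi_id_in: "Phi (id_diagram a) \<in> dcombs False S (heads a a) (tails a a)"
  by (rule Phi_in[OF id_diagram_in])

lemma E_in: "E a \<in> hom (cat S \<alpha>) a a"
  unfolding E_def by (rule cob.c_in_hom[OF Phi_id_in])

lemma Fm_in: "X \<in> hom (fb_cat fbB) a b \<Longrightarrow> Fm a b X \<in> hom (cat S \<alpha>) a b"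
  by (elim fb.hom_CE) (auto simp: Fm_cls intro!: cob.c_in_hom PhiL_in)

lemma Fm_cmp:
  assumes "X \<in> hom (fb_cat fbB) a b" "Y \<in> hom (fb_cat fbB) b c"
  shows "Fm a c (cmp (fb_cat fbB) a b c Y X) = cmp (cat S \<alpha>) a b c (Fm b c Y) (Fm a b X)"
  using assms
  by (elim fb.hom_CE) (simp add: fb.cmp_C Fm_cls cob.cmp_C PhiL_in cls_eq_ceq PhiL_stack)

lemma Fm_idm: "Fm a a (idm (fb_cat fbB) a) = E a"
  by (simp add: fb.idm_C Fm_cls E_def)

lemma fb_idm_left: "X \<in> hom (fb_cat fbB) a b \<Longrightarrow> cmp (fb_cat fbB) a b b (idm (fb_cat fbB) b) X = X"
  by (elim fb.hom_CE) (simp add: fb.idm_C fb.cmp_C id_diagram_in bilin_id_left)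

lemma fb_idm_right: "X \<in> hom (fb_cat fbB) a b \<Longrightarrow> cmp (fb_cat fbB) a a b X (idm (fb_cat fbB) a) = X"
  by (elim fb.hom_CE) (simp add: fb.idm_C fb.cmp_C id_diagram_in bilin_id_right)

text \<open>\<open>E b\<close> is the image of an identity, so functoriality turns the identity law
  into invariance under the idempotents. This is what membership in a hom space of the envelope asks
  for.\<close>

lemma E_left: "X \<in> hom (fb_cat fbB) a b \<Longrightarrow> cmp (cat S \<alpha>) a b b (E b) (Fm a b X) = Fm a b X"
  using Fm_cmp[of X a b "idm (fb_cat fbB) b" b] fb.idm_hom by (simp add: Fm_idm fb_idm_left)

lemma E_right: "X \<in> hom (fb_cat fbB) a b \<Longrightarrow> cmp (cat S \<alpha>) a a b (Fm a b X) (E a) = Fm a b X"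
  using Fm_cmp[of "idm (fb_cat fbB) a" a a X b] fb.idm_hom by (simp add: Fm_idm fb_idm_right)

lemma E_idem: "cmp (cat S \<alpha>) a a a (E a) (E a) = E a"
  using E_left[OF fb.idm_hom] by (simp add: Fm_idm)

lemma kC_hom: "hom kC ([a], mat1 (E a)) ([b], mat1 (E b)) =
    mat1 ` {m \<in> hom (cat S \<alpha>) a b. cmp (cat S \<alpha>) a b b (E b) (cmp (cat S \<alpha>) a a b m (E a)) = m}"
  by (rule kar_hom[OF E_in E_in])

lemma Fm_in_kC: "X \<in> hom (fb_cat fbB) a b \<Longrightarrow> mat1 (Fm a b X) \<in> hom kC ([a], mat1 (E a)) ([b], mat1 (E b))"
  unfolding kC_hom by (auto simp: Fm_in E_right E_left)

lemma E_append: "E (a @ b) = tensm (cat S \<alpha>) a a b b (E a) (E b)"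
proof -
  have "Phi (id_diagram (a @ b)) = bilin (juxtapose (length a) (length a)) (Phi (id_diagram a)) (Phi (id_diagram b))"
    by (simp add: id_diagram_append juxtapose_def Phi_plus Phi_rename bilin_juxtapose)
  then show ?thesis by (simp add: E_def cob.tensm_C Phi_id_in)
qed

lemma F0_linear: "linear_functor (fb_cat fbB) kC F0"
  unfolding linear_functor_def F0_def
proof (simp add: kar_simps Fm_in_kC Fm_idm, intro conjI allI ballI)
  show "([a], mat1 (E a)) \<in> obj kC" for a using kar_obj_iff[OF E_in] E_idem by blast
next
  fix a b c X Y assume XY: "X \<in> hom (fb_cat fbB) a b" "Y \<in> hom (fb_cat fbB) b c"
  show "mat1 (Fm a c (cmp (fb_cat fbB) a b c Y X)) = cmp kC ([a], mat1 (E a)) ([b], mat1 (E b)) ([c], mat1 (E c)) (mat1 (Fm b c Y)) (mat1 (Fm a b X))"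
    using kar_cmp[OF Fm_in[OF XY(1)] Fm_in[OF XY(2)]] by (simp add: Fm_cmp[OF XY])
next
  fix a b X Y assume XY: "X \<in> hom (fb_cat fbB) a b" "Y \<in> hom (fb_cat fbB) a b"
  then show "Fm a b (plusm (fb_cat fbB) a b X Y) = plusm (cat S \<alpha>) a b (Fm a b X) (Fm a b Y)"
    by (elim fb.hom_CE) (simp add: fb.plusm_C Fm_cls cob.plusm_C ext_add)
next
  fix a b X r assume "X \<in> hom (fb_cat fbB) a b"
  then show "Fm a b (scalm (fb_cat fbB) a b r X) = scalm (cat S \<alpha>) a b r (Fm a b X)"
    by (elim fb.hom_CE) (simp add: fb.scalm_C Fm_cls cob.scalm_C ext_scale)
qed

lemma F0_monoidal: "monoidal_functor (fb_cat fbB) kC F0"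
  unfolding monoidal_functor_def
proof (intro conjI F0_linear)
  show "on_obj F0 (unito (fb_cat fbB)) = unito kC"
    by (simp add: F0_def kar_simps E_def cob.idm_C)
  show "\<forall>a\<in>obj (fb_cat fbB). \<forall>b\<in>obj (fb_cat fbB).
    on_obj F0 (tenso (fb_cat fbB) a b) = tenso kC (on_obj F0 a) (on_obj F0 b)"
    by (simp add: F0_def kar_simps E_append)
  show "\<forall>a\<in>obj (fb_cat fbB). \<forall>a'\<in>obj (fb_cat fbB). \<forall>b\<in>obj (fb_cat fbB). \<forall>b'\<in>obj (fb_cat fbB).
     \<forall>x\<in>hom (fb_cat fbB) a a'. \<forall>y\<in>hom (fb_cat fbB) b b'.
        on_hom F0 (tenso (fb_cat fbB) a b) (tenso (fb_cat fbB) a' b') (tensm (fb_cat fbB) a a' b b' x y) =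
        tensm kC (on_obj F0 a) (on_obj F0 a') (on_obj F0 b) (on_obj F0 b') (on_hom F0 a a' x) (on_hom F0 b b' y)"
  proof (intro ballI)
    fix a a' b b' X Y assume "X \<in> hom (fb_cat fbB) a a'" "Y \<in> hom (fb_cat fbB) b b'"
    then show "on_hom F0 (tenso (fb_cat fbB) a b) (tenso (fb_cat fbB) a' b') (tensm (fb_cat fbB) a a' b b' X Y) =
        tensm kC (on_obj F0 a) (on_obj F0 a') (on_obj F0 b) (on_obj F0 b') (on_hom F0 a a' X) (on_hom F0 b b' Y)"
      by (elim fb.hom_CE) (simp add: F0_def kar_simps fb.tensm_C Fm_cls PhiL_in cob.tensm_C PhiL_mult PhiL_cren bilin_juxtapose)
  qed
qed

text \<open>The symmetry of the envelope is the swap composed with the idempotent. Stacking the swap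
  only renames the top ends of the strands of the idempotent, and the result is the image of the
  labelled swap.\<close>

lemma F0_symmetry: "preserves_symmetry (fb_cat fbB) kC F0"
  unfolding preserves_symmetry_def
proof (intro ballI)
  fix a b
  let ?z = "Phi (id_diagram (a @ b))"
  have "symm kC (on_obj F0 a) (on_obj F0 b) =
    mat1 (cmp (cat S \<alpha>) (a @ b) (a @ b) (b @ a) (symm (cat S \<alpha>) a b) (E (a @ b)))"
    by (simp add: F0_def kar_symm[OF E_in E_in] E_append)
  also have "\<dots> = mat1 (cls S \<alpha> (a @ b) (b @ a) (bilin (stack (length (a @ b))) (gen (swap_diagram a b)) ?z))"
    unfolding E_def cob.symm_C by (subst cob.cmp_C[OF Phi_id_in]) (simp_all add: swap_diagram_in)
  also have "bilin (stack (length (a @ b))) (gen (swap_diagram a b)) ?z = cren (topswap (length a) (length b)) ?z"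
    by (rule bilin_swap[OF Phi_id_in])
  also have "\<dots> = Phi (swap_diagram a b)"
    by (simp add: swap_diagram_eq Phi_rename)
  finally show "on_hom F0 (tenso (fb_cat fbB) a b) (tenso (fb_cat fbB) b a) (symm (fb_cat fbB) a b) =
      symm kC (on_obj F0 a) (on_obj F0 b)"
    by (simp add: F0_def fb.symm_C Fm_cls)
qed

lemma F0_arcs:
  assumes "heads a b = {h}" "tails a b = {t}" "X \<in> K"
  shows "on_hom F0 a b (fb_arc fbB h t a b X) = mat1 (bend_arc S \<alpha> h t a b X)"
proof -
  have ht: "h \<noteq> t" using heads_tails_disjoint[of a b] assms by auto
  have "bend_arc S \<alpha> h t a b X = cls S \<alpha> a b (cren (sub h t) (rep X))"
    using bend_arc_cls[OF Kc_in[OF rep_Kc[OF assms(3)]] assms(1,2), of \<alpha>] cls_rep[OF assms(3)] by simp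
  also have "\<dots> = cls S \<alpha> a b (cren (sub h t) (rho [X]))"
    using ceq_cren[OF ceq_sym[OF rho_single[OF assms(3)]], of "sub h t"] ht
    unfolding cls_eq_ceq by (simp add: assms)
  finally show ?thesis by (simp add: F0_def fb_arc_def Fm_cls)
qed

lemma F0_objects: "on_obj F0 [Pos] = X0_pos S \<alpha>" "on_obj F0 [Neg] = X0_neg S \<alpha>"
  by (simp_all add: F0_def X0_pos_def X0_neg_def kar_obj_def E_def id_diagram_single arc_def
      one_K_eps to_end_pos_cls to_end_neg_cls eps_in)

end

section \<open>Fullness and the kernel\<close>

text \<open>In each product the point \<open>p\<close> is the only outer point of the factor
  \<open>v\<close>, so it lies on a half-interval. The set \<open>P\<close> records where such
  points may sit, which decides the idempotent that kills the term.\<close>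

inductive_set halves :: "'s set \<Rightarrow> 'p set \<Rightarrow> 'p set \<Rightarrow> 'p set \<Rightarrow> (('p, 's) diagram \<Rightarrow>\<^sub>0 'k::field) set"
  for S P H T where
  zero: "0 \<in> halves S P H T"
| plus: "x \<in> halves S P H T \<Longrightarrow> y \<in> halves S P H T \<Longrightarrow> x + y \<in> halves S P H T"
| head: "p \<in> P \<Longrightarrow> p \<in> H \<Longrightarrow> v \<in> dcombs False S {p} {} \<Longrightarrow> z \<in> dcombs False S (H - {p}) T \<Longrightarrow> v * z \<in> halves S P H T"
| tail: "p \<in> P \<Longrightarrow> p \<in> T \<Longrightarrow> v \<in> dcombs False S {} {p} \<Longrightarrow> z \<in> dcombs False S H (T - {p}) \<Longrightarrow> v * z \<in> halves S P H T"

lemma halves_in: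
  assumes "x \<in> halves S P H T" "H \<inter> T = {}"
  shows "x \<in> dcombs False S H T"
  using assms(1)
proof (induct rule: halves.induct)
  case (head p v z)
  have "v * z \<in> dcombs False S ({p} \<union> (H - {p})) ({} \<union> T)"
    by (rule mult_in[OF head(3,4)]) (use head assms(2) in auto)
  then show ?case using head(2) by (simp add: insert_absorb)
next
  case (tail p v z)
  have "v * z \<in> dcombs False S ({} \<union> H) ({p} \<union> (T - {p}))"
    by (rule mult_in[OF tail(3,4)]) (use tail assms(2) in auto)
  then show ?case using tail(2) by (simp add: insert_absorb)
qed auto

lemma halves_scale: "x \<in> halves S P H T \<Longrightarrow> scale r x \<in> halves S P H T"
proof (induct rule: halves.induct)
  case (head p v z)
  then show ?case using halves.head[of p P H "scale r v" S z T] by (simp add: scale_mult_left combs_scale)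
next
  case (tail p v z)
  then show ?case using halves.tail[of p P T "scale r v" S z H] by (simp add: scale_mult_left combs_scale)
qed (auto simp: scale_add intro: halves.intros)

lemma halves_mult:
  assumes x: "x \<in> halves S P H T" and y: "y \<in> dcombs False S H' T'" and d: "(H \<union> T) \<inter> (H' \<union> T') = {}"
  shows "x * y \<in> halves S P (H \<union> H') (T \<union> T')"
  using x
proof (induct rule: halves.induct)
  case (head p v z)
  have e: "H - {p} \<union> H' = H \<union> H' - {p}" using head(2) d by auto
  have "z * y \<in> dcombs False S (H - {p} \<union> H') (T \<union> T')" by (rule mult_in[OF head(4) y]) (use d in auto)
  with head show ?case unfolding e mult.assoc by (intro halves.head) auto
next
  case (tail p v z)
  have e: "T - {p} \<union> T' = T \<union> T' - {p}" using tail(2) d by auto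
  have "z * y \<in> dcombs False S (H \<union> H') (T - {p} \<union> T')" by (rule mult_in[OF tail(4) y]) (use d in auto)
  with tail show ?case unfolding e mult.assoc by (intro halves.tail) auto
qed (auto simp: distrib_right intro: halves.intros)

lemma halves_cren:
  assumes x: "x \<in> halves S P H T" and i: "inj_on f (H \<union> T)"
  shows "cren f x \<in> halves S (f ` P) (f ` H) (f ` T)"
  using x
proof (induct rule: halves.induct)
  case (head p v z)
  have e: "f ` (H - {p}) = f ` H - {f p}"
    using head(2) i by (auto simp: inj_on_def)
  have "cren f v \<in> dcombs False S {f p} {}" using cren_in[OF head(3), of f] by simp
  moreover have "cren f z \<in> dcombs False S (f ` H - {f p}) (f ` T)"
    unfolding e[symmetric] by (rule cren_in[OF head(4)]) (rule inj_on_subset[OF i], auto)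
  ultimately show ?case unfolding cren_mult using head(1,2) by (intro halves.head) auto
next
  case (tail p v z)
  have e: "f ` (T - {p}) = f ` T - {f p}"
    using tail(2) i by (auto simp: inj_on_def)
  have "cren f v \<in> dcombs False S {} {f p}" using cren_in[OF tail(3), of f] by simp
  moreover have "cren f z \<in> dcombs False S (f ` H) (f ` T - {f p})"
    unfolding e[symmetric] by (rule cren_in[OF tail(4)]) (rule inj_on_subset[OF i], auto)
  ultimately show ?case unfolding cren_mult using tail(1,2) by (intro halves.tail) auto
qed (auto simp: lin_add intro: halves.intros)

lemma halves_mono: "x \<in> halves S P H T \<Longrightarrow> P \<subseteq> P' \<Longrightarrow> x \<in> halves S P' H T"
  by (induct rule: halves.induct) (auto intro: halves.intros)

text \<open>Separates terms broken at the top, killed by the idempotent of the target, from those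
  broken at the bottom, killed by that of the source.\<close>

lemma halves_split:
  "x \<in> halves S (P \<union> P') H T \<Longrightarrow> \<exists>y\<in>halves S P H T. \<exists>z\<in>halves S P' H T. x = y + z"
proof (induct rule: halves.induct)
  case zero
  then show ?case using halves.zero by force
next
  case (plus x x')
  then obtain y z y' z' where "y \<in> halves S P H T" "z \<in> halves S P' H T" "x = y + z"
    "y' \<in> halves S P H T" "z' \<in> halves S P' H T" "x' = y' + z'" by blast
  then show ?case by (intro bexI[of _ "y + y'"] bexI[of _ "z + z'"]) (auto simp: algebra_simps intro: halves.plus)
next
  case (head p v z)
  from head(1) show ?case
  proof
    assume "p \<in> P"
    from halves.head[OF this head(2-4)] show ?thesis using halves.zero by force
  next
    assume "p \<in> P'"
    from halves.head[OF this head(2-4)] show ?thesis using halves.zero by force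
  qed
next
  case (tail p v z)
  from tail(1) show ?case
  proof
    assume "p \<in> P"
    from halves.tail[OF this tail(2-4)] show ?thesis using halves.zero by force
  next
    assume "p \<in> P'"
    from halves.tail[OF this tail(2-4)] show ?thesis using halves.zero by force
  qed
qed

lemma okp_remove:
  assumes o: "okp H T ps" and p: "p \<notin> pts ps"
  shows "okp (H - {p}) (T - {p}) ps"
  unfolding okp_def
proof (intro conjI ballI)
  show "(H - {p}) \<inter> (T - {p}) = {}" using okp_disjoint[OF o] by auto
  show "distinct (map fst ps @ map snd ps)" using o by (simp add: okp_def)
  fix x assume x: "x \<in> set ps"
  obtain a b where ab: "x = (a, b)" by (cases x)
  have "a \<in> pts ps" "b \<in> pts ps"
    unfolding pts_def using imageI[OF x, of fst] imageI[OF x, of snd] by (simp_all add: ab)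
  then have "a \<noteq> p" "b \<noteq> p" using p by blast+
  moreover have "opp H T a b" using o x by (auto simp: okp_def ab)
  ultimately show "case x of (p', q') \<Rightarrow> opp (H - {p}) (T - {p}) p' q'" by (simp add: ab opp_def)
qed

lemma Diff_right_commute: "A - {p} - B = A - B - {p}"
  by auto

text \<open>The outer point of the half-interval is not glued, so its factor is pulled out and
  survives unchanged.\<close>

lemma halves_cglues:
  assumes x: "x \<in> halves S P H T" and o: "okp H T ps" and P: "P \<inter> pts ps = {}"
  shows "cglues ps x \<in> halves S P (H - pts ps) (T - pts ps)"
  using x
proof (induct rule: halves.induct)
  case (head p v z)
  have p: "p \<notin> pts ps" "p \<notin> T" using head P okp_disjoint[OF o] by auto
  have o': "okp (H - {p}) T ps" using okp_remove[OF o p(1)] p(2) by simp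
  have "cglues ps (v * z) = v * cglues ps z"
    by (rule cglues_mult_right[OF head(4) o' head(3)]) (use p in auto)
  moreover have "cglues ps z \<in> dcombs False S (H - pts ps - {p}) (T - pts ps)"
    using cglues_in[OF head(4) o'] Diff_right_commute[of H p "pts ps"] by simp
  ultimately show ?case using halves.head[OF head(1) _ head(3), of "H - pts ps" "cglues ps z" "T - pts ps"] head(2) p(1)
    by simp
next
  case (tail p v z)
  have p: "p \<notin> pts ps" "p \<notin> H" using tail P okp_disjoint[OF o] by auto
  have o': "okp H (T - {p}) ps" using okp_remove[OF o p(1)] p(2) by simp
  have "cglues ps (v * z) = v * cglues ps z"
    by (rule cglues_mult_right[OF tail(4) o' tail(3)]) (use p in auto)
  moreover have "cglues ps z \<in> dcombs False S (H - pts ps) (T - pts ps - {p})"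
    using cglues_in[OF tail(4) o'] Diff_right_commute[of T p "pts ps"] by simp
  ultimately show ?case using halves.tail[OF tail(1) _ tail(3), of "T - pts ps" "cglues ps z" "H - pts ps"] tail(2) p(1)
    by simp
qed (auto simp: lin_add intro: halves.intros)

lemma halves_stack_top:
  assumes x: "x \<in> halves S (range Top) (heads b c) (tails b c)" and y: "y \<in> dcombs False S (heads a b) (tails a b)"
  shows "bilin (stack (length b)) x y \<in> halves S (range Top) (heads a c) (tails a c)"
proof -
  have "cren Inr x \<in> halves S (Inr ` range Top) (Inr ` heads b c) (Inr ` tails b c)"
    by (rule halves_cren[OF x]) simp
  moreover have "cren Inl y \<in> dcombs False S (Inl ` heads a b) (Inl ` tails a b)"
    by (rule cren_in[OF y]) simp
  ultimately have "cren Inr x * cren Inl y \<in> halves S (Inr ` range Top) (Inr ` heads b c \<union> Inl ` heads a b) (Inr ` tails b c \<union> Inl ` tails a b)"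
    by (rule halves_mult) auto
  then have "cren Inl y * cren Inr x \<in> halves S (Inr ` range Top) (sH a b c) (sT a b c)"
    by (simp only: mult.commute Un_commute)
  from halves_cglues[OF this okp_stk]
  have "cglues (stk (length b)) (cren Inl y * cren Inr x) \<in> halves S (Inr ` range Top) (sH a b c - pts (stk (length b))) (sT a b c - pts (stk (length b)))"
    by (auto simp: pts_stk)
  from halves_cren[OF this stk_both(1)]
  show ?thesis unfolding stk_both bilin_stack by (rule halves_mono) auto
qed

context frob_eval
begin

text \<open>Multiply the arc on both sides by the undecorated arc, written as \<open>eps\<close>
  plus rank-one terms. The part between two copies of \<open>eps\<close> lies in the kernel algebra;
  every other term breaks into two half-intervals.\<close>

lemma arc_decomp:
  assumes "set w \<subseteq> S"
  shows "\<exists>k\<in>Kc S \<alpha>. \<exists>j\<in>halves S UNIV {T0} {T1}. gen {#Seg (Some T0) w (Some T1)#} = k + j"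
proof -
  let ?a = "gen {#Seg (Some T0) w (Some T1)#} :: ('s, 'k) comb"
  have a: "?a \<in> hA S" unfolding combs_gen using assms by (simp add: dgs_add)
  let ?y = "mu eps ?a" and ?k = "mu (mu eps ?a) eps"
  have y: "?y \<in> Kc S \<alpha>" by (rule Kc_mu[OF eps_Kc a])
  have yA: "?y \<in> hA S" by (rule Kc_in[OF y])
  have u: "unit_arc = eps + (\<Sum>i<n. bx i * bw i)" by (simp add: eps_def)
  have "?a = mu unit_arc ?a" by (rule mu_unit_left[OF a triv(2), symmetric])
  also have "\<dots> = ?y + (\<Sum>i<n. bx i * mu (bw i) ?a)"
    unfolding u mu_add_left mu_sum_left using mu_rank1_left[OF b_in a triv(2)] by simp
  also have "?y = mu ?y unit_arc" by (rule mu_unit_right[OF yA triv(1), symmetric])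
  also have "\<dots> = ?k + (\<Sum>i<n. mu ?y (bx i) * bw i)"
    unfolding u mu_add_right mu_sum_right using mu_rank1_right[OF b_in yA triv(1)] by simp
  finally have e: "?a = ?k + ((\<Sum>i<n. mu ?y (bx i) * bw i) + (\<Sum>i<n. bx i * mu (bw i) ?a))"
    by (simp only: add.assoc)
  have s: "sum f {..<n} \<in> halves S UNIV {T0} {T1}" if "\<And>i. i < n \<Longrightarrow> f i \<in> halves S UNIV {T0} {T1}" for f :: "nat \<Rightarrow> ('s, 'k) comb"
    using that by (induct n) (auto intro: halves.intros)
  have h: "v * z \<in> halves S UNIV {T0} {T1}" if "v \<in> hv S" "z \<in> hw S" for v z :: "('s, 'k) comb"
    using halves.head[of T0 UNIV "{T0}" v S z "{T1}"] that by simp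
  have "(\<Sum>i<n. mu ?y (bx i) * bw i) + (\<Sum>i<n. bx i * mu (bw i) ?a) \<in> halves S UNIV {T0} {T1}"
    by (intro halves.plus s h b_in mu_in[OF triv(1,4) yA] mu_in[OF triv(3,2) _ a])
  moreover have "?k \<in> Kc S \<alpha>" by (rule Kc_mu[OF y eps_in])
  ultimately show ?thesis using e by blast
qed

text \<open>Component by component: a closed one becomes a scalar, a half-interval puts the entire
  diagram among the broken terms, and an arc is split by \<open>arc_decomp\<close> into one labelled
  arc and broken terms.\<close>

lemma decomp:
  fixes D :: "('p, 's) diagram"
  shows "D \<in> dgs False S H T \<Longrightarrow> \<exists>x\<in>dcombs True K H T. \<exists>j\<in>halves S UNIV H T. ceq S \<alpha> H T (gen D) (PhiL x + j)"
proof (induct D arbitrary: H T)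
  case empty
  have e: "H = {}" "T = {}" using empty by auto
  let ?e = "gen {#} :: ('p, ('s, 'k) comb set) diagram \<Rightarrow>\<^sub>0 'k"
  have "PhiL ?e = gen {#}" by (simp only: ext_gen Phi_empty) (simp only: gen_0)
  then have "ceq S \<alpha> H T (gen {#}) (PhiL ?e + 0)" by (simp only: add_0_right ceq_refl)
  moreover have "?e \<in> dcombs True K H T" by (simp only: combs_gen dgs_empty e)
  ultimately show ?case using halves.zero by blast
next
  case (add c D)
  have HT: "H \<inter> T = {}" and l: "letters c \<subseteq> S" using add(2) by (auto simp: dgs_add)
  have g: "gen (add_mset c D) = gen {#c#} * gen D" unfolding gen_mult_gen by simp
  have closed: ?case if c: "head_end c = {#}" "tail_end c = {#}"
  proof -
    have D: "D \<in> dgs False S H T" using add(2) c by (simp add: dgs_add)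
    from add(1)[OF this] obtain x j where x: "x \<in> dcombs True K H T" and j: "j \<in> halves S UNIV H T"
      and q: "ceq S \<alpha> H T (gen D) (PhiL x + j)" by blast
    have z: "gen {#c#} \<in> dcombs False S {} {}" unfolding combs_gen using c l by (simp add: dgs_add)
    let ?r = "eval_comb \<alpha> (gen {#c#})"
    have "ceq S \<alpha> H T (gen (add_mset c D)) (scale ?r (gen D))"
      unfolding g ceq_def using closed_scalar[of "gen D" S H T "gen {#c#}" \<alpha>] D z
      by (simp add: mult.commute del: mult_single)
    also have "ceq S \<alpha> H T (scale ?r (gen D)) (PhiL (scale ?r x) + scale ?r j)"
      using ceq_scale[OF q, of ?r] by (simp add: scale_add ext_scale)
    finally show ?thesis using combs_scale[OF x] halves_scale[OF j] by blast
  qed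
  show ?case
  proof (cases c rule: no_inner.cases)
    case (2 e)
    then show ?thesis using closed by simp
  next
    case (1 p w q)
    show ?thesis
    proof (cases p; cases q)
      assume "p = None" "q = None"
      then show ?thesis using 1 closed by simp
    next
      fix t assume pq: "p = None" "q = Some t"
      have t: "t \<in> T" and D: "D \<in> dgs False S H (T - {t})" using add(2) 1 pq by (auto simp: dgs_add)
      have "gen {#c#} \<in> dcombs False S {} {t}" unfolding combs_gen using 1 pq l by (simp add: dgs_add)
      from halves.tail[OF UNIV_I t this, of "gen D" H] D have "gen (add_mset c D) \<in> halves S UNIV H T" unfolding g by simp
      then have "\<exists>j\<in>halves S UNIV H T. ceq S \<alpha> H T (gen (add_mset c D)) (PhiL 0 + j)"
        by (intro bexI[of _ "gen (add_mset c D)"]) simp_all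
      then show ?thesis using combs_0 by blast
    next
      fix h assume pq: "p = Some h" "q = None"
      have h: "h \<in> H" and D: "D \<in> dgs False S (H - {h}) T" using add(2) 1 pq by (auto simp: dgs_add)
      have "gen {#c#} \<in> dcombs False S {h} {}" unfolding combs_gen using 1 pq l by (simp add: dgs_add)
      from halves.head[OF UNIV_I h this, of "gen D" T] D have "gen (add_mset c D) \<in> halves S UNIV H T" unfolding g by simp
      then have "\<exists>j\<in>halves S UNIV H T. ceq S \<alpha> H T (gen (add_mset c D)) (PhiL 0 + j)"
        by (intro bexI[of _ "gen (add_mset c D)"]) simp_all
      then show ?thesis using combs_0 by blast
    next
      fix h t assume pq: "p = Some h" "q = Some t"
      have ht: "h \<in> H" "t \<in> T" "h \<noteq> t" and D: "D \<in> dgs False S (H - {h}) (T - {t})"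
        using add(2) 1 pq by (auto simp: dgs_add)
      have U: "{h} \<union> (H - {h}) = H" "{t} \<union> (T - {t}) = T" using ht by auto
      have dis: "({h} \<union> {t}) \<inter> (H - {h} \<union> (T - {t})) = {}" using ht HT by auto
      have dis': "(H - {h} \<union> (T - {t})) \<inter> ({h} \<union> {t}) = {}" using dis by (simp only: Int_commute)
      from add(1)[OF D] obtain x j where x: "x \<in> dcombs True K (H - {h}) (T - {t})" and j: "j \<in> halves S UNIV (H - {h}) (T - {t})"
        and xj: "ceq S \<alpha> (H - {h}) (T - {t}) (gen D) (PhiL x + j)" by blast
      have "set w \<subseteq> S" using l 1 by simp
      from arc_decomp[OF this] obtain k i where k: "k \<in> Kc S \<alpha>" and i: "i \<in> halves S UNIV {T0} {T1}"
        and ki: "gen {#Seg (Some T0) w (Some T1)#} = k + i" by blast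
      let ?R = "cren (sub h t)"
      have c: "gen {#c#} = ?R k + ?R i"
        unfolding lin_add[symmetric] ki[symmetric] by (simp add: 1 pq)
      have cin: "gen {#c#} \<in> dcombs False S {h} {t}" unfolding combs_gen using 1 pq l ht by (simp add: dgs_add)
      have "inj_on (sub h t) ({T0} \<union> {T1})" using ht by (auto simp: inj_on_def)
      from halves_cren[OF i this] have i': "?R i \<in> halves S UNIV {h} {t}" by (auto intro: halves_mono)
      let ?X = "cls S \<alpha> [] [Pos, Neg] k"
      have X: "?X \<in> K" by (rule cls_K[OF k])
      have "eqA (rho [?X]) k" using ceq_trans[OF rho_single[OF X] rep_cls[OF k]] .
      from ceq_cren[OF ceq_sym[OF this], of "sub h t"] ht
      have k': "ceq S \<alpha> {h} {t} (?R k) (Phi {#Seg (Some h) [?X] (Some t)#})" by (simp add: inj_on_def)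
      have dX: "{#Seg (Some h) [?X] (Some t)#} \<in> dgs True K {h} {t}" using X ht by (simp add: dgs_add)
      let ?x = "gen {#Seg (Some h) [?X] (Some t)#} * x"
      have x': "?x \<in> dcombs True K H T"
        using mult_in[OF _ x dis, of "gen {#Seg (Some h) [?X] (Some t)#}"] dX unfolding U by simp
      \<comment> \<open>Collects the products in which something is broken: the broken part of the
        arc with the labelled rest, and the whole arc with the broken rest.\<close>
      let ?j = "?R i * PhiL x + gen {#c#} * j"
      have j': "?j \<in> halves S UNIV H T"
      proof (rule halves.plus)
        show "?R i * PhiL x \<in> halves S UNIV H T"
          using halves_mult[OF i' PhiL_in[OF x] dis] unfolding U .
        have "j * gen {#c#} \<in> halves S UNIV (H - {h} \<union> {h}) (T - {t} \<union> {t})"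
          by (rule halves_mult[OF j cin dis'])
        then show "gen {#c#} * j \<in> halves S UNIV H T" using ht by (simp add: mult.commute insert_absorb del: mult_single)
      qed
      have "ceq S \<alpha> H T (gen (add_mset c D)) (gen {#c#} * (PhiL x + j))"
        using ceq_mult2[OF xj cin dis'] unfolding g U .
      also have "gen {#c#} * (PhiL x + j) = ?R k * PhiL x + ?j"
        by (subst distrib_left, subst c) (simp add: distrib_right)
      also have "ceq S \<alpha> H T (?R k * PhiL x + ?j) (PhiL ?x + ?j)"
        using ceq_mult1[OF k' PhiL_in[OF x] dis] unfolding U PhiL_mult ext_gen by (rule ceq_add) simp
      finally show ?thesis using x' j' by blast
    qed
  qed
qed

lemma decomp_comb:
  assumes "y \<in> dcombs False S H T"
  shows "\<exists>x\<in>dcombs True K H T. \<exists>j\<in>halves S UNIV H T. ceq S \<alpha> H T y (PhiL x + j)"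
  using assms
proof (induct rule: comb_induct)
  case zero
  have "ceq S \<alpha> H T 0 (PhiL 0 + 0)" by simp
  then show ?case using halves.zero combs_0 by blast
next
  case (gen D)
  then show ?case by (rule decomp)
next
  case (add y y')
  then obtain x j x' j' where *: "x \<in> dcombs True K H T" "j \<in> halves S UNIV H T" "ceq S \<alpha> H T y (PhiL x + j)"
    "x' \<in> dcombs True K H T" "j' \<in> halves S UNIV H T" "ceq S \<alpha> H T y' (PhiL x' + j')" by blast
  have e: "(PhiL x + j) + (PhiL x' + j') = PhiL (x + x') + (j + j')" by (simp add: ext_add algebra_simps)
  have "ceq S \<alpha> H T (y + y') (PhiL (x + x') + (j + j'))" using ceq_add[OF *(3,6)] unfolding e .
  then show ?case using * by (blast intro: halves.plus combs_add)
next
  case (scale r y)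
  then obtain x j where *: "x \<in> dcombs True K H T" "j \<in> halves S UNIV H T" "ceq S \<alpha> H T y (PhiL x + j)" by blast
  from ceq_scale[OF *(3), of r] have "ceq S \<alpha> H T (scale r y) (PhiL (scale r x) + scale r j)"
    by (simp add: ext_scale scale_add)
  then show ?case using * by (blast intro: halves_scale combs_scale)
qed

text \<open>A labelled strand has its value in the kernel of the action on A(+), so it annihilates
  the half-interval joined to it. The point \<open>d\<close> stands for the absent tail of
  \<open>v\<close>.\<close>

lemma kill_head1:
  assumes v: "v \<in> dcombs False S {p} {}" and w: "set w \<subseteq> K" and d: "distinct [r, q, p, d]"
  shows "cglue p q (v * cren (sub r q) (rho w)) \<in> null S \<alpha> {r} {}"
proof -
  let ?v = "cren (\<lambda>_. T0) v"
  have v0: "?v \<in> hv S" using cren_in[OF v, of "\<lambda>_. T0"] by simp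
  have e: "cren (sub p d) ?v = v" unfolding cren_cren by (rule cren_cong_id[OF v]) simp
  have "cglue q p (cren (sub r q) (rho w) * cren (sub p d) ?v) = cren (sub r d) (mu (rho w) ?v)"
    by (rule mu_glue[OF triv(1,4) rho_in[OF w] v0 d])
  moreover have "mu (rho w) ?v \<in> null S \<alpha> {T0} {}" using rho_Kc[OF w] v0 by (simp add: Kc_def)
  from null_cren[OF this, of "sub r d"] have "cren (sub r d) (mu (rho w) ?v) \<in> null S \<alpha> {r} {}" by simp
  ultimately show ?thesis unfolding e by (simp add: mult.commute glue_sym[of p])
qed

lemma kill_tail1:
  assumes v: "v \<in> dcombs False S {} {p}" and w: "set w \<subseteq> K" and d: "distinct [d, p, q, r]"
  shows "cglue p q (v * cren (sub q r) (rho w)) \<in> null S \<alpha> {} {r}"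
proof -
  let ?v = "cren (\<lambda>_. T1) v"
  have v0: "?v \<in> hw S" using cren_in[OF v, of "\<lambda>_. T1"] by simp
  have e: "cren (sub d p) ?v = v" unfolding cren_cren by (rule cren_cong_id[OF v]) simp
  have "cglue p q (cren (sub d p) ?v * cren (sub q r) (rho w)) = cren (sub d r) (mu ?v (rho w))"
    by (rule mu_glue[OF triv(3,2) v0 rho_in[OF w] d])
  moreover have "mu ?v (rho w) \<in> null S \<alpha> {} {T1}" by (rule Kc_w[OF rho_Kc[OF w] v0])
  from null_cren[OF this, of "sub d r"] have "cren (sub d r) (mu ?v (rho w)) \<in> null S \<alpha> {} {r}" by simp
  ultimately show ?thesis unfolding e by simp
qed

text \<open>The gluings may be reordered so that the annihilating one comes first; the remaining
  ones preserve nullity.\<close>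

lemma cglues_first:
  assumes x: "x \<in> dcombs False S H T" and o: "okp H T ps" and m: "(p, q) \<in> set ps \<or> (q, p) \<in> set ps"
    and z: "cglue p q x \<in> null S \<alpha> (H - {p, q}) (T - {p, q})"
  shows "cglues ps x \<in> null S \<alpha> (H - pts ps) (T - pts ps)"
proof -
  have *: "cglues ps x \<in> null S \<alpha> (H - pts ps) (T - pts ps)"
    if "(p, q) \<in> set ps" "cglue p q x \<in> null S \<alpha> (H - {p, q}) (T - {p, q})" for p q
  proof -
    note pq = that
    obtain us vs where ps: "ps = us @ (p, q) # vs" using split_list[OF pq(1)] by blast
    let ?qs = "(p, q) # us @ vs"
    have m: "mset ?qs = mset ps" by (simp add: ps)
    have o': "okp H T ?qs" by (rule okp_perm[OF o m])
    have "cglues ps x = cglues ?qs x" by (rule cglues_perm[OF x o m, symmetric])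
    also have "\<dots> = cglues (us @ vs) (cglue p q x)" by (rule cglues_Cons)
    finally have "cglues ps x = cglues (us @ vs) (cglue p q x)" .
    moreover have "cglues (us @ vs) (cglue p q x) \<in> null S \<alpha> (H - {p, q} - pts (us @ vs)) (T - {p, q} - pts (us @ vs))"
      by (rule null_cglues[OF pq(2)]) (use o' in \<open>simp add: okp_Cons\<close>)
    moreover have "H - {p, q} - pts (us @ vs) = H - pts ps" "T - {p, q} - pts (us @ vs) = T - pts ps"
      by (auto simp: ps)
    ultimately show ?thesis by (simp only:)
  qed
  from m show ?thesis
  proof
    assume "(p, q) \<in> set ps" then show ?thesis using * z by blast
  next
    assume "(q, p) \<in> set ps" then show ?thesis using *[of q p] z by (simp add: glue_sym[of q] insert_commute)
  qed
qed

text \<open>The outer point of the half-interval is glued to a labelled strand; this single gluing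
  already gives a null combination, and it may be performed first. Infinitely many points are
  assumed in order to have a dummy name for the absent end.\<close>

lemma kill:
  fixes F :: "('p, ('s, 'k) comb set) diagram"
  assumes j: "j \<in> halves S P H T" and F: "F \<in> dgs True K H' T'" and d: "(H \<union> T) \<inter> (H' \<union> T') = {}"
    and o: "okp (H \<union> H') (T \<union> T') ps" and inf: "infinite (UNIV :: 'p set)"
    and m: "\<And>p. p \<in> P \<Longrightarrow> p \<in> H \<union> T \<Longrightarrow> \<exists>q\<in>H' \<union> T'. (p, q) \<in> set ps \<or> (q, p) \<in> set ps"
  shows "cglues ps (j * Phi F) \<in> null S \<alpha> (H \<union> H' - pts ps) (T \<union> T' - pts ps)"
  using j
proof (induct rule: halves.induct)
  case (head p v z)
  have HT: "(H \<union> H') \<inter> (T \<union> T') = {}" by (rule okp_disjoint[OF o])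
  obtain q where q: "q \<in> H' \<union> T'" and pq: "(p, q) \<in> set ps \<or> (q, p) \<in> set ps" using m head by blast
  have "opp (H \<union> H') (T \<union> T') p q" using pq o by (auto simp: okp_def opp_def)
  then have qT: "q \<in> T'" using HT q head(2) d by (auto simp: opp_def)
  from dgs_tailE[OF F qT] obtain r' w F0 where F0: "F = add_mset (Seg r' w (Some q)) F0" by blast
  then obtain r where r': "r' = Some r" using F by (auto simp: dgs_add)
  have w: "set w \<subseteq> K" and r: "r \<in> H'" and F0': "F0 \<in> dgs True K (H' - {r}) (T' - {q})"
    using F F0 r' by (auto simp: dgs_add)
  have "finite {r, q, p}" by simp
  from ex_new_if_finite[OF inf this] obtain e where e: "e \<notin> {r, q, p}" by blast
  have dist: "distinct [r, q, p, e]" using e r qT head(2) d HT by auto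
  have k: "cglue p q (v * cren (sub r q) (rho w)) \<in> null S \<alpha> {r} {}" by (rule kill_head1[OF head(3) w dist])
  have a: "cren (sub r q) (rho w) \<in> dcombs False S {r} {q}" by (rule hA_sub[OF rho_in[OF w]]) (use dist in auto)
  have va: "v * cren (sub r q) (rho w) \<in> dcombs False S ({p} \<union> {r}) ({} \<union> {q})"
    by (rule mult_in[OF head(3) a]) (use dist in auto)
  have zF: "z * Phi F0 \<in> dcombs False S (H - {p} \<union> (H' - {r})) (T \<union> (T' - {q}))"
    by (rule mult_in[OF head(4) Phi_in[OF F0']]) (use d in auto)
  have "v * z * Phi F = (v * cren (sub r q) (rho w)) * (z * Phi F0)"
    by (simp add: F0 r' mult.commute mult.left_commute)
  also have "cglue p q \<dots> = cglue p q (v * cren (sub r q) (rho w)) * (z * Phi F0)"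
    by (rule cglue_mult[OF va _ zF]) (use head(2) r qT d HT in \<open>auto simp: opp_def\<close>)
  also have "\<dots> \<in> null S \<alpha> ({r} \<union> (H - {p} \<union> (H' - {r}))) ({} \<union> (T \<union> (T' - {q})))"
    by (rule null_mult[OF k zF]) (use r d HT in auto)
  also have "{r} \<union> (H - {p} \<union> (H' - {r})) = H \<union> H' - {p, q}" using r head(2) qT d HT by auto
  also have "{} \<union> (T \<union> (T' - {q})) = T \<union> T' - {p, q}" using r head(2) qT d HT by auto
  finally have "cglue p q (v * z * Phi F) \<in> null S \<alpha> (H \<union> H' - {p, q}) (T \<union> T' - {p, q})" .
  moreover have "v * z * Phi F \<in> dcombs False S (H \<union> H') (T \<union> T')"
    by (rule mult_in[OF halves_in[OF halves.head[OF head(1-4)]] Phi_in[OF F] d]) (use HT in auto)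
  ultimately show ?case using cglues_first[OF _ o pq] by blast
next
  case (tail p v z)
  have HT: "(H \<union> H') \<inter> (T \<union> T') = {}" by (rule okp_disjoint[OF o])
  obtain q where q: "q \<in> H' \<union> T'" and pq: "(p, q) \<in> set ps \<or> (q, p) \<in> set ps" using m tail by blast
  have "opp (H \<union> H') (T \<union> T') p q" using pq o by (auto simp: okp_def opp_def)
  then have qT: "q \<in> H'" using HT q tail(2) d by (auto simp: opp_def)
  from dgs_headE[OF F qT] obtain r' w F0 where F0: "F = add_mset (Seg (Some q) w r') F0" by blast
  then obtain r where r': "r' = Some r" using F by (auto simp: dgs_add)
  have w: "set w \<subseteq> K" and r: "r \<in> T'" and F0': "F0 \<in> dgs True K (H' - {q}) (T' - {r})"
    using F F0 r' by (auto simp: dgs_add)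
  have "finite {r, q, p}" by simp
  from ex_new_if_finite[OF inf this] obtain e where e: "e \<notin> {r, q, p}" by blast
  have dist: "distinct [e, p, q, r]" using e r qT tail(2) d HT by auto
  have k: "cglue p q (v * cren (sub q r) (rho w)) \<in> null S \<alpha> {} {r}" by (rule kill_tail1[OF tail(3) w dist])
  have a: "cren (sub q r) (rho w) \<in> dcombs False S {q} {r}" by (rule hA_sub[OF rho_in[OF w]]) (use dist in auto)
  have va: "v * cren (sub q r) (rho w) \<in> dcombs False S ({} \<union> {q}) ({p} \<union> {r})"
    by (rule mult_in[OF tail(3) a]) (use dist in auto)
  have zF: "z * Phi F0 \<in> dcombs False S (H \<union> (H' - {q})) (T - {p} \<union> (T' - {r}))"
    by (rule mult_in[OF tail(4) Phi_in[OF F0']]) (use d in auto)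
  have "v * z * Phi F = (v * cren (sub q r) (rho w)) * (z * Phi F0)"
    by (simp add: F0 r' mult.commute mult.left_commute)
  also have "cglue p q \<dots> = cglue p q (v * cren (sub q r) (rho w)) * (z * Phi F0)"
    by (rule cglue_mult[OF va _ zF]) (use tail(2) r qT d HT in \<open>auto simp: opp_def\<close>)
  also have "\<dots> \<in> null S \<alpha> ({} \<union> (H \<union> (H' - {q}))) ({r} \<union> (T - {p} \<union> (T' - {r})))"
    by (rule null_mult[OF k zF]) (use r d HT in auto)
  also have "{} \<union> (H \<union> (H' - {q})) = H \<union> H' - {p, q}" using r tail(2) qT d HT by auto
  also have "{r} \<union> (T - {p} \<union> (T' - {r})) = T \<union> T' - {p, q}" using r tail(2) qT d HT by auto
  finally have "cglue p q (v * z * Phi F) \<in> null S \<alpha> (H \<union> H' - {p, q}) (T \<union> T' - {p, q})" .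
  moreover have "v * z * Phi F \<in> dcombs False S (H \<union> H') (T \<union> T')"
    by (rule mult_in[OF halves_in[OF halves.tail[OF tail(1-4)]] Phi_in[OF F] d]) (use HT in auto)
  ultimately show ?case using cglues_first[OF _ o pq] by blast
qed (auto simp: distrib_right lin_add)

end

lemma infinite_point: "infinite (UNIV :: (point + point) set)"
proof
  assume "finite (UNIV :: (point + point) set)"
  then have "finite (range (\<lambda>i. Inl (Top i) :: point + point))" by (rule finite_subset[rotated]) simp
  then show False using finite_imageD[of "\<lambda>i. Inl (Top i) :: point + point" UNIV] by (auto simp: inj_on_def)
qed

lemma pts_pair: "pts (map (\<lambda>p. (f p, g p)) L) = f ` set L \<union> g ` set L"
  by (simp add: pts_def image_image)

context frob_eval
begin

lemma kill_stack_top: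
  assumes j: "j \<in> halves S (range Top) (heads a b) (tails a b)"
  shows "bilin (stack (length b)) (Phi (id_diagram b)) j \<in> null S \<alpha> (heads a b) (tails a b)"
proof -
  let ?F = "rename Inr (id_diagram b) :: (point + point, ('s, 'k) comb set) diagram"
  have j': "cren Inl j \<in> halves S (Inl ` range Top) (Inl ` heads a b) (Inl ` tails a b)"
    by (rule halves_cren[OF j]) simp
  have F: "?F \<in> dgs True K (Inr ` heads b b) (Inr ` tails b b)"
    by (rule dgs_rename[OF id_diagram_in]) simp
  have "cglues (stk (length b)) (cren Inl j * Phi ?F) \<in> null S \<alpha> (sH a b b - pts (stk (length b))) (sT a b b - pts (stk (length b)))"
  proof (rule kill[OF j' F _ okp_stk infinite_point])
    fix p :: "point + point" assume "p \<in> Inl ` range Top" "p \<in> Inl ` heads a b \<union> Inl ` tails a b"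
    then obtain i where i: "p = Inl (Top i)" "i < length b"
      unfolding image_Un[symmetric] heads_tails_Un by auto
    have "Bot i \<in> heads b b \<union> tails b b" unfolding heads_tails_Un using i by auto
    then show "\<exists>q\<in>Inr ` heads b b \<union> Inr ` tails b b. (p, q) \<in> set (stk (length b)) \<or> (q, p) \<in> set (stk (length b))"
      using i by (intro bexI[of _ "Inr (Bot i)"]) (auto simp: stk_def)
  qed auto
  from null_cren[OF this stk_both(1)] show ?thesis
    unfolding stk_both bilin_stack by (simp only: Phi_rename)
qed

lemma kill_stack_bot:
  assumes j: "j \<in> halves S (range Bot) (heads a b) (tails a b)"
  shows "bilin (stack (length a)) j (Phi (id_diagram a)) \<in> null S \<alpha> (heads a b) (tails a b)"
proof -
  let ?F = "rename Inl (id_diagram a) :: (point + point, ('s, 'k) comb set) diagram"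
  have j': "cren Inr j \<in> halves S (Inr ` range Bot) (Inr ` heads a b) (Inr ` tails a b)"
    by (rule halves_cren[OF j]) simp
  have F: "?F \<in> dgs True K (Inl ` heads a a) (Inl ` tails a a)"
    by (rule dgs_rename[OF id_diagram_in]) simp
  have e: "Inr ` heads a b \<union> Inl ` heads a a = sH a a b" "Inr ` tails a b \<union> Inl ` tails a a = sT a a b" by auto
  have "cglues (stk (length a)) (cren Inr j * Phi ?F) \<in> null S \<alpha> (sH a a b - pts (stk (length a))) (sT a a b - pts (stk (length a)))"
    unfolding e[symmetric]
  proof (rule kill[OF j' F _ _ infinite_point], goal_cases)
    case 1
    then show ?case by auto
  next
    case 2
    show ?case unfolding e by (rule okp_stk)
  next
    case (3 p)
    then obtain i where i: "p = Inr (Bot i)" "i < length a"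
      unfolding image_Un[symmetric] heads_tails_Un by auto
    have "Top i \<in> heads a a \<union> tails a a" unfolding heads_tails_Un using i by auto
    then show ?case
      using i by (intro bexI[of _ "Inl (Top i)"]) (auto simp: stk_def)
  qed
  from null_cren[OF this stk_both(1)] show ?thesis
    unfolding stk_both bilin_stack by (simp only: Phi_rename mult.commute)
qed

text \<open>A morphism of the envelope equals its own compression by the idempotents. In its
  decomposition the labelled part is already compressed, the terms broken at the top die against
  \<open>E b\<close>, and those broken at the bottom die against \<open>E a\<close>.\<close>

lemma Fm_full:
  assumes m: "m \<in> hom (cat S \<alpha>) a b" and e: "cmp (cat S \<alpha>) a b b (E b) (cmp (cat S \<alpha>) a a b m (E a)) = m"
  shows "\<exists>X\<in>hom (fb_cat fbB) a b. Fm a b X = m"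
proof -
  obtain y where y: "y \<in> dcombs False S (heads a b) (tails a b)" and my: "m = cls S \<alpha> a b y"
    using m by (elim cob.hom_CE)
  from decomp_comb[OF y] obtain x j where x: "x \<in> dcombs True K (heads a b) (tails a b)"
    and j: "j \<in> halves S UNIV (heads a b) (tails a b)"
    and yx: "ceq S \<alpha> (heads a b) (tails a b) y (PhiL x + j)" by blast
  have "range Top \<union> range Bot = (UNIV :: point set)"
    by (auto simp: image_iff) (metis point.exhaust)
  then have "j \<in> halves S (range Top \<union> range Bot) (heads a b) (tails a b)" using j by simp
  from halves_split[OF this] obtain j1 j2 where j1: "j1 \<in> halves S (range Top) (heads a b) (tails a b)"
    and j2: "j2 \<in> halves S (range Bot) (heads a b) (tails a b)" and jj: "j = j1 + j2" by blast
  let ?ea = "Phi (id_diagram a)" and ?eb = "Phi (id_diagram b)"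
  let ?S = "\<lambda>z. bilin (stack (length b)) ?eb (bilin (stack (length a)) z ?ea)"
  have S_in: "bilin (stack (length a)) z ?ea \<in> dcombs False S (heads a b) (tails a b)" if "z \<in> dcombs False S (heads a b) (tails a b)" for z
    by (rule stack_in[OF Phi_id_in that])
  have S_cls: "cmp (cat S \<alpha>) a b b (E b) (cmp (cat S \<alpha>) a a b (cls S \<alpha> a b z) (E a)) = cls S \<alpha> a b (?S z)"
    if "z \<in> dcombs False S (heads a b) (tails a b)" for z
    unfolding E_def by (simp add: cob.cmp_C Phi_id_in that S_in)
  let ?X = "fb_cls fbB a b x"
  have X: "?X \<in> hom (fb_cat fbB) a b" using x by (rule fb.c_in_hom)
  have px: "PhiL x \<in> dcombs False S (heads a b) (tails a b)" by (rule PhiL_in[OF x])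
  have s1: "ceq S \<alpha> (heads a b) (tails a b) (?S (PhiL x)) (PhiL x)"
  proof -
    have "cls S \<alpha> a b (?S (PhiL x)) = cls S \<alpha> a b (PhiL x)"
      using S_cls[OF px] E_left[OF X] E_right[OF X] by (simp add: Fm_cls)
    then show ?thesis by (simp only: cls_eq_ceq)
  qed
  \<comment> \<open>Stacking on \<open>?ea\<close> changes the bottom only, so the terms stay broken
    at the top until \<open>?eb\<close> meets them.\<close>
  have s2: "?S j1 \<in> null S \<alpha> (heads a b) (tails a b)"
    by (rule kill_stack_top[OF halves_stack_top[OF j1 Phi_id_in]])
  have s3: "?S j2 \<in> null S \<alpha> (heads a b) (tails a b)"
    by (rule null_stack1[OF kill_stack_bot[OF j2] Phi_id_in])
  have "m = cls S \<alpha> a b (?S y)" using e S_cls[OF y] my by simp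
  also have "\<dots> = cls S \<alpha> a b (?S (PhiL x + j))"
    unfolding cls_eq_ceq ceq_def
    using null_stack1[OF null_stack2[OF Phi_id_in yx[unfolded ceq_def]] Phi_id_in]
    using bilin_add_left[of "stack (length a)" "y - (PhiL x + j)" "PhiL x + j" ?ea]
      bilin_add_right[of "stack (length b)" ?eb "bilin (stack (length a)) (y - (PhiL x + j)) ?ea" "bilin (stack (length a)) (PhiL x + j) ?ea"]
    by simp
  also have "?S (PhiL x + j) = ?S (PhiL x) + (?S j1 + ?S j2)"
    by (simp add: jj bilin_add_left bilin_add_right)
  also have "cls S \<alpha> a b (?S (PhiL x) + (?S j1 + ?S j2)) = cls S \<alpha> a b (PhiL x)"
    unfolding cls_eq_ceq using ceq_add[OF s1, of "?S j1 + ?S j2" 0] null_add[OF s2 s3] by (simp add: ceq_def)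
  finally have "m = Fm a b ?X" by (simp add: Fm_cls)
  then show ?thesis using X by blast
qed

lemma F0_full: "full_functor (fb_cat fbB) kC F0"
  unfolding full_functor_def
proof (intro ballI set_eqI iffI)
  fix a b M assume "M \<in> hom kC (on_obj F0 a) (on_obj F0 b)"
  then obtain m where "M = mat1 m" "m \<in> hom (cat S \<alpha>) a b"
    "cmp (cat S \<alpha>) a b b (E b) (cmp (cat S \<alpha>) a a b m (E a)) = m"
    by (auto simp: F0_def kC_hom)
  then show "M \<in> on_hom F0 a b ` hom (fb_cat fbB) a b" using Fm_full[of m a b] by (auto simp: F0_def)
qed (auto simp: F0_def Fm_in_kC)

lemma F0_is_F0: "is_F0 S \<alpha> F0"
  unfolding is_F0_def using F0_monoidal F0_full F0_symmetry F0_objects F0_arcs by blast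

text \<open>In the closure every outer point of the test morphism is glued to a strand of a labelled
  diagram, so a broken term is killed wherever its half-interval ends; hence \<open>UNIV\<close> as
  set of positions.\<close>

lemma kill_closure:
  assumes x: "x \<in> dcombs True K (heads a b) (tails a b)" and j: "j \<in> halves S UNIV (heads b a) (tails b a)"
  shows "eval_comb \<alpha> (lin (diagram_closure (length a)) (bilin (stack (length b)) j (PhiL x))) = 0"
  using x
proof (induct rule: comb_induct)
  case (gen F)
  let ?ps = "map (\<lambda>p. (Inl p, Inr p)) (map Top [0..<length b] @ map Bot [0..<length a]) :: ((point + point) \<times> (point + point)) list"
  let ?F = "rename Inl F :: (point + point, ('s, 'k) comb set) diagram"
  have jin: "j \<in> dcombs False S (heads b a) (tails b a)" by (rule halves_in[OF j]) simp
  have j': "cren Inr (cren flip j) \<in> halves S UNIV (Inr ` tails a b) (Inr ` heads a b)"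
  proof -
    have "cren flip j \<in> halves S UNIV (tails a b) (heads a b)"
      using halves_cren[OF j inj_flip] by (simp add: flip_heads halves_mono)
    from halves_cren[OF this, of Inr] show ?thesis by (auto intro: halves_mono)
  qed
  have F: "?F \<in> dgs True K (Inl ` heads a b) (Inl ` tails a b)" by (rule dgs_rename[OF gen]) simp
  have pt: "p \<in> heads a b \<union> tails a b \<longleftrightarrow> p \<in> set (map Top [0..<length b] @ map Bot [0..<length a])" for p
    by (auto simp: heads_tails_Un)
  have "cglues ?ps (cren Inr (cren flip j) * Phi ?F) \<in> null S \<alpha>
    (Inr ` tails a b \<union> Inl ` heads a b - pts ?ps) (Inr ` heads a b \<union> Inl ` tails a b - pts ?ps)"
  proof (rule kill[OF j' F _ _ infinite_point])
    show "okp (Inr ` tails a b \<union> Inl ` heads a b) (Inr ` heads a b \<union> Inl ` tails a b) ?ps"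
      unfolding okp_def
    proof (intro conjI ballI)
      show "(Inr ` tails a b \<union> Inl ` heads a b) \<inter> (Inr ` heads a b \<union> Inl ` tails a b) = {}"
        using heads_tails_disjoint[of a b] by (auto simp del: heads_tails_disjoint)
      show "distinct (map fst ?ps @ map snd ?ps)" by (auto simp: distinct_map inj_on_def)
      fix x assume "x \<in> set ?ps"
      then obtain p where p: "x = (Inl p, Inr p)" "p \<in> heads a b \<union> tails a b" unfolding pt by auto
      then show "case x of (p, q) \<Rightarrow> opp (Inr ` tails a b \<union> Inl ` heads a b) (Inr ` heads a b \<union> Inl ` tails a b) p q"
        by (auto simp: opp_def)
    qed
    fix p :: "point + point" assume "p \<in> Inr ` tails a b \<union> Inr ` heads a b"
    then obtain p' where p': "p = Inr p'" "p' \<in> heads a b \<union> tails a b" by auto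
    then have "(Inl p', Inr p') \<in> set ?ps" unfolding pt by auto
    then show "\<exists>q\<in>Inl ` heads a b \<union> Inl ` tails a b. (p, q) \<in> set ?ps \<or> (q, p) \<in> set ?ps"
      using p' by blast
  qed auto
  moreover have "Inr ` tails a b \<union> Inl ` heads a b - pts ?ps = {}" "Inr ` heads a b \<union> Inl ` tails a b - pts ?ps = {}"
  proof -
    have "pts ?ps = Inl ` (heads a b \<union> tails a b) \<union> Inr ` (heads a b \<union> tails a b)"
      unfolding pts_pair using pt by blast
    then show "Inr ` tails a b \<union> Inl ` heads a b - pts ?ps = {}" "Inr ` heads a b \<union> Inl ` tails a b - pts ?ps = {}" by auto
  qed
  ultimately have "eval_comb \<alpha> (cglues ?ps (cren Inr (cren flip j) * Phi ?F)) = 0"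
    by (simp only: null_closed)
  then show ?case
    unfolding ext_gen closure_stack[OF Phi_in[OF gen] jin] by (simp only: Phi_rename mult.commute)
qed (simp_all add: ext_add ext_scale bilin_add_right bilin_scale_right lin_add lin_scale eval_comb_add eval_comb_scale)

text \<open>A test cobordism is a labelled part plus broken terms modulo null combinations, and by
  \<open>kill_closure\<close> the broken terms contribute zero. So images of labelled combinations
  suffice as tests.\<close>

lemma PhiL_null_iff:
  assumes x: "x \<in> dcombs True K (heads a b) (tails a b)"
  shows "PhiL x \<in> null S \<alpha> (heads a b) (tails a b) \<longleftrightarrow> (\<forall>y\<in>dcombs True K (heads b a) (tails b a).
    eval_comb \<alpha> (lin (diagram_closure (length a)) (bilin (stack (length b)) (PhiL y) (PhiL x))) = 0)"
proof
  assume "PhiL x \<in> null S \<alpha> (heads a b) (tails a b)"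
  then show "\<forall>y\<in>dcombs True K (heads b a) (tails b a).
    eval_comb \<alpha> (lin (diagram_closure (length a)) (bilin (stack (length b)) (PhiL y) (PhiL x))) = 0"
    using null_closure[OF null_stack1[OF _ PhiL_in]] by (auto simp: null_closed)
next
  assume z: "\<forall>y\<in>dcombs True K (heads b a) (tails b a).
    eval_comb \<alpha> (lin (diagram_closure (length a)) (bilin (stack (length b)) (PhiL y) (PhiL x))) = 0"
  have px: "PhiL x \<in> dcombs False S (heads a b) (tails a b)" by (rule PhiL_in[OF x])
  have "eval_comb \<alpha> (lin (diagram_closure (length a)) (bilin (stack (length b)) (gen D) (PhiL x))) = 0"
    if D: "D \<in> cobs S b a" for D
  proof -
    have "gen D \<in> dcombs False S (heads b a) (tails b a)" using D by (simp add: cobs_eq)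
    from decomp_comb[OF this] obtain y j where y: "y \<in> dcombs True K (heads b a) (tails b a)"
      and j: "j \<in> halves S UNIV (heads b a) (tails b a)"
      and d: "ceq S \<alpha> (heads b a) (tails b a) (gen D) (PhiL y + j)" by blast
    have "lin (diagram_closure (length a)) (bilin (stack (length b)) (gen D - (PhiL y + j)) (PhiL x)) \<in> null S \<alpha> {} {}"
      by (rule null_closure[OF null_stack2[OF px d[unfolded ceq_def]]])
    then have n: "eval_comb \<alpha> (lin (diagram_closure (length a)) (bilin (stack (length b)) (gen D - (PhiL y + j)) (PhiL x))) = 0"
      by (simp only: null_closed)
    have "gen D = (gen D - (PhiL y + j)) + (PhiL y + j)" by simp
    then have "eval_comb \<alpha> (lin (diagram_closure (length a)) (bilin (stack (length b)) (gen D) (PhiL x))) =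
      eval_comb \<alpha> (lin (diagram_closure (length a)) (bilin (stack (length b)) (gen D - (PhiL y + j)) (PhiL x))) +
      (eval_comb \<alpha> (lin (diagram_closure (length a)) (bilin (stack (length b)) (PhiL y) (PhiL x))) +
       eval_comb \<alpha> (lin (diagram_closure (length a)) (bilin (stack (length b)) j (PhiL x))))"
      by (metis bilin_add_left eval_comb_add lin_add)
    then show ?thesis unfolding n kill_closure[OF x j] using z y by simp
  qed
  then have "PhiL x \<in> null_combs S \<alpha> a b"
    using px by (simp add: null_combs_def cob_cat_def free_cat_def combs_def cobs_eq)
  then show "PhiL x \<in> null S \<alpha> (heads a b) (tails a b)" by (simp only: null_combs_eq)
qed

text \<open>The labels are multiplied together until one is left, or a unit is inserted if there is
  none; then the circle relation removes the component.\<close>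

lemma closed_circle:
  "set w \<subseteq> K \<Longrightarrow> D \<in> dgs True K {} {} \<Longrightarrow> \<exists>r. gen (add_mset (Circ (cyc w)) D) - scale r (gen D) \<in> frK {} {}"
proof (induct "length w" arbitrary: w rule: less_induct)
  case less
  have C: "add_mset (Circ (cyc v)) D \<in> dgs True K {} {}" if "set v \<subseteq> K" for v
    using less(3) that by (simp add: dgs_add)
  have one: "fone fbB \<in> K" "\<And>X Y. X \<in> K \<Longrightarrow> Y \<in> K \<Longrightarrow> fmult fbB X Y \<in> K"
    using K_closed by (auto simp: frob_closed_def)
  have single: "gen (add_mset (Circ (cyc [X])) D) - scale (ftrace fbB X) (gen D) \<in> frK {} {}" if "X \<in> K" for X
    by (rule frels.circle[OF C]) (use that in simp)
  show ?case
  proof (cases w)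
    case Nil
    have "gen (add_mset (Circ (cyc [fone fbB])) D) - gen (add_mset (Circ (cyc [])) D) \<in> frK {} {}"
      using frels.label_one[OF shapes_Circ, of "[]" "[]" D "dgs True K {} {}" fbB] C[of "[]"] by simp
    from frels_diff[OF single[OF one(1)] this]
    have "gen (add_mset (Circ (cyc [])) D) - scale (ftrace fbB (fone fbB)) (gen D) \<in> frK {} {}" by simp
    then show ?thesis unfolding Nil by blast
  next
    case (Cons X u)
    show ?thesis
    proof (cases u)
      case Nil
      then show ?thesis using single[of X] less(2) Cons by auto
    next
      case (Cons Y v)
      have w: "w = [X, Y] @ v" using \<open>w = _\<close> Cons by simp
      have XY: "X \<in> K" "Y \<in> K" "set v \<subseteq> K" using less(2) w by auto
      have 1: "gen (add_mset (Circ (cyc w)) D) - gen (add_mset (Circ (cyc (fmult fbB X Y # v))) D) \<in> frK {} {}"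
        using frels.label_mult[OF shapes_Circ, of "[]" X Y v D "dgs True K {} {}" fbB] C[OF less(2)] by (simp add: w)
      obtain r where "gen (add_mset (Circ (cyc (fmult fbB X Y # v))) D) - scale r (gen D) \<in> frK {} {}"
        using less(1)[of "fmult fbB X Y # v"] less(3) one(2)[OF XY(1,2)] XY(3) w by auto
      from frels.plus[OF 1 this] show ?thesis by auto
    qed
  qed
qed

lemma cyc_surj: "\<exists>w. c = cyc w"
  by transfer (use cyc_eq_equivp in \<open>auto intro: equivp_reflp\<close>)

lemma closed_fr: "D \<in> dgs True K {} {} \<Longrightarrow> \<exists>r. gen D - scale r 1 \<in> frK {} {}"
proof (induct D)
  case empty
  have "gen {#} - scale 1 1 \<in> frK {} {}" by (simp add: frels.zero)
  then show ?case by blast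
next
  case (add c D)
  have D: "D \<in> dgs True K {} {}" and l: "letters c \<subseteq> K" using add(2) by (cases c rule: no_inner.cases; auto simp: dgs_add)+
  obtain e where "c = Circ e" using add(2) by (cases c rule: no_inner.cases) (auto simp: dgs_add)
  moreover obtain w where "e = cyc w" using cyc_surj by blast
  ultimately have c: "c = Circ (cyc w)" and w: "set w \<subseteq> K" using l by simp_all
  obtain r where r: "gen (add_mset c D) - scale r (gen D) \<in> frK {} {}" using closed_circle[OF w D] c by blast
  obtain r' where "gen D - scale r' 1 \<in> frK {} {}" using add(1)[OF D] by blast
  from frels.plus[OF r frels.scal[OF this, of r]] show ?case by (auto simp: scale_diff)
qed

lemma closed_fr_comb: "z \<in> dcombs True K {} {} \<Longrightarrow> \<exists>r. z - scale r 1 \<in> frK {} {}"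
proof (induct rule: comb_induct)
  case zero
  have "0 - scale 0 1 \<in> frK {} {}" by (simp add: frels.zero)
  then show ?case by blast
next
  case (gen D)
  then show ?case by (rule closed_fr)
next
  case (add x y)
  then obtain r r' where "x - scale r 1 \<in> frK {} {}" "y - scale r' 1 \<in> frK {} {}" by blast
  from frels.plus[OF this] have "x + y - scale (r + r') 1 \<in> frK {} {}" by (simp add: scale_left_distrib algebra_simps)
  then show ?case by blast
next
  case (scale c x)
  then obtain r where "x - scale r 1 \<in> frK {} {}" by blast
  from frels.scal[OF this, of c] show ?case by (auto simp: scale_diff)
qed

lemma PhiL_1: "PhiL 1 = 1"
proof -
  have "PhiL (gen {#}) = 1" by (simp only: ext_gen Phi_empty)
  then show ?thesis by (simp only: gen_0)
qed

text \<open>The relations alone reduce a closed combination to some scalar. \<open>PhiL\<close>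
  annihilates the relations and fixes the unit, so that scalar has to be the evaluation.\<close>

lemma PhiL_closed:
  assumes z: "z \<in> dcombs True K {} {}"
  shows "z - scale (eval_comb \<alpha> (PhiL z)) 1 \<in> frK {} {}"
proof -
  obtain r where r: "z - scale r 1 \<in> frK {} {}" using closed_fr_comb[OF z] by blast
  from PhiL_frels[OF this] have "eval_comb \<alpha> (PhiL (z - scale r 1)) = 0" by (simp only: null_closed)
  then have "eval_comb \<alpha> (PhiL z) = r" by (simp add: ext_diff ext_scale PhiL_1 eval_comb_diff eval_comb_scale)
  then show ?thesis using r by simp
qed

lemma closed_frels_iff:
  assumes z: "z \<in> dcombs True K {} {}"
  shows "z \<in> frK {} {} \<longleftrightarrow> eval_comb \<alpha> (PhiL z) = 0"
  using PhiL_closed[OF z] PhiL_frels[of z "{}" "{}"] by (auto simp: null_closed)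

lemma fb_closure_cls:
  assumes "z \<in> dcombs True K (heads a a) (tails a a)"
  shows "fb_closure fbB a (fb_cls fbB a a z) = fb_cls fbB [] [] (lin (diagram_closure (length a)) z)"
  unfolding fb_closure_def
proof (rule fb.UN_c)
  fix y assume "y \<in> fb_cls fbB a a z"
  then have "y - z \<in> frK (heads a a) (tails a a)" by (simp add: fb.mem_c)
  from frels_closure[OF K_closed, simplified, OF this]
  show "fb_cls fbB [] [] (lin (diagram_closure (length a)) y) = fb_cls fbB [] [] (lin (diagram_closure (length a)) z)"
    by (simp add: fb.c_eq_iff lin_diff)
qed

text \<open>\<open>PhiL\<close> commutes with stacking and closing modulo null combinations, and the
  vanishing of closed labelled combinations is detected by their evaluation. Hence the two tests
  agree for each \<open>y\<close>.\<close>

lemma negligible_iff: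
  assumes x: "x \<in> dcombs True K (heads a b) (tails a b)"
  shows "fb_cls fbB a b x \<in> negligible fbB a b \<longleftrightarrow> PhiL x \<in> null S \<alpha> (heads a b) (tails a b)"
proof -
  have "fb_closure fbB a (cmp (fb_cat fbB) a b a (fb_cls fbB b a y) (fb_cls fbB a b x)) = zerom (fb_cat fbB) [] [] \<longleftrightarrow>
    eval_comb \<alpha> (lin (diagram_closure (length a)) (bilin (stack (length b)) (PhiL y) (PhiL x))) = 0"
    if y: "y \<in> dcombs True K (heads b a) (tails b a)" for y
  proof -
    let ?z = "bilin (stack (length b)) y x"
    have z: "?z \<in> dcombs True K (heads a a) (tails a a)" by (rule stack_in[OF x y])
    have "ceq S \<alpha> {} {} (lin (diagram_closure (length a)) (PhiL ?z)) (lin (diagram_closure (length a)) (bilin (stack (length b)) (PhiL y) (PhiL x)))"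
      unfolding ceq_def lin_diff[symmetric] by (rule null_closure) (use PhiL_stack[OF x y] in \<open>simp only: ceq_def\<close>)
    from ceq_eval[OF ceq_trans[OF PhiL_closure[OF z] this]]
    have e: "eval_comb \<alpha> (PhiL (lin (diagram_closure (length a)) ?z)) =
      eval_comb \<alpha> (lin (diagram_closure (length a)) (bilin (stack (length b)) (PhiL y) (PhiL x)))" .
    have "fb_closure fbB a (cmp (fb_cat fbB) a b a (fb_cls fbB b a y) (fb_cls fbB a b x)) = zerom (fb_cat fbB) [] [] \<longleftrightarrow>
      lin (diagram_closure (length a)) ?z \<in> frK {} {}"
      by (simp add: fb.cmp_C[OF x y] fb_closure_cls[OF z] fb.zerom_C fb.c_eq_iff)
    then show ?thesis unfolding closed_frels_iff[OF closure_in[OF z]] e .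
  qed
  then show ?thesis
    unfolding PhiL_null_iff[OF x] negligible_def fb.hom_C using x by auto
qed

lemma Fm_kernel:
  assumes X: "X \<in> hom (fb_cat fbB) a b"
  shows "X \<in> negligible fbB a b \<longleftrightarrow> Fm a b X = zerom (cat S \<alpha>) a b"
  using X by (elim fb.hom_CE) (simp add: negligible_iff Fm_cls cob.zerom_C cob.c_eq_iff)

end

section \<open>Functors on quotients\<close>

text \<open>By \<open>ker\<close> the cosets are exactly the fibres of \<open>F\<close>. This makes
  the induced map well defined and injective at once, and it also shows that the operations of the
  quotient can be computed on representatives: \<open>F\<close> determines the coset of the
  result.\<close>

lemma quotient_functor:
  fixes C :: "('o, 'm, 'k) moncat" and F :: "('o, 'm, 'p, 'n) funct"
  assumes mon: "monoidal_functor C D F" and full: "full_functor C D F" and obj: "obj C = UNIV"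
    and ker: "\<And>a b X. X \<in> hom C a b \<Longrightarrow> coset C N a b X = {Y \<in> hom C a b. on_hom F a b Y = on_hom F a b X}"
    and idm: "\<And>a. idm C a \<in> hom C a a"
    and cmp: "\<And>a b c X Y. X \<in> hom C a b \<Longrightarrow> Y \<in> hom C b c \<Longrightarrow> cmp C a b c Y X \<in> hom C a c"
    and plusm: "\<And>a b X Y. X \<in> hom C a b \<Longrightarrow> Y \<in> hom C a b \<Longrightarrow> plusm C a b X Y \<in> hom C a b"
    and scalm: "\<And>a b X r. X \<in> hom C a b \<Longrightarrow> scalm C a b r X \<in> hom C a b"
    and tensm: "\<And>a a' b b' X Y. X \<in> hom C a a' \<Longrightarrow> Y \<in> hom C b b' \<Longrightarrow> tensm C a a' b b' X Y \<in> hom C (tenso C a b) (tenso C a' b')"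
  shows "\<exists>F'. (\<forall>a. on_obj F' a = on_obj F a) \<and> (\<forall>a b. \<forall>X\<in>hom C a b. on_hom F' a b (coset C N a b X) = on_hom F a b X) \<and>
    monoidal_functor (quot C N) D F' \<and> full_functor (quot C N) D F' \<and> faithful_functor (quot C N) F'"
proof -
  let ?c = "coset C N"
  \<comment> \<open>A fibre has a single image, so \<open>the_elem\<close> is meaningful on cosets
    of morphisms.\<close>
  define F' where "F' = \<lparr>on_obj = on_obj F, on_hom = (\<lambda>a b Q. the_elem (on_hom F a b ` Q))\<rparr>"
  have o: "on_obj F' a = on_obj F a" for a by (simp add: F'_def)
  have self: "X \<in> ?c a b X" if "X \<in> hom C a b" for a b X using that by (simp add: ker)
  have h: "on_hom F' a b (?c a b X) = on_hom F a b X" if "X \<in> hom C a b" for a b X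
  proof -
    have "on_hom F a b ` ?c a b X = {on_hom F a b X}" using self[OF that] by (auto simp: ker[OF that])
    then show ?thesis by (simp add: F'_def)
  qed
  have ceq: "?c a b X = ?c a b Y" if "X \<in> hom C a b" "Y \<in> hom C a b" "on_hom F a b X = on_hom F a b Y" for a b X Y
    using that by (simp add: ker)
  have memD: "Y \<in> hom C a b" "on_hom F a b Y = on_hom F a b X" if "Y \<in> ?c a b X" "X \<in> hom C a b" for a b X Y
    using that by (simp_all add: ker)
  have U: "(\<Union>x\<in>?c a b X. G x) = G X"
    if "X \<in> hom C a b" "\<And>x. x \<in> ?c a b X \<Longrightarrow> G x = G X" for a b X and G :: "'m \<Rightarrow> 'z set"
    using that self[OF that(1)] by blast
  have lin: "linear_functor C D F" using mon by (simp add: monoidal_functor_def)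
  have Fcmp: "on_hom F a c (moncat.cmp C a b c Y X) = moncat.cmp D (on_obj F a) (on_obj F b) (on_obj F c) (on_hom F b c Y) (on_hom F a b X)"
    if "X \<in> hom C a b" "Y \<in> hom C b c" for a b c X Y using lin that by (simp add: linear_functor_def obj)
  have Fplus: "on_hom F a b (moncat.plusm C a b X Y) = moncat.plusm D (on_obj F a) (on_obj F b) (on_hom F a b X) (on_hom F a b Y)"
    if "X \<in> hom C a b" "Y \<in> hom C a b" for a b X Y using lin that by (simp add: linear_functor_def obj)
  have Fscal: "on_hom F a b (moncat.scalm C a b r X) = moncat.scalm D (on_obj F a) (on_obj F b) r (on_hom F a b X)"
    if "X \<in> hom C a b" for a b X r using lin that by (simp add: linear_functor_def obj)
  have Fid: "on_hom F a a (moncat.idm C a) = moncat.idm D (on_obj F a)" for a using lin by (simp add: linear_functor_def obj)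
  have Ftens: "on_hom F (tenso C a b) (tenso C a' b') (moncat.tensm C a a' b b' X Y) =
      moncat.tensm D (on_obj F a) (on_obj F a') (on_obj F b) (on_obj F b') (on_hom F a a' X) (on_hom F b b' Y)"
    if "X \<in> hom C a a'" "Y \<in> hom C b b'" for a a' b b' X Y using mon that by (simp add: monoidal_functor_def obj)
  have qh: "hom (quot C N) a b = ?c a b ` hom C a b" for a b by (simp add: quot_def)
  have qcmp: "moncat.cmp (quot C N) a b c (?c b c Y) (?c a b X) = ?c a c (moncat.cmp C a b c Y X)"
    if X: "X \<in> hom C a b" and Y: "Y \<in> hom C b c" for a b c X Y
  proof -
    have "(\<Union>x\<in>?c a b X. ?c a c (moncat.cmp C a b c y x)) = ?c a c (moncat.cmp C a b c Y X)" if "y \<in> ?c b c Y" for y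
    proof -
      note y = memD[OF that Y]
      have "(\<Union>x\<in>?c a b X. ?c a c (moncat.cmp C a b c y x)) = ?c a c (moncat.cmp C a b c y X)"
        by (rule U[OF X], rule ceq) (use memD[OF _ X] X y in \<open>auto simp: Fcmp intro: cmp\<close>)
      also have "\<dots> = ?c a c (moncat.cmp C a b c Y X)"
        by (rule ceq) (use X Y y in \<open>auto simp: Fcmp intro: cmp\<close>)
      finally show ?thesis .
    qed
    then show ?thesis unfolding quot_def using self[OF Y] by auto
  qed
  have qplus: "moncat.plusm (quot C N) a b (?c a b X) (?c a b Y) = ?c a b (moncat.plusm C a b X Y)"
    if X: "X \<in> hom C a b" and Y: "Y \<in> hom C a b" for a b X Y
  proof -
    have "(\<Union>y\<in>?c a b Y. ?c a b (moncat.plusm C a b x y)) = ?c a b (moncat.plusm C a b X Y)" if "x \<in> ?c a b X" for x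
    proof -
      note x = memD[OF that X]
      have "(\<Union>y\<in>?c a b Y. ?c a b (moncat.plusm C a b x y)) = ?c a b (moncat.plusm C a b x Y)"
        by (rule U[OF Y], rule ceq) (use memD[OF _ Y] Y x in \<open>auto simp: Fplus intro: plusm\<close>)
      also have "\<dots> = ?c a b (moncat.plusm C a b X Y)"
        by (rule ceq) (use X Y x in \<open>auto simp: Fplus intro: plusm\<close>)
      finally show ?thesis .
    qed
    then show ?thesis unfolding quot_def using self[OF X] by auto
  qed
  have qscal: "moncat.scalm (quot C N) a b r (?c a b X) = ?c a b (moncat.scalm C a b r X)"
    if X: "X \<in> hom C a b" for a b r X
  proof -
    have "(\<Union>x\<in>?c a b X. ?c a b (moncat.scalm C a b r x)) = ?c a b (moncat.scalm C a b r X)"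
      by (rule U[OF X], rule ceq) (use memD[OF _ X] X in \<open>auto simp: Fscal intro: scalm\<close>)
    then show ?thesis by (simp add: quot_def)
  qed
  have qtens: "moncat.tensm (quot C N) a a' b b' (?c a a' X) (?c b b' Y) =
      ?c (tenso C a b) (tenso C a' b') (moncat.tensm C a a' b b' X Y)"
    if X: "X \<in> hom C a a'" and Y: "Y \<in> hom C b b'" for a a' b b' X Y
  proof -
    let ?d = "?c (tenso C a b) (tenso C a' b')"
    have "(\<Union>y\<in>?c b b' Y. ?d (moncat.tensm C a a' b b' x y)) = ?d (moncat.tensm C a a' b b' X Y)" if "x \<in> ?c a a' X" for x
    proof -
      note x = memD[OF that X]
      have "(\<Union>y\<in>?c b b' Y. ?d (moncat.tensm C a a' b b' x y)) = ?d (moncat.tensm C a a' b b' x Y)"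
        by (rule U[OF Y], rule ceq) (use memD[OF _ Y] Y x in \<open>auto simp: Ftens intro: tensm\<close>)
      also have "\<dots> = ?d (moncat.tensm C a a' b b' X Y)"
        by (rule ceq) (use X Y x in \<open>auto simp: Ftens intro: tensm\<close>)
      finally show ?thesis .
    qed
    then show ?thesis unfolding quot_def using self[OF X] by auto
  qed
  have q_simps: "obj (quot C N) = UNIV" "unito (quot C N) = unito C" "tenso (quot C N) = tenso C"
    "moncat.idm (quot C N) a = ?c a a (moncat.idm C a)" for a
    by (simp_all add: quot_def obj)
  have "linear_functor (quot C N) D F'"
    unfolding linear_functor_def q_simps qh
  proof (intro conjI ballI allI; (elim imageE)?)
    fix a b :: 'o
    show "on_obj F' a \<in> obj D" using lin by (simp add: o linear_functor_def obj)
    show "on_hom F' a a (?c a a (moncat.idm C a)) = moncat.idm D (on_obj F' a)" by (simp add: h[OF idm] o Fid)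
    fix x X assume x: "x = ?c a b X" and X: "X \<in> hom C a b"
    show "on_hom F' a b x \<in> hom D (on_obj F' a) (on_obj F' b)"
      using lin X by (simp add: x h o linear_functor_def obj)
    show "on_hom F' a b (moncat.scalm (quot C N) a b r x) = moncat.scalm D (on_obj F' a) (on_obj F' b) r (on_hom F' a b x)" for r
      by (simp add: x qscal[OF X] h[OF scalm[OF X]] h[OF X] Fscal[OF X] o)
    show "on_hom F' a b (moncat.plusm (quot C N) a b x y) = moncat.plusm D (on_obj F' a) (on_obj F' b) (on_hom F' a b x) (on_hom F' a b y)"
      if y: "y = ?c a b Y" and Y: "Y \<in> hom C a b" for y Y
      by (simp add: x y qplus[OF X Y] h[OF plusm[OF X Y]] h[OF X] h[OF Y] Fplus[OF X Y] o)
    show "on_hom F' a c (moncat.cmp (quot C N) a b c y x) =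
      moncat.cmp D (on_obj F' a) (on_obj F' b) (on_obj F' c) (on_hom F' b c y) (on_hom F' a b x)"
      if y: "y = ?c b c Y" and Y: "Y \<in> hom C b c" for c y Y
      by (simp add: x y qcmp[OF X Y] h[OF cmp[OF X Y]] h[OF X] h[OF Y] Fcmp[OF X Y] o)
  qed
  then have "monoidal_functor (quot C N) D F'"
    unfolding monoidal_functor_def q_simps qh
  proof (intro conjI ballI; (elim imageE)?)
    show "on_obj F' (unito C) = unito D" using mon by (simp add: o monoidal_functor_def)
    show "on_obj F' (tenso C a b) = tenso D (on_obj F' a) (on_obj F' b)" for a b
      using mon by (simp add: o monoidal_functor_def obj)
    show "on_hom F' (tenso C a b) (tenso C a' b') (moncat.tensm (quot C N) a a' b b' x y) =
      moncat.tensm D (on_obj F' a) (on_obj F' a') (on_obj F' b) (on_obj F' b') (on_hom F' a a' x) (on_hom F' b b' y)"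
      if x: "x = ?c a a' X" and X: "X \<in> hom C a a'" and y: "y = ?c b b' Y" and Y: "Y \<in> hom C b b'" for a a' b b' x y X Y
      by (simp add: x y qtens[OF X Y] h[OF tensm[OF X Y]] h[OF X] h[OF Y] Ftens[OF X Y] o)
  qed
  moreover have "full_functor (quot C N) D F'"
    unfolding full_functor_def q_simps qh
  proof (intro ballI)
    fix a b :: 'o
    have "on_hom F' a b ` ?c a b ` hom C a b = on_hom F a b ` hom C a b"
      unfolding image_image by (rule image_cong[OF refl h])
    then show "on_hom F' a b ` ?c a b ` hom C a b = hom D (on_obj F' a) (on_obj F' b)"
      using full by (simp add: full_functor_def obj o)
  qed
  moreover have "faithful_functor (quot C N) F'"
    unfolding faithful_functor_def q_simps qh
  proof (intro ballI inj_onI; elim imageE)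
    fix a b :: 'o and x y X Y
    assume e: "on_hom F' a b x = on_hom F' a b y" and "x = ?c a b X" "y = ?c a b Y" and XY: "X \<in> hom C a b" "Y \<in> hom C a b"
    then show "x = y" using ceq[OF XY] by (simp add: h)
  qed
  ultimately show ?thesis using o h by blast
qed

section \<open>The partial trace\<close>

fun opposite :: "sign \<Rightarrow> sign" where "opposite Pos = Neg" | "opposite Neg = Pos"

definition cup :: "sign list \<Rightarrow> sign \<Rightarrow> (point, 'b) diagram" where
  "cup a s = juxtapose (length a) (length a) (id_diagram a) {#arc_at (s = Pos) T0 T1#}"

text \<open>At a bottom point a sign has the orientation opposite to that at a top point, hence the
  exchanged arguments compared with \<open>cup\<close>.\<close>

definition cap :: "sign list \<Rightarrow> sign \<Rightarrow> (point, 'b) diagram" where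
  "cap a s = juxtapose (length a) (length a) (id_diagram a) {#arc_at (s = Pos) (Bot 1) (Bot 0)#}"

lemma cup_boundary:
  "heads [] [s, opposite s] = {if s = Pos then T0 else T1}" "tails [] [s, opposite s] = {if s = Pos then T1 else T0}"
  "heads [s, opposite s] [] = {if s = Pos then Bot 1 else Bot 0}" "tails [s, opposite s] [] = {if s = Pos then Bot 0 else Bot 1}"
  by (cases s; simp add: heads_eq tails_eq pos_Cons neg_Cons)+

lemma cup_in: "{#arc_at (s = Pos) T0 T1#} \<in> hdgs f S [] [s, opposite s]"
  and cap_in: "{#arc_at (s = Pos) (Bot 1) (Bot 0)#} \<in> hdgs f S [s, opposite s] []"
proof -
  have arc_in: "{#arc h t#} \<in> dgs f S {h} {t}" if "h \<noteq> t" for h t :: point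
    using that by (simp add: dgs_add arc_def)
  show "{#arc_at (s = Pos) T0 T1#} \<in> hdgs f S [] [s, opposite s]"
    unfolding cup_boundary arc_at_def using arc_in[of T0 T1] arc_in[of T1 T0] by (cases "s = Pos") simp_all
  show "{#arc_at (s = Pos) (Bot 1) (Bot 0)#} \<in> hdgs f S [s, opposite s] []"
    unfolding cup_boundary arc_at_def using arc_in[of "Bot 0" "Bot 1"] arc_in[of "Bot 1" "Bot 0"] by (cases "s = Pos") simp_all
qed

text \<open>The identity strands and one leg of the cup are arcs absorbed by
  \<open>glues_arcs\<close>. Then the far end of the cup stands in for the point
  \<open>Bot (length a)\<close>, and the last pair joins it to the next bottom point of
  \<open>F\<close> itself.\<close>

lemma stack_cup:
  assumes F: "F \<in> hdgs f S (a @ [s, opposite s]) c"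
  shows "stack (length (a @ [s, opposite s])) F (cup a s) = glue (Bot (length a)) (Bot (Suc (length a))) F"
proof -
  let ?n = "length a"
  let ?b = "a @ [s, opposite s]"
  let ?p = "\<lambda>i. Inr (Bot i) :: point + point" and ?g = "\<lambda>i. Inl (Top i) :: point + point"
  \<comment> \<open>At index \<open>?n\<close> the arc is the cup, whose free end is the
    neighbouring top point.\<close>
  let ?f = "\<lambda>i. if i < ?n then Inl (Bot i) else Inl (Top (Suc ?n)) :: point + point"
  let ?h = "\<lambda>q. case q of Bot i \<Rightarrow> if i \<le> ?n then ?f i else Inr (Bot i) | Top i \<Rightarrow> Inr (Top i)"
  let ?F = "case_sum Inl ?h"
  have F': "rename Inr F \<in> dgs f S (Inr ` heads ?b c) (Inr ` tails ?b c)" by (rule dgs_rename[OF F]) simp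
  have b1: "a ! i = Neg \<longleftrightarrow> ?b ! i = Neg" if "i < ?n" for i using that by (simp add: nth_append)
  have ac: "rename Inl (cup a s) = mset (map (\<lambda>i. arc_at (?b ! i = Neg) (?f i) (?g i)) [0..<Suc ?n])"
  proof -
    have "rename Inl (cup a s) = mset (map (\<lambda>i. arc_at (a ! i = Neg) (Inl (Bot i)) (Inl (Top i) :: point + point)) [0..<?n]) +
       {#arc_at (s = Neg) (Inl (Top (Suc ?n))) (Inl (Top ?n))#}"
      unfolding cup_def juxtapose_def id_diagram_def perm_diagram_arcs
      by (simp add: rename_def multiset.map_comp o_def arc_at_Pos)
    also have "map (\<lambda>i. arc_at (a ! i = Neg) (Inl (Bot i)) (Inl (Top i) :: point + point)) [0..<?n] =
       map (\<lambda>i. arc_at (?b ! i = Neg) (?f i) (?g i)) [0..<?n]"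
      by (rule map_cong) (auto simp: nth_append)
    finally show ?thesis by simp
  qed
  have s: "stk (length ?b) = map prod.swap (map (\<lambda>i. (?p i, ?g i)) [0..<Suc ?n]) @ [(?g (Suc ?n), ?p (Suc ?n))]"
    by (simp add: stk_def)
  have 1: "glues (map (\<lambda>i. (?p i, ?g i)) [0..<Suc ?n]) (rename Inr F + rename Inl (cup a s)) = rename ?F (rename Inr F)"
    unfolding ac
  proof (rule glues_arcs[OF F'])
    show "inj_on ?f (set [0..<Suc ?n])" by (auto simp: inj_on_def split: if_splits)
    show "?p ` set [0..<Suc ?n] \<subseteq> Inr ` heads ?b c \<union> Inr ` tails ?b c"
      unfolding image_Un[symmetric] heads_tails_Un by auto
    show "?f ` set [0..<Suc ?n] \<inter> ?g ` set [0..<Suc ?n] = {}" by (auto split: if_splits)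
    show "(?f ` set [0..<Suc ?n] \<union> ?g ` set [0..<Suc ?n]) \<inter> (Inr ` heads ?b c \<union> Inr ` tails ?b c) = {}"
      by (auto split: if_splits)
    show "?F (?p i) = ?f i" if "i \<in> set [0..<Suc ?n]" for i using that by auto
    show "?F x = x" if "x \<in> Inr ` heads ?b c \<union> Inr ` tails ?b c" "x \<notin> ?p ` set [0..<Suc ?n]" for x
    proof -
      note x = that
      obtain q where q: "x = Inr q" using x(1) by auto
      show ?thesis
      proof (cases q)
        case (Bot i)
        have "\<not> i \<le> ?n"
        proof
          assume "i \<le> ?n"
          then have "?p i \<in> ?p ` set [0..<Suc ?n]" by (intro imageI) auto
          then show False using x(2) q Bot by simp
        qed
        then show ?thesis by (simp add: q Bot)
      qed (simp add: q)
    qed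
    show "?b ! i = Neg \<longleftrightarrow> ?p i \<in> Inr ` heads ?b c" if "i \<in> set [0..<Suc ?n]" for i
      using that by (auto simp: heads_def)
  qed (auto simp: inj_on_def)
  have o: "opp (heads ?b c) (tails ?b c) (Bot ?n) (Bot (Suc ?n))"
    by (cases s) (auto simp: opp_def heads_def tails_def nth_append)
  have i: "inj_on ?h (heads ?b c \<union> tails ?b c)"
    by (auto simp: inj_on_def split: point.splits if_splits)
  have G: "glue (Bot ?n) (Bot (Suc ?n)) F \<in> dgs f S (heads ?b c - {Bot ?n, Bot (Suc ?n)}) (tails ?b c - {Bot ?n, Bot (Suc ?n)})"
    by (rule glue_dgs[OF F o])
  have "stack (length ?b) F (cup a s) = rename both (glue (?g (Suc ?n)) (?p (Suc ?n)) (rename ?h F))"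
    unfolding stack_eq s glues_append glues_swap add.commute[of "rename Inl _"] 1 by (simp add: rename_rename)
  also have "glue (?g (Suc ?n)) (?p (Suc ?n)) (rename ?h F) = rename ?h (glue (Bot ?n) (Bot (Suc ?n)) F)"
    using rename_glue[OF F o i] by simp
  also have "rename both \<dots> = rename (\<lambda>q. q) (glue (Bot ?n) (Bot (Suc ?n)) F)"
    unfolding rename_rename by (rule rename_cong[OF G]) (auto split: point.split)
  finally show ?thesis by (simp only: rename_ident)
qed

lemma stack_cap:
  assumes F: "F \<in> hdgs f S c (a @ [s, opposite s])"
  shows "stack (length (a @ [s, opposite s])) (cap a s) F = glue (Top (length a)) (Top (Suc (length a))) F"
proof -
  let ?n = "length a"
  let ?b = "a @ [s, opposite s]"
  let ?p = "\<lambda>i. Inl (Top i) :: point + point" and ?g = "\<lambda>i. Inr (Bot i) :: point + point"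
  let ?f = "\<lambda>i. if i < ?n then Inr (Top i) else Inr (Bot (Suc ?n)) :: point + point"
  let ?h = "\<lambda>q. case q of Top i \<Rightarrow> if i \<le> ?n then ?f i else Inl (Top i) | Bot i \<Rightarrow> Inl (Bot i)"
  let ?F = "case_sum ?h Inr"
  have F': "rename Inl F \<in> dgs f S (Inl ` heads c ?b) (Inl ` tails c ?b)" by (rule dgs_rename[OF F]) simp
  have ac: "rename Inr (cap a s) = mset (map (\<lambda>i. arc_at (?b ! i = Pos) (?f i) (?g i)) [0..<Suc ?n])"
  proof -
    have "rename Inr (cap a s) = mset (map (\<lambda>i. arc_at (a ! i = Pos) (Inr (Top i)) (Inr (Bot i) :: point + point)) [0..<?n]) +
       {#arc_at (s = Pos) (Inr (Bot (Suc ?n))) (Inr (Bot ?n))#}"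
      unfolding cap_def juxtapose_def id_diagram_def perm_diagram_arcs
      by (simp add: rename_def multiset.map_comp o_def)
    also have "map (\<lambda>i. arc_at (a ! i = Pos) (Inr (Top i)) (Inr (Bot i) :: point + point)) [0..<?n] =
       map (\<lambda>i. arc_at (?b ! i = Pos) (?f i) (?g i)) [0..<?n]"
      by (rule map_cong) (auto simp: nth_append)
    finally show ?thesis by simp
  qed
  have s: "stk (length ?b) = map (\<lambda>i. (?p i, ?g i)) [0..<Suc ?n] @ [(?p (Suc ?n), ?g (Suc ?n))]"
    by (simp add: stk_def)
  have 1: "glues (map (\<lambda>i. (?p i, ?g i)) [0..<Suc ?n]) (rename Inl F + rename Inr (cap a s)) = rename ?F (rename Inl F)"
    unfolding ac
  proof (rule glues_arcs[OF F'])
    show "inj_on ?f (set [0..<Suc ?n])" by (auto simp: inj_on_def split: if_splits)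
    show "?p ` set [0..<Suc ?n] \<subseteq> Inl ` heads c ?b \<union> Inl ` tails c ?b"
      unfolding image_Un[symmetric] heads_tails_Un by auto
    show "?f ` set [0..<Suc ?n] \<inter> ?g ` set [0..<Suc ?n] = {}" by (auto split: if_splits)
    show "(?f ` set [0..<Suc ?n] \<union> ?g ` set [0..<Suc ?n]) \<inter> (Inl ` heads c ?b \<union> Inl ` tails c ?b) = {}"
      by (auto split: if_splits)
    show "?F (?p i) = ?f i" if "i \<in> set [0..<Suc ?n]" for i using that by auto
    show "?F x = x" if "x \<in> Inl ` heads c ?b \<union> Inl ` tails c ?b" "x \<notin> ?p ` set [0..<Suc ?n]" for x
    proof -
      note x = that
      obtain q where q: "x = Inl q" using x(1) by auto
      show ?thesis
      proof (cases q)
        case (Top i)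
        have "\<not> i \<le> ?n"
        proof
          assume "i \<le> ?n"
          then have "?p i \<in> ?p ` set [0..<Suc ?n]" by (intro imageI) auto
          then show False using x(2) q Top by simp
        qed
        then show ?thesis by (simp add: q Top)
      qed (simp add: q)
    qed
    show "?b ! i = Pos \<longleftrightarrow> ?p i \<in> Inl ` heads c ?b" if "i \<in> set [0..<Suc ?n]" for i
      using that by (auto simp: heads_def)
  qed (auto simp: inj_on_def)
  have o: "opp (heads c ?b) (tails c ?b) (Top ?n) (Top (Suc ?n))"
    by (cases s) (auto simp: opp_def heads_def tails_def nth_append)
  have i: "inj_on ?h (heads c ?b \<union> tails c ?b)"
    by (auto simp: inj_on_def split: point.splits if_splits)
  have G: "glue (Top ?n) (Top (Suc ?n)) F \<in> dgs f S (heads c ?b - {Top ?n, Top (Suc ?n)}) (tails c ?b - {Top ?n, Top (Suc ?n)})"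
    by (rule glue_dgs[OF F o])
  have "stack (length ?b) (cap a s) F = rename both (glue (?p (Suc ?n)) (?g (Suc ?n)) (rename ?h F))"
    unfolding stack_eq s glues_append 1 by (simp add: rename_rename)
  also have "glue (?p (Suc ?n)) (?g (Suc ?n)) (rename ?h F) = rename ?h (glue (Top ?n) (Top (Suc ?n)) F)"
    using rename_glue[OF F o i] by (simp add: glue_sym[of "Inl _"])
  also have "rename both \<dots> = rename (\<lambda>q. q) (glue (Top ?n) (Top (Suc ?n)) F)"
    unfolding rename_rename by (rule rename_cong[OF G]) (auto split: point.split)
  finally show ?thesis by (simp only: rename_ident)
qed

text \<open>The strand added next to \<open>D\<close> is an arc. Gluing along the cup therefore only
  moves the last bottom point of \<open>D\<close> to the new top point, and the cap joins that to
  the last top point of \<open>D\<close>.\<close>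

lemma partial_trace:
  assumes D: "D \<in> hdgs f S (a @ [s]) (a @ [s])"
  shows "stack (length (a @ [s, opposite s])) (cap a s) (stack (length (a @ [s, opposite s]))
      (juxtapose (Suc (length a)) (Suc (length a)) D (id_diagram [opposite s])) (cup a s)) =
    glue (Bot (length a)) (Top (length a)) D"
proof -
  let ?n = "length a"
  let ?b = "a @ [s, opposite s]"
  let ?M = "juxtapose (Suc ?n) (Suc ?n) D (id_diagram [opposite s])"
  have ab: "a @ [s, opposite s] = (a @ [s]) @ [opposite s]" by simp
  have M: "?M \<in> hdgs f S ?b ?b"
    using juxtapose_dgs[OF D id_diagram_in[of "[opposite s]"]] unfolding ab by simp
  have M2: "?M = add_mset (arc_at (s = Pos) (Bot (Suc ?n)) (Top (Suc ?n))) D"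
    by (cases s) (simp_all add: juxtapose_def id_diagram_single arc_at_def arc_def)
  let ?r = "id(Bot ?n := Top (Suc ?n))"
  have mem: "Bot ?n \<in> (if s = Pos then tails (a @ [s]) (a @ [s]) else heads (a @ [s]) (a @ [s]))"
    "Top ?n \<in> (if s = Pos then heads (a @ [s]) (a @ [s]) else tails (a @ [s]) (a @ [s]))"
    by (cases s; simp add: heads_def tails_def)+
  have 1: "glue (Bot ?n) (Bot (Suc ?n)) ?M = rename ?r D"
  proof (cases "s = Pos")
    case True
    then have "add_mset (arc (Bot (Suc ?n)) (Top (Suc ?n))) D \<in> hdgs f S ?b ?b" using M M2 by (simp add: arc_at_def)
    from glue_arc(2)[OF D this, of "Bot ?n"] mem(1) True show ?thesis unfolding M2 by (simp add: arc_at_def)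
  next
    case False
    then have "add_mset (arc (Top (Suc ?n)) (Bot (Suc ?n))) D \<in> hdgs f S ?b ?b" using M M2 by (simp add: arc_at_def)
    from glue_arc(1)[OF D this, of "Bot ?n"] mem(1) False show ?thesis unfolding M2 by (simp add: arc_at_def)
  qed
  have ob: "opp (heads ?b ?b) (tails ?b ?b) (Bot ?n) (Bot (Suc ?n))"
    by (cases s) (auto simp: opp_def heads_def tails_def nth_append)
  have e: "heads ?b ?b - {Bot ?n, Bot (Suc ?n)} = heads a ?b" "tails ?b ?b - {Bot ?n, Bot (Suc ?n)} = tails a ?b"
    by (auto simp: heads_def tails_def nth_append less_Suc_eq)
  have R: "rename ?r D \<in> hdgs f S a ?b" using glue_dgs[OF M ob] unfolding 1 e .
  have o: "opp (heads (a @ [s]) (a @ [s])) (tails (a @ [s]) (a @ [s])) (Top ?n) (Bot ?n)"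
    using mem by (auto simp: opp_def split: if_splits)
  have i: "inj_on ?r (heads (a @ [s]) (a @ [s]) \<union> tails (a @ [s]) (a @ [s]))"
    unfolding heads_tails_Un by (auto simp: inj_on_def)
  have "stack (length ?b) (cap a s) (stack (length ?b) ?M (cup a s)) = glue (Top ?n) (Top (Suc ?n)) (rename ?r D)"
    unfolding stack_cup[OF M] 1 by (rule stack_cap[OF R])
  also have "\<dots> = rename ?r (glue (Top ?n) (Bot ?n) D)"
    using rename_glue[OF D o i] by simp
  also have "\<dots> = rename (\<lambda>q. q) (glue (Top ?n) (Bot ?n) D)"
    by (rule rename_cong[OF glue_dgs[OF D o]]) auto
  finally show ?thesis by (simp only: rename_ident glue_sym[of "Top ?n"])
qed

context frob_eval
begin

abbreviation fbC where "fbC \<equiv> fb_cat fbB"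

text \<open>Written with operations of the category only, so that the value of a monoidal functor on
  it is determined by the values on \<open>X\<close>, the cup and the cap.\<close>

definition ptr :: "sign list \<Rightarrow> sign \<Rightarrow> (('s, 'k) comb set, 'k) comb set \<Rightarrow> (('s, 'k) comb set, 'k) comb set" where
  "ptr a s X = cmp fbC a (a @ [s, opposite s]) a
     (tensm fbC a a [s, opposite s] [] (idm fbC a) (fb_cls fbB [s, opposite s] [] (gen {#arc_at (s = Pos) (Bot 1) (Bot 0)#})))
     (cmp fbC a (a @ [s, opposite s]) (a @ [s, opposite s])
       (tensm fbC (a @ [s]) (a @ [s]) [opposite s] [opposite s] X (idm fbC [opposite s]))
       (tensm fbC a a [] [s, opposite s] (idm fbC a) (fb_cls fbB [] [s, opposite s] (gen {#arc_at (s = Pos) T0 T1#}))))"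

lemma cls_cup: "tensm fbC a a [] [s, opposite s] (idm fbC a) (fb_cls fbB [] [s, opposite s] (gen {#arc_at (s = Pos) T0 T1#})) =
    fb_cls fbB a (a @ [s, opposite s]) (gen (cup a s))"
  unfolding fb.idm_C
  by (subst fb.tensm_C) (simp_all add: id_diagram_in cup_in cup_def)

lemma cls_cap: "tensm fbC a a [s, opposite s] [] (idm fbC a) (fb_cls fbB [s, opposite s] [] (gen {#arc_at (s = Pos) (Bot 1) (Bot 0)#})) =
    fb_cls fbB (a @ [s, opposite s]) a (gen (cap a s))"
  unfolding fb.idm_C
  using fb.tensm_C[of "gen (id_diagram a)" a a "gen {#arc_at (s = Pos) (Bot 1) (Bot 0)#}" "[s, opposite s]" "[]"]
    cap_in[of s True K] by (simp add: id_diagram_in cap_def)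

lemma cup_dgs: "cup a s \<in> hdgs True K a (a @ [s, opposite s])"
  using juxtapose_dgs[OF id_diagram_in[of a] cup_in] by (simp add: cup_def)

lemma cap_dgs: "cap a s \<in> hdgs True K (a @ [s, opposite s]) a"
  using juxtapose_dgs[OF id_diagram_in[of a] cap_in] by (simp add: cap_def)

lemma ptr_cls:
  assumes x: "x \<in> dcombs True K (heads (a @ [s]) (a @ [s])) (tails (a @ [s]) (a @ [s]))"
  shows "ptr a s (fb_cls fbB (a @ [s]) (a @ [s]) x) = fb_cls fbB a a (cglue (Bot (length a)) (Top (length a)) x)"
proof -
  let ?b = "a @ [s, opposite s]" and ?n = "Suc (length a)"
  let ?m = "bilin (juxtapose ?n ?n) x (gen (id_diagram [opposite s]))"
  have i: "gen (id_diagram [opposite s]) \<in> dcombs True K (heads [opposite s] [opposite s]) (tails [opposite s] [opposite s])"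
    by (simp add: id_diagram_in)
  have m: "?m \<in> dcombs True K (heads ?b ?b) (tails ?b ?b)"
    using fb.juxtapose_combs[OF x i] by simp
  have t: "tensm fbC (a @ [s]) (a @ [s]) [opposite s] [opposite s] (fb_cls fbB (a @ [s]) (a @ [s]) x) (idm fbC [opposite s]) =
    fb_cls fbB ?b ?b ?m"
    unfolding fb.idm_C using fb.tensm_C[OF x i] by simp
  have cu: "gen (cup a s) \<in> dcombs True K (heads a ?b) (tails a ?b)"
    and ca: "gen (cap a s) \<in> dcombs True K (heads ?b a) (tails ?b a)" by (simp_all add: cup_dgs cap_dgs)
  have e: "bilin (stack (length ?b)) (gen (cap a s)) (bilin (stack (length ?b)) ?m (gen (cup a s))) =
    cglue (Bot (length a)) (Top (length a)) x"
    using x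
  proof (induct rule: comb_induct)
    case (gen D)
    show ?case using partial_trace[OF gen] by simp
  qed (simp_all add: bilin_add_left bilin_add_right bilin_scale_left bilin_scale_right lin_add lin_scale del: length_append)
  show ?thesis
    unfolding ptr_def cls_cup cls_cap t fb.cmp_C[OF cu m] fb.cmp_C[OF fb.stack_combs[OF cu m] ca] e ..
qed

lemma cglue_snoc_in:
  assumes "x \<in> dcombs True K (heads (a @ [s]) (a @ [s])) (tails (a @ [s]) (a @ [s]))"
  shows "cglue (Bot (length a)) (Top (length a)) x \<in> dcombs True K (heads a a) (tails a a)"
proof -
  have "opp (heads (a @ [s]) (a @ [s])) (tails (a @ [s]) (a @ [s])) (Bot (length a)) (Top (length a))"
    by (cases s) (simp_all add: opp_def heads_def tails_def)
  from cglue_in[OF assms this]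
  show ?thesis
  proof (rule back_subst[where P = "\<lambda>X. _ \<in> X"])
    have "heads (a @ [s]) (a @ [s]) - {Bot (length a), Top (length a)} = heads a a"
      "tails (a @ [s]) (a @ [s]) - {Bot (length a), Top (length a)} = tails a a"
      by (auto simp: heads_def tails_def nth_append less_Suc_eq)
    then show "dcombs True K (heads (a @ [s]) (a @ [s]) - {Bot (length a), Top (length a)})
      (tails (a @ [s]) (a @ [s]) - {Bot (length a), Top (length a)}) = dcombs True K (heads a a) (tails a a)" by simp
  qed
qed

lemma closure_snoc:
  assumes x: "x \<in> dcombs True K (heads (a @ [s]) (a @ [s])) (tails (a @ [s]) (a @ [s]))"
  shows "lin (diagram_closure (length (a @ [s]))) x =
    lin (diagram_closure (length a)) (cglue (Bot (length a)) (Top (length a)) x)"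
proof -
  have "clo (length (a @ [s])) = clo (length a) @ [(Bot (length a), Top (length a))]" by (simp add: clo_def)
  then have m: "mset ((Bot (length a), Top (length a)) # clo (length a)) = mset (clo (length (a @ [s])))" by simp
  have "lin (diagram_closure (length (a @ [s]))) x = cglues (clo (length (a @ [s]))) x" by (simp only: diagram_closure_eq)
  also have "\<dots> = cglues ((Bot (length a), Top (length a)) # clo (length a)) x"
    by (rule cglues_perm[OF x okp_clo m, symmetric])
  also have "\<dots> = cglues (clo (length a)) (cglue (Bot (length a)) (Top (length a)) x)" by (rule cglues_Cons)
  finally show ?thesis by (simp only: diagram_closure_eq)
qed

lemma fb_closure_snoc:
  assumes X: "X \<in> hom fbC (a @ [s]) (a @ [s])"
  shows "ptr a s X \<in> hom fbC a a" "fb_closure fbB (a @ [s]) X = fb_closure fbB a (ptr a s X)"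
  using X by (elim fb.hom_CE; auto simp: ptr_cls fb_closure_cls closure_snoc cglue_snoc_in simp del: length_append)+

lemma fb_closure_hom: "X \<in> hom fbC a a \<Longrightarrow> fb_closure fbB a X \<in> hom fbC [] []"
  by (elim fb.hom_CE) (auto simp: fb_closure_cls closure_in intro!: fb.c_in_hom)

lemma cup_hom: "fb_cls fbB [] [s, opposite s] (gen {#arc_at (s = Pos) T0 T1#}) \<in> hom fbC [] [s, opposite s]"
  by (rule fb.c_in_hom) (simp add: cup_in)

lemma cap_hom: "fb_cls fbB [s, opposite s] [] (gen {#arc_at (s = Pos) (Bot 1) (Bot 0)#}) \<in> hom fbC [s, opposite s] []"
  by (rule fb.c_in_hom) (use cap_in[of s True K] in simp)

text \<open>\<open>is_F0\<close> prescribes values on arcs with exactly one dot. Inserting the unit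
  label brings undecorated cups and caps under this prescription.\<close>

lemma one_arc:
  assumes "heads a b = {h}" "tails a b = {t}"
  shows "fb_arc fbB h t a b (one_K S \<alpha>) = fb_cls fbB a b (gen {#arc h t#})"
proof -
  have ht: "h \<noteq> t" using heads_tails_disjoint[of a b] assms by auto
  have "{#Seg (Some h) [] (Some t)#} \<in> dgs True K {h} {t}" using ht by (simp add: dgs_add)
  then have "gen {#Seg (Some h) [fone fbB] (Some t)#} - gen {#Seg (Some h) [] (Some t)#} \<in> frK {h} {t}"
    using frels.label_one[OF shapes_Seg, of h "[]" "[]" t "{#}" "dgs True K {h} {t}" fbB] by simp
  moreover have "fone fbB = one_K S \<alpha>" by (simp add: K_alg_def)
  ultimately show ?thesis by (simp add: fb_arc_def arc_def fb.c_eq_iff assms)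
qed

section \<open>Arbitrary functors with the prescribed values\<close>

context
  fixes G
  assumes G: "is_F0 S \<alpha> G"
begin

lemma G_mon: "monoidal_functor fbC kC G" and G_full: "full_functor fbC kC G"
  using G by (simp_all add: is_F0_def)

lemma G_lin: "linear_functor fbC kC G"
  using G_mon by (simp add: monoidal_functor_def)

text \<open>Every object is a tensor product of single signs, where the value is prescribed, and the
  tensor product is preserved strictly.\<close>

lemma G_obj: "on_obj G a = ([a], mat1 (E a))"
proof -
  have "on_obj G a = on_obj F0 a"
  proof (induct a)
    case Nil
    then show ?case using G_mon F0_monoidal by (simp add: monoidal_functor_def)
  next
    case (Cons s a)
    have "on_obj H ([s] @ a) = tenso kC (on_obj H [s]) (on_obj H a)" if "monoidal_functor fbC kC H" for H
      using that by (simp add: monoidal_functor_def del: append_Cons append_Nil)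
    moreover have "on_obj G [s] = on_obj F0 [s]"
      using G F0_objects by (cases s) (simp_all add: is_F0_def)
    ultimately show ?case using G_mon F0_monoidal Cons by (metis append_Cons append_Nil)
  qed
  then show ?thesis by (simp add: F0_def)
qed

lemma full_surj:
  assumes "full_functor fbC kC H" "on_obj H = on_obj F0" "M \<in> hom kC ([a], mat1 (E a)) ([b], mat1 (E b))"
  shows "\<exists>X\<in>hom fbC a b. on_hom H a b X = M"
proof -
  have "on_obj F0 c = ([c], mat1 (E c))" for c by (simp add: F0_def)
  then have "on_hom H a b ` hom fbC a b = hom kC ([a], mat1 (E a)) ([b], mat1 (E b))"
    using assms(1,2) unfolding full_functor_def by simp
  then have "M \<in> on_hom H a b ` hom fbC a b" using assms(3) by simp
  then show ?thesis by blast
qed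

lemma G_obj': "on_obj G = on_obj F0"
  by (rule HOL.ext) (simp add: G_obj F0_def)

lemma G_arc: "heads a b = {h} \<Longrightarrow> tails a b = {t} \<Longrightarrow> on_hom G a b (fb_cls fbB a b (gen {#arc h t#})) = on_hom F0 a b (fb_cls fbB a b (gen {#arc h t#}))"
proof -
  assume b: "heads a b = {h}" "tails a b = {t}"
  have "one_K S \<alpha> \<in> K" using K_closed by (simp add: frob_closed_def K_alg_def)
  then have "on_hom H a b (fb_arc fbB h t a b (one_K S \<alpha>)) = mat1 (bend_arc S \<alpha> h t a b (one_K S \<alpha>))" if "is_F0 S \<alpha> H" for H
    using that b unfolding is_F0_def by blast
  from this[OF G] this[OF F0_is_F0] show ?thesis unfolding one_arc[OF b] by simp
qed

lemma ptr_functor: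
  assumes H: "monoidal_functor fbC kC H" and X: "X \<in> hom fbC (a @ [s]) (a @ [s])"
  shows "on_hom H a a (ptr a s X) =
    cmp kC (on_obj H a) (on_obj H (a @ [s, opposite s])) (on_obj H a)
     (tensm kC (on_obj H a) (on_obj H a) (on_obj H [s, opposite s]) (on_obj H []) (idm kC (on_obj H a))
       (on_hom H [s, opposite s] [] (fb_cls fbB [s, opposite s] [] (gen {#arc_at (s = Pos) (Bot 1) (Bot 0)#}))))
     (cmp kC (on_obj H a) (on_obj H (a @ [s, opposite s])) (on_obj H (a @ [s, opposite s]))
       (tensm kC (on_obj H (a @ [s])) (on_obj H (a @ [s])) (on_obj H [opposite s]) (on_obj H [opposite s])
          (on_hom H (a @ [s]) (a @ [s]) X) (idm kC (on_obj H [opposite s])))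
       (tensm kC (on_obj H a) (on_obj H a) (on_obj H []) (on_obj H [s, opposite s]) (idm kC (on_obj H a))
          (on_hom H [] [s, opposite s] (fb_cls fbB [] [s, opposite s] (gen {#arc_at (s = Pos) T0 T1#})))))"
proof -
  have L: "linear_functor fbC kC H" using H by (simp add: monoidal_functor_def)
  have c: "on_hom H a d (cmp fbC a b d Y X) = cmp kC (on_obj H a) (on_obj H b) (on_obj H d) (on_hom H b d Y) (on_hom H a b X)"
    if "X \<in> hom fbC a b" "Y \<in> hom fbC b d" for a b d X Y using L that by (simp add: linear_functor_def)
  have i: "on_hom H a a (idm fbC a) = idm kC (on_obj H a)" for a using L by (simp add: linear_functor_def)
  have t: "on_hom H (a @ b) (a' @ b') (tensm fbC a a' b b' X Y) =
      tensm kC (on_obj H a) (on_obj H a') (on_obj H b) (on_obj H b') (on_hom H a a' X) (on_hom H b b' Y)"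
    if "X \<in> hom fbC a a'" "Y \<in> hom fbC b b'" for a a' b b' X Y using H that by (simp add: monoidal_functor_def)
  let ?b = "a @ [s, opposite s]"
  note cu = fb.tensm_hom[OF fb.idm_hom[of a] cup_hom[of s], simplified]
  note ca = fb.tensm_hom[OF fb.idm_hom[of a] cap_hom[of s], unfolded append_Nil2]
  note m = fb.tensm_hom[OF X fb.idm_hom[of "[opposite s]"], simplified]
  note tcu = t[OF fb.idm_hom[of a] cup_hom[of s], simplified]
  note tca = t[OF fb.idm_hom[of a] cap_hom[of s], unfolded append_Nil2]
  note tm = t[OF X fb.idm_hom[of "[opposite s]"], simplified]
  show ?thesis
    unfolding ptr_def c[OF fb.cmp_hom[OF cu m] ca] c[OF cu m] tca i tcu[unfolded i] tm[unfolded i] ..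
qed

text \<open>Since \<open>G\<close> and \<open>F0\<close> may differ, \<open>X\<close> and
  \<open>X'\<close> are compared through their images. The partial trace removes the last sign, and
  its image is assembled from that of the argument, identities, and the images of cup and cap, on
  which the two functors agree.\<close>

lemma G_closure:
  "X \<in> hom fbC a a \<Longrightarrow> X' \<in> hom fbC a a \<Longrightarrow> on_hom G a a X = on_hom F0 a a X' \<Longrightarrow>
    on_hom G [] [] (fb_closure fbB a X) = on_hom F0 [] [] (fb_closure fbB a X')"
proof (induct a arbitrary: X X' rule: rev_induct)
  case Nil
  have "fb_closure fbB [] X = X" if "X \<in> hom fbC [] []" for X
    using that
  proof (elim fb.hom_CE)
    fix x assume x: "x \<in> dcombs True K (heads [] []) (tails [] [])" "X = fb_cls fbB [] [] x"
    have "lin (diagram_closure 0) x = x" by (simp only: diagram_closure_eq clo_def upt_0 list.map cglues_Nil)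
    then show "fb_closure fbB [] X = X" using fb_closure_cls[OF x(1)] x(2) by simp
  qed
  then show ?case using Nil by simp
next
  case (snoc s a)
  have cu: "on_hom G [] [s, opposite s] (fb_cls fbB [] [s, opposite s] (gen {#arc_at (s = Pos) T0 T1#})) =
    on_hom F0 [] [s, opposite s] (fb_cls fbB [] [s, opposite s] (gen {#arc_at (s = Pos) T0 T1#}))"
    by (cases s) (simp_all add: arc_at_def G_arc cup_boundary[of Pos, simplified] cup_boundary[of Neg, simplified])
  have ca: "on_hom G [s, opposite s] [] (fb_cls fbB [s, opposite s] [] (gen {#arc_at (s = Pos) (Bot 1) (Bot 0)#})) =
    on_hom F0 [s, opposite s] [] (fb_cls fbB [s, opposite s] [] (gen {#arc_at (s = Pos) (Bot 1) (Bot 0)#}))"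
    by (cases s) (simp_all add: arc_at_def G_arc cup_boundary[of Pos, simplified] cup_boundary[of Neg, simplified])
  have "on_hom G a a (ptr a s X) = on_hom F0 a a (ptr a s X')"
    unfolding ptr_functor[OF G_mon snoc(2)] ptr_functor[OF F0_monoidal snoc(3)] G_obj' snoc(4) cu ca ..
  from snoc(1)[OF fb_closure_snoc(1)[OF snoc(2)] fb_closure_snoc(1)[OF snoc(3)] this]
  show ?case by (simp only: fb_closure_snoc(2)[OF snoc(2)] fb_closure_snoc(2)[OF snoc(3)])
qed

text \<open>Closed labelled combinations reduce to their evaluation, so the endomorphisms of the
  unit object are the scalars.\<close>

lemma scalar_hom:
  assumes "X \<in> hom fbC [] []"
  shows "\<exists>r. X = scalm fbC [] [] r (idm fbC []) \<and> (X = zerom fbC [] [] \<longleftrightarrow> r = 0)"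
  using assms
proof (elim fb.hom_CE)
  fix z assume z: "z \<in> dcombs True K (heads [] []) (tails [] [])" and X: "X = fb_cls fbB [] [] z"
  then have z': "z \<in> dcombs True K {} {}" by simp
  let ?r = "eval_comb \<alpha> (PhiL z)"
  have "X = scalm fbC [] [] ?r (idm fbC [])"
    using PhiL_closed[OF z'] by (simp add: X fb.idm_C fb.scalm_C fb.c_eq_iff)
  moreover have "X = zerom fbC [] [] \<longleftrightarrow> ?r = 0"
    using closed_frels_iff[OF z'] by (simp add: X fb.zerom_C fb.c_eq_iff)
  ultimately show ?thesis by blast
qed

lemma scalar_inj: "scalm (cat S \<alpha>) [] [] r (E []) = scalm (cat S \<alpha>) [] [] r' (E []) \<Longrightarrow> r = r'"
  by (simp add: E_def cob.scalm_C cls_eq_ceq ceq_def null_closed eval_comb_diff eval_comb_scale)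

text \<open>Both closures are multiples of the identity of the unit object, which either functor
  sends to the nonzero morphism \<open>E []\<close>; equal images therefore force equal
  scalars.\<close>

lemma G_closure_zero:
  assumes X: "X \<in> hom fbC a a" "X' \<in> hom fbC a a" "on_hom G a a X = on_hom F0 a a X'"
  shows "fb_closure fbB a X = zerom fbC [] [] \<longleftrightarrow> fb_closure fbB a X' = zerom fbC [] []"
proof -
  obtain r where r: "fb_closure fbB a X = scalm fbC [] [] r (idm fbC [])" "fb_closure fbB a X = zerom fbC [] [] \<longleftrightarrow> r = 0"
    using scalar_hom[OF fb_closure_hom[OF X(1)]] by blast
  obtain r' where r': "fb_closure fbB a X' = scalm fbC [] [] r' (idm fbC [])" "fb_closure fbB a X' = zerom fbC [] [] \<longleftrightarrow> r' = 0"
    using scalar_hom[OF fb_closure_hom[OF X(2)]] by blast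
  have s: "on_hom H [] [] (scalm fbC [] [] r (idm fbC [])) = mat1 (scalm (cat S \<alpha>) [] [] r (E []))"
    if "linear_functor fbC kC H" "on_obj H = on_obj F0" for H r
    using that fb.idm_hom[of "[]"] by (simp add: linear_functor_def F0_def kar_simps)
  have "scalm (cat S \<alpha>) [] [] r (E []) = scalm (cat S \<alpha>) [] [] r' (E [])"
    using G_closure[OF X] s[OF G_lin G_obj'] s[OF F0_linear refl] r(1) r'(1) by simp
  then have "r = r'" by (rule scalar_inj)
  then show ?thesis using r(2) r'(2) by simp
qed

lemma G_hom: "X \<in> hom fbC a b \<Longrightarrow> on_hom G a b X \<in> hom kC ([a], mat1 (E a)) ([b], mat1 (E b))"
  using G_lin by (simp add: linear_functor_def G_obj)

lemma G_cmp: "X \<in> hom fbC a b \<Longrightarrow> Y \<in> hom fbC b c \<Longrightarrow>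
  on_hom G a c (cmp fbC a b c Y X) = cmp kC (on_obj F0 a) (on_obj F0 b) (on_obj F0 c) (on_hom G b c Y) (on_hom G a b X)"
  using G_lin by (simp add: linear_functor_def G_obj')

lemma F0_cmp: "X \<in> hom fbC a b \<Longrightarrow> Y \<in> hom fbC b c \<Longrightarrow>
  on_hom F0 a c (cmp fbC a b c Y X) = cmp kC (on_obj F0 a) (on_obj F0 b) (on_obj F0 c) (on_hom F0 b c Y) (on_hom F0 a b X)"
  using F0_linear by (simp add: linear_functor_def)

text \<open>Both functors are full onto the same hom spaces, so each test morphism for
  \<open>X\<close> has a partner for \<open>X'\<close> with the same image, and conversely. The
  closures of the composites then vanish together.\<close>

lemma negligible_transfer:
  assumes X: "X \<in> hom fbC a b" "X' \<in> hom fbC a b" "on_hom G a b X = on_hom F0 a b X'"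
  shows "X \<in> negligible fbB a b \<longleftrightarrow> X' \<in> negligible fbB a b"
proof -
  have *: "fb_closure fbB a (cmp fbC a b a Y X) = zerom fbC [] [] \<longleftrightarrow> fb_closure fbB a (cmp fbC a b a Y' X') = zerom fbC [] []"
    if "Y \<in> hom fbC b a" "Y' \<in> hom fbC b a" "on_hom G b a Y = on_hom F0 b a Y'" for Y Y'
    by (rule G_closure_zero) (use that X in \<open>auto simp: G_cmp F0_cmp intro: fb.cmp_hom\<close>)
  have 1: "\<exists>Y'\<in>hom fbC b a. on_hom G b a Y = on_hom F0 b a Y'" if "Y \<in> hom fbC b a" for Y
    using full_surj[OF F0_full refl G_hom[OF that]] by metis
  have 2: "\<exists>Y\<in>hom fbC b a. on_hom G b a Y = on_hom F0 b a Y'" if "Y' \<in> hom fbC b a" for Y'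
    using full_surj[OF G_full G_obj' Fm_in_kC[OF that]] by (simp add: F0_def)
  show ?thesis unfolding negligible_def using X(1,2) * 1 2 by (smt (verit) mem_Collect_eq)
qed

lemma G_kernel:
  assumes X: "X \<in> hom fbC a b"
  shows "X \<in> negligible fbB a b \<longleftrightarrow> on_hom G a b X = mat1 (zerom (cat S \<alpha>) a b)"
proof -
  obtain X' where X': "X' \<in> hom fbC a b" "on_hom G a b X = on_hom F0 a b X'"
    using full_surj[OF F0_full refl G_hom[OF X]] by metis
  show ?thesis
    unfolding negligible_transfer[OF X X'] Fm_kernel[OF X'(1)] X'(2) by (simp add: F0_def)
qed

lemma G_plus: "X \<in> hom fbC a b \<Longrightarrow> Y \<in> hom fbC a b \<Longrightarrow>
  on_hom G a b (plusm fbC a b X Y) = plusm kC ([a], mat1 (E a)) ([b], mat1 (E b)) (on_hom G a b X) (on_hom G a b Y)"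
  using G_lin by (simp add: linear_functor_def G_obj)

lemma G_scal: "X \<in> hom fbC a b \<Longrightarrow>
  on_hom G a b (scalm fbC a b r X) = scalm kC ([a], mat1 (E a)) ([b], mat1 (E b)) r (on_hom G a b X)"
  using G_lin by (simp add: linear_functor_def G_obj)

text \<open>Linearity turns the kernel into fibres: adding a negligible morphism keeps the image,
  and the difference of two morphisms with equal images is negligible.\<close>

lemma G_coset:
  assumes X: "X \<in> hom fbC a b"
  shows "coset fbC (negligible fbB) a b X = {Y \<in> hom fbC a b. on_hom G a b Y = on_hom G a b X}"
proof (intro set_eqI iffI)
  have G1: "\<exists>m\<in>hom (cat S \<alpha>) a b. on_hom G a b Y = mat1 m" if "Y \<in> hom fbC a b" for Y
    using G_hom[OF that] by (auto simp: kC_hom)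
  fix Y assume "Y \<in> coset fbC (negligible fbB) a b X"
  then obtain N where N: "N \<in> negligible fbB a b" and Y: "Y = plusm fbC a b X N" by (auto simp: coset_def)
  have N': "N \<in> hom fbC a b" using N by (simp add: negligible_def)
  obtain m where m: "m \<in> hom (cat S \<alpha>) a b" "on_hom G a b X = mat1 m" using G1[OF X] by blast
  have "on_hom G a b Y = on_hom G a b X"
    unfolding Y G_plus[OF X N'] using N m by (simp add: G_kernel[OF N'] kar_simps cob.plusm_zerom)
  then show "Y \<in> {Y \<in> hom fbC a b. on_hom G a b Y = on_hom G a b X}"
    using fb.plusm_hom[OF X N'] Y by simp
next
  fix Y assume "Y \<in> {Y \<in> hom fbC a b. on_hom G a b Y = on_hom G a b X}"
  then have Y: "Y \<in> hom fbC a b" and e: "on_hom G a b Y = on_hom G a b X" by auto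
  obtain m where m: "m \<in> hom (cat S \<alpha>) a b" "on_hom G a b X = mat1 m" using G_hom[OF X] by (auto simp: kC_hom)
  let ?N = "plusm fbC a b Y (scalm fbC a b (- 1) X)"
  have N: "?N \<in> hom fbC a b" by (intro fb.plusm_hom fb.scalm_hom X Y)
  have "on_hom G a b ?N = mat1 (plusm (cat S \<alpha>) a b m (scalm (cat S \<alpha>) a b (- 1) m))"
    unfolding G_plus[OF Y fb.scalm_hom[OF X]] G_scal[OF X] e m(2) by (simp add: kar_simps)
  also have "plusm (cat S \<alpha>) a b m (scalm (cat S \<alpha>) a b (- 1) m) = zerom (cat S \<alpha>) a b"
    using m(1) by (elim cob.hom_CE) (simp add: cob.plusm_C cob.scalm_C cob.zerom_C scale_minus_one)
  finally have "?N \<in> negligible fbB a b" by (simp add: G_kernel[OF N])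
  moreover have "Y = plusm fbC a b X ?N"
    using X Y by (elim fb.hom_CE) (simp add: fb.plusm_C fb.scalm_C scale_minus_one)
  ultimately show "Y \<in> coset fbC (negligible fbB) a b X" by (auto simp: coset_def)
qed

lemma G_induces:
  "\<exists>F. induces fbB G F \<and> monoidal_functor (gligible_fb_cat fbB) kC F \<and>
    full_functor (gligible_fb_cat fbB) kC F \<and> faithful_functor (gligible_fb_cat fbB) F"
  unfolding gligible_fb_cat_def induces_def
  using quotient_functor[OF G_mon G_full fb.obj_C G_coset fb.idm_hom fb.cmp_hom fb.plusm_hom fb.scalm_hom]
    fb.tensm_hom by simp

end

end

theorem proposition2p16:
  fixes S :: "'s set" and \<alpha> :: "('s, 'k::field) evaluation"
  assumes "finite S" and "rational S \<alpha>"
  shows "(\<exists>F0. is_F0 S \<alpha> F0) \<and>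
    (\<forall>F0. is_F0 S \<alpha> F0 \<longrightarrow>
      (\<exists>F. induces (K_alg S \<alpha>) F0 F \<and>
           monoidal_functor (gligible_fb_cat (K_alg S \<alpha>)) (karoubi (cat S \<alpha>)) F \<and>
           full_functor (gligible_fb_cat (K_alg S \<alpha>)) (karoubi (cat S \<alpha>)) F \<and>
           faithful_functor (gligible_fb_cat (K_alg S \<alpha>)) F))"
  proof -
  \<comment> \<open>These are representatives of the dual bases picked inside \<open>one_K\<close>,
    the data on which the translation of labelled diagrams depends.\<close>
  obtain n x y where "complete S \<alpha> n x y"
    "one_K S \<alpha> = cls S \<alpha> [] [Pos, Neg] (unit_arc - (\<Sum>i<n. x i * y i))"
    using one_K_complete[OF assms(2)] by blast
  then interpret frob_eval S \<alpha> n x y by unfold_locales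
  show ?thesis using F0_is_F0 G_induces by blast
qed

end
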